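(* Let $S_{g,k}$ be an oriented surface of genus $g$ with $k\ge 1$ punctures and negative Euler characteristic, and let $T$ be a bipartite ideal triangulation of $S_{g,k}$. For every $T$-bent representation $\rho:\pi_1(S_{g,k})\to \mathrm{PU}(2,1)$ there exists a discrete and faithful representation $\rho_0:\pi_1(S_{g,k})\to \mathrm{PO}(2,1)$ that dominates $\rho$, i.e. $\ell(\rho(\gamma))\le \ell(\rho_0(\gamma))$ for all $\gamma\in\pi_1(S_{g,k})$. Moreover, if $\gamma\in\pi_1(S_{g,k})$ is a peripheral loop, then $\ell(\rho(\gamma))=\ell(\rho_0(\gamma))$.
   Context: Complex hyperbolic plane: equip $\mathbb{C}^3$ with the Hermitian form of signature $(2,1)$ $\langle \mathbf z,\mathbf w\rangle=z_1\bar w_3+z_2\bar w_2+z_3\bar w_1$, with matrix $J=\begin{pmatrix}0&0&1\\0&1&0\\1&0&0\end{pmatrix}$. $\mathbf{H}^2_{\mathbb C}$ is the set of complex lines in $\mathbb{C}^3$ spanned by negative vectors, and $\partial \mathbf{H}^2_{\mathbb C}$ the set of complex lines spanned by non-zero null vectors. $\mathrm{U}(2,1)=\{A\in \mathrm{GL}_3(\mathbb C): A^*JA=J\}$ and $\mathrm{PU}(2,1)$ is its quotient by unit scalars; it is the group of holomorphic isometries of $\mathbf{H}^2_{\mathbb C}$. $\mathrm{PO}(2,1)$ denotes the identity component of the isometry group of the real hyperbolic plane $\mathbf{H}^2_{\mathbb R}$, regarded as the subgroup of $\mathrm{PU}(2,1)$ which is the image of the identity component of the group of real matrices preserving $J$.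 Translation length: for $A\in \mathrm{PU}(2,1)$ with lift $\tilde A\in \mathrm{U}(2,1)$, the Bergman translation length is $\ell(A):=2\ln\sigma(\tilde A)$, where $\sigma$ is the spectral radius (maximum modulus of an eigenvalue); it does not depend on the lift. Real ideal triangles: a real plane is a non-empty intersection of $\mathbf{H}^2_{\mathbb C}$ with (the projectivization of) a totally real subspace, i.e. a totally geodesic Lagrangian copy of $\mathbf{H}^2_{\mathbb R}$ in $\mathbf{H}^2_{\mathbb C}$. A real ideal triangle is a triple of distinct points of $\partial\mathbf{H}^2_{\mathbb C}$ lying on the boundary of a common real plane. $T$-bent representations: an ideal triangulation $T$ of $S_{g,k}$ has its vertices at the punctures; it is bipartite if its dual graph is bipartite. Let $\widetilde T$ be its lift to the universal cover $\widetilde S_{g,k}$ and let $\mathcal F_\infty\subset\partial\widetilde S_{g,k}$ (the Farey set) be the set of lifts of the punctures, i.e. the set of vertices of $\widetilde T$, on which $\pi_1(S_{g,k})$ acts. A representation $\rho:\pi_1(S_{g,k})\to\mathrm{PU}(2,1)$ is $T$-bent if there is a $\rho$-equivariant map (framing) $\phi:\mathcal F_\infty\to\partial\mathbf{H}^2_{\mathbb C}$ such that for every ideal triangle of $\widetilde T$ with vertices $a,b,c$, the points $\phi(a),\phi(b),\phi(c)$ form a real ideal triangle. A peripheral loop is an element of $\pi_1(S_{g,k})$ freely homotopic into a neighbourhood of a puncture. *)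

theory Defs
  imports
    "HOL-Complex_Analysis.Complex_Analysis"
    "HOL-Homology.Homology"
    "HOL-Algebra.Coset"
begin

no_notation fps_nth (infixl \<open>$\<close> 75)

section \<open>The complex hyperbolic plane and \<open>PU(2,1)\<close>\<close>

definition herm :: "complex^3 \<Rightarrow> complex^3 \<Rightarrow> complex" where
  "herm z w = z $ 1 * cnj (w $ 3) + z $ 2 * cnj (w $ 2) + z $ 3 * cnj (w $ 1)"

definition J21 :: "'a::zero_neq_one^3^3" where
  "J21 = vector [vector [0, 0, 1], vector [0, 1, 0], vector [1, 0, 0]]"

definition adjoint_matrix :: "complex^3^3 \<Rightarrow> complex^3^3" where
  "adjoint_matrix A = (\<chi> i j. cnj (A $ j $ i))"

definition U21 :: "(complex^3^3) monoid" where
  "U21 = \<lparr>carrier = {A. invertible A \<and> adjoint_matrix A ** J21 ** A = J21},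
          monoid.mult = (**), one = mat 1\<rparr>"

definition unit_scalars :: "(complex^3^3) set" where
  "unit_scalars = {mat c | c. cmod c = 1}"

text \<open>An element of \<open>PU(2,1)\<close> is a coset, i.e. the set of all its lifts to \<open>U(2,1)\<close>.\<close>

definition PU21 :: "(complex^3^3) set monoid" where
  "PU21 = U21 Mod unit_scalars"

definition PU21_topology :: "(complex^3^3) set topology" where
  "PU21_topology = topology (\<lambda>\<U>. \<U> \<subseteq> carrier PU21 \<and> openin (top_of_set (carrier U21)) (\<Union>\<U>))"

lemma adjoint_matrix_mult: "adjoint_matrix (A ** B) = adjoint_matrix B ** adjoint_matrix A"
  by (simp add: adjoint_matrix_def matrix_matrix_mult_def vec_eq_iff mult.commute)

lemma adjoint_matrix_mat: "adjoint_matrix (mat c) = mat (cnj c)"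
  by (simp add: adjoint_matrix_def mat_def vec_eq_iff)

lemma matrix_mult_mat_commute: "(A::complex^3^3) ** mat c = mat c ** A"
  by (simp add: vec_eq_iff forall_3 matrix_matrix_mult_def mat_def sum_3 mult.commute)

lemma mat_mult_mat: "(mat a::complex^3^3) ** mat c = mat (a * c)"
  by (simp add: vec_eq_iff forall_3 matrix_matrix_mult_def mat_def sum_3)

lemma invertible_mat: "c \<noteq> 0 \<Longrightarrow> invertible (mat c :: complex^3^3)"
  unfolding invertible_def by (rule exI[of _ "mat (1/c)"]) (simp add: mat_mult_mat)

lemma mat_in_U21: "mat c \<in> carrier U21" if "cmod c = 1"
proof -
  have "c \<noteq> 0" using that by auto
  have "cnj c * c = 1" using that by (metis complex_norm_square mult.commute of_real_1 one_power2)
  have "mat (cnj c) ** J21 ** mat c = mat (cnj c) ** (mat c ** (J21::complex^3^3))"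
    by (metis matrix_mult_mat_commute matrix_mul_assoc)
  also have "\<dots> = J21" by (simp add: matrix_mul_assoc mat_mult_mat \<open>cnj c * c = 1\<close>)
  finally show ?thesis by (simp add: U21_def adjoint_matrix_mat invertible_mat \<open>c \<noteq> 0\<close>)
qed

lemma group_U21: "group U21"
proof (rule groupI)
  fix x y assume a: "x \<in> carrier U21" "y \<in> carrier U21"
  have "adjoint_matrix (x ** y) ** J21 ** (x ** y) =
      adjoint_matrix y ** (adjoint_matrix x ** J21 ** x) ** y"
    by (simp add: adjoint_matrix_mult matrix_mul_assoc)
  then show "x \<otimes>\<^bsub>U21\<^esub> y \<in> carrier U21" using a by (simp add: U21_def invertible_mult)
next
  show "\<one>\<^bsub>U21\<^esub> \<in> carrier U21" using mat_in_U21[of 1] by (simp add: U21_def)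
next
  fix x assume a: "x \<in> carrier U21"
  then obtain y where y: "x ** y = mat 1" "y ** x = mat 1" by (auto simp: U21_def invertible_def)
  have "adjoint_matrix y ** (adjoint_matrix x ** J21 ** x) ** y = adjoint_matrix (x ** y) ** J21 ** (x ** y)"
    by (simp add: adjoint_matrix_mult matrix_mul_assoc)
  then have "adjoint_matrix y ** J21 ** y = J21" using a y by (simp add: U21_def adjoint_matrix_mat)
  then show "\<exists>y\<in>carrier U21. y \<otimes>\<^bsub>U21\<^esub> x = \<one>\<^bsub>U21\<^esub>"
    using y by (auto simp: U21_def invertible_def intro!: bexI[of _ y])
qed (auto simp: U21_def matrix_mul_assoc)

lemma subgroup_unit_scalars: "subgroup unit_scalars U21"
proof (rule group.subgroupI[OF group_U21])
  show "unit_scalars \<subseteq> carrier U21" using mat_in_U21 by (auto simp: unit_scalars_def)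
  show "unit_scalars \<noteq> {}" by (auto simp: unit_scalars_def intro!: exI[of _ 1])
next
  fix a assume "a \<in> unit_scalars"
  then obtain c where c: "a = mat c" "cmod c = 1" by (auto simp: unit_scalars_def)
  have "inv\<^bsub>U21\<^esub> a = mat (1/c)"
    using c mat_in_U21[of c] mat_in_U21[of "1/c"] by
    (intro group.inv_equality[OF group_U21]) (auto simp: U21_def mat_mult_mat norm_divide)
  then show "inv\<^bsub>U21\<^esub> a \<in> unit_scalars" using c by (auto simp: unit_scalars_def norm_divide intro!: exI[of _ "1/c"])
next
  fix a b assume "a \<in> unit_scalars" "b \<in> unit_scalars"
  then show "a \<otimes>\<^bsub>U21\<^esub> b \<in> unit_scalars" by (auto simp: unit_scalars_def U21_def mat_mult_mat norm_mult)
qed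

lemma normal_unit_scalars: "normal unit_scalars U21"
  unfolding normal_def normal_axioms_def using subgroup_unit_scalars group_U21
  by (auto simp: r_coset_def l_coset_def unit_scalars_def U21_def matrix_mult_mat_commute)

lemma group_PU21: "group PU21"
  using normal_unit_scalars unfolding PU21_def by (rule normal.factorgroup_is_group)

lemma openin_PU21_topology:
  "openin PU21_topology \<U> \<longleftrightarrow>
     \<U> \<subseteq> carrier PU21 \<and> openin (top_of_set (carrier U21)) (\<Union>\<U>)"
proof -
  have disj: "X \<inter> Y = {}" if "X \<in> carrier PU21" "Y \<in> carrier PU21" "X \<noteq> Y" for X Y
    using group.rcos_disjoint[OF group_U21 subgroup_unit_scalars] that
    by (auto simp: PU21_def FactGroup_def pairwise_def disjnt_def)
  have "\<Union>(\<U> \<inter> \<V>) = \<Union>\<U> \<inter> \<Union>\<V>" if "\<U> \<subseteq> carrier PU21" "\<V> \<subseteq> carrier PU21" for \<U> \<V>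
    using disj that by blast
  moreover have "openin (top_of_set (carrier U21)) (\<Union>(\<Union>\<K>))"
    if "\<forall>\<U>\<in>\<K>. openin (top_of_set (carrier U21)) (\<Union>\<U>)" for \<K>
  proof -
    have "\<Union>(\<Union>\<K>) = (\<Union>\<U>\<in>\<K>. \<Union>\<U>)" by auto
    moreover have "openin (top_of_set (carrier U21)) (\<Union>\<U>\<in>\<K>. \<Union>\<U>)"
      by (rule openin_Union) (use that in blast)
    ultimately show ?thesis by simp
  qed
  ultimately have "istopology (\<lambda>\<U>. \<U> \<subseteq> carrier PU21 \<and> openin (top_of_set (carrier U21)) (\<Union>\<U>))"
    unfolding istopology_def by (simp add: openin_Int Sup_le_iff le_infI1)
  then show ?thesis by (simp add: PU21_topology_def topology_inverse')
qed

definition O21_real :: "(real^3^3) set" where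
  "O21_real = {B. transpose B ** J21 ** B = J21}"

definition PO21 :: "(complex^3^3) set set" where
  "PO21 = {unit_scalars #>\<^bsub>U21\<^esub> map_matrix complex_of_real B | B.
             B \<in> connected_component_set O21_real (mat 1)}"

definition spectral_radius3 :: "complex^3^3 \<Rightarrow> real" where
  "spectral_radius3 A = Max {cmod l | l. \<exists>v. v \<noteq> 0 \<and> A *v v = l *s v}"

text \<open>All lifts of an element of \<open>PU(2,1)\<close> have the same spectral radius.\<close>

definition translation_length :: "(complex^3^3) set \<Rightarrow> real" where
  "translation_length X = 2 * ln (spectral_radius3 (SOME A. A \<in> X))"

definition H2C :: "(complex^3) set set" where
  "H2C = {vec.span {v} | v. Re (herm v v) < 0}"

definition boundary_H2C :: "(complex^3) set set" where
  "boundary_H2C = {vec.span {v} | v. v \<noteq> 0 \<and> herm v v = 0}"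

definition PU21_act :: "(complex^3^3) set \<Rightarrow> (complex^3) set \<Rightarrow> (complex^3) set" where
  "PU21_act X L = {A *v v | A v. A \<in> X \<and> v \<in> L}"

section \<open>Real planes and real ideal triangles\<close>

text \<open>Totally real (Lagrangian) subspaces of maximal dimension: \<open>dim\<close> is the real dimension.\<close>

definition totally_real :: "(complex^3) set \<Rightarrow> bool" where
  "totally_real W \<longleftrightarrow> subspace W \<and> dim W = 3 \<and> (\<forall>v\<in>W. \<i> *s v \<in> W \<longrightarrow> v = 0) \<and>
     (\<forall>v\<in>W. \<forall>w\<in>W. herm v w \<in> \<real>)"

definition real_plane :: "(complex^3) set set \<Rightarrow> bool" where
  "real_plane R \<longleftrightarrow> R \<noteq> {} \<and>
     (\<exists>W. totally_real W \<and> R = H2C \<inter> {vec.span {v} | v. v \<in> W \<and> v \<noteq> 0})"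

text \<open>The points of \<open>boundary_H2C\<close> in the closure of \<open>R\<close> in the complex projective plane:
  as the projection from the non-zero vectors is open, closures may be computed upstairs.\<close>

definition ideal_boundary :: "(complex^3) set set \<Rightarrow> (complex^3) set set" where
  "ideal_boundary R =
     {vec.span {v} | v. v \<noteq> 0 \<and> herm v v = 0 \<and> v \<in> closure {w. vec.span {w} \<in> R}}"

definition real_ideal_triangle ::
    "(complex^3) set \<Rightarrow> (complex^3) set \<Rightarrow> (complex^3) set \<Rightarrow> bool" where
  "real_ideal_triangle a b c \<longleftrightarrow>
     a \<in> boundary_H2C \<and> b \<in> boundary_H2C \<and> c \<in> boundary_H2C \<and>
     a \<noteq> b \<and> b \<noteq> c \<and> a \<noteq> c \<and>
     (\<exists>R. real_plane R \<and> {a, b, c} \<subseteq> ideal_boundary R)"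

section \<open>Punctured surfaces\<close>

text \<open>Local degree \<open>1\<close>, for an injective continuous map of plane domains.\<close>

definition orientation_preserving_at :: "(complex \<Rightarrow> complex) \<Rightarrow> complex \<Rightarrow> bool" where
  "orientation_preserving_at f z \<longleftrightarrow>
     (\<forall>\<^sub>F r in at_right 0. winding_number (f \<circ> circlepath z r) (f z) = 1)"

definition oriented_atlas ::
    "'a::t2_space set \<Rightarrow> ('a set \<times> ('a \<Rightarrow> complex)) set \<Rightarrow> bool" where
  "oriented_atlas M \<A> \<longleftrightarrow>
     (\<forall>(U, h)\<in>\<A>. openin (top_of_set M) U \<and> open (h ` U) \<and> (\<exists>h'. homeomorphism U (h ` U) h h')) \<and>
     (\<Union>(U, h)\<in>\<A>. U) = M \<and>
     (\<forall>(U, h)\<in>\<A>. \<forall>(V, k)\<in>\<A>. \<forall>x\<in>U \<inter> V.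
        orientation_preserving_at (k \<circ> inv_into U h) (h x))"

text \<open>\<open>S\<^sub>g\<^sub>,\<^sub>k\<close> is \<open>M - P\<close> for a closed connected oriented surface \<open>M\<close> whose first
  Betti number is \<open>2 * g\<close> and a set \<open>P\<close> of \<open>k\<close> points of \<open>M\<close>.\<close>

definition punctured_surface ::
    "nat \<Rightarrow> nat \<Rightarrow> 'a::t2_space set \<Rightarrow> ('a set \<times> ('a \<Rightarrow> complex)) set \<Rightarrow> 'a set \<Rightarrow> bool" where
  "punctured_surface g k M \<A> P \<longleftrightarrow>
     compact M \<and> connected M \<and> M \<noteq> {} \<and> oriented_atlas M \<A> \<and>
     homology_group 1 (top_of_set M) \<cong> free_Abelian_group {..<2 * g} \<and>
     P \<subseteq> M \<and> finite P \<and> card P = k"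

section \<open>Ideal triangulations\<close>

definition triangle :: "(real^3) set" where
  "triangle = {x. (\<forall>i. 0 \<le> x $ i) \<and> (\<Sum>i\<in>UNIV. x $ i) = 1}"

definition corner :: "3 \<Rightarrow> real^3" where
  "corner i = axis i 1"

definition barycentre :: "real^3" where
  "barycentre = (\<chi> i. 1 / 3)"

definition open_triangle :: "(real^3) set" where
  "open_triangle = {x \<in> triangle. \<forall>i. 0 < x $ i}"

definition open_side :: "3 \<Rightarrow> (real^3) set" where
  "open_side i = {x \<in> triangle. \<forall>j. x $ j = 0 \<longleftrightarrow> j = i}"

definition side_image :: "(real^3 \<Rightarrow> 'a) \<times> 3 \<Rightarrow> 'a set" where
  "side_image s = fst s ` open_side (snd s)"

text \<open>An ideal triangulation is given by the finite set of characteristic maps of its triangles.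
  Two sides of one triangle may be glued to each other, and vertices of a triangle may coincide
  in \<open>M\<close>. As \<open>M\<close> has no boundary, every edge is obtained from exactly two sides.\<close>

definition ideal_triangulation ::
    "'a::t2_space set \<Rightarrow> 'a set \<Rightarrow> (real^3 \<Rightarrow> 'a) set \<Rightarrow> bool" where
  "ideal_triangulation M P \<T> \<longleftrightarrow>
     finite \<T> \<and>
     (\<forall>\<tau>\<in>\<T>. continuous_on triangle \<tau> \<and> {x \<in> triangle. \<tau> x \<in> P} = range corner \<and>
        (\<forall>i. inj_on \<tau> (open_side i))) \<and>
     (\<Union>\<tau>\<in>\<T>. \<tau> ` triangle) = M \<and>
     (\<forall>\<tau>\<in>\<T>. \<forall>\<tau>'\<in>\<T>. \<forall>x\<in>open_triangle. \<forall>y\<in>triangle. \<tau> x = \<tau>' y \<longrightarrow> \<tau> = \<tau>' \<and> x = y) \<and>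
     (\<forall>s\<in>\<T> \<times> UNIV. \<forall>s'\<in>\<T> \<times> UNIV.
        side_image s = side_image s' \<or> side_image s \<inter> side_image s' = {}) \<and>
     (\<forall>s\<in>\<T> \<times> UNIV. \<exists>!s'. s' \<in> \<T> \<times> UNIV \<and> s' \<noteq> s \<and> side_image s' = side_image s)"

text \<open>A triangle glued to itself is a loop of the dual graph, and excludes bipartiteness.\<close>

definition bipartite_triangulation :: "(real^3 \<Rightarrow> 'a) set \<Rightarrow> bool" where
  "bipartite_triangulation \<T> \<longleftrightarrow>
     (\<exists>colour :: (real^3 \<Rightarrow> 'a) \<Rightarrow> bool. \<forall>s\<in>\<T> \<times> UNIV. \<forall>s'\<in>\<T> \<times> UNIV.
        s \<noteq> s' \<and> side_image s = side_image s' \<longrightarrow> colour (fst s) \<noteq> colour (fst s'))"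

section \<open>The fundamental group and peripheral loops\<close>

definition path_class :: "'a::topological_space set \<Rightarrow> (real \<Rightarrow> 'a) \<Rightarrow> (real \<Rightarrow> 'a) set" where
  "path_class S p = {q. homotopic_paths S p q}"

definition fundamental_group :: "'a::topological_space set \<Rightarrow> 'a \<Rightarrow> (real \<Rightarrow> 'a) set monoid" where
  "fundamental_group S x0 =
     \<lparr>carrier = {path_class S p | p.
         path p \<and> path_image p \<subseteq> S \<and> pathstart p = x0 \<and> pathfinish p = x0},
      monoid.mult = (\<lambda>\<alpha> \<beta>. {r. \<exists>p\<in>\<alpha>. \<exists>q\<in>\<beta>. homotopic_paths S (p +++ q) r}),
      one = path_class S (\<lambda>_. x0)\<rparr>"

text \<open>Neighbourhoods of a puncture are meant to be arbitrarily small.\<close>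

definition peripheral :: "'a::topological_space set \<Rightarrow> 'a set \<Rightarrow> (real \<Rightarrow> 'a) set \<Rightarrow> bool" where
  "peripheral M P \<gamma> \<longleftrightarrow>
     (\<exists>q\<in>P. \<forall>U. openin (top_of_set M) U \<and> q \<in> U \<longrightarrow>
        (\<exists>p\<in>\<gamma>. \<exists>c. path_image c \<subseteq> U \<and> homotopic_loops (M - P) p c))"

section \<open>The Farey set and bent representations\<close>

text \<open>The universal cover of \<open>M - P\<close> is taken in its standard model, the set of homotopy classes of
  paths in \<open>M - P\<close> that start at the base point \<open>x0\<close>. In the same way the lifts of the punctures,
  i.e. the vertices of the lifted triangulation, are the homotopy classes of paths from \<open>x0\<close> that
  stay in \<open>M - P\<close> until they end at a puncture; the homotopies run through such paths. (A path
  may be unwound around the puncture at which it ends, so that the stabilizer of a lift of a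
  puncture is a peripheral subgroup.)\<close>

definition puncture_path :: "'a::topological_space set \<Rightarrow> 'a set \<Rightarrow> 'a \<Rightarrow> (real \<Rightarrow> 'a) \<Rightarrow> bool" where
  "puncture_path M P x0 c \<longleftrightarrow>
     path c \<and> pathstart c = x0 \<and> c ` {0..<1} \<subseteq> M - P \<and> pathfinish c \<in> P"

definition puncture_homotopic ::
    "'a::topological_space set \<Rightarrow> 'a set \<Rightarrow> (real \<Rightarrow> 'a) \<Rightarrow> (real \<Rightarrow> 'a) \<Rightarrow> bool" where
  "puncture_homotopic M P c d \<longleftrightarrow>
     homotopic_with_canon (\<lambda>h. pathstart h = pathstart c \<and> pathfinish h = pathfinish c \<and>
       h ` {0..<1} \<subseteq> M - P) {0..1} M c d"

definition puncture_class ::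
    "'a::topological_space set \<Rightarrow> 'a set \<Rightarrow> (real \<Rightarrow> 'a) \<Rightarrow> (real \<Rightarrow> 'a) set" where
  "puncture_class M P c = {d. puncture_homotopic M P c d}"

definition farey_set :: "'a::topological_space set \<Rightarrow> 'a set \<Rightarrow> 'a \<Rightarrow> (real \<Rightarrow> 'a) set set" where
  "farey_set M P x0 = {puncture_class M P c | c. puncture_path M P x0 c}"

definition farey_act ::
    "'a::topological_space set \<Rightarrow> 'a set \<Rightarrow> (real \<Rightarrow> 'a) set \<Rightarrow> (real \<Rightarrow> 'a) set \<Rightarrow> (real \<Rightarrow> 'a) set" where
  "farey_act M P \<gamma> \<xi> = {d. \<exists>p\<in>\<gamma>. \<exists>c\<in>\<xi>. puncture_homotopic M P (p +++ c) d}"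

text \<open>The triangles of the lifted triangulation, as triples of vertices: a lift of the triangle
  \<open>\<tau>\<close> is determined by a lift of its centre, i.e. by (the class of) a path \<open>\<delta>\<close> from \<open>x0\<close> to the
  centre, and its vertices are reached by continuing \<open>\<delta>\<close> straight to the corners of \<open>\<tau>\<close>.\<close>

definition farey_vertex ::
    "'a::topological_space set \<Rightarrow> 'a set \<Rightarrow> (real \<Rightarrow> 'a) \<Rightarrow> (real^3 \<Rightarrow> 'a) \<Rightarrow> 3 \<Rightarrow> (real \<Rightarrow> 'a) set" where
  "farey_vertex M P \<delta> \<tau> i = puncture_class M P (\<delta> +++ (\<tau> \<circ> linepath barycentre (corner i)))"

definition farey_triangles ::
    "'a::topological_space set \<Rightarrow> 'a set \<Rightarrow> (real^3 \<Rightarrow> 'a) set \<Rightarrow> 'a \<Rightarrow>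
     ((real \<Rightarrow> 'a) set \<times> (real \<Rightarrow> 'a) set \<times> (real \<Rightarrow> 'a) set) set" where
  "farey_triangles M P \<T> x0 =
     {(farey_vertex M P \<delta> \<tau> 1, farey_vertex M P \<delta> \<tau> 2, farey_vertex M P \<delta> \<tau> 3) | \<delta> \<tau>.
        \<tau> \<in> \<T> \<and> path \<delta> \<and> path_image \<delta> \<subseteq> M - P \<and> pathstart \<delta> = x0 \<and> pathfinish \<delta> = \<tau> barycentre}"

definition T_bent ::
    "'a::topological_space set \<Rightarrow> 'a set \<Rightarrow> (real^3 \<Rightarrow> 'a) set \<Rightarrow> 'a \<Rightarrow>
     ((real \<Rightarrow> 'a) set \<Rightarrow> (complex^3^3) set) \<Rightarrow> bool" where
  "T_bent M P \<T> x0 \<rho> \<longleftrightarrow>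
     (\<exists>\<phi>. \<phi> \<in> farey_set M P x0 \<rightarrow> boundary_H2C \<and>
        (\<forall>\<gamma>\<in>carrier (fundamental_group (M - P) x0). \<forall>\<xi>\<in>farey_set M P x0.
           \<phi> (farey_act M P \<gamma> \<xi>) = PU21_act (\<rho> \<gamma>) (\<phi> \<xi>)) \<and>
        (\<forall>(a, b, c)\<in>farey_triangles M P \<T> x0. real_ideal_triangle (\<phi> a) (\<phi> b) (\<phi> c)))"

section \<open>Discrete and faithful representations\<close>

definition discrete_faithful ::
    "'g monoid \<Rightarrow> ('g \<Rightarrow> (complex^3^3) set) \<Rightarrow> bool" where
  "discrete_faithful G \<rho> \<longleftrightarrow> inj_on \<rho> (carrier G) \<and>
     subtopology PU21_topology (\<rho> ` carrier G) = discrete_topology (\<rho> ` carrier G)"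

end

theory Submission
 imports Defs "HOL-Computational_Algebra.Fundamental_Theorem_Algebra"
begin

text \<open>The vertices of a real ideal triangle have lifts with pairwise product \<open>-1\<close>, unique up to a common
unit scalar. So a framing gives a frame for every lifted triangle, and the frames of two adjacent
triangles differ, up to a unit scalar, by a matrix \<open>cross a b c t x\<close> followed by a relabelling of
the corners, with a shear \<open>t > 0\<close> and a bending \<open>|x| = 1\<close>. Up to conjugation and a unit scalar,
\<open>\<rho>(\<gamma>)\<close> is the product of these matrices along a gallery of triangles that represents \<open>\<gamma>\<close>.
Replacing every \<open>x\<close> by \<open>-1\<close> unbends \<open>\<rho>\<close> and gives \<open>\<rho>\<^sub>0\<close>. Its values lie in the identity
component because the gluings of an oriented surface reverse the cyclic order of the corners; it is
discrete and faithful because reduced galleries map cones into cones. Conjugated by the involutions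
\<open>turn i\<close>, the matrix of a crossing is bounded entrywise by the unbent one. For a cyclically reduced
gallery this bounds \<open>|tr \<rho>(\<gamma>)^n|\<close> by \<open>tr \<rho>\<^sub>0(\<gamma>)^n\<close> for all \<open>n\<close>, hence the spectral radius. A
peripheral loop has a gallery around one vertex, and the null vector of this vertex is an eigenvector
on both sides, with the same product of shears as eigenvalue.\<close>

section \<open>Local degree of plane maps\<close>

text \<open>The triangulation is only topological: edges are glued by homeomorphisms that need not
  be affine, and orientation is a local degree. The manageable pieces are the open stars of the
  edges: bipartiteness makes the two triangles at an edge distinct, so a star is homeomorphic to a
  convex plane region. Paths, also those in a homotopy or near a puncture, are cut into pieces lying
  in stars, each contributing at most one crossing. For a frame a, b, c the vector -a + b + c is
  polar to the edge bc, and the vertex beyond this edge is -x (-a + b + c) + t b + (1/t) c, while a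
  has polar coefficient -1. So x only rotates the polar part, and x = -1 is the flat position. The
  matrices \<open>turn\<close> pass to these polar bases: there the entries of a crossing have
  moduli independent of x, and at x = -1 they are non-negative. This computation is behind both the
  trace bound and the cones. Traces of powers detect the spectral radius because in U(2,1) an
  eigenvalue of modulus r > 1 comes with one of modulus 1/r and one of modulus 1, which cannot
  cancel it.\<close>

abbreviation op_at :: "(complex => complex) => complex => bool" where
 "op_at \<equiv> orientation_preserving_at"

lemma winding_number_eq_homotopy:
 fixes H :: "real \<times> real => complex"
 assumes "continuous_on ({0..1} \<times> {0..1}) H"
  and "\<And>s t. s \<in> {0..1} ==> t \<in> {0..1} ==> H (s, t) ~= 0"
  and "\<And>s. s \<in> {0..1} ==> H (s, 1) = H (s, 0)"
 shows "winding_number (\<lambda>t. H (0, t)) 0 = winding_number (\<lambda>t. H (1, t)) 0"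
proof (rule winding_number_homotopic_loops)
 show "homotopic_loops (- {0}) (\<lambda>t. H (0, t)) (\<lambda>t. H (1, t))"
  unfolding homotopic_loops using assms
  by (intro exI[of _ H]) (auto simp: pathstart_def pathfinish_def)
qed

lemma circlepath_in_sphere: "0 < r ==> circlepath z r t \<in> sphere z r"
 by (simp add: circlepath dist_norm norm_mult)

lemma circlepath_in_cball: "0 < r ==> r \<le> R ==> circlepath z r t \<in> cball z R"
 by (simp add: circlepath dist_norm norm_mult)

lemma circlepath_neq_centre: "0 < r ==> circlepath z r t ~= z"
 by (simp add: circlepath)

text \<open>The circles are homotopic in the closed disc without its centre, and f carries this
  homotopy into the complement of f z.\<close>

lemma winding_number_circle_image:
 assumes f: "continuous_on (cball z R) f" and inj: "\<And>u. u \<in> cball z R ==> u ~= z ==> f u ~= f z"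
  and r: "0 < r" "r \<le> R"
 shows "winding_number (f \<circ> circlepath z r) (f z) = winding_number (f \<circ> circlepath z R) (f z)"
proof (rule winding_number_homotopic_loops)
 have "homotopic_loops (cball z R - {z}) (circlepath z r) (circlepath z R)"
 proof (rule homotopic_loops_linear)
  fix t :: real
  define e where "e = exp (2 * of_real pi * \<i> * of_real t)"
  have ne: "norm e = 1" by (simp add: e_def norm_exp_eq_Re)
  show "closed_segment (circlepath z r t) (circlepath z R t) \<subseteq> cball z R - {z}"
  proof
   fix x assume "x \<in> closed_segment (circlepath z r t) (circlepath z R t)"
   then obtain u where u: "0 \<le> u" "u \<le> 1"
    "x = (1 - u) *\<^sub>R (z + of_real r * e) + u *\<^sub>R (z + of_real R * e)"
    by (auto simp: closed_segment_def circlepath e_def)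
   have x: "x = z + of_real ((1 - u) * r + u * R) * e"
    unfolding u(3) scaleR_conv_of_real by (simp add: algebra_simps)
   have pos: "0 < (1 - u) * r + u * R"
   proof (cases "u = 1")
    case False then show ?thesis using u r by (intro add_pos_nonneg) auto
   qed (use r in simp)
   have "(1 - u) * r + u * R \<le> (1 - u) * R + u * R"
    using u r by (intro add_mono mult_left_mono) auto
   then have "(1 - u) * r + u * R \<le> R" by (simp add: algebra_simps)
   then show "x \<in> cball z R - {z}" using pos ne
    unfolding x by (auto simp: dist_norm norm_mult simp del: of_real_add of_real_mult of_real_diff)
  qed
 qed auto
 then show "homotopic_loops (- {f z}) (f \<circ> circlepath z r) (f \<circ> circlepath z R)"
  by (rule homotopic_loops_continuous_image)
   (use inj in \<open>auto intro: continuous_on_subset[OF f]\<close>)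
qed

text \<open>The local degree is defined by all small radii; since the winding number does not depend
  on the radius up to R, a single circle decides it.\<close>

lemma op_at_iff:
 assumes f: "continuous_on (cball z R) f" and inj: "\<And>u. u \<in> cball z R ==> u ~= z ==> f u ~= f z"
  and R: "0 < R"
 shows "op_at f z \<longleftrightarrow> winding_number (f \<circ> circlepath z R) (f z) = 1"
proof -
 have "\<forall>\<^sub>F r in at_right 0. winding_number (f \<circ> circlepath z r) (f z) = winding_number (f \<circ> circlepath z R) (f z)"
  unfolding eventually_at_right_field
  by (intro exI[of _ R] conjI R allI impI winding_number_circle_image[OF f inj] less_imp_le)
 note ev = this
 have ne: "at_right (0::real) ~= bot" by simp
 show ?thesis
 proof
  assume "op_at f z"
  then have "\<forall>\<^sub>F r in at_right 0. winding_number (f \<circ> circlepath z r) (f z) = 1"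
   by (simp add: orientation_preserving_at_def)
  with ev have "\<forall>\<^sub>F r in at_right (0::real). winding_number (f \<circ> circlepath z R) (f z) = 1"
   by eventually_elim simp
  then show "winding_number (f \<circ> circlepath z R) (f z) = 1" by simp
 next
  assume "winding_number (f \<circ> circlepath z R) (f z) = 1"
  then show "op_at f z" unfolding orientation_preserving_at_def
   using ev by simp
 qed
qed

lemma op_at_cong:
 assumes "0 < R" "\<And>u. u \<in> cball z R ==> f u = g u"
 shows "op_at f z \<longleftrightarrow> op_at g z"
proof -
 have "\<forall>\<^sub>F r in at_right 0. f \<circ> circlepath z r = g \<circ> circlepath z r"
  using eventually_at_right_less[of 0] eventually_at_right_real[OF assms(1)]
  by eventually_elim (use assms circlepath_in_cball in \<open>fastforce intro!: ext\<close>)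
 moreover have "f z = g z" using assms by simp
 ultimately show ?thesis unfolding orientation_preserving_at_def
  by (auto elim: eventually_elim2)
qed

text \<open>The circle is moved along the segment from z to z' with its radius kept. The centres
  stay within r of z and the circles within 2 r, which explains the size of the disc on which f is
  assumed injective.\<close>

lemma op_at_near:
 assumes f: "continuous_on (cball z (2 * r)) f" and inj: "inj_on f (cball z (2 * r))"
  and r: "0 < r" and z': "z' \<in> cball z r"
 shows "op_at f z \<longleftrightarrow> op_at f z'"
proof -
 let ?H = "\<lambda>(s, t). f (linepath z z' s + (circlepath 0 r t)) - f (linepath z z' s)"
 have lp: "linepath z z' s \<in> cball z r" if "s \<in> {0..1}" for s
  using that z' by (metis centre_in_cball convex_cball convex_contains_segment in_mono less_eq_real_def linepath_in_path path_image_linepath r)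
 have sub: "linepath z z' s + circlepath 0 r t \<in> cball z (2 * r)" if "s \<in> {0..1}" for s t
  using lp[OF that] norm_triangle_ineq[of "z - linepath z z' s" "- circlepath 0 r t"] circlepath_in_sphere[OF r, of 0 t]
  by (auto simp: dist_norm algebra_simps)
 have sub2: "linepath z z' s \<in> cball z (2 * r)" if "s \<in> {0..1}" for s
  using lp[OF that] r by auto
 have "winding_number (\<lambda>t. ?H (0, t)) 0 = winding_number (\<lambda>t. ?H (1, t)) 0"
 proof (rule winding_number_eq_homotopy)
  show "continuous_on ({0..1} \<times> {0..1}) ?H"
   unfolding case_prod_unfold linepath_def circlepath
   by (intro continuous_intros continuous_on_compose2[OF f])
    (use sub sub2 in \<open>auto simp: linepath_def circlepath\<close>)
 next
  fix s t :: real assume s: "s \<in> {0..1}"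
  have "circlepath 0 r t ~= 0" using circlepath_neq_centre[OF r] by blast
  then show "?H (s, t) ~= 0"
   using inj_onD[OF inj _ sub[OF s] sub2[OF s]] by auto
 next
  fix s :: real show "?H (s, 1) = ?H (s, 0)" by (simp add: circlepath)
 qed
 moreover have "(\<lambda>t. ?H (0, t)) = (\<lambda>t. (f \<circ> circlepath z r) t - f z)"
  by (auto simp: linepath_def circlepath)
 moreover have "(\<lambda>t. ?H (1, t)) = (\<lambda>t. (f \<circ> circlepath z' r) t - f z')"
  by (auto simp: linepath_def circlepath)
 ultimately have eq: "winding_number (f \<circ> circlepath z r) (f z) = winding_number (f \<circ> circlepath z' r) (f z')"
  by (metis winding_number_offset)
 have c1: "cball z r \<subseteq> cball z (2 * r)" using r by auto
 have c2: "cball z' r \<subseteq> cball z (2 * r)"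
 proof
  fix x assume "x \<in> cball z' r"
  then show "x \<in> cball z (2 * r)" using z' dist_triangle[of z x z'] by auto
 qed
 have "op_at f z \<longleftrightarrow> winding_number (f \<circ> circlepath z r) (f z) = 1"
  by (rule op_at_iff) (use c1 r inj in \<open>auto intro: continuous_on_subset[OF f] simp: inj_on_def\<close>)
 moreover have "op_at f z' \<longleftrightarrow> winding_number (f \<circ> circlepath z' r) (f z') = 1"
 proof (rule op_at_iff)
  show "continuous_on (cball z' r) f" by (rule continuous_on_subset[OF f c2])
  fix u assume "u \<in> cball z' r" "u ~= z'"
  then show "f u ~= f z'" using c2 r inj centre_in_cball[of z' r]
   by (metis inj_onD less_eq_real_def subsetD)
 qed (rule r)
 ultimately show ?thesis using eq by simp
qed

text \<open>The image of the open disc is open by invariance of domain, and within the component of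
  f z off the image circle it is also closed, so it contains this component. The component is
  therefore bounded, f z lies inside the Jordan curve, and such a point has winding number 1 or
  -1.\<close>

lemma winding_number_injective_image:
 assumes f: "continuous_on (cball z R) f" and inj: "inj_on f (cball z R)" and R: "0 < R"
 shows "winding_number (f \<circ> circlepath z R) (f z) \<in> {1, -1}"
proof -
 let ?g = "f \<circ> circlepath z R"
 have im: "path_image (circlepath z R) = sphere z R" using R by simp
 have pi: "path_image ?g = f ` sphere z R" by (metis im path_image_compose)
 have sp: "simple_path ?g"
  by (intro simple_path_continuous_image) (use R f inj in \<open>auto intro: continuous_on_subset inj_on_subset simp: simple_path_circlepath\<close>)
 let ?C = "f ` sphere z R" and ?B = "f ` ball z R"
 let ?K = "connected_component_set (- ?C) (f z)"
 have "?B \<inter> ?C = f ` (ball z R \<inter> sphere z R)"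
  by (rule inj_on_image_Int[OF inj, symmetric]) auto
 also have "ball z R \<inter> sphere z R = {}" by auto
 finally have disj: "?B \<inter> ?C = {}" by simp
 have "open ?B"
  by (rule invariance_of_domain) (use f inj in \<open>auto intro: continuous_on_subset inj_on_subset\<close>)
 have "compact (f ` cball z R)" by (rule compact_continuous_image[OF f compact_cball])
 then have "closed (f ` cball z R)" by (rule compact_imp_closed)
 have "cball z R = ball z R \<union> sphere z R" by auto
 then have BC: "f ` cball z R = ?B \<union> ?C" by (simp add: image_Un)
 have fz: "f z \<in> ?B" using R by auto
 have K: "connected ?K" by simp
 have KC: "?K \<inter> ?C = {}" using connected_component_subset[of "- ?C" "f z"] by auto
 have "f z \<in> ?K" using fz disj by (auto simp: connected_component_refl_eq)
 have "?K \<inter> ?B = ?K \<inter> f ` cball z R" using BC KC by auto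
 have "openin (top_of_set ?K) (?K \<inter> ?B)" using \<open>open ?B\<close> by (simp add: openin_open_Int)
 moreover have "closedin (top_of_set ?K) (?K \<inter> ?B)"
  unfolding \<open>?K \<inter> ?B = _\<close> using \<open>closed (f ` cball z R)\<close> by (simp add: closedin_closed_Int)
 ultimately have "?K \<inter> ?B = {} \<or> ?K \<inter> ?B = ?K"
  using K by (auto simp: connected_clopen)
 then have "?K \<subseteq> ?B" using \<open>f z \<in> ?K\<close> fz by blast
 then have "?K \<subseteq> f ` cball z R" using BC by blast
 then have "bounded ?K" by (rule bounded_subset[OF compact_imp_bounded[OF \<open>compact (f ` cball z R)\<close>]])
 then have "f z \<in> inside (path_image ?g)"
  unfolding pi inside_def using fz disj by auto
 then show ?thesis using simple_closed_path_winding_number_inside[OF sp] by blast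
qed

text \<open>In the plane without T z, the image of a small circle under T is homotopic to a round
  circle or to its reverse, because its winding number is 1 or -1. Applying F to this homotopy
  multiplies the signs.\<close>

lemma op_at_compose:
 assumes T: "continuous_on (cball z R) T" "inj_on T (cball z R)" "0 < R"
  and F: "continuous_on E F" "inj_on F E" "open E" "T z \<in> E"
 shows "op_at (F \<circ> T) z \<longleftrightarrow>
  (op_at F (T z) \<longleftrightarrow> op_at T z)"
proof -
 let ?w = "T z"
 obtain \<rho> where \<rho>: "0 < \<rho>" "cball ?w \<rho> \<subseteq> E" using F open_contains_cball by blast
 have "continuous (at z) T" using T(1,3) by (intro continuous_on_interior[of "cball z R"]) auto
 then obtain d where d: "0 < d" "\<And>u. dist u z < d ==> dist (T u) ?w < \<rho>"
  using \<rho>(1) unfolding continuous_at by (auto simp: tendsto_iff eventually_at) (metis dist_self)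
 define r where "r = min R (d / 2)"
 have r: "0 < r" "r \<le> R" "r < d" using T d by (auto simp: r_def)
 have Tin: "T u \<in> cball ?w \<rho>" if "u \<in> cball z r" for u
 proof -
  have "dist u z < d" using that r by (simp add: dist_commute)
  then show ?thesis using d(2)[of u] by (simp add: dist_commute)
 qed
 have Tr: "continuous_on (cball z r) T" "inj_on T (cball z r)"
  using T r by (auto intro: continuous_on_subset inj_on_subset)
 have Tne: "T u ~= ?w" if "u \<in> cball z r" "u ~= z" for u
  using inj_onD[OF Tr(2), of u z] that r by auto
 \<comment> \<open>The homotopy may leave the disc on which F is controlled. \<open>Rt\<close> is
   the radial retraction of the plane onto this disc; it fixes the disc and sends only the centre to
   the centre, so G extends F to the plane and takes the value F w only at the centre w.\<close>
 define Rt where "Rt = (\<lambda>u. ?w + of_real (\<rho> / max \<rho> (norm (u - ?w))) * (u - ?w))"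
 define G where "G = F \<circ> Rt"
 have Rtid: "Rt u = u" if "u \<in> cball ?w \<rho>" for u
  using that \<rho> by (simp add: Rt_def dist_norm norm_minus_commute max_absorb1)
 have Rtin: "Rt u \<in> cball ?w \<rho>" for u
 proof -
  have "norm (of_real (\<rho> / max \<rho> (norm (u - ?w))) * (u - ?w)) = \<rho> * (norm (u - ?w) / max \<rho> (norm (u - ?w)))"
   using \<rho>(1) by (simp add: norm_mult norm_divide del: of_real_divide)
  also have "\<dots> \<le> \<rho> * 1" using \<rho>(1) by (intro mult_left_mono) (auto simp: divide_le_eq)
  finally show ?thesis by (simp add: Rt_def dist_norm)
 qed
 have Rtne: "Rt u ~= ?w" if "u ~= ?w" for u
  using that \<rho>(1) by (auto simp: Rt_def max_def)
 have "continuous_on UNIV Rt" unfolding Rt_def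
  by (intro continuous_intros) (use \<rho>(1) in \<open>auto simp: max_def\<close>)
 moreover have RtE: "Rt u \<in> E" for u using Rtin \<rho>(2) by blast
 then have "continuous_on (range Rt) F" by (intro continuous_on_subset[OF F(1)]) blast
 ultimately have Gc: "continuous_on UNIV G" unfolding G_def by (rule continuous_on_compose)
 have Gne: "G u ~= F ?w" if "u ~= ?w" for u
  using inj_on_eq_iff[OF F(2) RtE[of u] F(4)] Rtne[OF that] by (simp add: G_def)
 have GT: "G \<circ> (T \<circ> circlepath z r) = (F \<circ> T) \<circ> circlepath z r"
  using Tin[OF circlepath_in_cball[OF r(1) order_refl]] by (auto simp: G_def Rtid)
 have GC: "G \<circ> circlepath ?w \<rho> = F \<circ> circlepath ?w \<rho>"
  using circlepath_in_cball[OF \<rho>(1) order_refl] by (auto simp: G_def Rtid)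
 have opT: "op_at T z \<longleftrightarrow> winding_number (T \<circ> circlepath z r) ?w = 1"
  by (rule op_at_iff) (use Tr r Tne in auto)
 have FE: "continuous_on (cball ?w \<rho>) F" "inj_on F (cball ?w \<rho>)"
  using F \<rho> by (auto intro: continuous_on_subset inj_on_subset)
 have opF: "op_at F ?w \<longleftrightarrow> winding_number (F \<circ> circlepath ?w \<rho>) (F ?w) = 1"
  by (rule op_at_iff) (use FE \<rho> in \<open>auto simp: inj_on_def\<close>)
 have Fpm: "winding_number (F \<circ> circlepath ?w \<rho>) (F ?w) \<in> {1, -1}"
  by (rule winding_number_injective_image) (use FE \<rho> in auto)
 have opFT: "op_at (F \<circ> T) z \<longleftrightarrow> winding_number ((F \<circ> T) \<circ> circlepath z r) ((F \<circ> T) z) = 1"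
 proof (rule op_at_iff)
  show "continuous_on (cball z r) (F \<circ> T)"
   by (rule continuous_on_compose[OF Tr(1)]) (use Tin \<rho>(2) in \<open>auto intro!: continuous_on_subset[OF F(1)]\<close>)
  fix u assume u: "u \<in> cball z r" "u ~= z"
  show "(F \<circ> T) u ~= (F \<circ> T) z"
   using inj_on_eq_iff[OF F(2) subsetD[OF \<rho>(2) Tin[OF u(1)]] F(4)] Tne[OF u] by simp
 qed (rule r)
 have "path (T \<circ> circlepath z r)"
  by (rule path_continuous_image) (use r in \<open>auto intro!: continuous_on_subset[OF Tr(1)]\<close>)
 moreover have "?w \<notin> path_image (T \<circ> circlepath z r)"
 proof
  assume "?w \<in> path_image (T \<circ> circlepath z r)"
  then obtain t where "T (circlepath z r t) = ?w" by (auto simp: path_image_def)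
  then show False
   using Tne[OF circlepath_in_cball[OF r(1) order_refl] circlepath_neq_centre[OF r(1)]] by blast
 qed
 ultimately have pT: "path (T \<circ> circlepath z r)" "?w \<notin> path_image (T \<circ> circlepath z r)"
  "pathfinish (T \<circ> circlepath z r) = pathstart (T \<circ> circlepath z r)"
  by (auto simp: pathfinish_compose pathstart_compose)
 have Tpm: "winding_number (T \<circ> circlepath z r) ?w \<in> {1, -1}"
  by (rule winding_number_injective_image) (use Tr r in auto)
 have key: "winding_number ((F \<circ> T) \<circ> circlepath z r) (F ?w) = winding_number (G \<circ> q) (F ?w)"
  if q: "path q" "?w \<notin> path_image q" "pathfinish q = pathstart q"
   "winding_number (T \<circ> circlepath z r) ?w = winding_number q ?w" for q
 proof (rule winding_number_homotopic_loops)
  have "homotopic_loops (- {?w}) (T \<circ> circlepath z r) q"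
   using winding_number_homotopic_loops_eq[OF pT(1,2) q(1,2) pT(3) q(3)] q(4) by blast
  then have "homotopic_loops (- {F ?w}) (G \<circ> (T \<circ> circlepath z r)) (G \<circ> q)"
   by (rule homotopic_loops_continuous_image) (use Gne in \<open>auto intro: continuous_on_subset[OF Gc]\<close>)
  then show "homotopic_loops (- {F ?w}) ((F \<circ> T) \<circ> circlepath z r) (G \<circ> q)"
   unfolding GT .
 qed
 have rev: "G \<circ> reversepath (circlepath ?w \<rho>) = reversepath (F \<circ> circlepath ?w \<rho>)"
  unfolding GC[symmetric] by (auto simp: reversepath_def)
 have "path (F \<circ> circlepath ?w \<rho>)"
  by (rule path_continuous_image) (use \<rho> in \<open>auto intro!: continuous_on_subset[OF FE(1)]\<close>)
 moreover have "F ?w \<notin> path_image (F \<circ> circlepath ?w \<rho>)"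
 proof
  assume "F ?w \<in> path_image (F \<circ> circlepath ?w \<rho>)"
  then obtain t where "F (circlepath ?w \<rho> t) = F ?w" by (auto simp: path_image_def)
  then show False
   using inj_on_eq_iff[OF FE(2) circlepath_in_cball[OF \<rho>(1) order_refl], of ?w t] \<rho>(1)
    circlepath_neq_centre[OF \<rho>(1)] by auto
 qed
 ultimately have pF: "path (F \<circ> circlepath ?w \<rho>)" "F ?w \<notin> path_image (F \<circ> circlepath ?w \<rho>)" .
 have wc: "winding_number (circlepath ?w \<rho>) ?w = 1" using \<rho>(1) by (rule winding_number_circlepath_centre)
 have ni: "?w \<notin> path_image (circlepath ?w \<rho>)" using \<rho>(1) by simp
 show ?thesis
 proof (cases "op_at T z")
  case True
  then have "winding_number ((F \<circ> T) \<circ> circlepath z r) (F ?w) = winding_number (F \<circ> circlepath ?w \<rho>) (F ?w)"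
   unfolding GC[symmetric] using opT wc ni by (intro key) auto
  then show ?thesis using True opFT opF by simp
 next
  case False
  then have "winding_number (T \<circ> circlepath z r) ?w = -1" using opT Tpm by auto
  moreover have "winding_number (reversepath (circlepath ?w \<rho>)) ?w = -1"
   using winding_number_reversepath[of "circlepath ?w \<rho>" ?w] ni wc by simp
  ultimately have "winding_number ((F \<circ> T) \<circ> circlepath z r) (F ?w) = winding_number (G \<circ> reversepath (circlepath ?w \<rho>)) (F ?w)"
   using ni by (intro key) auto
  also have "\<dots> = - winding_number (F \<circ> circlepath ?w \<rho>) (F ?w)"
   unfolding rev by (rule winding_number_reversepath[OF pF])
  finally show ?thesis using False opFT opF Fpm by auto
 qed
qed

text \<open>On the circle, the straight homotopy from u - z to f u - f z can vanish only where these
  vectors point in opposite directions or the second one is 0; this is what the hypothesis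
  excludes.\<close>

lemma op_at_straight:
 assumes f: "continuous_on (cball z R) f" and R: "0 < R"
  and ne: "\<And>u c. u \<in> cball z R ==> u ~= z ==> 0 \<le> c ==> f u - f z ~= - (of_real c * (u - z))"
 shows "op_at f z"
proof -
 have inj: "f u ~= f z" if "u \<in> cball z R" "u ~= z" for u using ne[OF that, of 0] by auto
 let ?H = "\<lambda>(s, t). of_real (1 - s) * (circlepath z R t - z) + of_real s * (f (circlepath z R t) - f z)"
 have "winding_number (\<lambda>t. ?H (0, t)) 0 = winding_number (\<lambda>t. ?H (1, t)) 0"
 proof (rule winding_number_eq_homotopy)
  show "continuous_on ({0..1} \<times> {0..1}) ?H"
   unfolding case_prod_unfold circlepath
   by (intro continuous_intros continuous_on_compose2[OF f])
    (use circlepath_in_cball[OF R order_refl, of z] in \<open>auto simp: circlepath\<close>)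
 next
  fix s t :: real assume s: "s \<in> {0..1}"
  let ?u = "circlepath z R t"
  have u: "?u \<in> cball z R" "?u ~= z" using circlepath_in_cball[OF R order_refl] circlepath_neq_centre[OF R] by auto
  show "?H (s, t) ~= 0"
  proof (cases "s = 0")
   case True then show ?thesis using u by auto
  next
   case False
   show ?thesis
   proof
    assume "?H (s, t) = 0"
    then have "of_real s * (f ?u - f z) = - (of_real (1 - s) * (?u - z))"
     by (simp add: add_eq_0_iff)
    also have "of_real (1 - s) * (?u - z) = of_real s * (of_real ((1 - s) / s) * (?u - z))"
     using False by simp
    finally have "of_real s * (f ?u - f z) = of_real s * (- (of_real ((1 - s) / s) * (?u - z)))"
     by (simp only: mult_minus_right)
    moreover have "complex_of_real s ~= 0" using False by simp
    ultimately have "f ?u - f z = - (of_real ((1 - s) / s) * (?u - z))"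
     by (metis mult_left_cancel)
    then show False using ne[OF u, of "(1 - s) / s"] s by auto
   qed
  qed
 qed (simp add: circlepath)
 moreover have "(\<lambda>t. ?H (0, t)) = (\<lambda>t. circlepath z R t - z)" by auto
 moreover have "(\<lambda>t. ?H (1, t)) = (\<lambda>t. (f \<circ> circlepath z R) t - f z)" by auto
 ultimately have "winding_number (f \<circ> circlepath z R) (f z) = winding_number (circlepath z R) z"
  by (metis winding_number_offset)
 then show ?thesis using winding_number_circlepath_centre[OF R, of z]
  by (subst op_at_iff[OF f _ R]) (use inj in auto)
qed

lemma not_op_at_cnj: "\<not> op_at cnj z"
proof -
 have "op_at cnj z \<longleftrightarrow> winding_number (cnj \<circ> circlepath z 1) (cnj z) = 1"
  by (rule op_at_iff) (auto intro: continuous_intros)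
 moreover have "winding_number (cnj \<circ> circlepath z 1) (cnj z) = - cnj (winding_number (circlepath z 1) z)"
  by (rule winding_number_cnj) auto
 ultimately show ?thesis using winding_number_circlepath_centre[of 1 z] by auto
qed

section \<open>Crossing matrices\<close>

lemma three_cases: "(k::3) = 1 \<or> k = 2 \<or> k = 3" using exhaust_3 by blast

lemma distinct_three_cases:
 assumes "distinct [a, b, c :: 3]"
 shows "(a, b, c) \<in> {(1,2,3), (1,3,2), (2,1,3), (2,3,1), (3,1,2), (3,2,1)}"
 using assms three_cases[of a] three_cases[of b] three_cases[of c] by auto

lemma distinct_three_exhaust:
 assumes "distinct [a, b, c :: 3]"
 shows "k = a \<or> k = b \<or> k = c"
 using distinct_three_cases[OF assms] three_cases[of k] by auto

lemma sum_three_distinct: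
 assumes "distinct [a, b, c :: 3]"
 shows "sum f UNIV = f a + f b + f c"
proof -
 have "UNIV = {a, b, c}" using distinct_three_exhaust[OF assms] by auto
 moreover have "sum f {a, b, c} = f a + f b + f c" using assms by (simp add: add.assoc)
 ultimately show ?thesis by metis
qed

definition gram :: "'a::comm_ring_1^3^3" where
 "gram = (\<chi> i j. if i = j then 0 else -1)"

text \<open>The coordinates of the frame on the far side of an edge in the frame on the near side: the vectors
of the end points \<open>b\<close>, \<open>c\<close> are scaled, and column \<open>a\<close> is the general null vector with products \<open>-1\<close>.\<close>

definition cross :: "3 => 3 => 3 => 'a::field => 'a => 'a^3^3" where
 "cross a b c t x = (\<chi> k l.
  if l = a then (if k = a then x else if k = b then t - x else 1 / t - x)
  else if l = b then (if k = b then t else 0)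
  else (if k = c then 1 / t else 0))"

text \<open>Convention: left multiplication reads row \<sigma> i in place of row i, right
  multiplication moves column k to column \<sigma> k. Products therefore compose in the reverse
  order.\<close>

definition perm_matrix :: "(3 => 3) => 'a::semiring_1^3^3" where
 "perm_matrix \<sigma> = (\<chi> k l. if \<sigma> k = l then 1 else 0)"

text \<open>Column i is the vector -a + b + c of a frame, which is orthogonal for
  \<open>gram\<close> to the other two frame vectors: the polar vector of the side opposite to i. In
  these coordinates \<open>side_cone i\<close> becomes the cone of vectors with non-negative
  entries.\<close>

definition turn :: "3 => 'a::comm_ring_1^3^3" where
 "turn i = (\<chi> k l. if l = i then (if k = i then -1 else 1) else (if k = l then 1 else 0))"

lemma perm_matrix_mult_nth: "(perm_matrix \<sigma> ** A) $ i $ k = A $ (\<sigma> i) $ k"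
 by (simp add: perm_matrix_def matrix_matrix_mult_def if_distrib[of "\<lambda>x. x * _"] cong: if_cong)

lemma mult_perm_matrix_nth: "inj \<sigma> ==> (A ** perm_matrix \<sigma>) $ i $ \<sigma> k = A $ i $ k"
 by (simp add: perm_matrix_def matrix_matrix_mult_def if_distrib[of "\<lambda>x. _ * x"] inj_eq cong: if_cong)

lemma perm_matrix_comp: "perm_matrix \<sigma> ** perm_matrix \<tau> = perm_matrix (\<tau> \<circ> \<sigma>)"
 by (simp add: vec_eq_iff perm_matrix_mult_nth) (simp add: perm_matrix_def)

lemma perm_matrix_id: "perm_matrix id = mat 1"
 by (simp add: perm_matrix_def mat_def vec_eq_iff)

lemma perm_matrix_eqI:
 assumes "bij \<sigma>" and "\<And>i k. A $ i $ k = B $ (\<sigma> i) $ (\<sigma> k)"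
 shows "A ** perm_matrix \<sigma> = perm_matrix \<sigma> ** B"
proof -
 have "(A ** perm_matrix \<sigma>) $ i $ l = (perm_matrix \<sigma> ** B) $ i $ l" for i l
 proof -
  obtain k where "l = \<sigma> k" using assms(1) by (metis bij_pointE)
  then show ?thesis
   using assms by (simp add: perm_matrix_mult_nth mult_perm_matrix_nth bij_is_inj)
 qed
 then show ?thesis by (simp add: vec_eq_iff)
qed

lemma perm_matrix_turn:
 "bij \<sigma> ==> turn m ** perm_matrix \<sigma> = perm_matrix \<sigma> ** (turn (\<sigma> m) :: 'a::comm_ring_1^3^3)"
 by (rule perm_matrix_eqI) (auto simp: turn_def bij_def inj_eq)

lemma perm_matrix_cross:
 "bij \<sigma> ==> cross a b c t x ** perm_matrix \<sigma> =
  perm_matrix \<sigma> ** (cross (\<sigma> a) (\<sigma> b) (\<sigma> c) t x :: 'a::field^3^3)"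
 by (rule perm_matrix_eqI) (auto simp: cross_def bij_def inj_eq)

lemma turn_turn: "turn i ** turn i = mat 1"
 using three_cases[of i] by (auto simp: turn_def matrix_matrix_mult_def mat_def vec_eq_iff forall_3 sum_3)

lemma cross_swap: "distinct [a, b, c] ==> cross a b c t x = cross a c b (1 / t) x"
 using distinct_three_cases[of a b c] by (auto simp: cross_def vec_eq_iff forall_3)

lemma cross_inverse:
 assumes "distinct [a, b, c]" "t ~= 0" "x ~= 0"
 shows "cross a b c t x ** cross a b c (1 / t) (1 / x) = mat 1"
 using distinct_three_cases[OF assms(1)] assms(2,3)
 by (elim insertE emptyE) (simp_all add: cross_def matrix_matrix_mult_def mat_def vec_eq_iff forall_3 sum_3 field_simps)

text \<open>The crossing back is written with the labels of the far triangle. Moving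
  \<open>perm_matrix \<sigma>\<close> past it restores the near labels, where
  \<open>cross_inverse\<close> applies.\<close>

lemma cross_perm_inverse:
 assumes "distinct [a, b, c]" "t ~= 0" "x ~= 0" "\<tau> \<circ> \<sigma> = id" "\<sigma> \<circ> \<tau> = id"
 shows "(cross a b c t x ** perm_matrix \<sigma>) ** (cross (\<sigma> a) (\<sigma> b) (\<sigma> c) (1 / t) (1 / x) ** perm_matrix \<tau>) = mat 1"
proof -
 have b: "bij \<sigma>" using assms o_bij by blast
 have "(cross a b c t x ** perm_matrix \<sigma>) ** (cross (\<sigma> a) (\<sigma> b) (\<sigma> c) (1 / t) (1 / x) ** perm_matrix \<tau>)
  = cross a b c t x ** (perm_matrix \<sigma> ** cross (\<sigma> a) (\<sigma> b) (\<sigma> c) (1 / t) (1 / x)) ** perm_matrix \<tau>"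
  by (simp add: matrix_mul_assoc)
 also have "\<dots> = (cross a b c t x ** cross a b c (1 / t) (1 / x)) ** (perm_matrix \<sigma> ** perm_matrix \<tau>)"
  unfolding perm_matrix_cross[OF b, symmetric] by (simp add: matrix_mul_assoc)
 also have "\<dots> = mat 1" using assms by (simp add: cross_inverse perm_matrix_comp perm_matrix_id)
 finally show ?thesis .
qed

lemma distinct_three_bij:
 assumes "distinct [a, b, c :: 3]"
 obtains \<sigma> :: "3 => 3" where "bij \<sigma>" "\<sigma> 1 = a" "\<sigma> 2 = b" "\<sigma> 3 = c"
proof -
 define \<sigma> where "\<sigma> = (\<lambda>k :: 3. if k = 1 then a else if k = 2 then b else c)"
 have s: "\<sigma> 1 = a" "\<sigma> 2 = b" "\<sigma> 3 = c" by (auto simp: \<sigma>_def)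
 have "inj \<sigma>"
 proof (rule injI)
  fix x y assume "\<sigma> x = \<sigma> y"
  then show "x = y" using three_cases[of x] three_cases[of y] assms s by auto
 qed
 then have "bij \<sigma>" by (simp add: bij_def finite_UNIV_inj_surj)
 then show ?thesis using s that by blast
qed

text \<open>The columns of \<open>turn 1\<close> times the crossing are (-x, t, 1/t), (0, t, 0), (0,
  0, 1/t). The second \<open>turn\<close> replaces column 2 by (-x, 0, 2/t) or column 3 by (-x, 2t,
  0). So the moduli do not depend on x, and -x is 1 in the unbent case. For m = 1 an entry x would
  appear, which is negative at x = -1.\<close>

lemma norm_turn_cross_turn_le_123:
 fixes t :: real and x :: complex
 assumes "m ~= 1" "0 < t" "cmod x = 1"
 shows "cmod ((turn 1 ** cross 1 2 3 (of_real t) x ** turn m) $ j $ k) \<le>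
  (turn 1 ** cross 1 2 3 t (-1) ** turn m) $ j $ k"
proof -
 have n: "norm (1 / of_real t :: complex) = 1 / t" "norm (2 / of_real t :: complex) = 2 / t"
  using assms by (simp_all add: norm_divide)
 have "m = 2 \<or> m = 3" using three_cases[of m] assms(1) by blast
 then show ?thesis using assms(2,3) three_cases[of j] three_cases[of k]
  by (elim disjE) (simp_all add: cross_def turn_def matrix_matrix_mult_def sum_3 norm_divide n)
qed

lemma norm_turn_cross_turn_le_aux:
 fixes t :: real and x :: complex
 assumes "distinct [a, b, c]" "m ~= a" "0 < t" "cmod x = 1"
 shows "cmod ((turn a ** cross a b c (of_real t) x ** turn m) $ j $ k) \<le>
  (turn a ** cross a b c t (-1) ** turn m) $ j $ k"
proof -
 obtain \<sigma> :: "3 => 3" where s: "bij \<sigma>" "\<sigma> 1 = a" "\<sigma> 2 = b" "\<sigma> 3 = c"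
  using distinct_three_bij[OF assms(1)] by blast
 obtain m' j' k' :: 3 where m: "m = \<sigma> m'" and j: "j = \<sigma> j'" and k: "k = \<sigma> k'"
  using s(1) by (metis bij_pointE)
 have eq: "(turn 1 ** cross 1 2 3 t' x' ** turn m') ** perm_matrix \<sigma>
   = perm_matrix \<sigma> ** (turn a ** cross a b c t' x' ** turn m)" for t' x' :: "'z::field"
  using perm_matrix_turn[OF s(1), of 1] perm_matrix_turn[OF s(1), of m'] perm_matrix_cross[OF s(1), of 1 2 3 t' x']
  unfolding m s(2-4) by (metis matrix_mul_assoc)
 have nth: "(turn a ** cross a b c t' x' ** turn m) $ j $ k = (turn 1 ** cross 1 2 3 t' x' ** turn m') $ j' $ k'"
  for t' x' :: "'z::field"
  using arg_cong[OF eq, of "\<lambda>A. A $ j' $ k" t' x'] s(1)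
  by (simp add: perm_matrix_mult_nth j k mult_perm_matrix_nth bij_is_inj)
 have "m' ~= 1" using assms(2) m s(2) by auto
 then show ?thesis unfolding nth using norm_turn_cross_turn_le_123 assms(3,4) by blast
qed

lemma norm_turn_cross_turn_le:
 fixes t :: real and x :: complex
 assumes "distinct [a, b, c]" "bij \<sigma>" "l ~= \<sigma> a" "0 < t" "cmod x = 1"
 shows "cmod ((turn a ** (cross a b c (of_real t) x ** perm_matrix \<sigma>) ** turn l) $ j $ k) \<le>
  (turn a ** (cross a b c t (-1) ** perm_matrix \<sigma>) ** turn l) $ j $ k"
proof -
 obtain m k' where l: "l = \<sigma> m" and k: "k = \<sigma> k'" using assms(2) by (metis bij_pointE)
 have eq: "turn a ** (X ** perm_matrix \<sigma>) ** turn l = (turn a ** X ** turn m) ** perm_matrix \<sigma>"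
  for X :: "'z::field^3^3"
  unfolding l by (metis matrix_mul_assoc perm_matrix_turn[OF assms(2)])
 show ?thesis unfolding eq k
  using norm_turn_cross_turn_le_aux[of a b c m t x j k'] assms l
  by (auto simp: mult_perm_matrix_nth bij_is_inj)
qed

text \<open>The cone over the closed arc that the side opposite to the corner \<open>i\<close> cuts off.\<close>

definition side_cone :: "3 => (real^3) set" where
 "side_cone i = {v. v $ i \<le> 0 \<and> (\<forall>j. j ~= i --> 0 \<le> v $ i + v $ j)}"

text \<open>In the near labels the flat crossing negates coordinate a and multiplies the sums of a
  with b and with c by t and 1/t. It thus exchanges the two sides of the edge and keeps the signs of
  these sums.\<close>

lemma side_cone_cross:
 assumes "distinct [a, b, c]" "bij \<sigma>" "0 < t"
  and v: "0 \<le> v $ \<sigma> a" "\<And>j. j ~= \<sigma> a ==> 0 \<le> v $ \<sigma> a + v $ j"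
 shows "(cross a b c t (-1) ** perm_matrix \<sigma>) *v v \<in> side_cone a"
proof -
 define u :: "real^3" where "u = perm_matrix \<sigma> *v v"
 have u: "u $ k = v $ \<sigma> k" for k
  by (simp add: u_def matrix_vector_mult_def perm_matrix_def if_distrib[of "\<lambda>x. x * _"] cong: if_cong)
 have ne: "\<sigma> b ~= \<sigma> a" "\<sigma> c ~= \<sigma> a" using assms(1,2) by (auto simp: bij_def inj_eq)
 have 1: "0 \<le> u $ a" "0 \<le> u $ a + u $ b" "0 \<le> u $ a + u $ c" using v ne by (auto simp: u)
 have eq: "(cross a b c t (-1) ** perm_matrix \<sigma>) *v v = cross a b c t (-1) *v u"
  by (simp add: u_def matrix_vector_mul_assoc)
 have ea: "(cross a b c t (-1) *v u) $ a = - u $ a"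
  and eb: "(cross a b c t (-1) *v u) $ b = u $ a + t * (u $ a + u $ b)"
  and ec: "(cross a b c t (-1) *v u) $ c = u $ a + (u $ a + u $ c) / t"
  using assms(1,3) by (auto simp: cross_def matrix_vector_mult_def sum_three_distinct[OF assms(1)] field_simps)
 have "0 \<le> (cross a b c t (-1) *v u) $ a + (cross a b c t (-1) *v u) $ j" if "j ~= a" for j
  using distinct_three_exhaust[OF assms(1), of j] that 1 assms(3) by (auto simp: ea eb ec)
 then show ?thesis unfolding eq side_cone_def using 1 by (simp add: ea)
qed

text \<open>This is the ping-pong step: what lies beyond one side of a triangle is on the inner side
  of each other side, which is the input of \<open>side_cone_cross\<close> for the next
  crossing.\<close>

lemma side_cone_other:
 assumes "v \<in> side_cone i" "i ~= k"
 shows "0 \<le> v $ k \<and> (\<forall>j. j ~= k --> 0 \<le> v $ k + v $ j)"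
 using assms unfolding side_cone_def
 by simp (smt (verit, best))

text \<open>An inequality between moduli remains visible after multiplication by unit scalars.
  Column i of the identity matrix violates this one, which separates the cones from the
  scalars.\<close>

lemma side_cone_abs: 
 assumes "v \<in> side_cone i"
 shows "\<bar>v $ i\<bar> \<le> (\<Sum>j\<in>UNIV - {i}. \<bar>v $ j\<bar>)"
proof -
 obtain j where j: "j ~= i" by (metis one_neq_zero)
 then have "\<bar>v $ i\<bar> \<le> \<bar>v $ j\<bar>" using assms by (force simp: side_cone_def)
 also have "\<dots> \<le> (\<Sum>j\<in>UNIV - {i}. \<bar>v $ j\<bar>)" using j by (intro member_le_sum) auto
 finally show ?thesis .
qed

section \<open>Spectral radius and traces of powers\<close>

primrec mpow :: "'a::semiring_1^'n^'n => nat => 'a^'n^'n" where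
 "mpow A 0 = mat 1"
| "mpow A (Suc n) = A ** mpow A n"

lemma eigenvalue_iff_det:
 fixes A :: "'a::field^'n^'n"
 shows "(\<exists>v. v ~= 0 \<and> A *v v = l *s v) \<longleftrightarrow> det (mat l - A) = 0"
proof -
 have "mat l *v v = l *s v" for v :: "'a^'n"
  by (simp add: vec_eq_iff matrix_vector_mult_def mat_def if_distrib[of "\<lambda>x. x * _"] cong: if_cong)
 then have "(mat l - A) *v v = l *s v - A *v v" for v
  by (simp add: matrix_vector_mult_diff_rdistrib)
 then have "A *v v = l *s v \<longleftrightarrow> (mat l - A) *v v = 0" for v by auto
 then show ?thesis
  using invertible_left_inverse[of "mat l - A"] matrix_left_invertible_ker[of "mat l - A"] invertible_det_nz[of "mat l - A"]
  by metis
qed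

text \<open>The fundamental theorem of algebra gives one root \<open>a\<close>; the other two solve
  a quadratic equation with sum p and product q.\<close>

lemma cubic_roots:
 fixes e1 e2 e3 :: complex
 obtains a b c where "e1 = a + b + c" "e2 = a * b + b * c + c * a" "e3 = a * b * c"
proof -
 define f where "f k = (if k = 0 then - e3 else if k = 1 then e2 else if k = 2 then - e1 else 1)" for k :: nat
 have "\<exists>a. (\<Sum>k\<le>3. f k * a ^ k) = 0"
  by (rule alg_closed) (simp_all add: f_def)
 then obtain a where "(\<Sum>k\<le>3. f k * a ^ k) = 0" by (rule exE)
 then have a: "- e3 + e2 * a - e1 * a\<^sup>2 + a ^ 3 = 0"
  by (simp add: f_def numeral_3_eq_3 numeral_2_eq_2)
 define p where "p = e1 - a"
 define q where "q = a\<^sup>2 - e1 * a + e2"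
 define d where "d = csqrt (p\<^sup>2 - 4 * q)"
 have d: "d\<^sup>2 = p\<^sup>2 - 4 * q" by (simp add: d_def)
 define b where "b = (p + d) / 2"
 define c where "c = (p - d) / 2"
 have bc: "b + c = p" by (simp add: b_def c_def field_simps)
 have "b * c = (p\<^sup>2 - d\<^sup>2) / 4" by (simp add: b_def c_def power2_eq_square field_simps)
 then have bq: "b * c = q" using d by simp
 have e3: "e3 = a * (a * (a - e1) + e2)" using a by (simp add: power2_eq_square power3_eq_cube algebra_simps)
 show ?thesis
 proof
  show "e1 = a + b + c" using bc by (simp add: p_def algebra_simps)
  have "a * b + b * c + c * a = a * (b + c) + b * c" by (simp add: algebra_simps)
  then show "e2 = a * b + b * c + c * a" unfolding bc bq by (simp add: p_def q_def power2_eq_square algebra_simps)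
  have "a * b * c = a * q" by (simp add: bq[symmetric])
  then show "e3 = a * b * c" unfolding e3 by (simp add: q_def power2_eq_square algebra_simps)
 qed
qed

text \<open>The three eigenvalues with multiplicity, prescribed through the coefficients of the
  characteristic polynomial.\<close>

definition eigenvalues3 :: "complex^3^3 => complex => complex => complex => bool" where
 "eigenvalues3 A a b c \<longleftrightarrow> trace A = a + b + c \<and>
  A$1$1 * A$2$2 - A$1$2 * A$2$1 + (A$1$1 * A$3$3 - A$1$3 * A$3$1) + (A$2$2 * A$3$3 - A$2$3 * A$3$2)
   = a * b + b * c + c * a \<and> det A = a * b * c"

lemma eigenvalues3_exist: "\<exists>a b c. eigenvalues3 A a b c"
 unfolding eigenvalues3_def by (meson cubic_roots)

lemma eigenvalues3_det:
 assumes "eigenvalues3 A a b c"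
 shows "det (mat l - A) = (l - a) * (l - b) * (l - c)"
proof -
 have "det (mat l - A) = l ^ 3 - trace A * l\<^sup>2
  + (A$1$1 * A$2$2 - A$1$2 * A$2$1 + (A$1$1 * A$3$3 - A$1$3 * A$3$1) + (A$2$2 * A$3$3 - A$2$3 * A$3$2)) * l - det A"
  by (simp add: det_3 mat_def trace_def sum_3 power2_eq_square power3_eq_cube algebra_simps)
 also have "\<dots> = l ^ 3 - (a + b + c) * l\<^sup>2 + (a * b + b * c + c * a) * l - a * b * c"
  using assms unfolding eigenvalues3_def by (elim conjE) (simp only:)
 finally show ?thesis by (simp add: power2_eq_square power3_eq_cube algebra_simps)
qed

lemma cayley_hamilton3:
 fixes A :: "'a::comm_ring_1^3^3"
 shows "(A ** (A ** A)) $ i $ j = trace A * (A ** A) $ i $ j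
  - (A$1$1 * A$2$2 - A$1$2 * A$2$1 + (A$1$1 * A$3$3 - A$1$3 * A$3$1) + (A$2$2 * A$3$3 - A$2$3 * A$3$2)) * A $ i $ j
  + det A * mat 1 $ i $ j"
 using exhaust_3[of i] exhaust_3[of j]
 by (elim disjE) (simp_all add: matrix_matrix_mult_def det_3 mat_def trace_def sum_3 algebra_simps)

text \<open>The Cayley-Hamilton identity, multiplied by a power of A, yields the linear recursion
  that the power sums of a, b, c satisfy; the exponents 0, 1, 2 are computed directly.\<close>

lemma trace_mpow:
 assumes "eigenvalues3 A a b c"
 shows "trace (mpow A n) = a ^ n + b ^ n + c ^ n"
proof (induction n rule: less_induct)
 case (less n)
 let ?e2 = "A$1$1 * A$2$2 - A$1$2 * A$2$1 + (A$1$1 * A$3$3 - A$1$3 * A$3$1) + (A$2$2 * A$3$3 - A$2$3 * A$3$2)"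
 have e: "trace A = a + b + c" "?e2 = a * b + b * c + c * a" "det A = a * b * c"
  using assms by (auto simp: eigenvalues3_def)
 consider "n = 0" | "n = 1" | "n = 2" | m where "n = m + 3"
  by (metis One_nat_def Suc_1 add.commute add_2_eq_Suc add_Suc_right less_2_cases not_less_eq numeral_3_eq_3 le_add_diff_inverse linorder_not_less Suc_leI)
 then show ?case
 proof cases
  case 1 then show ?thesis by (simp add: trace_def mat_def)
 next
  case 2 then show ?thesis using e by simp
 next
  case 3
  have "trace (A ** A) = (trace A)\<^sup>2 - 2 * ?e2"
   by (simp add: trace_def matrix_matrix_mult_def sum_3 power2_eq_square algebra_simps)
  then show ?thesis unfolding 3 e by (simp add: numeral_2_eq_2 e power2_eq_square algebra_simps)
 next
  case (4 m)
  define B where "B = mpow A m"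
  have "trace (A ** (A ** A) ** B) = (\<Sum>i\<in>UNIV. \<Sum>j\<in>UNIV. (A ** (A ** A)) $ i $ j * B $ j $ i)"
   by (simp add: trace_def matrix_matrix_mult_def[of "A ** (A ** A)"])
  also have "\<dots> = (\<Sum>i\<in>UNIV. \<Sum>j\<in>UNIV. trace A * ((A ** A) $ i $ j * B $ j $ i) - ?e2 * (A $ i $ j * B $ j $ i)
    + det A * ((mat 1 :: complex^3^3) $ i $ j * B $ j $ i))"
   by (intro sum.cong refl) (simp only: cayley_hamilton3, simp only: algebra_simps)
  also have "\<dots> = trace A * trace (A ** A ** B) - ?e2 * trace (A ** B) + det A * trace (mat 1 ** B)"
   by (simp add: trace_def matrix_matrix_mult_def[of "A ** A" B] matrix_matrix_mult_def[of A B]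
     matrix_matrix_mult_def[of "mat 1" B] sum.distrib sum_subtractf sum_distrib_left del: matrix_mul_lid)
  finally have "trace (mpow A n) = (a + b + c) * trace (mpow A (m + 2)) - (a * b + b * c + c * a) * trace (mpow A (m + 1))
   + a * b * c * trace (mpow A m)"
   unfolding e 4 by (simp add: B_def numeral_3_eq_3 numeral_2_eq_2 matrix_mul_assoc)
  also have "\<dots> = (a + b + c) * (a ^ (m + 2) + b ^ (m + 2) + c ^ (m + 2))
   - (a * b + b * c + c * a) * (a ^ (m + 1) + b ^ (m + 1) + c ^ (m + 1)) + a * b * c * (a ^ m + b ^ m + c ^ m)"
   using less[of m] less[of "m + 1"] less[of "m + 2"] unfolding 4 by (simp del: mpow.simps)
  also have "\<dots> = a ^ n + b ^ n + c ^ n"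
   unfolding 4 by (simp add: power_add power2_eq_square power3_eq_cube algebra_simps)
  finally show ?thesis .
 qed
qed

lemma det_adjoint_matrix: "det (adjoint_matrix A) = cnj (det A)"
 by (simp add: adjoint_matrix_def det_3 algebra_simps)

lemma det_J21: "det (J21 :: complex^3^3) = -1"
 by (simp add: J21_def det_3)

lemma U21_det:
 assumes "A \<in> carrier U21"
 shows "cmod (det A) = 1"
proof -
 have "adjoint_matrix A ** J21 ** A = J21" using assms by (simp add: U21_def)
 then have "det (adjoint_matrix A ** J21 ** A) = -1" by (simp add: det_J21)
 then have "cnj (det A) * det A = 1" by (simp add: det_mul det_adjoint_matrix det_J21)
 then have "cmod (det A) * cmod (det A) = 1" by (metis complex_mod_cnj norm_mult norm_one)
 then show ?thesis by (metis abs_norm_cancel mult_1 power2_eq_square real_sqrt_abs real_sqrt_one)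
qed

text \<open>The adjoint of l - A, multiplied by J A, is J (cnj l A - 1) because A preserves the
  form. So the spectrum is symmetric under reflection in the unit circle.\<close>

lemma U21_eigenvalue_reflect:
 assumes A: "A \<in> carrier U21" and l: "det (mat l - A) = 0"
 shows "l ~= 0" "det (mat (1 / cnj l) - A) = 0"
proof -
 have J: "adjoint_matrix A ** J21 ** A = J21" using A by (simp add: U21_def)
 have dA: "det A ~= 0" using U21_det[OF A] by auto
 show "l ~= 0"
 proof
  assume "l = 0"
  then have "mat l - A = - A" by (simp add: vec_eq_iff mat_def)
  then have "det (- A) = 0" using l by (simp only:)
  moreover have "det (- A) = - det A" by (simp add: det_3 algebra_simps)
  ultimately show False using dA by (simp only: neg_equal_0_iff_equal)
 qed
 have adj: "adjoint_matrix (mat l - A) = mat (cnj l) - adjoint_matrix A"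
  by (simp add: adjoint_matrix_def mat_def vec_eq_iff)
 have diff: "(X - Y) ** Z = X ** Z - Y ** Z" for X Y Z :: "complex^3^3"
  by (simp add: vec_eq_iff matrix_matrix_mult_def left_diff_distrib sum_subtractf)
 have "(mat (cnj l) - adjoint_matrix A) ** J21 ** A = mat (cnj l) ** J21 ** A - J21"
  by (simp only: diff J)
 also have "\<dots> = J21 ** (mat (cnj l) ** A - mat 1)"
  by (simp add: vec_eq_iff matrix_matrix_mult_def mat_def forall_3 sum_3 algebra_simps)
 finally have "det (mat (cnj l) ** A - mat 1) = 0"
  using l dA det_J21 by (metis (no_types) adj complex_cnj_zero det_adjoint_matrix det_mul mult_zero_left mult_eq_0_iff neg_equal_0_iff_equal one_neq_zero)
 moreover have "mat (cnj l) ** A - mat 1 = mat (- cnj l) ** (mat (1 / cnj l) - A)"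
  using \<open>l ~= 0\<close> by (simp add: vec_eq_iff forall_3 matrix_matrix_mult_def mat_def sum_3 right_diff_distrib)
 ultimately have "det (mat (- cnj l) :: complex^3^3) * det (mat (1 / cnj l) - A) = 0"
  by (simp add: det_mul)
 moreover have "det (mat (- cnj l) :: complex^3^3) ~= 0" using \<open>l ~= 0\<close> by (simp add: det_3 mat_def)
 ultimately show "det (mat (1 / cnj l) - A) = 0" by simp
qed

lemma spectral_radius3_eq:
 assumes "eigenvalues3 A a b c"
 shows "spectral_radius3 A = max (cmod a) (max (cmod b) (cmod c))"
proof -
 have "{cmod l | l. \<exists>v. v ~= 0 \<and> A *v v = l *s v} = {cmod a, cmod b, cmod c}"
  unfolding eigenvalue_iff_det eigenvalues3_det[OF assms] by auto
 then show ?thesis by (simp add: spectral_radius3_def)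
qed

lemma U21_spectral_radius_ge_1:
 assumes "A \<in> carrier U21"
 shows "1 \<le> spectral_radius3 A"
proof -
 obtain a b c where e: "eigenvalues3 A a b c" using eigenvalues3_exist by blast
 then have "cmod a * cmod b * cmod c = 1" using U21_det[OF assms] by (simp add: eigenvalues3_def norm_mult)
 then have "\<not> (cmod a < 1 \<and> cmod b < 1 \<and> cmod c < 1)"
  by (metis mult_strict_mono' mult_1 norm_ge_zero order_less_irrefl zero_le_mult_iff)
 then show ?thesis unfolding spectral_radius3_eq[OF e] by auto
qed

lemma spectral_radius3_power:
 "cmod (trace (mpow A n)) \<le> 3 * spectral_radius3 A ^ n"
proof -
 obtain a b c where e: "eigenvalues3 A a b c" using eigenvalues3_exist by blast
 let ?r = "spectral_radius3 A"
 have "cmod a \<le> ?r" "cmod b \<le> ?r" "cmod c \<le> ?r" unfolding spectral_radius3_eq[OF e] by auto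
 then have "cmod a ^ n \<le> ?r ^ n" "cmod b ^ n \<le> ?r ^ n" "cmod c ^ n \<le> ?r ^ n"
  by (auto intro: power_mono)
 moreover have "cmod (a ^ n + b ^ n + c ^ n) \<le> cmod a ^ n + cmod b ^ n + cmod c ^ n"
  by (metis (no_types) norm_power norm_triangle_ineq order_trans add_right_mono)
 ultimately show ?thesis unfolding trace_mpow[OF e] by linarith
qed

text \<open>The eigenvalue of modulus r > 1 has its mirror image of modulus 1/r in the spectrum, and
  the determinant of modulus 1 leaves modulus 1 for the third. The last two contribute at most 2 to
  any trace.\<close>

lemma U21_spectral_radius_power:
 assumes A: "A \<in> carrier U21" and gt: "1 < spectral_radius3 A"
 shows "spectral_radius3 A ^ n - 2 \<le> cmod (trace (mpow A n))"
proof -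
 let ?r = "spectral_radius3 A"
 obtain a b c where e: "eigenvalues3 A a b c" using eigenvalues3_exist by blast
 have m: "?r = max (cmod a) (max (cmod b) (cmod c))" by (rule spectral_radius3_eq[OF e])
 have prod: "cmod a * cmod b * cmod c = 1" using U21_det[OF A] e by (simp add: eigenvalues3_def norm_mult)
 have key: "?r ^ n - 2 \<le> cmod (x ^ n + y ^ n + z ^ n)"
  if x: "cmod x = ?r" and p: "cmod x * cmod y * cmod z = 1" and
   "\<And>l. det (mat l - A) = (l - x) * (l - y) * (l - z)" for x y z
 proof -
  have "det (mat x - A) = 0" using that(3) by simp
  then have "1 / cnj x \<in> {x, y, z}" using U21_eigenvalue_reflect[OF A] that(3) by auto
  moreover have "cmod (1 / cnj x) < 1" using x gt by (simp add: norm_divide)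
  ultimately have "1 / cnj x = y \<or> 1 / cnj x = z" using x gt by auto
  then have "cmod y = 1 / ?r \<or> cmod z = 1 / ?r" using x by (auto simp: norm_divide)
  then have "(cmod y = 1 / ?r \<and> cmod z = 1) \<or> (cmod z = 1 / ?r \<and> cmod y = 1)"
   using p x gt by auto
  moreover have "1 / ?r \<le> 1" using gt by simp
  ultimately have "cmod y \<le> 1 \<and> cmod z \<le> 1" by linarith
  then have "cmod y ^ n \<le> 1" "cmod z ^ n \<le> 1" by (auto intro: power_le_one)
  moreover have "cmod (x ^ n) \<le> cmod (x ^ n + y ^ n + z ^ n) + cmod (y ^ n) + cmod (z ^ n)"
   using norm_triangle_ineq4[of "x ^ n + y ^ n + z ^ n" "y ^ n + z ^ n"] norm_triangle_ineq[of "y ^ n" "z ^ n"]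
   by (simp add: algebra_simps)
  ultimately show ?thesis using x by (simp add: norm_power)
 qed
 have d: "det (mat l - A) = (l - a) * (l - b) * (l - c)" for l by (rule eigenvalues3_det[OF e])
 consider "cmod a = ?r" | "cmod b = ?r" | "cmod c = ?r" using m by linarith
 then show ?thesis
 proof cases
  case 1 show ?thesis unfolding trace_mpow[OF e] by (rule key) (use 1 prod d in auto)
 next
  case 2
  have "?r ^ n - 2 \<le> cmod (b ^ n + a ^ n + c ^ n)" by (rule key) (use 2 prod d in \<open>auto simp: mult_ac\<close>)
  then show ?thesis unfolding trace_mpow[OF e] by (simp add: add_ac)
 next
  case 3
  have "?r ^ n - 2 \<le> cmod (c ^ n + a ^ n + b ^ n)" by (rule key) (use 3 prod d in \<open>auto simp: mult_ac\<close>)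
  then show ?thesis unfolding trace_mpow[OF e] by (simp add: add_ac)
 qed
qed

lemma spectral_radius3_le_of_trace:
 assumes A: "A \<in> carrier U21" and B: "B \<in> carrier U21"
  and le: "\<And>n. cmod (trace (mpow A n)) \<le> cmod (trace (mpow B n))"
 shows "spectral_radius3 A \<le> spectral_radius3 B"
proof (rule ccontr)
 let ?r = "spectral_radius3 A" and ?s = "spectral_radius3 B"
 assume "\<not> ?r \<le> ?s"
 then have rs: "?s < ?r" "1 \<le> ?s" using U21_spectral_radius_ge_1[OF B] by auto
 \<comment> \<open>The bound 3 s^n on one side and the loss 2 on the other combine to 5 s^n because
   s is at least 1.\<close>
 have "(?r / ?s) ^ n \<le> 5" for n
 proof -
  have "?r ^ n - 2 \<le> 3 * ?s ^ n"
   using U21_spectral_radius_power[OF A, of n] rs le[of n] spectral_radius3_power[of B n] by auto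
  moreover have "1 \<le> ?s ^ n" using rs by simp
  ultimately have "?r ^ n \<le> 5 * ?s ^ n" by linarith
  then show ?thesis using rs by (simp add: power_divide divide_le_eq)
 qed
 moreover have "1 < ?r / ?s" using rs by (simp add: less_divide_eq)
 ultimately show False using real_arch_pow[of "?r / ?s" 5] by (metis not_less)
qed

section \<open>Frames of real ideal triangles\<close>

lemma herm_scale_left: "herm (c *s v) w = c * herm v w"
 by (simp add: herm_def algebra_simps)
lemma herm_scale_right: "herm v (c *s w) = cnj c * herm v w"
 by (simp add: herm_def algebra_simps)
lemma herm_commute: "herm w v = cnj (herm v w)"
 by (simp add: herm_def algebra_simps)

lemma sum_cnj_matrix_vector:
 "(\<Sum>i\<in>UNIV. u $ i * cnj ((A *v w) $ i)) = (\<Sum>k\<in>UNIV. (adjoint_matrix A *v u) $ k * cnj (w $ k))"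
 by (simp add: matrix_vector_mult_def adjoint_matrix_def sum_3 algebra_simps)

lemma herm_eq_sum: "herm z w = (\<Sum>i\<in>UNIV. (J21 *v z) $ i * cnj (w $ i))"
 by (simp add: herm_def J21_def matrix_vector_mult_def sum_3)

lemma herm_matrix:
 "herm (A *v z) (A *v w) = (\<Sum>k\<in>UNIV. ((adjoint_matrix A ** J21 ** A) *v z) $ k * cnj (w $ k))"
 unfolding herm_eq_sum sum_cnj_matrix_vector by (simp add: matrix_vector_mul_assoc matrix_mul_assoc)

lemma herm_U21: "A \<in> carrier U21 ==> herm (A *v z) (A *v w) = herm z w"
 unfolding herm_matrix by (simp add: U21_def herm_eq_sum)

lemma adjoint_J21_nth: "(adjoint_matrix F ** J21 ** F) $ j $ k = herm (column k F) (column j F)"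
 by (simp add: matrix_matrix_mult_def adjoint_matrix_def J21_def herm_def column_def sum_3 algebra_simps)

lemma herm_null_zero: "herm v v = 0 ==> v $ 3 = 0 ==> v $ 2 = 0"
 by (simp add: herm_def)

text \<open>A form of signature (2,1) contains no isotropic plane. With third coordinate normalised
  to 1, the squared distance of the second coordinates is a combination of the three products and
  hence 0; then the first coordinates agree as well. Null vectors with third coordinate 0 are
  multiples of the first basis vector.\<close>

lemma null_orthogonal_dependent:
 assumes v: "v ~= 0" "herm v v = 0" and w: "w ~= 0" "herm w w = 0" and vw: "herm v w = 0"
 obtains c where "c ~= 0" "w = c *s v"
proof (cases "v $ 3 = 0")
 case True
 then have v2: "v $ 2 = 0" by (rule herm_null_zero[OF v(2)])
 then have v1: "v $ 1 ~= 0" using True v(1) by (auto simp: vec_eq_iff forall_3)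
 then have w3: "w $ 3 = 0" using vw True v2 by (simp add: herm_def)
 then have w2: "w $ 2 = 0" by (rule herm_null_zero[OF w(2)])
 then have w1: "w $ 1 ~= 0" using w3 w(1) by (auto simp: vec_eq_iff forall_3)
 show ?thesis
  by (rule that[of "w $ 1 / v $ 1"]) (use v1 w1 w2 w3 v2 True in \<open>auto simp: vec_eq_iff forall_3\<close>)
next
 case v3: False
 have w3: "w $ 3 ~= 0"
 proof
  assume w3: "w $ 3 = 0"
  then have w2: "w $ 2 = 0" by (rule herm_null_zero[OF w(2)])
  then have "w $ 1 ~= 0" using w3 w(1) by (auto simp: vec_eq_iff forall_3)
  then show False using vw v3 w2 w3 by (simp add: herm_def)
 qed
 define p1 where "p1 = v $ 1 / v $ 3"
 define p2 where "p2 = v $ 2 / v $ 3"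
 define q1 where "q1 = w $ 1 / w $ 3"
 define q2 where "q2 = w $ 2 / w $ 3"
 have veq: "v $ 1 = p1 * v $ 3" "v $ 2 = p2 * v $ 3" using v3 by (auto simp: p1_def p2_def)
 have weq: "w $ 1 = q1 * w $ 3" "w $ 2 = q2 * w $ 3" using w3 by (auto simp: q1_def q2_def)
 have "(v $ 3 * cnj (v $ 3)) * (p1 + p2 * cnj p2 + cnj p1) = herm v v"
  by (simp add: herm_def veq algebra_simps)
 then have hv: "p1 + p2 * cnj p2 + cnj p1 = 0" using v(2) v3 by simp
 have "(w $ 3 * cnj (w $ 3)) * (q1 + q2 * cnj q2 + cnj q1) = herm w w"
  by (simp add: herm_def weq algebra_simps)
 then have hw: "q1 + q2 * cnj q2 + cnj q1 = 0" using w(2) w3 by simp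
 have "(v $ 3 * cnj (w $ 3)) * (p1 + p2 * cnj q2 + cnj q1) = herm v w"
  by (simp add: herm_def veq weq algebra_simps)
 then have hvw: "p1 + p2 * cnj q2 + cnj q1 = 0" using vw v3 w3 by simp
 have hvw': "cnj p1 + cnj p2 * q2 + q1 = 0" using arg_cong[OF hvw, of cnj]
  by (simp only: complex_cnj_add complex_cnj_mult complex_cnj_cnj complex_cnj_zero)
 have "(p2 - q2) * cnj (p2 - q2) = (p1 + p2 * cnj p2 + cnj p1) + (q1 + q2 * cnj q2 + cnj q1)
   - (p1 + p2 * cnj q2 + cnj q1) - (cnj p1 + cnj p2 * q2 + q1)" by (simp add: algebra_simps)
 then have "p2 = q2" unfolding hv hw hvw hvw' by simp
 then have "cnj p1 = cnj q1" using hv hvw by (metis add_left_cancel)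
 then have "p1 = q1" by simp
 show ?thesis
  by (rule that[of "w $ 3 / v $ 3"])
   (use v3 w3 veq weq \<open>p2 = q2\<close> \<open>p1 = q1\<close> in \<open>auto simp: vec_eq_iff forall_3\<close>)
qed

definition is_frame :: "complex^3^3 => bool" where
 "is_frame F \<longleftrightarrow> adjoint_matrix F ** J21 ** F = gram"

lemma is_frame_iff: "is_frame F \<longleftrightarrow> (\<forall>j k. herm (column j F) (column k F) = (if j = k then 0 else -1))"
 by (auto simp: is_frame_def vec_eq_iff adjoint_J21_nth gram_def)

lemma is_frame_det: "is_frame F ==> det F ~= 0"
proof
 assume "is_frame F" "det F = 0"
 then have "det (gram :: complex^3^3) = 0" by (metis is_frame_def det_mul mult_zero_right)
 then show False by (simp add: gram_def det_3)
qed

lemma is_frame_U21: "A \<in> carrier U21 ==> is_frame F ==> is_frame (A ** F)"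
proof -
 assume A: "A \<in> carrier U21" "is_frame F"
 have "adjoint_matrix (A ** F) ** J21 ** (A ** F) = adjoint_matrix F ** (adjoint_matrix A ** J21 ** A) ** F"
  by (simp add: adjoint_matrix_mult matrix_mul_assoc)
 then show ?thesis using A by (simp add: is_frame_def U21_def)
qed

lemma column_mult: "column j (A ** F) = A *v column j F"
 by (simp add: vec_eq_iff column_def matrix_matrix_mult_def matrix_vector_mult_def)

lemma mat_mult_vector: "mat c *v v = c *s (v :: 'a::comm_semiring_1^'n)"
 by (simp add: vec_eq_iff matrix_vector_mult_def mat_def if_distrib[of "\<lambda>x. x * _"] cong: if_cong)

lemma matrix_eq_columns: "(\<And>j. column j A = column j B) ==> A = B"
 by (simp add: vec_eq_iff column_def)

lemma unit_cnj: "cmod c = 1 \<longleftrightarrow> c * cnj c = 1"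
 by (metis complex_mod_cnj complex_norm_square norm_mult norm_one of_real_1 one_power2 power2_eq_square real_sqrt_abs real_sqrt_one abs_norm_cancel)

lemma span_singleton_eq:
 assumes "vec.span {u} = vec.span {v :: complex^3}" "v ~= 0"
 obtains c where "c ~= 0" "u = c *s v"
proof -
 have "u \<in> vec.span {v}" using assms(1) vec.span_base[of u "{u}"] by auto
 then obtain c where c: "u = c *s v" by (auto simp: vec.span_singleton)
 have "v \<in> vec.span {u}" using assms(1) vec.span_base[of v "{v}"] by auto
 then obtain d where "v = d *s u" by (auto simp: vec.span_singleton)
 then have "c ~= 0" using c assms(2) by auto
 then show ?thesis using c that by blast
qed

lemma frame_column_nonzero: "is_frame F ==> column j F ~= 0"
proof
 assume F: "is_frame F" "column j F = 0"
 obtain k :: 3 where "k ~= j" by (metis one_neq_zero)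
 then have "herm (column j F) (column k F) = -1" using F(1) by (simp add: is_frame_iff)
 then show False by (simp add: F(2) herm_def)
qed

text \<open>With three columns, the relations \<open>c j * cnj (c k) = 1\<close> for different j, k
  force all factors to be equal, and then of modulus 1.\<close>

lemma frame_unique:
 assumes F: "is_frame F" and G: "is_frame G"
  and span: "\<And>j. vec.span {column j G} = vec.span {column j F}"
 obtains c where "cmod c = 1" "G = mat c ** F"
proof -
 have "\<exists>c. column j G = c *s column j F" for j
  by (rule span_singleton_eq[OF span frame_column_nonzero[OF F]]) blast
 then obtain c where c: "\<And>j. column j G = c j *s column j F" by metis
 have cc: "c j * cnj (c k) = 1" if "j ~= k" for j k
 proof -
  have "herm (column j G) (column k G) = -1" "herm (column j F) (column k F) = -1"
   using F G that by (simp_all add: is_frame_iff)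
  then show ?thesis unfolding c by (simp add: herm_scale_left herm_scale_right mult.commute)
 qed
 have 12: "c 1 * cnj (c 2) = 1" and 32: "c 3 * cnj (c 2) = 1" and 13: "c 1 * cnj (c 3) = 1" and 23: "c 2 * cnj (c 3) = 1"
  by (simp_all add: cc)
 have "cnj (c 2) ~= 0" "cnj (c 3) ~= 0" using 12 13 by auto
 then have "c 1 = c 3" "c 1 = c 2" using 12 32 13 23 by (metis mult_right_cancel)+
 then have "c j = c 1" for j using exhaust_3[of j] by auto
 moreover have "cmod (c 1) = 1" using 12 \<open>c 1 = c 2\<close> unit_cnj by auto
 moreover have "G = mat (c 1) ** F"
  by (rule matrix_eq_columns) (metis c calculation(1) column_mult mat_mult_vector)
 ultimately show ?thesis using that by blast
qed

text \<open>A boundary point is a limit of vectors f n whose lines meet W. Positive factors can be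
  absorbed into W, so up to unit scalars c n these vectors lie in W, which is closed; the scalars
  accumulate on the unit circle, and removing their limit leaves a lift in W.\<close>

lemma ex_totally_real_lift:
 assumes W: "totally_real W" and R: "R = H2C \<inter> {vec.span {v} | v. v \<in> W \<and> v ~= 0}"
  and a: "a \<in> ideal_boundary R"
 obtains w where "w \<in> W" "w ~= 0" "herm w w = 0" "a = vec.span {w}"
proof -
 obtain v where v: "a = vec.span {v}" "v ~= 0" "herm v v = 0" "v \<in> closure {w. vec.span {w} \<in> R}"
  using a by (auto simp: ideal_boundary_def)
 then obtain f where f: "\<And>n. vec.span {f n :: complex^3} \<in> R" "f \<longlonglongrightarrow> v"
  by (auto simp: closure_sequential)
 have "\<exists>c w. cmod c = 1 \<and> w \<in> W \<and> f n = c *s w" for n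
 proof -
  obtain w where w: "vec.span {f n} = vec.span {w}" "w \<in> W" "w ~= 0"
   using f(1)[of n] R by auto
  obtain c where c: "c ~= 0" "f n = c *s w" by (rule span_singleton_eq[OF w(1,3)]) blast
  have "subspace W" using W by (simp add: totally_real_def)
  then have "cmod c *\<^sub>R w \<in> W" using w(2) by (rule subspace_scale)
  moreover have "f n = (c / of_real (cmod c)) *s (cmod c *\<^sub>R w)"
   unfolding c(2) using c(1) by (simp add: vec_eq_iff) (simp add: scaleR_conv_of_real)
  moreover have "cmod (c / of_real (cmod c)) = 1" using c(1) by (simp add: norm_divide)
  ultimately show ?thesis by blast
 qed
 then obtain c w where cw: "\<And>n. cmod (c n) = 1" "\<And>n. w n \<in> W" "\<And>n. f n = c n *s w n" by metis
 have "compact (sphere (0::complex) 1)" by simp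
 then obtain l r where l: "l \<in> sphere (0::complex) 1" "strict_mono r" "(c \<circ> r) \<longlonglongrightarrow> l"
  using cw(1) unfolding compact_def by (metis mem_sphere_0)
 have fr: "(f \<circ> r) \<longlonglongrightarrow> v" by (rule LIMSEQ_subseq_LIMSEQ[OF f(2) l(2)])
 have "cnj (c n) *s f n = w n" for n
  using cw(1)[of n] unfolding cw(3) by (simp add: vector_smult_assoc unit_cnj mult.commute[of "cnj (c n)"])
 then have wr: "w (r n) = cnj ((c \<circ> r) n) *s (f \<circ> r) n" for n by simp
 have "(\<lambda>n. w (r n)) \<longlonglongrightarrow> (\<chi> i. cnj l * v $ i)"
  unfolding wr
 proof (rule vec_tendstoI)
  fix i
  have "(\<lambda>n. cnj ((c \<circ> r) n) * (f \<circ> r) n $ i) \<longlonglongrightarrow> cnj l * v $ i"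
   by (intro tendsto_mult tendsto_cnj l(3) tendsto_vec_nth fr)
  then show "(\<lambda>n. (cnj ((c \<circ> r) n) *s (f \<circ> r) n) $ i) \<longlonglongrightarrow> (\<chi> i. cnj l * v $ i) $ i" by simp
 qed
 moreover have "closed W" using W by (simp add: totally_real_def closed_subspace)
 ultimately have u: "(\<chi> i. cnj l * v $ i) \<in> W" (is "?u \<in> W") using closed_sequentially[of W "\<lambda>n. w (r n)"] cw(2) by blast
 have l0: "cnj l ~= 0" using l(1) by auto
 have ueq: "?u = cnj l *s v" by (simp add: vec_eq_iff)
 show ?thesis
 proof
  show "?u \<in> W" by (rule u)
  show "?u ~= 0" using v(2) l0 by (simp add: ueq)
  show "herm ?u ?u = 0" using v(3) by (simp add: ueq herm_scale_left herm_scale_right)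
  show "a = vec.span {?u}" unfolding ueq v(1)
  proof (rule vec.span_eq[THEN iffD2], intro conjI)
   show "{v} \<subseteq> vec.span {cnj l *s v}"
    using vec.span_scale[OF vec.span_base[of "cnj l *s v" "{cnj l *s v}"], of "1 / cnj l"] l0
    by (simp add: vector_smult_assoc)
   show "{cnj l *s v} \<subseteq> vec.span {v}" by (simp add: vec.span_base vec.span_scale)
  qed
 qed
qed

text \<open>Lifts in a totally real subspace have real products \<alpha>, \<beta>, \<gamma>. Real
  factors can turn all three into -1 exactly if the product of the three is negative, and this is
  forced by the signature: the Gram determinant equals both 2 \<alpha> \<beta> \<gamma> and minus
  the squared modulus of the determinant of the lifts.\<close>

lemma frame_exists:
 assumes "real_ideal_triangle (L 1) (L 2) (L 3)"
 obtains F where "is_frame F" "\<And>j. L j = vec.span {column j F}"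
proof -
 obtain R where R: "real_plane R" "{L 1, L 2, L 3} \<subseteq> ideal_boundary R"
  using assms by (auto simp: real_ideal_triangle_def)
 obtain W where W: "totally_real W" "R = H2C \<inter> {vec.span {v} | v. v \<in> W \<and> v ~= 0}"
  using R(1) by (auto simp: real_plane_def)
 have "\<exists>w. w \<in> W \<and> w ~= 0 \<and> herm w w = 0 \<and> L j = vec.span {w}" for j
 proof -
  have "L j \<in> ideal_boundary R" using R(2) exhaust_3[of j] by auto
  then show ?thesis using ex_totally_real_lift[OF W] by metis
 qed
 then obtain w where w: "\<And>j. w j \<in> W" "\<And>j. w j ~= 0" "\<And>j. herm (w j) (w j) = 0" "\<And>j. L j = vec.span {w j}"
  by metis
 have "\<forall>v\<in>W. \<forall>w\<in>W. herm v w \<in> \<real>" using W(1) by (simp add: totally_real_def)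
 then have "\<exists>r. herm (w j) (w k) = complex_of_real r" for j k using w(1) by (meson Reals_cases)
 then obtain h where h: "\<And>j k. herm (w j) (w k) = complex_of_real (h j k)" by metis
 have hs: "h j k = h k j" for j k using herm_commute[of "w j" "w k"] by (simp add: h)
 have Lne: "L j ~= L k" if "j ~= k" for j k
  using assms that exhaust_3[of j] exhaust_3[of k] by (auto simp: real_ideal_triangle_def)
 have hn: "h j k ~= 0" if "j ~= k" for j k
 proof
  assume "h j k = 0"
  then have "herm (w j) (w k) = 0" by (simp add: h)
  then obtain c where c: "c ~= 0" "w k = c *s w j"
   using null_orthogonal_dependent[OF w(2,3) w(2,3)] by metis
  have "vec.span {w k} = vec.span {w j}"
  proof (rule vec.span_eq[THEN iffD2], intro conjI)
   show "{w k} \<subseteq> vec.span {w j}" by (simp add: c vec.span_base vec.span_scale)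
   show "{w j} \<subseteq> vec.span {w k}"
    using vec.span_scale[OF vec.span_base[of "w k" "{w k}"], of "1 / c"] c
    by (simp add: vector_smult_assoc)
  qed
  then show False using Lne[OF that] w(4) by metis
 qed
 define \<alpha> where "\<alpha> = h 1 2"
 define \<beta> where "\<beta> = h 2 3"
 define \<gamma> where "\<gamma> = h 1 3"
 have nz: "\<alpha> ~= 0" "\<beta> ~= 0" "\<gamma> ~= 0" by (simp_all add: \<alpha>_def \<beta>_def \<gamma>_def hn)
 define F0 :: "complex^3^3" where "F0 = (\<chi> i j. w j $ i)"
 have col0: "column j F0 = w j" for j by (simp add: column_def F0_def vec_eq_iff)
 have h0: "h j j = 0" for j using w(3)[of j] h[of j j] by simp
 have ent: "(adjoint_matrix F0 ** J21 ** F0) $ j $ k = of_real (h k j)" for j k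
  by (simp add: adjoint_J21_nth col0 h)
 have "det (adjoint_matrix F0 ** J21 ** F0) = of_real (2 * \<alpha> * \<beta> * \<gamma>)"
  unfolding det_3 ent by (simp add: h0 hs[of 2 1] hs[of 3 1] hs[of 3 2] \<alpha>_def \<beta>_def \<gamma>_def algebra_simps)
 moreover have "det (adjoint_matrix F0 ** J21 ** F0) = of_real (- (cmod (det F0))\<^sup>2)"
  by (simp add: det_mul det_adjoint_matrix det_J21) (simp add: complex_norm_square[symmetric] mult.commute)
 ultimately have "2 * \<alpha> * \<beta> * \<gamma> = - (cmod (det F0))\<^sup>2" by (metis of_real_eq_iff)
 moreover have "0 \<le> (cmod (det F0))\<^sup>2" by simp
 ultimately have "\<alpha> * \<beta> * \<gamma> \<le> 0" by (simp only: mult.assoc)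
 then have neg: "\<alpha> * \<beta> * \<gamma> < 0" using nz by (simp add: order_le_less)
 have pos: "0 < - \<beta> / (\<alpha> * \<gamma>)"
  using neg nz by (simp add: zero_less_divide_iff divide_less_0_iff mult_less_0_iff zero_less_mult_iff) argo
 \<comment> \<open>The factors have to solve s 1 s 2 \<alpha> = s 1 s 3 \<gamma> = s 2 s 3 \<beta> =
   -1. Two equations express s 2 and s 3 through s 1 = p, and the third one gives p^2.\<close>
 define p where "p = sqrt (- \<beta> / (\<alpha> * \<gamma>))"
 have p: "p > 0" "p * p = - \<beta> / (\<alpha> * \<gamma>)"
  unfolding p_def real_sqrt_mult_self using pos by (simp_all only: real_sqrt_gt_zero abs_of_pos)
 define s where "s = (\<lambda>j :: 3. if j = 1 then p else if j = 2 then - 1 / (p * \<alpha>) else - 1 / (p * \<gamma>))"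
 have s0: "s j ~= 0" for j using p nz by (auto simp: s_def)
 have "s 2 * s 3 * \<beta> = \<beta> / ((p * p) * \<alpha> * \<gamma>)" by (simp add: s_def)
 also have "\<dots> = -1" unfolding p(2) using nz by (simp add: field_simps)
 finally have s23: "s 2 * s 3 * h 2 3 = -1" by (simp add: \<beta>_def)
 have s12: "s 1 * s 2 * h 1 2 = -1" and s13: "s 1 * s 3 * h 1 3 = -1"
  using p nz by (simp_all add: s_def \<alpha>_def \<gamma>_def)
 define F :: "complex^3^3" where "F = (\<chi> i j. of_real (s j) * w j $ i)"
 have col: "column j F = of_real (s j) *s w j" for j by (simp add: column_def F_def vec_eq_iff)
 have sh: "s j * s k * h j k = (if j = k then 0 else -1)" for j k
  using exhaust_3[of j] exhaust_3[of k] s12 s13 s23 hs[of 2 1] hs[of 3 1] hs[of 3 2] h0 by (auto simp: mult_ac)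
 have "herm (column j F) (column k F) = of_real (s j * s k * h j k)" for j k
  unfolding col by (simp add: herm_scale_left herm_scale_right h)
 then have "is_frame F" unfolding is_frame_iff by (auto simp: sh)
 moreover have "L j = vec.span {column j F}" for j
  unfolding w(4) col
 proof (rule vec.span_eq[THEN iffD2], intro conjI)
  show "{w j} \<subseteq> vec.span {complex_of_real (s j) *s w j}"
   using vec.span_scale[OF vec.span_base[of "of_real (s j) *s w j" "{of_real (s j) *s w j}"], of "1 / of_real (s j)"] s0[of j]
   by (simp add: vector_smult_assoc)
 qed (simp add: vec.span_base vec.span_scale)
 ultimately show ?thesis using that by blast
qed

text \<open>The products of column a with the columns b and c are linear equations that express its
  entries through x; that column a is null then reduces to 2 - 2 |x|^2 = 0.\<close>

lemma cross_of_gram: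
 fixes N :: "complex^3^3"
 assumes d: "distinct [a, b, c]" and t: "0 < t" and N: "adjoint_matrix N ** gram ** N = gram"
  and b: "\<And>k. N $ k $ b = (if k = b then of_real t else 0)"
  and c: "\<And>k. N $ k $ c = (if k = c then 1 / of_real t else 0)"
 obtains x where "cmod x = 1" "N = cross a b c (of_real t) x"
proof -
 define x where "x = N $ a $ a"
 define y where "y = N $ b $ a"
 define z where "z = N $ c $ a"
 have ne: "a ~= b" "b ~= c" "a ~= c" using d by auto
 have g: "(adjoint_matrix N ** gram ** N) $ i $ j = (if i = j then 0 else -1)" for i j
  unfolding N by (simp add: gram_def)
 have e: "(adjoint_matrix N ** gram ** N) $ i $ j =
   - (cnj (N $ a $ i) * (N $ b $ j + N $ c $ j) + cnj (N $ b $ i) * (N $ a $ j + N $ c $ j)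
   + cnj (N $ c $ i) * (N $ a $ j + N $ b $ j))" for i j
  using ne unfolding matrix_matrix_mult_def gram_def adjoint_matrix_def
  by (simp add: sum_three_distinct[OF d] algebra_simps)
 have tc: "complex_of_real t ~= 0" using t by simp
 have "complex_of_real t * (x + z) = 1"
  using g[of b a] ne unfolding e by (simp add: b x_def z_def)
 then have z: "z = 1 / of_real t - x" using tc by (simp add: field_simps)
 have "(1 / complex_of_real t) * (x + y) = 1"
  using g[of c a] ne unfolding e by (simp add: c x_def y_def)
 then have y: "y = of_real t - x" using tc by (simp add: field_simps)
 have "cnj x * (y + z) + cnj y * (x + z) + cnj z * (x + y) = 0"
  using g[of a a] unfolding e x_def y_def z_def by (simp only: simp_thms if_True neg_equal_0_iff_equal)
 moreover have "cnj x * (y + z) + cnj y * (x + z) + cnj z * (x + y) = 2 - 2 * (x * cnj x)"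
  unfolding y z using tc by (simp add: field_simps)
 ultimately have "cmod x = 1" by (simp add: unit_cnj)
 moreover have "N = cross a b c (of_real t) x"
 proof -
  have "N $ k $ l = cross a b c (of_real t) x $ k $ l" for k l
   using distinct_three_exhaust[OF d, of k] distinct_three_exhaust[OF d, of l] ne y z
   by (auto simp: cross_def b c x_def y_def z_def)
  then show ?thesis by (simp add: vec_eq_iff)
 qed
 ultimately show ?thesis using that by blast
qed

lemma column_mult_perm: "\<sigma> \<circ> \<tau> = id ==> \<tau> \<circ> \<sigma> = id ==> column j (A ** perm_matrix \<tau>) = column (\<sigma> j) A"
proof -
 assume a: "\<sigma> \<circ> \<tau> = id" "\<tau> \<circ> \<sigma> = id"
 have "inj \<tau>" using a by (metis inj_on_id inj_on_imageI2)
 moreover have "j = \<tau> (\<sigma> j)" using a(2) by (metis comp_apply id_apply)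
 ultimately show ?thesis
  by (metis (no_types, lifting) mult_perm_matrix_nth column_def vec_lambda_beta vec_eq_iff)
qed

lemma column_eq_mult_axis: "column j F = F *v axis j (1 :: 'a::comm_semiring_1)"
 by (simp add: vec_eq_iff column_def matrix_vector_mult_def axis_def if_distrib[of "\<lambda>x. _ * x"] cong: if_cong)

text \<open>At the two shared vertices the frames differ by factors p and q, and the products -1
  give \<open>p * cnj q = 1\<close>. So p and q have the same phase k, and their moduli are t and
  1/t. Removing the phase and renumbering gives G', to which \<open>cross_of_gram\<close>
  applies.\<close>

lemma frame_cross:
 assumes F: "is_frame F" and G: "is_frame G" and d: "distinct [a, b, c]" and s: "bij \<sigma>"
  and sb: "vec.span {column (\<sigma> b) G} = vec.span {column b F}"
  and sc: "vec.span {column (\<sigma> c) G} = vec.span {column c F}"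
 obtains t x k where "0 < t" "cmod x = 1" "cmod k = 1"
  "G = mat k ** (F ** (cross a b c (of_real t) x ** perm_matrix \<sigma>))"
proof -
 define \<tau> where "\<tau> = inv_into UNIV \<sigma>"
 have st: "\<sigma> \<circ> \<tau> = id" "\<tau> \<circ> \<sigma> = id"
  using s by (auto simp: \<tau>_def bij_def fun_eq_iff surj_f_inv_f)
 obtain p where p: "p ~= 0" "column (\<sigma> b) G = p *s column b F"
  by (rule span_singleton_eq[OF sb frame_column_nonzero[OF F]])
 obtain q where q: "q ~= 0" "column (\<sigma> c) G = q *s column c F"
  by (rule span_singleton_eq[OF sc frame_column_nonzero[OF F]])
 have ne: "\<sigma> b ~= \<sigma> c" "b ~= c" using d s by (auto simp: bij_def inj_eq)
 then have "herm (column (\<sigma> b) G) (column (\<sigma> c) G) = -1" "herm (column b F) (column c F) = -1"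
  using F G by (simp_all add: is_frame_iff)
 then have pq: "p * cnj q = 1" unfolding p q by (simp add: herm_scale_left herm_scale_right mult.commute)
 define t where "t = cmod p"
 define k where "k = p / of_real t"
 have t: "0 < t" using p by (simp add: t_def)
 have k: "cmod k = 1" using t by (simp add: k_def norm_divide t_def)
 have kk: "k * cnj k = 1" using k unit_cnj by blast
 have kp: "cnj k * p = of_real t"
  using kk t by (simp add: k_def field_simps) 
 have kq: "cnj k * q = 1 / of_real t"
 proof -
  have "cnj p * q = 1" using arg_cong[OF pq, of cnj] by simp
  then show ?thesis using t by (simp add: k_def)
 qed
 define G' where "G' = mat (cnj k) ** G ** perm_matrix \<tau>"
 have colG: "column j G' = cnj k *s column (\<sigma> j) G" for j
 proof -
  have "column j G' = column (\<sigma> j) (mat (cnj k) ** G)" by (simp only: G'_def column_mult_perm[OF st])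
  then show ?thesis by (simp only: column_mult mat_mult_vector)
 qed
 have "is_frame G'"
  using G kk s unfolding is_frame_iff colG
  by (auto simp: herm_scale_left herm_scale_right bij_def inj_eq mult.assoc[symmetric] mult.commute[of k])
 obtain Fi where Fi: "Fi ** F = mat 1" "F ** Fi = mat 1"
  using is_frame_det[OF F] invertible_det_nz[of F] unfolding invertible_def by blast
 define N where "N = Fi ** G'"
 have FN: "F ** N = G'" by (simp add: N_def matrix_mul_assoc Fi)
 have "adjoint_matrix N ** gram ** N = adjoint_matrix (F ** N) ** J21 ** (F ** N)"
  unfolding F[unfolded is_frame_def, symmetric] by (simp add: adjoint_matrix_mult matrix_mul_assoc)
 then have Ng: "adjoint_matrix N ** gram ** N = gram"
  using \<open>is_frame G'\<close> by (simp add: FN is_frame_def)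
 have colN: "column j N = r *s axis j 1" if "column j G' = r *s column j F" for j r
 proof -
  have "column j N = Fi *v (r *s (F *v axis j 1))"
   unfolding N_def column_mult that by (simp only: column_eq_mult_axis)
  also have "\<dots> = r *s ((Fi ** F) *v axis j 1)"
   by (simp add: vector_scalar_commute matrix_vector_mul_assoc)
  finally show ?thesis by (simp add: Fi)
 qed
 have "column b N = of_real t *s axis b 1" "column c N = (1 / of_real t) *s axis c 1"
  by (rule colN, simp add: colG p q vector_smult_assoc kp kq)+
 then have Nb: "N $ i $ b = (if i = b then of_real t else 0)" and Nc: "N $ i $ c = (if i = c then 1 / of_real t else 0)" for i
  by (auto simp: vec_eq_iff column_def axis_def)
 obtain x where x: "cmod x = 1" "N = cross a b c (of_real t) x"
  by (rule cross_of_gram[OF d t Ng Nb Nc])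
 have "mat k ** (F ** (cross a b c (of_real t) x ** perm_matrix \<sigma>)) = mat k ** (G' ** perm_matrix \<sigma>)"
  by (simp add: FN[symmetric] x matrix_mul_assoc)
 also have "\<dots> = (mat k ** mat (cnj k)) ** G ** (perm_matrix \<tau> ** perm_matrix \<sigma>)"
  by (simp only: G'_def matrix_mul_assoc)
 also have "\<dots> = G" by (simp add: mat_mult_mat kk perm_matrix_comp st perm_matrix_id)
 finally show ?thesis using that t x(1) k by metis
qed

text \<open>If the spectral radius exceeds 1, an eigenvector u for an eigenvalue \<mu> of that
  modulus is null, since A preserves its product with itself. Either u is proportional to v, or the
  product of u and v is not 0 and forces \<open>l * cnj \<mu> = 1\<close>.\<close>

lemma U21_spectral_radius_null_eigenvector:
 assumes A: "A \<in> carrier U21" and v: "v ~= 0" "herm v v = 0" "A *v v = l *s v"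
 shows "spectral_radius3 A = max (cmod l) (1 / cmod l)"
proof -
 obtain a b c where e: "eigenvalues3 A a b c" using eigenvalues3_exist by blast
 have m: "spectral_radius3 A = max (cmod a) (max (cmod b) (cmod c))" by (rule spectral_radius3_eq[OF e])
 have d: "det (mat l - A) = (l - a) * (l - b) * (l - c)" for l by (rule eigenvalues3_det[OF e])
 have dl: "det (mat l - A) = 0" using v eigenvalue_iff_det[of A l] by blast
 have l0: "l ~= 0" "det (mat (1 / cnj l) - A) = 0" using U21_eigenvalue_reflect[OF A dl] by auto
 have le: "cmod z \<le> spectral_radius3 A" if "det (mat z - A) = 0" for z
  using that unfolding m d by auto
 have le2: "max (cmod l) (1 / cmod l) \<le> spectral_radius3 A"
  using le[OF dl] le[OF l0(2)] by (simp add: norm_divide)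
 obtain \<mu> where mu: "cmod \<mu> = spectral_radius3 A" "det (mat \<mu> - A) = 0"
 proof -
  have "cmod a = spectral_radius3 A \<or> cmod b = spectral_radius3 A \<or> cmod c = spectral_radius3 A"
   unfolding m by linarith
  moreover have "det (mat a - A) = 0" "det (mat b - A) = 0" "det (mat c - A) = 0" unfolding d by auto
  ultimately show ?thesis using that by blast
 qed
 obtain u where u: "u ~= 0" "A *v u = \<mu> *s u" using mu(2) eigenvalue_iff_det[of A \<mu>] by blast
 show ?thesis
 proof (cases "spectral_radius3 A = 1")
  case True
  have "1 \<le> max (cmod l) (1 / cmod l)"
   using l0(1) by (cases "cmod l \<le> 1") (auto simp: le_max_iff_disj)
  then show ?thesis using le2 True by linarith
 next
  case False
  then have gt: "1 < spectral_radius3 A" using U21_spectral_radius_ge_1[OF A] by simp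
  have "herm u u = \<mu> * cnj \<mu> * herm u u"
   using herm_U21[OF A, of u u] u(2) by (simp add: herm_scale_left herm_scale_right mult_ac)
  moreover have "\<mu> * cnj \<mu> ~= 1" using gt mu(1) unit_cnj[of \<mu>] by auto
  ultimately have hu: "herm u u = 0" by simp
  have hvu: "herm v u = l * cnj \<mu> * herm v u"
   using herm_U21[OF A, of v u] u(2) v(3) by (simp add: herm_scale_left herm_scale_right mult_ac)
  show ?thesis
  proof (cases "herm v u = 0")
   case True
   then obtain k where k: "k ~= 0" "u = k *s v"
    using null_orthogonal_dependent[OF v(1,2) u(1) hu] by blast
   have "\<mu> *s u = l *s u" using u(2) v(3) unfolding k
    by (metis vector_scalar_commute vector_smult_assoc mult.commute)
   moreover obtain i where "u $ i ~= 0" using u(1) by (auto simp: vec_eq_iff)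
   ultimately have "\<mu> = l" by (metis mult_right_cancel vector_smult_component)
   then show ?thesis using mu(1) le2 by auto
  next
   case False
   then have "l * cnj \<mu> = 1" using hvu by simp
   then have "cmod l * cmod \<mu> = 1" by (metis complex_mod_cnj norm_mult norm_one)
   then have "cmod \<mu> = 1 / cmod l" using l0(1) by (simp add: field_simps)
   then show ?thesis using mu(1) le2 by auto
  qed
 qed
qed

section \<open>Elements of PU(2,1) as classes of matrices\<close>

abbreviation pclass :: "complex^3^3 => (complex^3^3) set" where
 "pclass A \<equiv> unit_scalars #>\<^bsub>U21\<^esub> A"

lemma pclass_eq: "pclass A = {mat c ** A | c. cmod c = 1}"
 by (auto simp: r_coset_def unit_scalars_def U21_def)

lemma mem_pclass: "A \<in> pclass A"
 unfolding pclass_eq by (auto intro!: exI[of _ 1])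

lemma carrier_PU21: "carrier PU21 = pclass ` carrier U21"
 by (auto simp: PU21_def FactGroup_def RCOSETS_def)

lemma mult_PU21:
 "A \<in> carrier U21 ==> B \<in> carrier U21 ==> pclass A \<otimes>\<^bsub>PU21\<^esub> pclass B = pclass (A ** B)"
 using normal.rcos_sum[OF normal_unit_scalars, of A B] by (simp add: PU21_def U21_def)

lemma spectral_radius3_unit_scalar:
 assumes "cmod c = 1"
 shows "spectral_radius3 (mat c ** A) = spectral_radius3 A"
proof -
 have "c ~= 0" using assms by auto
 have 1: "(mat c ** A) *v v = c *s (A *v v)" for v
  by (simp only: matrix_vector_mul_assoc[symmetric] mat_mult_vector)
 have "{cmod l | l. \<exists>v. v ~= 0 \<and> (mat c ** A) *v v = l *s v} = {cmod l | l. \<exists>v. v ~= 0 \<and> A *v v = l *s v}"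
  (is "?X = ?Y")
 proof
  show "?X \<subseteq> ?Y"
  proof safe
   fix l v assume "v ~= 0" "(mat c ** A) *v v = l *s v"
   then have "(1 / c) *s (c *s (A *v v)) = (l / c) *s v" unfolding 1 by (simp add: vector_smult_assoc)
   then have "A *v v = (l / c) *s v" using \<open>c ~= 0\<close> by (simp add: vector_smult_assoc)
   then show "\<exists>la. cmod l = cmod la \<and> (\<exists>v. v ~= 0 \<and> A *v v = la *s v)"
    using \<open>v ~= 0\<close> assms by (intro exI[of _ "l / c"]) (auto simp: norm_divide)
  qed
  show "?Y \<subseteq> ?X"
  proof safe
   fix l v assume "v ~= 0" "A *v v = l *s v"
   then show "\<exists>la. cmod l = cmod la \<and> (\<exists>v. v ~= 0 \<and> (mat c ** A) *v v = la *s v)"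
    using assms by (intro exI[of _ "c * l"]) (auto simp: 1 norm_mult vector_smult_assoc)
  qed
 qed
 then show ?thesis by (simp add: spectral_radius3_def)
qed

lemma translation_length_pclass: "translation_length (pclass A) = 2 * ln (spectral_radius3 A)"
proof -
 have "(SOME B. B \<in> pclass A) \<in> pclass A" using mem_pclass by (rule someI)
 then obtain c where "cmod c = 1" "(SOME B. B \<in> pclass A) = mat c ** A" unfolding pclass_eq by auto
 then show ?thesis by (simp add: translation_length_def spectral_radius3_unit_scalar)
qed

lemma PU21_act_span: "PU21_act (pclass A) (vec.span {v}) = vec.span {A *v v}"
proof -
 have 1: "(mat c ** A) *v (d *s v) = (c * d) *s (A *v v)" for c d
  by (simp add: matrix_vector_mul_assoc[symmetric] mat_mult_vector vector_scalar_commute vector_smult_assoc)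
 show ?thesis
 proof
  show "PU21_act (pclass A) (vec.span {v}) \<subseteq> vec.span {A *v v}"
   unfolding PU21_act_def pclass_eq vec.span_singleton by (auto simp: 1)
  show "vec.span {A *v v} \<subseteq> PU21_act (pclass A) (vec.span {v})"
  proof
   fix x assume "x \<in> vec.span {A *v v}"
   then obtain d where "x = d *s (A *v v)" by (auto simp: vec.span_singleton)
   then have "x = (mat 1 ** A) *v (d *s v)" unfolding 1 by simp
   moreover have "mat 1 ** A \<in> pclass A" unfolding pclass_eq by (auto intro!: exI[of _ 1])
   moreover have "d *s v \<in> vec.span {v}" by (simp add: vec.span_base vec.span_scale)
   ultimately show "x \<in> PU21_act (pclass A) (vec.span {v})" unfolding PU21_act_def by blast
  qed
 qed
qed

section \<open>The cyclic order of the three corners\<close>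

definition nx :: "3 => 3" where
 "nx k = (if k = 1 then 2 else if k = 2 then 3 else 1)"

definition pv :: "3 => 3" where
 "pv k = (if k = 1 then 3 else if k = 2 then 1 else 2)"

lemma nx_pv [simp]: "nx (pv k) = k" "pv (nx k) = k" "nx (nx k) = pv k" "pv (pv k) = nx k"
 using three_cases[of k] by (auto simp: nx_def pv_def)

lemma nx_pv_neq [simp]: "nx k ~= k" "pv k ~= k" "k ~= nx k" "k ~= pv k" "nx k ~= pv k" "pv k ~= nx k"
 using three_cases[of k] by (auto simp: nx_def pv_def)

lemma three_nx_cases: "(k::3) = i \<or> k = nx i \<or> k = pv i"
 using three_cases[of k] three_cases[of i] by (auto simp: nx_def pv_def)

lemma all_three_iff: "(\<forall>j. Q j) \<longleftrightarrow> Q i \<and> Q (nx i) \<and> Q (pv i)"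
proof
 assume q: "Q i \<and> Q (nx i) \<and> Q (pv i)"
 show "\<forall>j. Q j"
 proof
  fix j show "Q j" using three_nx_cases[of j i] q by (elim disjE) auto
 qed
qed blast

lemma nx_eq_iff [simp]: "nx j = nx k \<longleftrightarrow> j = k" "pv j = pv k \<longleftrightarrow> j = k"
 using nx_pv(1,2) by metis+

section \<open>Coordinates on triangles\<close>

text \<open>Half of the open star of an edge: the interior of the triangle and the open side
  opposite to i, see \<open>half_triangle_eq\<close>.\<close>

definition half_triangle :: "3 => (real^3) set" where
 "half_triangle i = {x \<in> triangle. \<forall>j. j ~= i --> 0 < x $ j}"

definition side_point :: "3 => 3 => real => real^3" where
 "side_point b c u = (\<chi> k. if k = b then 1 - u else if k = c then u else 0)"

lemma triangle_iff:
 assumes "distinct [a, b, c]"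
 shows "x \<in> triangle \<longleftrightarrow> 0 \<le> x $ a \<and> 0 \<le> x $ b \<and> 0 \<le> x $ c \<and> x $ a + x $ b + x $ c = 1"
proof -
 have "(\<forall>i. 0 \<le> x $ i) \<longleftrightarrow> 0 \<le> x $ a \<and> 0 \<le> x $ b \<and> 0 \<le> x $ c"
 proof
  assume q: "0 \<le> x $ a \<and> 0 \<le> x $ b \<and> 0 \<le> x $ c"
  show "\<forall>i. 0 \<le> x $ i"
  proof
   fix i show "0 \<le> x $ i" using distinct_three_exhaust[OF assms, of i] q by (elim disjE) auto
  qed
 qed blast
 then show ?thesis unfolding triangle_def sum_three_distinct[OF assms] by blast
qed

lemma vec_eq_distinct:
 assumes "distinct [a, b, c :: 3]"
 shows "x = y \<longleftrightarrow> x $ a = y $ a \<and> x $ b = y $ b \<and> x $ c = y $ c"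
proof
 assume eq: "x $ a = y $ a \<and> x $ b = y $ b \<and> x $ c = y $ c"
 have "x $ k = y $ k" for k using distinct_three_exhaust[OF assms, of k] eq by (elim disjE) auto
 then show "x = y" by (simp add: vec_eq_iff)
qed simp

lemma compact_triangle: "compact triangle"
proof -
 have eq: "triangle = (\<Inter>i. {x. 0 \<le> x $ i}) \<inter> {x. (\<Sum>i\<in>UNIV. x $ i) = 1}" by (auto simp: triangle_def)
 have "closed (\<Inter>i. {x :: real^3. 0 \<le> x $ i})" by (intro closed_INT ballI closed_Collect_le continuous_intros)
 moreover have "closed {x :: real^3. (\<Sum>i\<in>UNIV. x $ i) = 1}" by (intro closed_Collect_eq continuous_intros)
 ultimately have cl: "closed triangle" unfolding eq by (rule closed_Int)
 have "triangle \<subseteq> cball 0 (sqrt 3)"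
 proof
  fix x assume "x \<in> triangle"
  then have "\<bar>x $ i\<bar> \<le> 1" for i
   using member_le_sum[of i UNIV "\<lambda>i. x $ i"] by (auto simp: triangle_def)
  then have "(x $ i)\<^sup>2 \<le> 1" for i by (simp add: abs_square_le_1)
  then have "(\<Sum>i\<in>UNIV. (x $ i)\<^sup>2) \<le> (\<Sum>i\<in>(UNIV::3 set). 1)" by (intro sum_mono)
  then show "x \<in> cball 0 (sqrt 3)" by (simp add: norm_vec_def L2_set_def)
 qed
 then have "triangle = cball 0 (sqrt 3) \<inter> triangle" by blast
 then show ?thesis using compact_Int_closed[OF compact_cball cl] by metis
qed

lemma convex_triangle: "convex triangle"
 unfolding triangle_def
 by (rule convexI) (auto simp: sum.distrib sum_distrib_left[symmetric])

lemma corner_nth: "corner i $ j = (if j = i then 1 else 0)"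
 by (simp add: corner_def axis_def)

lemma triangle_corner_iff: "x \<in> triangle ==> x = corner i \<longleftrightarrow> x $ i = 1"
proof
 assume x: "x \<in> triangle" "x $ i = 1"
 have d: "distinct [i, nx i, pv i]" by simp
 show "x = corner i"
  using x unfolding triangle_iff[OF d] vec_eq_distinct[OF d] by (auto simp: corner_nth)
qed (auto simp: corner_nth)

lemma corner_in_triangle: "corner i \<in> triangle"
proof -
 have d: "distinct [i, nx i, pv i]" by simp
 show ?thesis unfolding triangle_iff[OF d] by (simp add: corner_nth)
qed

lemma barycentre_half: "barycentre \<in> half_triangle i" "barycentre \<in> open_triangle" "barycentre \<in> triangle"
 by (simp_all add: half_triangle_def open_triangle_def barycentre_def triangle_def)

lemma half_triangle_iff: "x \<in> half_triangle i \<longleftrightarrow> x \<in> triangle \<and> 0 < x $ nx i \<and> 0 < x $ pv i"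
 unfolding half_triangle_def all_three_iff[of _ i] by simp

lemma open_triangle_iff: "x \<in> open_triangle \<longleftrightarrow> x \<in> triangle \<and> 0 < x $ i \<and> 0 < x $ nx i \<and> 0 < x $ pv i"
 unfolding open_triangle_def all_three_iff[of _ i] by simp

lemma open_side_iff: "x \<in> open_side i \<longleftrightarrow> x \<in> triangle \<and> x $ i = 0 \<and> x $ nx i ~= 0 \<and> x $ pv i ~= 0"
 unfolding open_side_def all_three_iff[of _ i] by simp

lemma half_triangle_eq: "half_triangle i = open_triangle \<union> open_side i"
proof -
 have d: "distinct [i, nx i, pv i]" by simp
 have "x \<in> half_triangle i \<longleftrightarrow> x \<in> open_triangle \<or> x \<in> open_side i" for x
  unfolding half_triangle_iff open_triangle_iff[of x i] open_side_iff triangle_iff[OF d] by auto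
 then show ?thesis by blast
qed

lemma triangle_cases:
 assumes "x \<in> triangle"
 shows "x \<in> open_triangle \<or> x \<in> range corner \<or> (\<exists>i. x \<in> open_side i)"
proof (cases "x \<in> open_triangle")
 case False
 then obtain i where i: "x $ i = 0" using assms by (auto simp: open_triangle_def triangle_def less_le)
 have d: "distinct [i, nx i, pv i]" by simp
 have s: "0 \<le> x $ nx i" "0 \<le> x $ pv i" "x $ nx i + x $ pv i = 1"
  using assms i unfolding triangle_iff[OF d] by auto
 consider "x $ nx i = 0" | "x $ pv i = 0" | "x $ nx i ~= 0" "x $ pv i ~= 0" by blast
 then show ?thesis
 proof cases
  case 1 then show ?thesis using s triangle_corner_iff[OF assms, of "pv i"] by auto
 next
  case 2 then show ?thesis using s triangle_corner_iff[OF assms, of "nx i"] by auto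
 next
  case 3
  then have "x \<in> open_side i" unfolding open_side_iff using assms i by auto
  then show ?thesis by blast
 qed
qed simp

lemma open_side_not_corner: "x \<in> open_side i ==> x \<notin> range corner"
proof
 assume x: "x \<in> open_side i" "x \<in> range corner"
 then obtain j where "x = corner j" by auto
 then show False using x(1) unfolding open_side_iff by (auto simp: corner_nth split: if_splits)
qed

lemma open_triangle_not_corner: "x \<in> open_triangle ==> x \<notin> range corner"
proof
 assume x: "x \<in> open_triangle" "x \<in> range corner"
 then obtain j where "x = corner j" by auto
 then show False using x(1) unfolding open_triangle_iff[of x j] by (auto simp: corner_nth)
qed

lemma half_triangle_subset: "half_triangle i \<subseteq> triangle - range corner"
proof
 fix x assume x: "x \<in> half_triangle i"
 then have "x \<notin> range corner"
  using open_side_not_corner[of x i] open_triangle_not_corner[of x] by (auto simp only: half_triangle_eq)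
 then show "x \<in> triangle - range corner" using x by (simp add: half_triangle_def)
qed

lemma side_point_in_open_side:
 assumes "distinct [a, b, c]" "0 < u" "u < 1"
 shows "side_point b c u \<in> open_side a"
proof -
 have "side_point b c u $ j = 0 \<longleftrightarrow> j = a" for j
  using distinct_three_exhaust[OF assms(1), of j] assms by (auto simp: side_point_def)
 moreover have "side_point b c u \<in> triangle"
  unfolding triangle_iff[OF assms(1)] using assms by (auto simp: side_point_def)
 ultimately show ?thesis by (simp add: open_side_def)
qed

lemma open_side_point:
 assumes "distinct [a, b, c]" "x \<in> open_side a"
 shows "x = side_point b c (x $ c)" "0 < x $ c" "x $ c < 1"
proof -
 have x: "x \<in> triangle" "\<And>j. x $ j = 0 \<longleftrightarrow> j = a" using assms(2) unfolding open_side_def by blast+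
 have s: "0 \<le> x $ b" "0 \<le> x $ c" "x $ b + x $ c = 1" using x(1) x(2)[of a] unfolding triangle_iff[OF assms(1)] by auto
 moreover have "x $ b ~= 0" "x $ c ~= 0" using x(2)[of b] x(2)[of c] assms(1) by auto
 ultimately show "0 < x $ c" "x $ c < 1" by linarith+
 show "x = side_point b c (x $ c)" unfolding vec_eq_distinct[OF assms(1)]
  using assms(1) x(2)[of a] s by (auto simp: side_point_def)
qed

lemma side_point_in_triangle:
 assumes "distinct [a, b, c]" "0 \<le> u" "u \<le> 1"
 shows "side_point b c u \<in> triangle"
 unfolding triangle_iff[OF assms(1)] using assms by (auto simp: side_point_def)

lemma continuous_on_vec_lambda_3:
 "(\<And>i. continuous_on S (\<lambda>x. f x i)) ==> continuous_on S (\<lambda>x. \<chi> i. f x i)"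
 by (rule continuous_on_vec_lambda)

lemma continuous_on_side_point: "continuous_on S f ==> continuous_on S (\<lambda>x. side_point b c (f x))"
 unfolding side_point_def 
proof (intro continuous_on_vec_lambda_3)
 fix k :: 3
 assume f: "continuous_on S f"
 show "continuous_on S (\<lambda>x. if k = b then 1 - f x else if k = c then f x else 0)"
  by (cases "k = b"; cases "k = c") (auto intro!: continuous_intros f)
qed

section \<open>Ideal triangulations without self-glued triangles\<close>

type_synonym 'a side = "(real^3 => 'a) \<times> 3"

locale bipartite_surface =
 fixes M P :: "'a::t2_space set" and \<T> :: "(real^3 => 'a) set"
 assumes triangulation: "ideal_triangulation M P \<T>"
  and bipartite: "bipartite_triangulation \<T>"
begin

abbreviation sides :: "'a side set" where
 "sides \<equiv> \<T> \<times> UNIV"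

definition opp :: "'a side => 'a side" where
 "opp s = (THE s'. s' \<in> sides \<and> s' ~= s \<and> side_image s' = side_image s)"

lemma finite_T: "finite \<T>"
 using triangulation by (simp add: ideal_triangulation_def)

lemma T_continuous: "\<tau> \<in> \<T> ==> continuous_on triangle \<tau>"
 using triangulation by (simp add: ideal_triangulation_def)

lemma T_corner: "\<tau> \<in> \<T> ==> {x \<in> triangle. \<tau> x \<in> P} = range corner"
 using triangulation by (simp add: ideal_triangulation_def)

lemma T_inj: "\<tau> \<in> \<T> ==> inj_on \<tau> (open_side i)"
 using triangulation by (simp add: ideal_triangulation_def)

lemma T_Union: "(\<Union>\<tau>\<in>\<T>. \<tau> ` triangle) = M"
 using triangulation by (simp add: ideal_triangulation_def)

lemma T_interior:
 assumes "\<tau> \<in> \<T>" "\<tau>' \<in> \<T>" "x \<in> open_triangle" "y \<in> triangle" "\<tau> x = \<tau>' y"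
 shows "\<tau> = \<tau>' \<and> x = y"
proof -
 have "\<forall>\<tau>\<in>\<T>. \<forall>\<tau>'\<in>\<T>. \<forall>x\<in>open_triangle. \<forall>y\<in>triangle. \<tau> x = \<tau>' y --> \<tau> = \<tau>' \<and> x = y"
  using triangulation unfolding ideal_triangulation_def by (elim conjE)
 then show ?thesis using assms by blast
qed

lemma T_sides:
 assumes "s \<in> sides" "s' \<in> sides"
 shows "side_image s = side_image s' \<or> side_image s \<inter> side_image s' = {}"
proof -
 have "\<forall>s\<in>sides. \<forall>s'\<in>sides. side_image s = side_image s' \<or> side_image s \<inter> side_image s' = {}"
  using triangulation unfolding ideal_triangulation_def by (elim conjE)
 then show ?thesis using assms by blast
qed

lemma T_opp:
 assumes "s \<in> sides"
 shows "\<exists>!s'. s' \<in> sides \<and> s' ~= s \<and> side_image s' = side_image s"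
proof -
 have "\<forall>s\<in>sides. \<exists>!s'. s' \<in> sides \<and> s' ~= s \<and> side_image s' = side_image s"
  using triangulation unfolding ideal_triangulation_def by (elim conjE)
 then show ?thesis using assms by (rule bspec)
qed

lemma opp: assumes "s \<in> sides"
 shows "opp s \<in> sides" "opp s ~= s" "side_image (opp s) = side_image s"
proof -
 have c: "opp s \<in> sides \<and> opp s ~= s \<and> side_image (opp s) = side_image s"
  unfolding opp_def by (rule theI'[OF T_opp[OF assms]])
 show "opp s \<in> sides" "opp s ~= s" "side_image (opp s) = side_image s"
  using c[THEN conjunct1] c[THEN conjunct2, THEN conjunct1] c[THEN conjunct2, THEN conjunct2] .
qed

lemma opp_unique: "s \<in> sides ==> s' \<in> sides ==> s' ~= s ==> side_image s' = side_image s ==> s' = opp s"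
 unfolding opp_def by (rule sym, rule the1_equality[OF T_opp]) (assumption | intro conjI)+

lemma opp_opp [simp]: "s \<in> sides ==> opp (opp s) = s"
proof -
 assume s: "s \<in> sides"
 show "opp (opp s) = s"
  by (rule opp_unique[OF opp(1)[OF s] s opp(2)[OF s, symmetric] opp(3)[OF s, symmetric], symmetric])
qed

text \<open>Equal side images force different colours, so a triangle is never glued to itself. This
  is what makes the characteristic map injective on a half triangle in
  \<open>T_half_inj\<close>.\<close>

lemma fst_opp_neq: "s \<in> sides ==> fst (opp s) ~= fst s"
proof -
 assume s: "s \<in> sides"
 obtain colour :: "(real^3 => 'a) => bool" where
  c: "\<forall>s\<in>sides. \<forall>s'\<in>sides. s ~= s' \<and> side_image s = side_image s' --> colour (fst s) ~= colour (fst s')"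
  using bipartite unfolding bipartite_triangulation_def by (rule exE)
 have "colour (fst s) ~= colour (fst (opp s))"
  by (rule c[THEN bspec, OF s, THEN bspec, OF opp(1)[OF s], THEN mp])
   (rule conjI[OF opp(2)[OF s, symmetric] opp(3)[OF s, symmetric]])
 then show "fst (opp s) ~= fst s" by auto
qed

lemma fst_in_T:
 assumes "s \<in> sides"
 shows "fst s \<in> \<T>" "fst (opp s) \<in> \<T>"
 using SigmaE[OF assms] SigmaE[OF opp(1)[OF assms]] by (metis fst_conv)+

lemma T_in_M:
 assumes "\<tau> \<in> \<T>" "x \<in> triangle"
 shows "\<tau> x \<in> M"
proof -
 have "\<tau> x \<in> (\<Union>\<tau>\<in>\<T>. \<tau> ` triangle)" using assms by blast
 then show ?thesis by (simp only: T_Union)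
qed

lemma T_in_P_iff: "\<tau> \<in> \<T> ==> x \<in> triangle ==> \<tau> x \<in> P \<longleftrightarrow> x \<in> range corner"
 unfolding T_corner[symmetric, of \<tau>] by (simp only: mem_Collect_eq simp_thms)

lemma T_punctured: "\<tau> \<in> \<T> ==> x \<in> triangle - range corner ==> \<tau> x \<in> M - P"
 using T_in_M[of \<tau> x] T_in_P_iff[of \<tau> x] by (simp only: Diff_iff simp_thms)

text \<open>Interior points have one preimage and only corners go to P, so side points remain. Sides
  with a common image point have equal images, and the only sides with the image of s are s and
  \<open>opp s\<close>.\<close>

lemma T_half_eq:
 assumes s: "s \<in> sides" and x: "x \<in> half_triangle (snd s)"
  and \<tau>': "\<tau>' \<in> \<T>" and y: "y \<in> triangle" and eq: "fst s x = \<tau>' y"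
 shows "(\<tau>' = fst s \<and> y = x) \<or>
  (\<tau>' = fst (opp s) \<and> x \<in> open_side (snd s) \<and> y \<in> open_side (snd (opp s)))"
proof (cases "x \<in> open_triangle")
 case True
 have "fst s \<in> \<T>" using s by (metis mem_Times_iff)
 from T_interior[OF this \<tau>' True y eq] show ?thesis by simp
next
 case False
 then have xs: "x \<in> open_side (snd s)" using x by (auto simp: half_triangle_eq)
 have xt: "x \<in> triangle" using x by (auto simp: half_triangle_def)
 have fs: "fst s \<in> \<T>" using s by (metis mem_Times_iff)
 have "y \<notin> open_triangle" using T_interior[OF \<tau>' fs _ xt eq[symmetric]] False by auto
 moreover have "y \<notin> range corner"
 proof
  assume "y \<in> range corner"
  then have "fst s x \<in> P" using T_in_P_iff[OF \<tau>' y] eq by simp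
  then show False using T_in_P_iff[OF fs xt] open_side_not_corner[OF xs] by simp
 qed
 ultimately obtain j where j: "y \<in> open_side j" using triangle_cases[OF y] by blast
 have jin: "(\<tau>', j) \<in> sides" using \<tau>' by simp
 have "fst s x \<in> side_image s" unfolding side_image_def using xs by (rule imageI)
 moreover have "fst s x \<in> side_image (\<tau>', j)" unfolding side_image_def eq using j by simp
 ultimately have im: "side_image (\<tau>', j) = side_image s" using T_sides[OF jin s] by blast
 show ?thesis
 proof (cases "(\<tau>', j) = s")
  case True
  then have "y = x" using inj_onD[OF T_inj[OF fs, of "snd s"], of x y] xs j eq by force
  then show ?thesis using True by auto
 next
  case False
  then have "(\<tau>', j) = opp s" by (rule opp_unique[OF s jin _ im])
  then have "\<tau>' = fst (opp s)" "j = snd (opp s)" by (simp_all add: prod_eq_iff)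
  then show ?thesis using xs j by simp
 qed
qed

lemma T_half_inj:
 assumes s: "s \<in> sides" and x: "x \<in> half_triangle (snd s)" and y: "y \<in> triangle" and eq: "fst s x = fst s y"
 shows "y = x"
 using T_half_eq[OF s x fst_in_T(1)[OF s] y eq] fst_opp_neq[OF s] by auto

text \<open>The open quadrilateral formed by the two triangles at an edge, with the edge but without
  its end points and without the other four sides.\<close>

definition star :: "'a side => 'a set" where
 "star s = fst s ` half_triangle (snd s) \<union> fst (opp s) ` half_triangle (snd (opp s))"

lemma star_opp: "s \<in> sides ==> star (opp s) = star s"
 by (auto simp: star_def)

lemma star_iff:
 assumes s: "s \<in> sides" and \<tau>: "\<tau> \<in> \<T>" and y: "y \<in> triangle"
 shows "\<tau> y \<in> star s \<longleftrightarrow> (\<tau> = fst s \<and> y \<in> half_triangle (snd s)) \<or>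
  (\<tau> = fst (opp s) \<and> y \<in> half_triangle (snd (opp s)))"
proof
 assume "\<tau> y \<in> star s"
 then consider x where "x \<in> half_triangle (snd s)" "fst s x = \<tau> y"
  | x where "x \<in> half_triangle (snd (opp s))" "fst (opp s) x = \<tau> y"
  unfolding star_def by (metis UnE imageE)
 then show "(\<tau> = fst s \<and> y \<in> half_triangle (snd s)) \<or>
  (\<tau> = fst (opp s) \<and> y \<in> half_triangle (snd (opp s)))"
 proof cases
  case (1 x)
  show ?thesis using T_half_eq[OF s 1(1) \<tau> y 1(2)] 1(1) by (auto simp: half_triangle_eq)
 next
  case (2 x)
  show ?thesis using T_half_eq[OF opp(1)[OF s] 2(1) \<tau> y 2(2)] 2(1) s by (auto simp: half_triangle_eq)
 qed
qed (auto simp: star_def)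

lemma closed_T_image: "\<tau> \<in> \<T> ==> compact K ==> K \<subseteq> triangle ==> closed (\<tau> ` K)"
 by (intro compact_imp_closed compact_continuous_image continuous_on_subset[OF T_continuous])

lemma compact_triangle_minus_half: "compact (triangle - half_triangle i)"
proof -
 have "triangle - half_triangle i = triangle \<inter> (\<Union>j\<in>-{i}. {x. x $ j \<le> 0})"
  by (auto simp: half_triangle_def not_less)
 moreover have "closed (\<Union>j\<in>-{i}. {x :: real^3. x $ j \<le> 0})"
  by (intro closed_UN) (auto intro!: closed_Collect_le continuous_intros)
 ultimately show ?thesis using compact_triangle by (simp add: compact_Int_closed)
qed

text \<open>Each triangle meets the star in one half triangle or not at all, so the complement of
  the star is a finite union of images of compact sets.\<close>

lemma openin_star:
 assumes s: "s \<in> sides"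
 shows "openin (top_of_set M) (star s)"
proof -
 define K where "K \<tau> = {y \<in> triangle. \<tau> y \<notin> star s}" for \<tau>
 have "compact (K \<tau>)" if \<tau>: "\<tau> \<in> \<T>" for \<tau>
 proof -
  have "K \<tau> = (if \<tau> = fst s then triangle - half_triangle (snd s)
   else if \<tau> = fst (opp s) then triangle - half_triangle (snd (opp s)) else triangle)"
   using star_iff[OF s \<tau>] fst_opp_neq[OF s] by (auto simp: K_def)
  then show ?thesis by (simp add: compact_triangle_minus_half compact_triangle)
 qed
 then have "closed (\<Union>\<tau>\<in>\<T>. \<tau> ` K \<tau>)"
  using finite_T closed_T_image by (intro closed_UN) (auto simp: K_def)
 moreover have "star s = M - (\<Union>\<tau>\<in>\<T>. \<tau> ` K \<tau>)"
 proof
  have "star s \<subseteq> M"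
   using T_in_M[OF fst_in_T(1)[OF s]] T_in_M[OF fst_in_T(2)[OF s]] by (auto simp: star_def half_triangle_def)
  then show "star s \<subseteq> M - (\<Union>\<tau>\<in>\<T>. \<tau> ` K \<tau>)" by (auto simp: K_def)
  show "M - (\<Union>\<tau>\<in>\<T>. \<tau> ` K \<tau>) \<subseteq> star s"
   using T_Union by (auto simp: K_def)
 qed
 moreover have "openin (top_of_set M) (M - A)" if "closed A" for A
  using openin_open_Int[OF open_Compl[OF that], of M] by (simp add: Diff_eq)
 ultimately show ?thesis by simp
qed

lemma star_subset: "s \<in> sides ==> star s \<subseteq> M - P"
proof -
 assume s: "s \<in> sides"
 have "\<tau> ` half_triangle i \<subseteq> M - P" if "\<tau> \<in> \<T>" for \<tau> i
  using T_punctured[OF that] half_triangle_subset[of i] by blast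
 then show "star s \<subseteq> M - P" unfolding star_def using fst_in_T[OF s] by (simp add: Un_least)
qed


text \<open>Closedness is checked on the compact closed triangle; this is enough because points of
  the half triangle share their image with no other point of the closed triangle.\<close>

lemma T_half_inverse_continuous:
 assumes s: "s \<in> sides"
 shows "continuous_on (fst s ` half_triangle (snd s)) (inv_into (half_triangle (snd s)) (fst s))"
  (is "continuous_on (?\<tau> ` ?H) ?inv")
 unfolding continuous_on_closed_invariant
proof (intro allI impI)
 fix B :: "(real^3) set" assume B: "closed B"
 have fs: "?\<tau> \<in> \<T>" by (rule fst_in_T(1)[OF s])
 have inj: "inj_on ?\<tau> ?H"
 proof (rule inj_onI)
  fix x y assume xy: "x \<in> ?H" "y \<in> ?H" "?\<tau> x = ?\<tau> y"
  have "y \<in> triangle" using xy(2) by (simp add: half_triangle_iff)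
  then show "x = y" by (rule T_half_inj[OF s xy(1) _ xy(3), symmetric])
 qed
 have inv: "?inv (?\<tau> x) = x" if "x \<in> ?H" for x by (rule inv_into_f_f[OF inj that])
 have "closed (?\<tau> ` (triangle \<inter> B))"
  by (rule closed_T_image[OF fs]) (auto intro: compact_Int_closed compact_triangle B)
 moreover have "?\<tau> ` (triangle \<inter> B) \<inter> ?\<tau> ` ?H = ?inv -` B \<inter> ?\<tau> ` ?H"
 proof
  show "?\<tau> ` (triangle \<inter> B) \<inter> ?\<tau> ` ?H \<subseteq> ?inv -` B \<inter> ?\<tau> ` ?H"
  proof
   fix y assume "y \<in> ?\<tau> ` (triangle \<inter> B) \<inter> ?\<tau> ` ?H"
   then obtain k x where kx: "y = ?\<tau> k" "k \<in> triangle" "k \<in> B" "y = ?\<tau> x" "x \<in> ?H" by blast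
   have "?\<tau> x = ?\<tau> k" using kx by simp
   then have "k = x" by (rule T_half_inj[OF s kx(5,2)])
   then have "?inv y \<in> B" using kx inv[OF kx(5)] by simp
   then show "y \<in> ?inv -` B \<inter> ?\<tau> ` ?H" using kx by blast
  qed
  show "?inv -` B \<inter> ?\<tau> ` ?H \<subseteq> ?\<tau> ` (triangle \<inter> B) \<inter> ?\<tau> ` ?H"
  proof
   fix y assume "y \<in> ?inv -` B \<inter> ?\<tau> ` ?H"
   then obtain x where x: "?inv y \<in> B" "y = ?\<tau> x" "x \<in> ?H" by blast
   then have "x \<in> B" using inv[OF x(3)] by simp
   moreover have "x \<in> triangle" using x(3) by (simp add: half_triangle_iff)
   ultimately show "y \<in> ?\<tau> ` (triangle \<inter> B) \<inter> ?\<tau> ` ?H" using x by blast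
  qed
 qed
 ultimately show "\<exists>A. closed A \<and> A \<inter> ?\<tau> ` ?H = ?inv -` B \<inter> ?\<tau> ` ?H" by blast
qed

text \<open>\<open>fst s\<close> and \<open>fst (opp s)\<close> are glued by a homeomorphism of the sides that need not be affine.\<close>

definition glues :: "(real^3 => 'a) => 3 => 3 => (real^3 => 'a) => 3 => 3 => (real => real) => bool" where
 "glues \<tau> b c \<tau>' b' c' f \<longleftrightarrow> strict_mono f \<and> continuous_on UNIV f \<and> f 0 = 0 \<and> f 1 = 1 \<and> surj f \<and>
  (\<forall>u\<in>{0..1}. \<tau> (side_point b c u) = \<tau>' (side_point b' c' (f u)))"

text \<open>The two parametrisations of the open edge differ by a continuous bijection h of the open
  interval, which is monotone. It is extended by fixed end points; a decreasing h becomes increasing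
  when b' and c' are exchanged.\<close>

lemma glues_exists:
 assumes s: "s \<in> sides" and i: "i = snd s" and i': "i' = snd (opp s)"
 obtains f b' c' where "distinct [i', b', c']" "glues (fst s) (nx i) (pv i) (fst (opp s)) b' c' f"
proof -
 let ?\<tau> = "fst s" and ?\<tau>' = "fst (opp s)"
 let ?p = "side_point (nx i) (pv i)" and ?q = "side_point (nx i') (pv i')"
 let ?I = "{0<..<1::real}"
 have d: "distinct [i, nx i, pv i]" "distinct [i', nx i', pv i']" by auto
 have T: "?\<tau> \<in> \<T>" "?\<tau>' \<in> \<T>" by (rule fst_in_T[OF s])+
 have pin: "?p u \<in> open_side i" "?q u \<in> open_side i'" if "u \<in> ?I" for u
  using side_point_in_open_side[OF d(1)] side_point_in_open_side[OF d(2)] that by auto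
 have ptri: "?p u \<in> triangle" "?q u \<in> triangle" if "u \<in> {0..1}" for u
  using side_point_in_triangle[OF d(1)] side_point_in_triangle[OF d(2)] that by auto
 have nth: "?p u $ pv i = u" "?q u $ pv i' = u" for u by (auto simp: side_point_def)
 have sub: "u \<in> {0..1}" if "u \<in> ?I" for u using that by auto
 have ex: "\<exists>v\<in>?I. ?\<tau>' (?q v) = ?\<tau> (?p u)" if u: "u \<in> ?I" for u
 proof -
  have "?\<tau> (?p u) \<in> side_image s"
   unfolding side_image_def i[symmetric] by (rule imageI[OF pin(1)[OF u]])
  then have "?\<tau> (?p u) \<in> side_image (opp s)" by (simp only: opp(3)[OF s])
  then obtain y where y: "y \<in> open_side i'" "?\<tau>' y = ?\<tau> (?p u)" by (auto simp: side_image_def i')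
  then have "y = ?q (y $ pv i')" "y $ pv i' \<in> ?I" using open_side_point[OF d(2) y(1)] by auto
  then show ?thesis using y(2) by metis
 qed
 have ex': "\<exists>u\<in>?I. ?\<tau> (?p u) = ?\<tau>' (?q v)" if v: "v \<in> ?I" for v
 proof -
  have "?\<tau>' (?q v) \<in> side_image (opp s)"
   unfolding side_image_def i'[symmetric] by (rule imageI[OF pin(2)[OF v]])
  then have "?\<tau>' (?q v) \<in> side_image s" by (simp only: opp(3)[OF s])
  then obtain y where y: "y \<in> open_side i" "?\<tau> y = ?\<tau>' (?q v)" by (auto simp: side_image_def i)
  then have "y = ?p (y $ pv i)" "y $ pv i \<in> ?I" using open_side_point[OF d(1) y(1)] by auto
  then show ?thesis using y(2) by metis
 qed
 have inj: "v = w" if v: "v \<in> ?I" and w: "w \<in> {0..1}" and eq: "?\<tau>' (?q v) = ?\<tau>' (?q w)" for v w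
 proof -
  have "?q v \<in> half_triangle i'" using pin(2)[OF v] by (simp add: half_triangle_eq)
  then have "?q w = ?q v" using T_half_inj[OF opp(1)[OF s], of "?q v" "?q w"] ptri(2)[OF w] eq i' by simp
  then show ?thesis using nth(2) by metis
 qed
 have injp: "v = w" if v: "v \<in> ?I" and w: "w \<in> {0..1}" and eq: "?\<tau> (?p v) = ?\<tau> (?p w)" for v w
 proof -
  have "?p v \<in> half_triangle i" using pin(1)[OF v] by (simp add: half_triangle_eq)
  then have "?p w = ?p v" using T_half_inj[OF s, of "?p v" "?p w"] ptri(1)[OF w] eq i by simp
  then show ?thesis using nth(1) by metis
 qed
 define h where "h u = (SOME v. v \<in> ?I \<and> ?\<tau>' (?q v) = ?\<tau> (?p u))" for u
 have h: "h u \<in> ?I" "?\<tau>' (?q (h u)) = ?\<tau> (?p u)" if "u \<in> ?I" for u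
  using someI_ex[of "\<lambda>v. v \<in> ?I \<and> ?\<tau>' (?q v) = ?\<tau> (?p u)"] ex[OF that] unfolding h_def by blast+
 have hinj: "inj_on h ?I"
  by (intro inj_onI) (metis h(2) injp sub)
 have himg: "\<exists>u\<in>?I. h u = v" if v: "v \<in> ?I" for v
  using ex'[OF v] h inj[OF _ sub] v by metis
 \<comment> \<open>Continuity of h comes from compactness: the preimage of a closed set is cut out
   by the image of a compact part of the other side.\<close>
 have hcont: "continuous_on ?I h"
  unfolding continuous_on_closed_invariant
 proof (intro allI impI)
  fix B :: "real set" assume B: "closed B"
  have cq: "continuous_on {0..1} ?q" "continuous_on {0..1} ?p" by (intro continuous_on_side_point continuous_intros)+
  have "compact (?q ` ({0..1} \<inter> B))"
   by (rule compact_continuous_image) (auto intro: continuous_on_subset[OF cq(1)] compact_Int_closed B)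
  then have "closed (?\<tau>' ` ?q ` ({0..1} \<inter> B))"
   by (rule closed_T_image[OF T(2)]) (use ptri(2) in auto)
  moreover have "continuous_on {0..1} (\<lambda>u. ?\<tau> (?p u))"
   by (rule continuous_on_compose2[OF T_continuous[OF T(1)] cq(2)]) (use ptri(1) in auto)
  ultimately have cl: "closed ((\<lambda>u. ?\<tau> (?p u)) -` (?\<tau>' ` ?q ` ({0..1} \<inter> B)) \<inter> {0..1})"
   by (intro continuous_on_closed_vimage[THEN iffD1, rule_format]) auto
  have eq: "u \<in> (\<lambda>u. ?\<tau> (?p u)) -` (?\<tau>' ` ?q ` ({0..1} \<inter> B)) \<inter> {0..1} \<inter> ?I \<longleftrightarrow> u \<in> h -` B \<inter> ?I" for u
  proof
   assume "u \<in> (\<lambda>u. ?\<tau> (?p u)) -` (?\<tau>' ` ?q ` ({0..1} \<inter> B)) \<inter> {0..1} \<inter> ?I"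
   then obtain v where v: "v \<in> {0..1}" "v \<in> B" "?\<tau> (?p u) = ?\<tau>' (?q v)" and u: "u \<in> ?I" by blast
   have "h u = v" by (rule inj[OF h(1)[OF u] v(1)]) (simp only: h(2)[OF u] v(3))
   then show "u \<in> h -` B \<inter> ?I" using v(2) u by simp
  next
   assume u: "u \<in> h -` B \<inter> ?I"
   then have uI: "u \<in> ?I" by blast
   have "?\<tau> (?p u) = ?\<tau>' (?q (h u))" by (simp only: h(2)[OF uI])
   moreover have "h u \<in> {0..1} \<inter> B" using u sub[OF h(1)[OF uI]] by simp
   ultimately show "u \<in> (\<lambda>u. ?\<tau> (?p u)) -` (?\<tau>' ` ?q ` ({0..1} \<inter> B)) \<inter> {0..1} \<inter> ?I"
    using sub[OF uI] uI by blast
  qed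
  show "\<exists>A. closed A \<and> A \<inter> ?I = h -` B \<inter> ?I"
  proof (intro exI conjI)
   show "closed ((\<lambda>u. ?\<tau> (?p u)) -` (?\<tau>' ` ?q ` ({0..1} \<inter> B)) \<inter> {0..1})" by (rule cl)
   show "(\<lambda>u. ?\<tau> (?p u)) -` (?\<tau>' ` ?q ` ({0..1} \<inter> B)) \<inter> {0..1} \<inter> ?I = h -` B \<inter> ?I"
    by (rule equalityI[OF subsetI subsetI]) (erule eq[THEN iffD1], erule eq[THEN iffD2])
  qed
 qed
 \<comment> \<open>Outside the open interval the identity is used, which gives a homeomorphism of
   the whole line. The gluing identity at the end points follows by continuity, as the parameters
   where both sides agree form a closed set; the clamp \<open>cl\<close> makes both maps continuous
   on the line.\<close>
 have extend: "glues ?\<tau> (nx i) (pv i) ?\<tau>' b' c' (\<lambda>u. if u \<in> ?I then k u else u)"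
  if d': "distinct [i', b', c']" and k: "strict_mono_on ?I k" "\<And>u. u \<in> ?I ==> k u \<in> ?I" "\<And>v. v \<in> ?I ==> \<exists>u\<in>?I. k u = v"
   and eq: "\<And>u. u \<in> ?I ==> ?\<tau> (?p u) = ?\<tau>' (side_point b' c' (k u))" for k b' c'
 proof -
  let ?f = "\<lambda>u. if u \<in> ?I then k u else u"
  have sm: "strict_mono ?f"
  proof (rule strict_monoI)
   fix x y :: real assume "x < y"
   then show "?f x < ?f y"
    using strict_mono_onD[OF k(1), of x y] k(2)[of x] k(2)[of y] by (auto simp: not_less)
  qed
  have su: "surj ?f"
  proof -
   have "\<exists>u. v = ?f u" for v :: real
   proof (cases "v \<in> ?I")
    case True
    then obtain u where "u \<in> ?I" "k u = v" using k(3) by blast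
    then show ?thesis by (intro exI[of _ u]) simp
   next
    case False
    show ?thesis by (rule exI[of _ v]) (simp only: False if_False)
   qed
   then show ?thesis unfolding surj_def by blast
  qed
  have co: "continuous_on UNIV ?f"
  proof (rule continuous_onI_mono)
   show "open (range ?f)" unfolding su by simp
   show "?f x \<le> ?f y" if "x \<le> y" for x y using strict_mono_less_eq[OF sm] that by blast
  qed
  have "?\<tau> (?p u) = ?\<tau>' (side_point b' c' (?f u))" if u: "u \<in> {0..1}" for u
  proof -
   define cl where "cl = (\<lambda>u::real. max 0 (min 1 u))"
   have cl: "continuous_on UNIV cl" "\<And>u. cl u \<in> {0..1}" "\<And>u. u \<in> {0..1} ==> cl u = u"
    by (auto simp: cl_def intro!: continuous_intros)
   have f01: "?f u \<in> {0..1}" if "u \<in> {0..1}" for u using that k(2)[of u] by (auto dest: less_imp_le)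
   have 1: "continuous_on UNIV (\<lambda>u. ?\<tau> (?p (cl u)))"
    by (rule continuous_on_compose2[OF T_continuous[OF T(1)] continuous_on_side_point[OF cl(1)]])
     (use cl(2) ptri(1) in auto)
   have "continuous_on UNIV (\<lambda>u. ?f (cl u))"
    by (rule continuous_on_compose2[OF co cl(1)]) auto
   then have 2: "continuous_on UNIV (\<lambda>u. ?\<tau>' (side_point b' c' (?f (cl u))))"
    by (intro continuous_on_compose2[OF T_continuous[OF T(2)] continuous_on_side_point])
     (use side_point_in_triangle[OF d'] f01[OF cl(2)] in auto)
   have "closed {u. ?\<tau> (?p (cl u)) = ?\<tau>' (side_point b' c' (?f (cl u)))}" (is "closed ?C")
    by (rule closed_Collect_eq[OF 1 2])
   moreover have "?I \<subseteq> ?C"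
   proof
    fix u assume u: "u \<in> ?I"
    then have "cl u = u" by (intro cl(3)) auto
    then show "u \<in> ?C" using eq[OF u] u by simp
   qed
   ultimately have "closure ?I \<subseteq> ?C" by (rule closure_minimal[rotated])
   then have "{0..1} \<subseteq> ?C" by simp
   then have "u \<in> ?C" using u by (rule subsetD)
   then have "?\<tau> (?p (cl u)) = ?\<tau>' (side_point b' c' (?f (cl u)))" by (rule CollectD)
   then show ?thesis unfolding cl(3)[OF u] .
  qed
  then show ?thesis unfolding glues_def by (intro conjI sm co su ballI) simp_all
 qed
 have "strict_mono_on ?I h \<or> strict_antimono_on ?I h"
  using injective_eq_monotone_map[OF _ hcont] hinj by (simp add: is_interval_oo)
 then show ?thesis
 proof
  assume m: "strict_mono_on ?I h"
  show ?thesis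
   by (rule that[OF d(2) extend[OF d(2) m h(1) himg]]) (use h(2) in auto)
 next
  assume m: "strict_antimono_on ?I h"
  have d': "distinct [i', pv i', nx i']" by auto
  have flip: "side_point (pv i') (nx i') (1 - v) = ?q v" for v
   by (auto simp: side_point_def vec_eq_iff)
  show ?thesis
  proof (rule that[OF d' extend[OF d', of "\<lambda>u. 1 - h u"]])
   show "strict_mono_on ?I (\<lambda>u. 1 - h u)"
    using m by (auto simp: monotone_on_def)
   show "1 - h u \<in> ?I" if "u \<in> ?I" for u using h(1)[OF that] by auto
   show "\<exists>u\<in>?I. 1 - h u = v" if "v \<in> ?I" for v using himg[of "1 - v"] that by force
   show "?\<tau> (?p u) = ?\<tau>' (side_point (pv i') (nx i') (1 - h u))" if "u \<in> ?I" for u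
    unfolding flip using h(2)[OF that] by simp
  qed
 qed
qed

end

section \<open>Paths ending at a puncture\<close>

lemma puncture_homotopic_iff:
 "puncture_homotopic M P c d \<longleftrightarrow>
  (\<exists>h :: real \<times> real => _. continuous_on ({0..1} \<times> {0..1}) h \<and> (\<forall>s\<in>{0..1}. \<forall>t\<in>{0..1}. h (s, t) \<in> M) \<and>
   (\<forall>t\<in>{0..1}. h (0, t) = c t \<and> h (1, t) = d t) \<and>
   (\<forall>s\<in>{0..1}. h (s, 0) = c 0 \<and> h (s, 1) = c 1 \<and> (\<forall>t\<in>{0..<1}. h (s, t) \<in> M - P)))"
 unfolding puncture_homotopic_def
 apply (subst homotopic_with)
 subgoal by (auto simp: pathstart_def pathfinish_def image_subset_iff)
 apply (rule arg_cong[where f = Ex], rule ext)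
 apply (simp add: pathstart_def pathfinish_def Pi_iff image_subset_iff)
 apply (intro iffI conjI ballI allI impI; (elim conjE)?)
 by auto

lemma puncture_homotopic_refl:
 assumes "puncture_path M P x0 c" "P \<subseteq> M"
 shows "puncture_homotopic M P c c"
proof -
 have c: "path c" "c ` {0..<1} \<subseteq> M - P" "c 1 \<in> P" using assms(1) by (auto simp: puncture_path_def pathfinish_def)
 have "c t \<in> M" if "t \<in> {0..1}" for t
 proof (cases "t = 1")
  case False
  then have "c t \<in> c ` {0..<1}" using that by (intro imageI) auto
  then show ?thesis using c(2) by blast
 qed (use c(3) assms(2) in blast)
 then show ?thesis using c(1,2) unfolding puncture_homotopic_def path_def
  by (simp add: image_subset_iff Pi_iff)
qed

lemma puncture_homotopic_sym: "puncture_homotopic M P c d ==> puncture_homotopic M P d c"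
proof -
 assume a: "puncture_homotopic M P c d"
 then have "pathstart d = pathstart c" "pathfinish d = pathfinish c"
  unfolding puncture_homotopic_def by (auto dest: homotopic_with_imp_property)
 then show ?thesis using a unfolding puncture_homotopic_def by (simp add: homotopic_with_sym)
qed

lemma puncture_homotopic_trans:
 "puncture_homotopic M P c d ==> puncture_homotopic M P d e ==> puncture_homotopic M P c e"
proof -
 assume a: "puncture_homotopic M P c d" "puncture_homotopic M P d e"
 then have "pathstart d = pathstart c" "pathfinish d = pathfinish c"
  unfolding puncture_homotopic_def by (auto dest: homotopic_with_imp_property)
 then show ?thesis using a unfolding puncture_homotopic_def by (auto intro: homotopic_with_trans)
qed

lemma puncture_class_eqI: "puncture_homotopic M P c d ==> puncture_class M P c = puncture_class M P d"
 unfolding puncture_class_def using puncture_homotopic_sym puncture_homotopic_trans by blast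

lemma puncture_homotopic_join:
 assumes "homotopic_paths (M - P) p p'" "puncture_homotopic M P c c'" "pathfinish p = pathstart c"
 shows "puncture_homotopic M P (p +++ c) (p' +++ c')"
proof -
 obtain h where h: "continuous_on ({0..1} \<times> {0..1}) h" "h \<in> ({0..1} \<times> {0..1}) \<rightarrow> M - P"
  "\<forall>x\<in>{0..1}. h (0, x) = p x" "\<forall>x\<in>{0..1}. h (1, x) = p' x"
  "\<forall>t\<in>{0..1::real}. pathstart (h \<circ> Pair t) = pathstart p \<and> pathfinish (h \<circ> Pair t) = pathfinish p"
  using assms(1) unfolding homotopic_paths by blast
 obtain k :: "real \<times> real => _" where k: "continuous_on ({0..1} \<times> {0..1}) k" "\<forall>s\<in>{0..1}. \<forall>t\<in>{0..1}. k (s, t) \<in> M"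
  "\<forall>t\<in>{0..1}. k (0, t) = c t \<and> k (1, t) = c' t"
  "\<forall>s\<in>{0..1}. k (s, 0) = c 0 \<and> k (s, 1) = c 1 \<and> (\<forall>t\<in>{0..<1}. k (s, t) \<in> M - P)"
  using assms(2) unfolding puncture_homotopic_iff by blast
 define H where "H = (\<lambda>y. ((\<lambda>t. h (fst y, t)) +++ (\<lambda>t. k (fst y, t))) (snd y))"
 have "continuous_on ({0..1} \<times> {0..1}) H"
  unfolding H_def
  by (rule continuous_on_homotopic_join_lemma[of "\<lambda>s t. h (s, t)" "\<lambda>s t. k (s, t)"])
   (use h k assms(3) in \<open>auto simp: pathfinish_def pathstart_def\<close>)
 moreover have Hin: "H (s, t) \<in> M - P" if s: "s \<in> {0..1}" and t: "t \<in> {0..<1}" for s t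
 proof (cases "t \<le> 1/2")
  case True
  then have "(s, 2 * t) \<in> {0..1} \<times> {0..1}" using s t by auto
  then show ?thesis using True h(2) by (auto simp: H_def joinpaths_def)
 next
  case False
  then have "2 * t - 1 \<in> {0..<1}" using t by auto
  then show ?thesis using False k(4) s by (auto simp: H_def joinpaths_def)
 qed
 moreover have H1: "H (s, 1) = c 1" and "H (s, 0) = p 0" if "s \<in> {0..1}" for s
  using that k(4) h(5) by (auto simp: H_def joinpaths_def pathstart_def)
 moreover have "H (0, t) = (p +++ c) t" "H (1, t) = (p' +++ c') t" if "t \<in> {0..1}" for t
  using that h(3,4) k(3) by (auto simp: H_def joinpaths_def)
 moreover have "c 1 \<in> M" 
 proof -
  have "k (0, 1) \<in> M" using k(2)[THEN bspec, of 0, THEN bspec, of 1] by simp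
  moreover have "k (0, 1) = c 1" using k(4)[THEN bspec, of 0] by simp
  ultimately show ?thesis by simp
 qed
 moreover have "H (s, t) \<in> M" if "s \<in> {0..1}" "t \<in> {0..1}" for s t
 proof (cases "t = 1")
  case True
  then show ?thesis using H1[OF that(1)] \<open>c 1 \<in> M\<close> by simp
 next
  case False
  then have "t \<in> {0..<1}" using that by auto
  then show ?thesis using Hin[OF that(1)] by blast
 qed
 ultimately show ?thesis unfolding puncture_homotopic_iff
  by (intro exI[of _ H]) (auto simp: joinpaths_def)
qed

text \<open>Interpolating linearly between the identity and f keeps parameters below 1 below 1, so
  every intermediate path reaches the puncture only at its end.\<close>

lemma puncture_homotopic_reparametrize:
 assumes c: "puncture_path M P x0 c" "P \<subseteq> M"
  and f: "continuous_on {0..1} f" "f 0 = 0" "f 1 = 1" "\<And>t. t \<in> {0..<1} ==> f t \<in> {0..<1}"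
  and d: "\<And>t. t \<in> {0..1} ==> d t = c (f t)"
 shows "puncture_homotopic M P c d"
proof -
 have c': "path c" "c ` {0..<1} \<subseteq> M - P" "c 1 \<in> P" using c(1) by (auto simp: puncture_path_def pathfinish_def)
 define g where "g s t = (1 - s) * t + s * f t" for s t
 have lt: "g s t \<in> {0..<1}" if s: "s \<in> {0..1}" and t: "t \<in> {0..<1}" for s t
 proof -
  have ft: "0 \<le> f t" "f t < 1" using f(4)[OF t] by auto
  have "(1 - s) * t + s * f t < 1"
  proof (cases "s = 1")
   case False
   then have "(1 - s) * t < (1 - s) * 1" using s t by (intro mult_strict_left_mono) auto
   moreover have "s * f t \<le> s * 1" using s ft by (intro mult_left_mono) auto
   ultimately have "(1 - s) * t + s * f t < (1 - s) * 1 + s * 1" by (rule add_less_le_mono)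
   then show ?thesis by simp
  qed (use ft in simp)
  then show ?thesis using s t ft by (simp add: g_def)
 qed
 have one: "g s 1 = 1" for s by (simp add: g_def f(3))
 have in01: "g s t \<in> {0..1}" if s: "s \<in> {0..1}" and t: "t \<in> {0..1}" for s t
 proof (cases "t = 1")
  case False
  then have "t \<in> {0..<1}" using t by simp
  then show ?thesis using lt[OF s] by fastforce
 qed (simp add: one)
 have "continuous_on ({0..1} \<times> {0..1}) (\<lambda>y. g (fst y) (snd y))"
  unfolding g_def by (intro continuous_intros continuous_on_compose2[OF f(1)]) auto
 then have "continuous_on ({0..1} \<times> {0..1}) (\<lambda>y. c (g (fst y) (snd y)))"
  by (rule continuous_on_compose2[OF c'(1)[unfolded path_def]]) (use in01 in auto)
 moreover have gin: "c (g s t) \<in> M - P" if "s \<in> {0..1}" "t \<in> {0..<1}" for s t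
  using imageI[OF lt[OF that], of c] c'(2) by blast
 moreover have "c (g s 0) = c 0" for s by (simp add: g_def f(2))
 moreover have "c (g 0 t) = c t" for t by (simp add: g_def)
 moreover have "c (g 1 t) = d t" if "t \<in> {0..1}" for t by (simp add: g_def d[OF that])
 moreover have "c (g s t) \<in> M" if "s \<in> {0..1}" "t \<in> {0..1}" for s t
 proof (cases "t = 1")
  case True
  have "c 1 \<in> M" using c'(3) c(2) by blast
  then show ?thesis unfolding True by (simp only: one)
 next
  case False
  then have "t \<in> {0..<1}" using that by auto
  then show ?thesis using gin[OF that(1)] by blast
 qed
 ultimately show ?thesis unfolding puncture_homotopic_iff
  by (intro exI[of _ "\<lambda>y. c (g (fst y) (snd y))"]) (simp add: one)
qed

lemma puncture_path_join:
 assumes "path p" "path_image p \<subseteq> M - P" "pathstart p = x0" "puncture_path M P x1 c" "pathfinish p = x1"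
 shows "puncture_path M P x0 (p +++ c)"
proof -
 have c: "path c" "c ` {0..<1} \<subseteq> M - P" "c 1 \<in> P" "c 0 = x1"
  using assms(4) by (auto simp: puncture_path_def pathfinish_def pathstart_def)
 have "(p +++ c) t \<in> M - P" if "t \<in> {0..<1}" for t
 proof (cases "t \<le> 1/2")
  case True
  then have "p (2 * t) \<in> path_image p" using that by (auto simp: path_image_def)
  then show ?thesis using True assms(2) by (auto simp: joinpaths_def)
 next
  case False
  then have "2 * t - 1 \<in> {0..<1}" using that by auto
  then have "c (2 * t - 1) \<in> M - P" using c(2) by blast
  then show ?thesis using False by (simp add: joinpaths_def)
 qed
 then show ?thesis unfolding puncture_path_def
  using assms c by (auto intro!: path_join_imp simp: pathstart_def pathfinish_def) (auto simp: joinpaths_def)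
qed

lemma puncture_homotopic_assoc:
 assumes p: "path p" "path_image p \<subseteq> M - P" and q: "path q" "path_image q \<subseteq> M - P"
  and c: "puncture_path M P x1 c" and e: "pathfinish p = pathstart q" "pathfinish q = x1" and P: "P \<subseteq> M"
 shows "puncture_homotopic M P (p +++ (q +++ c)) ((p +++ q) +++ c)"
\<comment> \<open>The pieces occupy [0,1/2], [1/2,3/4], [3/4,1] in the first path and [0,1/4],
  [1/4,1/2], [1/2,1] in the second; the function matches the second division with the first.\<close>
proof (rule puncture_homotopic_reparametrize[where f = "\<lambda>t. if t \<le> 1/4 then 2 * t else if t \<le> 1/2 then t + 1/4 else t / 2 + 1 / 2"])
 show "puncture_path M P (pathstart p) (p +++ (q +++ c))"
  by (rule puncture_path_join[OF p refl puncture_path_join[OF q refl c e(2)] e(1)])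
 show "continuous_on {0..1} (\<lambda>t::real. if t \<le> 1/4 then 2 * t else if t \<le> 1/2 then t + 1/4 else t / 2 + 1 / 2)"
  by (rule continuous_on_cases_1 continuous_intros | auto)+
qed (use P e c in \<open>auto simp: joinpaths_def pathstart_def pathfinish_def puncture_path_def algebra_simps\<close>)

section \<open>The identity component\<close>

abbreviation O21_component :: "(real^3^3) set" where
 "O21_component \<equiv> connected_component_set O21_real (mat 1)"

lemma O21_real_mult: "A \<in> O21_real ==> B \<in> O21_real ==> A ** B \<in> O21_real"
proof -
 assume A: "A \<in> O21_real" and B: "B \<in> O21_real"
 have "transpose (A ** B) ** J21 ** (A ** B) = transpose B ** (transpose A ** J21 ** A) ** B"
  by (simp add: matrix_transpose_mul matrix_mul_assoc)
 then show ?thesis using A B by (simp add: O21_real_def)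
qed

text \<open>Right translation by B carries a connected set through 1 and A to one through B and A
  B.\<close>

lemma O21_component_mult:
 assumes "A \<in> O21_component" "B \<in> O21_component"
 shows "A ** B \<in> O21_component"
proof -
 have B: "connected_component O21_real (mat 1) B" "B \<in> O21_real"
  using assms(2) connected_component_in by auto
 obtain T where T: "connected T" "T \<subseteq> O21_real" "mat 1 \<in> T" "A \<in> T"
  using assms(1) by (auto simp: connected_component_def)
 have "continuous_on T (\<lambda>X. X ** B)"
  unfolding matrix_matrix_mult_def by (intro continuous_on_vec_lambda continuous_intros)
 then have "connected ((\<lambda>X. X ** B) ` T)" using T(1) by (rule connected_continuous_image)
 moreover have "(\<lambda>X. X ** B) ` T \<subseteq> O21_real" using O21_real_mult T(2) B(2) by blast
 moreover have "B \<in> (\<lambda>X. X ** B) ` T" using T(3) by (metis imageI matrix_mul_lid)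
 moreover have "A ** B \<in> (\<lambda>X. X ** B) ` T" using T(4) by (rule imageI)
 ultimately have "connected_component O21_real B (A ** B)" unfolding connected_component_def by blast
 then have "connected_component O21_real (mat 1) (A ** B)" by (rule connected_component_trans[OF B(1)])
 then show ?thesis by simp
qed

text \<open>The one-parameter group of parabolic isometries that fix the null line of the first
  basis vector; \<open>lower_unipotent\<close> is its counterpart for the third one.\<close>

definition upper_unipotent :: "real => real^3^3" where
 "upper_unipotent s = (\<chi> i j. if i = j then 1 else if i = 1 \<and> j = 2 then - s else
  if i = 1 \<and> j = 3 then - (s * s / 2) else if i = 2 \<and> j = 3 then s else 0)"

definition lower_unipotent :: "real => real^3^3" where
 "lower_unipotent s = (\<chi> i j. if i = j then 1 else if i = 2 \<and> j = 1 then s else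
  if i = 3 \<and> j = 1 then - (s * s / 2) else if i = 3 \<and> j = 2 then - s else 0)"

lemma O21_component_one_parameter:
 assumes "\<And>s. f s \<in> O21_real" "continuous_on UNIV f" "f 0 = mat 1"
 shows "f (s :: real) \<in> O21_component"
proof -
 have "connected (range f)" using assms(2) by (intro connected_continuous_image) auto
 moreover have "range f \<subseteq> O21_real" using assms(1) by blast
 moreover have "mat 1 \<in> range f" using assms(3) by (metis rangeI)
 ultimately show ?thesis by (auto simp: connected_component_def)
qed

lemma upper_unipotent_component: "upper_unipotent s \<in> O21_component"
proof (rule O21_component_one_parameter)
 show "upper_unipotent s \<in> O21_real" for s
  by (simp add: O21_real_def upper_unipotent_def transpose_def J21_def matrix_matrix_mult_def vec_eq_iff forall_3 sum_3 algebra_simps)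
 show "continuous_on UNIV upper_unipotent" unfolding upper_unipotent_def
 proof (intro continuous_on_vec_lambda)
  fix i j :: 3
  show "continuous_on UNIV (\<lambda>s :: real. if i = j then 1 else if i = 1 \<and> j = 2 then - s else
  if i = 1 \<and> j = 3 then - (s * s / 2) else if i = 2 \<and> j = 3 then s else 0)"
   using three_cases[of i] three_cases[of j] by (elim disjE) (auto intro!: continuous_intros)
 qed
 show "upper_unipotent 0 = mat 1" by (simp add: upper_unipotent_def mat_def vec_eq_iff)
qed

lemma lower_unipotent_component: "lower_unipotent s \<in> O21_component"
proof (rule O21_component_one_parameter)
 show "lower_unipotent s \<in> O21_real" for s
  by (simp add: O21_real_def lower_unipotent_def transpose_def J21_def matrix_matrix_mult_def vec_eq_iff forall_3 sum_3 algebra_simps)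
 show "continuous_on UNIV lower_unipotent" unfolding lower_unipotent_def
 proof (intro continuous_on_vec_lambda)
  fix i j :: 3
  show "continuous_on UNIV (\<lambda>s :: real. if i = j then 1 else if i = 2 \<and> j = 1 then s else
  if i = 3 \<and> j = 1 then - (s * s / 2) else if i = 3 \<and> j = 2 then - s else 0)"
   using three_cases[of i] three_cases[of j] by (elim disjE) (auto intro!: continuous_intros)
 qed
 show "lower_unipotent 0 = mat 1" by (simp add: lower_unipotent_def mat_def vec_eq_iff)
qed

text \<open>The columns are real null vectors whose pairwise products are \<open>-1\<close>.\<close>

definition base_frame :: "real^3^3" where
 "base_frame = vector [vector [1, 1, 0], vector [0, sqrt 2, 0], vector [0, -1, -1]]"

definition base_frame_inv :: "real^3^3" where
 "base_frame_inv = vector [vector [1, - (1 / sqrt 2), 0], vector [0, 1 / sqrt 2, 0], vector [0, - (1 / sqrt 2), -1]]"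

lemma base_frame_inv: "base_frame ** base_frame_inv = mat 1" "base_frame_inv ** base_frame = mat 1"
 by (simp_all add: base_frame_def base_frame_inv_def matrix_matrix_mult_def mat_def vec_eq_iff forall_3 sum_3)

lemma transpose_base_frame_gram: "transpose base_frame ** J21 ** base_frame = gram"
 by (simp add: base_frame_def gram_def J21_def transpose_def matrix_matrix_mult_def vec_eq_iff forall_3 sum_3)

text \<open>Crossing matrices preserve \<open>gram\<close>, not \<open>J21\<close>;
  \<open>base_frame\<close> translates between the two forms.\<close>

definition base_component :: "(real^3^3) set" where
 "base_component = {N. base_frame ** N ** base_frame_inv \<in> O21_component}"

lemma base_component_mult:
 assumes "A \<in> base_component" "B \<in> base_component"
 shows "A ** B \<in> base_component"
proof -
 have "base_frame ** (A ** B) ** base_frame_inv =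
   base_frame ** A ** (base_frame_inv ** base_frame) ** B ** base_frame_inv"
  by (simp add: base_frame_inv matrix_mul_assoc)
 also have "\<dots> = (base_frame ** A ** base_frame_inv) ** (base_frame ** B ** base_frame_inv)"
  by (simp only: matrix_mul_assoc)
 finally show ?thesis using O21_component_mult assms by (simp add: base_component_def)
qed

lemma base_componentI: "X \<in> O21_component ==> base_frame ** N = X ** base_frame ==> N \<in> base_component"
proof -
 assume X: "X \<in> O21_component" and eq: "base_frame ** N = X ** base_frame"
 have "base_frame ** N ** base_frame_inv = X ** (base_frame ** base_frame_inv)"
  unfolding eq by (simp only: matrix_mul_assoc)
 then show ?thesis using X by (simp add: base_component_def base_frame_inv)
qed

text \<open>A matrix that exchanges two null lines is a product of three unipotents, as for the Weyl
  element of SL(2).\<close>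

lemma half_turn_component:
 assumes "0 < t"
 shows "(\<chi> i j. if i = 1 \<and> j = 3 then - t else if i = 2 \<and> j = 2 then -1 else if i = 3 \<and> j = 1 then - (1 / t) else 0)
  \<in> O21_component" (is "?W \<in> _")
proof -
 \<comment> \<open>The corner entries of the product are -s^2/2 and -r^2/2, which must be -t and
   -1/t; then r s = 2 makes the remaining entries cancel.\<close>
 define s where "s = sqrt (2 * t)"
 have s: "s * s = 2 * t" "s ~= 0" using assms by (auto simp: s_def)
 have t: "t = s * s / 2" using s by simp
 define r where "r = 2 / s"
 have rs: "r * s = 2" "s * r = 2" "r * (s * x) = 2 * x" "s * (r * x) = 2 * x" for x
  using s(2) by (auto simp: r_def)
 have "1 / t = r * r / 2" unfolding t r_def using s(2) by simp
 then have W: "?W = (\<chi> i j. if i = 1 \<and> j = 3 then - (s * s / 2) else if i = 2 \<and> j = 2 then -1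
  else if i = 3 \<and> j = 1 then - (r * r / 2) else 0)"
  by (simp only: \<open>1 / t = r * r / 2\<close> t[symmetric])
 have "upper_unipotent s ** lower_unipotent r ** upper_unipotent s = ?W"
  unfolding W
  by (simp add: upper_unipotent_def lower_unipotent_def matrix_matrix_mult_def vec_eq_iff forall_3 sum_3
    algebra_simps rs)
 then show ?thesis
  using O21_component_mult[OF O21_component_mult[OF upper_unipotent_component[of s] lower_unipotent_component[of r]]
   upper_unipotent_component[of s]] by (simp only:)
qed

definition swap13 :: "3 => 3" where
 "swap13 k = (if k = 1 then 3 else if k = 2 then 2 else 1)"

text \<open>The flat crossing whose relabelling exchanges the two end points of the edge is the half
  turn about a point of the edge.\<close>

lemma cross_swap13_base_component:
 assumes "0 < t"
 shows "cross 2 1 3 t (-1) ** perm_matrix swap13 \<in> base_component"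
proof (rule base_componentI[OF half_turn_component[OF assms]])
 show "base_frame ** (cross 2 1 3 t (-1) ** perm_matrix swap13) =
  (\<chi> i j. if i = 1 \<and> j = 3 then - t else if i = 2 \<and> j = 2 then -1 else if i = 3 \<and> j = 1 then - (1 / t) else 0) ** base_frame"
  by (simp add: base_frame_def cross_def perm_matrix_def swap13_def matrix_matrix_mult_def vec_eq_iff forall_3 sum_3 algebra_simps)
qed

text \<open>As in the modular group, the rotation of order 3 is a half turn times a parabolic
  element; the parameter sqrt 2 is adapted to \<open>base_frame\<close>.\<close>

lemma perm_nx_base_component: "perm_matrix nx \<in> base_component"
proof (rule base_componentI)
 have W: "(\<chi> i j. if i = 1 \<and> j = 3 then - 1 else if i = 2 \<and> j = 2 then -1 else if i = 3 \<and> j = 1 then - (1 / 1) else 0)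
  \<in> O21_component" (is "?W \<in> _")
  by (rule half_turn_component) simp
 show "?W ** upper_unipotent (sqrt 2) \<in> O21_component"
  by (rule O21_component_mult[OF W upper_unipotent_component])
 show "base_frame ** perm_matrix nx = (?W ** upper_unipotent (sqrt 2)) ** base_frame"
  by (simp add: base_frame_def upper_unipotent_def perm_matrix_def nx_def matrix_matrix_mult_def vec_eq_iff forall_3 sum_3)
qed

lemma rotation_cases:
 assumes "\<And>k. \<sigma> (nx k) = nx (\<sigma> k)"
 shows "\<sigma> = id \<or> \<sigma> = nx \<or> \<sigma> = pv"
proof -
 have n: "nx 1 = 2" "nx 2 = 3" "nx 3 = 1" "pv 1 = 3" "pv 2 = 1" "pv 3 = 2" by (simp_all add: nx_def pv_def)
 have e: "\<sigma> 2 = nx (\<sigma> 1)" "\<sigma> 3 = nx (\<sigma> 2)" using assms[of 1] assms[of 2] unfolding n by simp_all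
 have eqI: "\<sigma> = f" if "\<sigma> 1 = f 1" "\<sigma> 2 = f 2" "\<sigma> 3 = f 3" for f
 proof
  fix k show "\<sigma> k = f k" using three_cases[of k] by (elim disjE) (simp_all only: that)
 qed
 from three_cases[of "\<sigma> 1"] show ?thesis
 proof (elim disjE)
  assume 1: "\<sigma> 1 = 1"
  then have 2: "\<sigma> 2 = 2" using e(1) by (simp only: n)
  then have 3: "\<sigma> 3 = 3" using e(2) by (simp only: n)
  have "\<sigma> = id" by (rule eqI) (simp_all only: 1 2 3 n id_apply)
  then show ?thesis by (simp only: simp_thms)
 next
  assume 1: "\<sigma> 1 = 2"
  then have 2: "\<sigma> 2 = 3" using e(1) by (simp only: n)
  then have 3: "\<sigma> 3 = 1" using e(2) by (simp only: n)
  have "\<sigma> = nx" by (rule eqI) (simp_all only: 1 2 3 n id_apply)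
  then show ?thesis by (simp only: simp_thms)
 next
  assume 1: "\<sigma> 1 = 3"
  then have 2: "\<sigma> 2 = 1" using e(1) by (simp only: n)
  then have 3: "\<sigma> 3 = 2" using e(2) by (simp only: n)
  have "\<sigma> = pv" by (rule eqI) (simp_all only: 1 2 3 n id_apply)
  then show ?thesis by (simp only: simp_thms)
 qed
qed

lemma rotation_base_component:
 assumes "\<And>k. \<sigma> (nx k) = nx (\<sigma> k)"
 shows "perm_matrix \<sigma> \<in> base_component"
proof -
 have c: "nx \<circ> nx = pv" "nx \<circ> pv = id" by (rule ext, simp only: o_apply nx_pv id_apply)+
 have pv: "perm_matrix pv \<in> base_component"
  using base_component_mult[OF perm_nx_base_component perm_nx_base_component]
  unfolding perm_matrix_comp c .
 have id: "perm_matrix id \<in> base_component"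
  using base_component_mult[OF pv perm_nx_base_component] unfolding perm_matrix_comp c .
 from rotation_cases[of \<sigma>, OF assms] show ?thesis
  using pv perm_nx_base_component id by (elim disjE) (simp_all only:)
qed

text \<open>The cyclic relabelling \<pi> moves the crossed side to corner 2, where
  \<open>cross_swap13_base_component\<close> applies. Since \<sigma> and \<open>swap13\<close> both
  reverse the cyclic order, the permutation \<theta> that remains preserves it and is a
  rotation.\<close>

lemma cross_base_component:
 assumes d: "distinct [a, b, c]" and t: "0 < t" and odd: "\<And>k. \<sigma> (nx k) = pv (\<sigma> k)"
 shows "cross a b c t (-1) ** perm_matrix \<sigma> \<in> base_component"
proof -
 define \<pi> where "\<pi> = (if a = 2 then id else if a = 3 then nx else pv)"
 define \<pi>' where "\<pi>' = (if a = 2 then id else if a = 3 then pv else nx)"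
 have rot: "\<pi> (nx k) = nx (\<pi> k)" "\<pi>' (nx k) = nx (\<pi>' k)" for k by (auto simp: \<pi>_def \<pi>'_def)
 have inv: "\<pi> \<circ> \<pi>' = id" "\<pi>' \<circ> \<pi> = id" by (auto simp: \<pi>_def \<pi>'_def fun_eq_iff)
 have bij: "bij \<pi>" by (rule o_bij[OF inv(2) inv(1)])
 have p2: "\<pi> 2 = a" using three_cases[of a] by (elim disjE) (simp_all add: \<pi>_def nx_def pv_def)
 have "(\<pi> 1 = b \<and> \<pi> 3 = c) \<or> (\<pi> 1 = c \<and> \<pi> 3 = b)"
  using distinct_three_cases[OF d] by (elim insertE emptyE) (simp_all add: \<pi>_def nx_def pv_def)
 \<comment> \<open>If \<pi> puts b and c in the opposite order, \<open>cross_swap\<close> exchanges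
   them at the cost of inverting t.\<close>
 then obtain t' where t': "0 < t'" "cross a b c t (-1) = cross (\<pi> 2) (\<pi> 1) (\<pi> 3) t' (-1)"
 proof
  assume p: "\<pi> 1 = b \<and> \<pi> 3 = c"
  show ?thesis by (rule that[of t]) (simp_all only: t p p2)
 next
  assume p: "\<pi> 1 = c \<and> \<pi> 3 = b"
  show ?thesis
   by (rule that[of "1 / t"]) (simp_all only: p p2 cross_swap[OF d, of t "-1"] zero_less_divide_1_iff t)
 qed
 define \<theta> where "\<theta> = \<sigma> \<circ> \<pi> \<circ> swap13"
 have sw: "swap13 (nx k) = pv (swap13 k)" "swap13 (swap13 k) = k" for k
  using three_cases[of k] by (auto simp: swap13_def nx_def pv_def)
 have rotp: "\<pi> (pv k) = pv (\<pi> k)" for k using rot(1)[of "nx k"] rot(1)[of k] by simp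
 have oddp: "\<sigma> (pv k) = nx (\<sigma> k)" for k using odd[of "nx k"] odd[of k] by simp
 have \<theta>: "\<theta> (nx k) = nx (\<theta> k)" for k by (simp add: \<theta>_def sw rotp oddp)
 have "cross a b c t (-1) ** perm_matrix \<sigma> =
  (perm_matrix \<pi>' ** perm_matrix \<pi>) ** cross (\<pi> 2) (\<pi> 1) (\<pi> 3) t' (-1) ** perm_matrix \<sigma>"
  by (simp add: t' perm_matrix_comp inv perm_matrix_id)
 also have "\<dots> = perm_matrix \<pi>' ** (perm_matrix \<pi> ** cross (\<pi> 2) (\<pi> 1) (\<pi> 3) t' (-1)) ** perm_matrix \<sigma>"
  by (simp only: matrix_mul_assoc)
 also have "perm_matrix \<pi> ** cross (\<pi> 2) (\<pi> 1) (\<pi> 3) t' (-1) = cross 2 1 3 t' (-1) ** perm_matrix \<pi>"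
  by (rule perm_matrix_cross[OF bij, symmetric])
 also have "cross 2 1 3 t' (-1) ** perm_matrix \<pi> = cross 2 1 3 t' (-1) ** (perm_matrix swap13 ** perm_matrix swap13) ** perm_matrix \<pi>"
 proof -
  have "swap13 \<circ> swap13 = id" by (simp add: fun_eq_iff sw)
  then show ?thesis by (simp only: perm_matrix_comp perm_matrix_id matrix_mul_rid)
 qed
 finally have "cross a b c t (-1) ** perm_matrix \<sigma> =
  perm_matrix \<pi>' ** (cross 2 1 3 t' (-1) ** perm_matrix swap13) ** (perm_matrix swap13 ** perm_matrix \<pi> ** perm_matrix \<sigma>)"
  by (simp only: matrix_mul_assoc)
 also have "perm_matrix swap13 ** perm_matrix \<pi> ** perm_matrix \<sigma> = (perm_matrix \<theta> :: real^3^3)"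
  by (simp add: \<theta>_def perm_matrix_comp o_assoc)
 finally show ?thesis
  using base_component_mult[OF base_component_mult[OF rotation_base_component[of \<pi>', OF rot(2)]
   cross_swap13_base_component[OF t'(1)]] rotation_base_component[of \<theta>, OF \<theta>]] by (simp only:)
qed

lemma map_matrix_mult: "map_matrix complex_of_real (A ** B) = map_matrix complex_of_real A ** map_matrix complex_of_real B"
 by (simp add: map_matrix_def matrix_matrix_mult_def vec_eq_iff)

lemma map_matrix_mat: "map_matrix complex_of_real (mat c) = mat (of_real c)"
 by (simp add: map_matrix_def mat_def vec_eq_iff)

lemma O21_real_U21:
 assumes "A \<in> O21_real"
 shows "map_matrix complex_of_real A \<in> carrier U21"
proof -
 have A: "transpose A ** J21 ** A = J21" using assms by (simp add: O21_real_def)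
 have J: "map_matrix complex_of_real J21 = J21" by (simp add: map_matrix_def J21_def vec_eq_iff forall_3)
 have "adjoint_matrix (map_matrix complex_of_real A) = map_matrix complex_of_real (transpose A)"
  by (simp add: map_matrix_def adjoint_matrix_def transpose_def vec_eq_iff)
 then have e: "adjoint_matrix (map_matrix complex_of_real A) ** J21 ** map_matrix complex_of_real A = J21"
  using arg_cong[OF A, of "map_matrix complex_of_real"] by (simp add: map_matrix_mult J)
 have "det (map_matrix complex_of_real A) ~= 0"
 proof
  assume "det (map_matrix complex_of_real A) = 0"
  then have "det (adjoint_matrix (map_matrix complex_of_real A) ** J21 ** map_matrix complex_of_real A) = 0"
   by (simp only: det_mul mult_zero_right)
  then show False unfolding e det_J21 by simp
 qed
 then show ?thesis using e by (simp add: U21_def invertible_det_nz)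
qed

section \<open>Charts around the edges\<close>

text \<open>The open triangle with corners i, -i, 1. The edge is the real interval (0,1); the upper
  half has its apex at i, the lower half at -i.\<close>

definition kite :: "complex set" where
 "kite = {z. 0 < Re z \<and> Re z + \<bar>Im z\<bar> < 1}"

text \<open>The affine map that sends i, 1 and 0 to the corners a, c and the third corner.\<close>

definition tri_pt :: "3 => 3 => complex => real^3" where
 "tri_pt a c z = (\<chi> k. if k = a then Im z else if k = c then Re z else 1 - Re z - Im z)"

text \<open>The lower half is reflected, and on the parallel to the edge at height Im z, of width 1
  + Im z, the relative position is changed by f. On the edge this is f itself, and lines through the
  apex -i go to lines through the apex i.\<close>

definition twist :: "(real => real) => complex => complex" where
 "twist f z = Complex ((1 + Im z) * f (Re z / (1 + Im z))) (- Im z)"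

definition untwist :: "(real => real) => complex => complex" where
 "untwist g w = Complex ((1 - Im w) * g (Re w / (1 - Im w))) (- Im w)"

lemma open_kite: "open kite"
 unfolding kite_def by (intro open_Collect_conj open_Collect_less continuous_intros)

lemma convex_kite: "convex kite"
proof -
 have "kite = {z. 0 < Re z} \<inter> ({z. Re z + Im z < 1} \<inter> {z. Re z - Im z < 1})"
  by (auto simp: kite_def abs_less_iff)
 moreover have "{z. 0 < Re z} = {z. inner 1 z > (0::real)}" "{z. Re z + Im z < 1} = {z. inner (Complex 1 1) z < 1}"
  "{z. Re z - Im z < 1} = {z. inner (Complex 1 (-1)) z < 1}"
  by (auto simp: inner_complex_def)
 ultimately have eq: "kite = {z. inner 1 z > (0::real)} \<inter> ({z. inner (Complex 1 1) z < 1} \<inter> {z. inner (Complex 1 (-1)) z < 1})"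
  by (simp only:)
 show ?thesis unfolding eq by (intro convex_Int convex_halfspace_gt convex_halfspace_lt)
qed

lemma kite_insert_convex:
 assumes "e \<in> {0, 1}" "x \<in> kite" "0 \<le> u" "u < 1"
 shows "(1 - u) *\<^sub>R x + u *\<^sub>R e \<in> kite"
proof -
 have x: "0 < Re x" "Re x + \<bar>Im x\<bar> < 1" using assms(2) by (auto simp: kite_def)
 have "\<bar>(1 - u) * Im x\<bar> = (1 - u) * \<bar>Im x\<bar>" using assms by (simp add: abs_mult)
 moreover have "(1 - u) * (Re x + \<bar>Im x\<bar>) < (1 - u) * 1" using x assms by (intro mult_strict_left_mono) auto
 moreover have "0 < (1 - u) * Re x" using x assms by simp
 ultimately show ?thesis using assms(1,3) by (auto simp: kite_def algebra_simps)
qed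

lemma tri_pt_half:
 assumes "a ~= c" "z \<in> kite" "0 \<le> Im z"
 shows "tri_pt a c z \<in> half_triangle a"
proof -
 obtain b where d: "distinct [a, b, c]"
 proof (cases "c = nx a")
  case True then show ?thesis by (intro that[of "pv a"]) simp
 next
  case False
  then have "c = pv a" using three_nx_cases[of c a] assms(1) by auto
  then show ?thesis by (intro that[of "nx a"]) simp
 qed
 have z: "0 < Re z" "Re z + Im z < 1" using assms(2,3) by (auto simp: kite_def)
 have v: "tri_pt a c z $ a = Im z" "tri_pt a c z $ c = Re z" "tri_pt a c z $ b = 1 - Re z - Im z"
  using d by (auto simp: tri_pt_def)
 have "tri_pt a c z \<in> triangle" unfolding triangle_iff[OF d] v using z assms(3) by simp
 moreover have "0 < tri_pt a c z $ k" if "k ~= a" for k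
  using distinct_three_exhaust[OF d, of k] that v z by (elim disjE) simp_all
 ultimately show ?thesis by (simp add: half_triangle_def)
qed

lemma tri_pt_coords:
 assumes "a ~= c" "x \<in> triangle"
 shows "tri_pt a c (Complex (x $ c) (x $ a)) = x"
proof -
 obtain b where d: "distinct [a, b, c]"
 proof (cases "c = nx a")
  case True then show ?thesis by (intro that[of "pv a"]) simp
 next
  case False
  then have "c = pv a" using three_nx_cases[of c a] assms(1) by auto
  then show ?thesis by (intro that[of "nx a"]) simp
 qed
 show ?thesis using assms(2) d unfolding triangle_iff[OF d] vec_eq_distinct[OF d] by (auto simp: tri_pt_def)
qed

lemma tri_pt_nth: "a ~= c ==> tri_pt a c z $ a = Im z" "a ~= c ==> tri_pt a c z $ c = Re z"
 by (auto simp: tri_pt_def)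

lemma half_coords:
 assumes "a ~= c" "x \<in> half_triangle a"
 shows "Complex (x $ c) (x $ a) \<in> kite" "0 \<le> Im (Complex (x $ c) (x $ a))"
proof -
 obtain b where d: "distinct [a, b, c]"
 proof (cases "c = nx a")
  case True then show ?thesis by (intro that[of "pv a"]) simp
 next
  case False
  then have "c = pv a" using three_nx_cases[of c a] assms(1) by auto
  then show ?thesis by (intro that[of "nx a"]) simp
 qed
 have "x \<in> triangle" "0 < x $ b" "0 < x $ c" using assms(2) d by (auto simp: half_triangle_def)
 then show "Complex (x $ c) (x $ a) \<in> kite" "0 \<le> Im (Complex (x $ c) (x $ a))"
  unfolding triangle_iff[OF d] by (auto simp: kite_def)
qed

lemma continuous_on_tri_pt: "continuous_on S (tri_pt a c)"
 unfolding tri_pt_def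
proof (intro continuous_on_vec_lambda_3)
 fix k :: 3
 show "continuous_on S (\<lambda>z. if k = a then Im z else if k = c then Re z else 1 - Re z - Im z)"
  by (cases "k = a"; cases "k = c") (auto intro!: continuous_intros)
qed

lemma tri_pt_real: "distinct [a, b, c] ==> tri_pt a c (of_real u) = side_point b c u"
 by (simp only: vec_eq_distinct[of a b c]) (auto simp: tri_pt_def side_point_def)

lemma tri_pt_affine: "tri_pt a c (linepath z w t) = linepath (tri_pt a c z) (tri_pt a c w) t"
proof -
 have "tri_pt a c (linepath z w t) $ k = linepath (tri_pt a c z) (tri_pt a c w) t $ k" for k
  by (cases "k = a"; cases "k = c") (auto simp: tri_pt_def linepath_def algebra_simps)
 then show ?thesis by (simp only: vec_eq_iff) simp
qed

context
 fixes f :: "real => real"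
 assumes f: "strict_mono f" "f 0 = 0" "f 1 = 1"
begin

lemma twist_kite:
 assumes "z \<in> kite" "Im z \<le> 0"
 shows "twist f z \<in> kite" "0 \<le> Im (twist f z)"
proof -
 define v where "v = 1 + Im z"
 have z: "0 < Re z" "Re z < v" "0 < v" using assms by (auto simp: kite_def v_def)
 have "0 < Re z / v" "Re z / v < 1" using z by auto
 then have "f 0 < f (Re z / v)" "f (Re z / v) < f 1" using strict_mono_less[OF f(1)] by blast+
 then have "0 < v * f (Re z / v)" "v * f (Re z / v) < v" using f z by auto
 then show "twist f z \<in> kite" "0 \<le> Im (twist f z)" using assms(2) by (auto simp: twist_def kite_def v_def)
qed

lemma untwist_kite:
 assumes "z \<in> kite" "0 \<le> Im z"
 shows "untwist f z \<in> kite" "Im (untwist f z) \<le> 0"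
proof -
 define v where "v = 1 - Im z"
 have z: "0 < Re z" "Re z < v" "0 < v" using assms by (auto simp: kite_def v_def)
 have "0 < Re z / v" "Re z / v < 1" using z by auto
 then have "f 0 < f (Re z / v)" "f (Re z / v) < f 1" using strict_mono_less[OF f(1)] by blast+
 then have "0 < v * f (Re z / v)" "v * f (Re z / v) < v" using f z by auto
 then show "untwist f z \<in> kite" "Im (untwist f z) \<le> 0" using assms(2) by (auto simp: untwist_def kite_def v_def)
qed

lemma untwist_twist:
 assumes "\<And>u. g (f u) = u" "z \<in> kite" "Im z \<le> 0"
 shows "untwist g (twist f z) = z"
proof -
 have "1 + Im z ~= 0" using assms(2,3) by (auto simp: kite_def)
 then show ?thesis by (simp add: untwist_def twist_def assms(1) complex_eq_iff)
qed

lemma twist_untwist: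
 assumes "\<And>u. f (g u) = u" "z \<in> kite" "0 \<le> Im z"
 shows "twist f (untwist g z) = z"
proof -
 have "1 - Im z ~= 0" using assms(2,3) by (auto simp: kite_def)
 then show ?thesis by (simp add: untwist_def twist_def assms(1) complex_eq_iff)
qed

end

lemma continuous_on_twist:
 assumes "continuous_on UNIV f" "\<And>z. z \<in> S ==> Im z ~= -1"
 shows "continuous_on S (twist f)"
 unfolding twist_def
 by (intro continuous_intros continuous_on_compose2[OF assms(1)] continuous_on_Complex) (use assms(2) in \<open>auto simp: add_eq_0_iff\<close>)

lemma continuous_on_untwist:
 assumes "continuous_on UNIV f" "\<And>z. z \<in> S ==> Im z ~= 1"
 shows "continuous_on S (untwist f)"
 unfolding untwist_def
 by (intro continuous_intros continuous_on_compose2[OF assms(1)] continuous_on_Complex) (use assms(2) in auto)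

context bipartite_surface
begin

definition gluing :: "'a side => (3 => 3) => (real => real) => bool" where
 "gluing s \<sigma> f \<longleftrightarrow> bij \<sigma> \<and> \<sigma> (snd s) = snd (opp s) \<and>
  glues (fst s) (nx (snd s)) (pv (snd s)) (fst (opp s)) (\<sigma> (nx (snd s))) (\<sigma> (pv (snd s))) f"

lemma bij_three:
 assumes "distinct [a', b', c' :: 3]"
 obtains \<sigma> where "bij \<sigma>" "\<sigma> i = a'" "\<sigma> (nx i) = b'" "\<sigma> (pv i) = c'"
proof
 define \<sigma> where "\<sigma> = (\<lambda>k. if k = i then a' else if k = nx i then b' else c')"
 show v: "\<sigma> i = a'" "\<sigma> (nx i) = b'" "\<sigma> (pv i) = c'" by (auto simp: \<sigma>_def)
 have "inj \<sigma>"
 proof (rule injI)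
  fix x y assume "\<sigma> x = \<sigma> y"
  then show "x = y" using three_nx_cases[of x i] three_nx_cases[of y i] assms v
   by (elim disjE) simp_all
 qed
 then show "bij \<sigma>" by (simp add: bij_def finite_UNIV_inj_surj)
qed

lemma gluing_exists:
 assumes s: "s \<in> sides"
 obtains \<sigma> f where "gluing s \<sigma> f"
proof -
 obtain f b' c' where f: "distinct [snd (opp s), b', c']" "glues (fst s) (nx (snd s)) (pv (snd s)) (fst (opp s)) b' c' f"
  by (rule glues_exists[OF s refl refl])
 obtain \<sigma> where \<sigma>: "bij \<sigma>" "\<sigma> (snd s) = snd (opp s)" "\<sigma> (nx (snd s)) = b'" "\<sigma> (pv (snd s)) = c'"
  by (rule bij_three[OF f(1)])
 have "gluing s \<sigma> f" unfolding gluing_def \<sigma>(2-4) using \<sigma>(1) f(2) by simp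
 then show ?thesis by (rule that)
qed

text \<open>By \<open>gluing_unique\<close> this permutation does not depend on the choice, whereas
  \<open>gfun\<close> is determined only on [0,1].\<close>

definition gperm :: "'a side => 3 => 3" where
 "gperm s = (SOME \<sigma>. \<exists>f. gluing s \<sigma> f)"

definition gfun :: "'a side => real => real" where
 "gfun s = (SOME f. gluing s (gperm s) f)"

abbreviation gfun_inv :: "'a side => real => real" where
 "gfun_inv s \<equiv> inv_into UNIV (gfun s)"

lemma gluing: assumes "s \<in> sides" shows "gluing s (gperm s) (gfun s)"
proof -
 have "\<exists>\<sigma> f. gluing s \<sigma> f" using gluing_exists[OF assms] by metis
 then have "\<exists>f. gluing s (gperm s) f" unfolding gperm_def by (rule someI_ex)
 then show ?thesis unfolding gfun_def by (rule someI_ex)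
qed

text \<open>Gluings with different permutations would run through the edge in opposite directions,
  so that f' = 1 - f on (0,1). This is impossible for two increasing functions, as the values at 1/3
  and 1/2 show.\<close>

lemma gluing_unique:
 assumes s: "s \<in> sides" and g: "gluing s \<sigma> f" and h: "gluing s \<sigma>' f'"
 shows "\<sigma> = \<sigma>'"
proof -
 let ?i = "snd s" and ?i' = "snd (opp s)"
 have b: "bij \<sigma>" "bij \<sigma>'" "\<sigma> ?i = ?i'" "\<sigma>' ?i = ?i'" using g h by (auto simp: gluing_def)
 have inj: "\<sigma> x = \<sigma> y \<longleftrightarrow> x = y" "\<sigma>' x = \<sigma>' y \<longleftrightarrow> x = y" for x y using b(1,2) by (auto simp: bij_def inj_eq)
 have d: "distinct [?i', \<sigma> (nx ?i), \<sigma> (pv ?i)]" "distinct [?i', \<sigma>' (nx ?i), \<sigma>' (pv ?i)]"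
  unfolding b(3)[symmetric] by (simp_all add: inj) (simp_all add: b(3) b(4)[symmetric] inj)
 have f: "strict_mono f" "f 0 = 0" "f 1 = 1" and f': "strict_mono f'" "f' 0 = 0" "f' 1 = 1"
  using g h by (auto simp: gluing_def glues_def)
 have eq: "side_point (\<sigma>' (nx ?i)) (\<sigma>' (pv ?i)) (f' u) = side_point (\<sigma> (nx ?i)) (\<sigma> (pv ?i)) (f u)" if u: "0 < u" "u < 1" for u
 proof -
  have fu: "0 < f u" "f u < 1" "0 \<le> f' u" "f' u \<le> 1"
   using strict_mono_less[OF f(1), of 0 u] strict_mono_less[OF f(1), of u 1]
    strict_mono_less[OF f'(1), of 0 u] strict_mono_less[OF f'(1), of u 1] u f f' by simp_all
  have "u \<in> {0..1}" using u by simp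
  then have "fst (opp s) (side_point (\<sigma> (nx ?i)) (\<sigma> (pv ?i)) (f u)) = fst (opp s) (side_point (\<sigma>' (nx ?i)) (\<sigma>' (pv ?i)) (f' u))"
   using g h unfolding gluing_def glues_def by metis
  moreover have "side_point (\<sigma> (nx ?i)) (\<sigma> (pv ?i)) (f u) \<in> half_triangle ?i'"
   using side_point_in_open_side[OF d(1) fu(1,2)] by (simp add: half_triangle_eq)
  moreover have "side_point (\<sigma>' (nx ?i)) (\<sigma>' (pv ?i)) (f' u) \<in> triangle"
   by (rule side_point_in_triangle[OF d(2) fu(3,4)])
  ultimately show ?thesis using T_half_inj[OF opp(1)[OF s]] by blast
 qed
 have nx_eq: "\<sigma> (nx ?i) = \<sigma>' (nx ?i)"
 proof (rule ccontr)
  assume ne: "\<sigma> (nx ?i) ~= \<sigma>' (nx ?i)"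
  then have sw: "\<sigma>' (nx ?i) = \<sigma> (pv ?i)" "\<sigma>' (pv ?i) = \<sigma> (nx ?i)"
   using distinct_three_exhaust[OF d(1), of "\<sigma>' (nx ?i)"] distinct_three_exhaust[OF d(1), of "\<sigma>' (pv ?i)"] d(2) by auto
  have "f' u = 1 - f u" if "0 < u" "u < 1" for u
   using arg_cong[OF eq[OF that], of "\<lambda>x. x $ \<sigma> (nx ?i)"] d(1) unfolding sw by (auto simp: side_point_def)
  from this[of "1/3"] this[of "1/2"] have "f' (1/3) = 1 - f (1/3)" "f' (1/2) = 1 - f (1/2)" by simp_all
  moreover have "f (1/3) < f (1/2)" "f' (1/3) < f' (1/2)"
   by (simp_all add: strict_mono_less[OF f(1)] strict_mono_less[OF f'(1)])
  ultimately show False by simp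
 qed
 have pv_eq: "\<sigma> (pv ?i) = \<sigma>' (pv ?i)"
  using distinct_three_exhaust[OF d(1), of "\<sigma>' (pv ?i)"] d(2) nx_eq by auto
 show ?thesis
 proof
  fix k show "\<sigma> k = \<sigma>' k" using three_nx_cases[of k ?i] nx_eq pv_eq b(3,4) by (elim disjE) simp_all
 qed
qed

lemma gperm: assumes "s \<in> sides"
 shows "bij (gperm s)" "gperm s (snd s) = snd (opp s)"
  "distinct [snd (opp s), gperm s (nx (snd s)), gperm s (pv (snd s))]"
proof -
 show b: "bij (gperm s)" and e: "gperm s (snd s) = snd (opp s)"
  using gluing[OF assms] by (simp_all add: gluing_def)
 have "gperm s x = gperm s y \<longleftrightarrow> x = y" for x y using b by (auto simp: bij_def inj_eq)
 then show "distinct [snd (opp s), gperm s (nx (snd s)), gperm s (pv (snd s))]"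
  unfolding e[symmetric] by simp
qed

lemma gfun: assumes "s \<in> sides"
 shows "strict_mono (gfun s)" "gfun s 0 = 0" "gfun s 1 = 1" "continuous_on UNIV (gfun s)" "surj (gfun s)"
  "u \<in> {0..1} ==> fst s (side_point (nx (snd s)) (pv (snd s)) u)
   = fst (opp s) (side_point (gperm s (nx (snd s))) (gperm s (pv (snd s))) (gfun s u))"
 using gluing[OF assms] by (simp_all add: gluing_def glues_def)

lemma glues_inverse:
 assumes "glues \<tau> b c \<tau>' b' c' f"
 shows "glues \<tau>' b' c' \<tau> b c (inv_into UNIV f)"
proof -
 let ?g = "inv_into UNIV f"
 have f: "strict_mono f" "f 0 = 0" "f 1 = 1" "surj f"
  and eq: "\<And>u. u \<in> {0..1} ==> \<tau> (side_point b c u) = \<tau>' (side_point b' c' (f u))"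
  using assms by (simp_all add: glues_def)
 have inj: "inj f" using f(1) by (rule strict_mono_imp_inj_on)
 have gf: "?g (f u) = u" for u by (rule inv_f_f[OF inj])
 have fg: "f (?g u) = u" for u by (rule surj_f_inv_f[OF f(4)])
 have sm: "strict_mono ?g"
 proof (rule strict_monoI)
  fix x y :: real assume "x < y"
  then have "f (?g x) < f (?g y)" by (simp only: fg)
  then show "?g x < ?g y" by (simp only: strict_mono_less[OF f(1)])
 qed
 have su: "surj ?g" by (rule surjI[of _ f]) (rule gf)
 have co: "continuous_on UNIV ?g"
 proof (rule continuous_onI_mono)
  show "open (range ?g)" unfolding su by simp
  show "?g x \<le> ?g y" if "x \<le> y" for x y using strict_mono_less_eq[OF sm] that by blast
 qed
 have g01: "?g 0 = 0" "?g 1 = 1" using gf[of 0] gf[of 1] f(2,3) by simp_all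
 have "\<tau>' (side_point b' c' u) = \<tau> (side_point b c (?g u))" if u: "u \<in> {0..1}" for u
 proof -
  have "?g 0 \<le> ?g u" "?g u \<le> ?g 1" using strict_mono_less_eq[OF sm] u by auto
  then have "?g u \<in> {0..1}" using g01 by simp
  then show ?thesis using eq[of "?g u"] by (simp only: fg)
 qed
 then show ?thesis unfolding glues_def by (intro conjI ballI sm co su g01)
qed

lemma glues_flip:
 assumes g: "glues \<tau> b c \<tau>' b' c' f" and ne: "b ~= c" "b' ~= c'"
 shows "glues \<tau> c b \<tau>' c' b' (\<lambda>u. 1 - f (1 - u))"
proof -
 have f: "strict_mono f" "f 0 = 0" "f 1 = 1" "surj f" "continuous_on UNIV f"
  and eq: "\<And>u. u \<in> {0..1} ==> \<tau> (side_point b c u) = \<tau>' (side_point b' c' (f u))"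
  using g by (simp_all add: glues_def)
 have flip: "side_point c b u = side_point b c (1 - u)" if "b ~= c" for b c u
  using that by (auto simp: side_point_def vec_eq_iff)
 have "strict_mono (\<lambda>u. 1 - f (1 - u))"
  by (rule strict_monoI) (simp add: strict_mono_less[OF f(1)])
 moreover have "surj (\<lambda>u. 1 - f (1 - u))"
 proof -
  have "\<exists>u. v = 1 - f (1 - u)" for v
  proof -
   obtain w where "f w = 1 - v" using f(4) by (metis surjD)
   then show ?thesis by (intro exI[of _ "1 - w"]) simp
  qed
  then show ?thesis unfolding surj_def by blast
 qed
 moreover have "continuous_on UNIV (\<lambda>u. 1 - f (1 - u))"
  by (intro continuous_intros continuous_on_compose2[OF f(5)]) auto
 moreover have "\<tau> (side_point c b u) = \<tau>' (side_point c' b' (1 - f (1 - u)))" if "u \<in> {0..1}" for u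
  unfolding flip[OF ne(1)] flip[OF ne(2)] using eq[of "1 - u"] that by simp
 ultimately show ?thesis unfolding glues_def by (intro conjI ballI) (simp_all add: f)
qed

text \<open>The gluing of \<open>opp s\<close> is again parametrised from the successor to the
  predecessor of its own corner. If the permutation reverses the cyclic order, the inverse of
  \<open>gfun s\<close> must therefore be flipped before uniqueness applies.\<close>

lemma gperm_opp:
 assumes s: "s \<in> sides"
 shows "gperm (opp s) (gperm s k) = k"
proof -
 let ?\<sigma> = "gperm s" and ?\<tau> = "inv_into UNIV (gperm s)"
 let ?i = "snd s" and ?i' = "snd (opp s)"
 have b: "bij ?\<sigma>" by (rule gperm(1)[OF s])
 have inv: "?\<tau> (?\<sigma> k) = k" for k using b by (simp add: bij_is_inj inv_f_f)
 have g: "glues (fst s) (nx ?i) (pv ?i) (fst (opp s)) (?\<sigma> (nx ?i)) (?\<sigma> (pv ?i)) (gfun s)"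
  using gluing[OF s] by (simp add: gluing_def)
 have g': "glues (fst (opp s)) (?\<sigma> (nx ?i)) (?\<sigma> (pv ?i)) (fst s) (nx ?i) (pv ?i) (gfun_inv s)"
  by (rule glues_inverse[OF g])
 have d: "distinct [?i', ?\<sigma> (nx ?i), ?\<sigma> (pv ?i)]" by (rule gperm(3)[OF s])
 have bt: "bij ?\<tau>" using b by (rule bij_imp_bij_inv)
 have ti: "?\<tau> ?i' = ?i" using inv[of ?i] gperm(2)[OF s] by simp
 have "\<exists>f. gluing (opp s) ?\<tau> f"
 proof (cases "?\<sigma> (nx ?i) = nx ?i'")
  case True
  then have "?\<sigma> (pv ?i) = pv ?i'" using three_nx_cases[of "?\<sigma> (pv ?i)" ?i'] d by auto
  note e = True this
  have t: "?\<tau> (nx ?i') = nx ?i" "?\<tau> (pv ?i') = pv ?i" using inv[of "nx ?i"] inv[of "pv ?i"] unfolding e by simp_all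
  have "gluing (opp s) ?\<tau> (gfun_inv s)"
   unfolding gluing_def opp_opp[OF s] using g'[unfolded e] bt ti t by simp
  then show ?thesis by blast
 next
  case False
  then have e: "?\<sigma> (nx ?i) = pv ?i'" using three_nx_cases[of "?\<sigma> (nx ?i)" ?i'] d by auto
  then have e': "?\<sigma> (pv ?i) = nx ?i'" using three_nx_cases[of "?\<sigma> (pv ?i)" ?i'] d by auto
  have t: "?\<tau> (nx ?i') = pv ?i" "?\<tau> (pv ?i') = nx ?i" using inv[of "nx ?i"] inv[of "pv ?i"] unfolding e e' by simp_all
  have "glues (fst (opp s)) (nx ?i') (pv ?i') (fst s) (pv ?i) (nx ?i) (\<lambda>u. 1 - gfun_inv s (1 - u))"
   by (rule glues_flip) (use g' e e' in simp_all)
  then have "gluing (opp s) ?\<tau> (\<lambda>u. 1 - gfun_inv s (1 - u))"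
   unfolding gluing_def opp_opp[OF s] using t bt ti by simp
  then show ?thesis by blast
 qed
 then have "gperm (opp s) = ?\<tau>" using gluing_unique[OF opp(1)[OF s] gluing[OF opp(1)[OF s]]] by blast
 then show ?thesis by (simp add: inv)
qed

text \<open>One plane chart for both halves: affine above the edge, twisted by the gluing function
  below it, so that the two formulas agree on the edge (\<open>chart_lower\<close>).\<close>

definition chart :: "'a side => complex => 'a" where
 "chart s z = (if 0 \<le> Im z then fst s (tri_pt (snd s) (pv (snd s)) z)
  else fst (opp s) (tri_pt (snd (opp s)) (gperm s (pv (snd s))) (twist (gfun s) z)))"

lemma chart_upper: "0 \<le> Im z ==> chart s z = fst s (tri_pt (snd s) (pv (snd s)) z)"
 by (simp add: chart_def)

lemma chart_lower:
 assumes s: "s \<in> sides" and z: "Im z \<le> 0" "Im z = 0 ==> Re z \<in> {0..1}"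
 shows "chart s z = fst (opp s) (tri_pt (snd (opp s)) (gperm s (pv (snd s))) (twist (gfun s) z))"
proof (cases "Im z = 0")
 case False
 then show ?thesis using z by (simp add: chart_def)
next
 case True
 have d: "distinct [snd s, nx (snd s), pv (snd s)]" by simp
 have zr: "z = of_real (Re z)" using True by (simp add: complex_eq_iff)
 have tw: "twist (gfun s) z = of_real (gfun s (Re z))" using True by (simp add: twist_def complex_eq_iff)
 have "chart s z = fst s (tri_pt (snd s) (pv (snd s)) z)" using True by (simp add: chart_def)
 also have "\<dots> = fst s (side_point (nx (snd s)) (pv (snd s)) (Re z))"
  by (subst zr) (simp only: tri_pt_real[OF d])
 also have "\<dots> = fst (opp s) (side_point (gperm s (nx (snd s))) (gperm s (pv (snd s))) (gfun s (Re z)))"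
  by (rule gfun(6)[OF s z(2)[OF True]])
 also have "\<dots> = fst (opp s) (tri_pt (snd (opp s)) (gperm s (pv (snd s))) (twist (gfun s) z))"
  unfolding tw tri_pt_real[OF gperm(3)[OF s]] ..
 finally show ?thesis .
qed

lemma tri_pt_triangle:
 assumes "a ~= c" "z \<in> insert 0 (insert 1 kite)" "0 \<le> Im z"
 shows "tri_pt a c z \<in> triangle"
proof (cases "z \<in> kite")
 case True
 then show ?thesis using tri_pt_half[OF assms(1) _ assms(3)] by (simp add: half_triangle_iff)
next
 case False
 then have "z = 0 \<or> z = 1" using assms(2) by simp
 moreover have "tri_pt a c 1 = corner c"
  using assms(1) by (simp add: vec_eq_iff tri_pt_def corner_nth)
 moreover have "tri_pt a c 0 \<in> triangle"
 proof -
  have "tri_pt a c 0 $ k \<ge> 0" for k by (simp add: tri_pt_def)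
  moreover obtain b where d: "distinct [a, b, c]"
  proof (cases "c = nx a")
   case True then show ?thesis by (intro that[of "pv a"]) simp
  next
   case False
   then have "c = pv a" using three_nx_cases[of c a] assms(1) by auto
   then show ?thesis by (intro that[of "nx a"]) simp
  qed
  moreover have "tri_pt a c 0 $ a + tri_pt a c 0 $ b + tri_pt a c 0 $ c = 1" using d by (auto simp: tri_pt_def)
  ultimately show ?thesis unfolding triangle_iff[OF d] by blast
 qed
 ultimately show ?thesis using corner_in_triangle by (elim disjE) simp_all
qed

lemma chart_lower_kite:
 assumes s: "s \<in> sides" and z: "z \<in> kite" "Im z \<le> 0"
 shows "chart s z = fst (opp s) (tri_pt (snd (opp s)) (gperm s (pv (snd s))) (twist (gfun s) z))"
  "tri_pt (snd (opp s)) (gperm s (pv (snd s))) (twist (gfun s) z) \<in> half_triangle (snd (opp s))"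
proof -
 show "chart s z = fst (opp s) (tri_pt (snd (opp s)) (gperm s (pv (snd s))) (twist (gfun s) z))"
  using z by (intro chart_lower[OF s]) (auto simp: kite_def)
 show "tri_pt (snd (opp s)) (gperm s (pv (snd s))) (twist (gfun s) z) \<in> half_triangle (snd (opp s))"
  using gperm(3)[OF s] twist_kite[OF gfun(1-3)[OF s] z] by (intro tri_pt_half) auto
qed

lemma chart_upper_kite:
 assumes "z \<in> kite" "0 \<le> Im z"
 shows "chart s z = fst s (tri_pt (snd s) (pv (snd s)) z)"
  "tri_pt (snd s) (pv (snd s)) z \<in> half_triangle (snd s)"
 using assms by (auto intro: chart_upper tri_pt_half)

text \<open>The end points 0 and 1 of the edge are included because paths to the punctures end
  there.\<close>

lemma continuous_on_chart:
 assumes s: "s \<in> sides"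
 shows "continuous_on (insert 0 (insert 1 kite)) (chart s)"
proof -
 let ?Q = "insert 0 (insert 1 kite)"
 let ?A = "?Q \<inter> {z. 0 \<le> Im z}" and ?B = "?Q \<inter> {z. Im z \<le> 0}"
 have Q: "?Q = ?A \<union> ?B" by auto
 have cl: "closed {z. 0 \<le> Im z}" "closed {z. Im z \<le> 0}"
  by (intro closed_Collect_le continuous_intros)+
 have A: "continuous_on ?A (chart s)"
 proof (rule continuous_on_cong[THEN iffD1, OF refl])
  show "fst s (tri_pt (snd s) (pv (snd s)) z) = chart s z" if "z \<in> ?A" for z
   by (rule chart_upper[symmetric]) (use that in blast)
  show "continuous_on ?A (\<lambda>z. fst s (tri_pt (snd s) (pv (snd s)) z))"
   by (rule continuous_on_compose2[OF T_continuous[OF fst_in_T(1)[OF s]] continuous_on_tri_pt])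
    (use tri_pt_triangle[of "snd s" "pv (snd s)"] in auto)
 qed
 have rng: "twist (gfun s) z \<in> ?Q \<and> 0 \<le> Im (twist (gfun s) z)" if "z \<in> ?B" for z
 proof (cases "z \<in> kite")
  case True
  have "Im z \<le> 0" using that by blast
  then show ?thesis using twist_kite[OF gfun(1-3)[OF s] True] by simp
 next
  case False
  then have "z = 0 \<or> z = 1" using that by simp
  then have "twist (gfun s) z = z" by (auto simp: twist_def complex_eq_iff gfun(2,3)[OF s])
  then show ?thesis using that \<open>z = 0 \<or> z = 1\<close> by auto
 qed
 have B: "continuous_on ?B (chart s)"
 proof (rule continuous_on_cong[THEN iffD1, OF refl])
  show "fst (opp s) (tri_pt (snd (opp s)) (gperm s (pv (snd s))) (twist (gfun s) z)) = chart s z" if "z \<in> ?B" for z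
   using that by (intro chart_lower[OF s, symmetric]) (auto simp: kite_def)
  have tw: "continuous_on ?B (twist (gfun s))"
   by (rule continuous_on_twist[OF gfun(4)[OF s]]) (auto simp: kite_def)
  have "continuous_on ?B (\<lambda>z. tri_pt (snd (opp s)) (gperm s (pv (snd s))) (twist (gfun s) z))"
   by (rule continuous_on_compose2[OF continuous_on_tri_pt[of UNIV] tw]) simp
  then show "continuous_on ?B (\<lambda>z. fst (opp s) (tri_pt (snd (opp s)) (gperm s (pv (snd s))) (twist (gfun s) z)))"
  proof (rule continuous_on_compose2[OF T_continuous[OF fst_in_T(2)[OF s]]])
   have "snd (opp s) ~= gperm s (pv (snd s))" using gperm(3)[OF s] by simp
   then show "(\<lambda>z. tri_pt (snd (opp s)) (gperm s (pv (snd s))) (twist (gfun s) z)) ` ?B \<subseteq> triangle"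
    using tri_pt_triangle rng by (intro image_subsetI) blast
  qed
 qed
 have "closedin (top_of_set (?A \<union> ?B)) ?A" "closedin (top_of_set (?A \<union> ?B)) ?B"
  unfolding Q[symmetric] by (rule closedin_closed_Int[OF cl(1)], rule closedin_closed_Int[OF cl(2)])
 from continuous_on_Un_local[OF this A B] show ?thesis unfolding Q[symmetric] .
qed

definition chart_inv :: "'a side => 'a => complex" where
 "chart_inv s y = (if y \<in> fst s ` half_triangle (snd s) then
   let x = inv_into (half_triangle (snd s)) (fst s) y in Complex (x $ pv (snd s)) (x $ snd s)
  else let x = inv_into (half_triangle (snd (opp s))) (fst (opp s)) y in
   untwist (gfun_inv s) (Complex (x $ gperm s (pv (snd s))) (x $ snd (opp s))))"

lemma T_half_inv:
 assumes s: "s \<in> sides" and x: "x \<in> half_triangle (snd s)"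
 shows "inv_into (half_triangle (snd s)) (fst s) (fst s x) = x"
proof -
 have "inj_on (fst s) (half_triangle (snd s))"
 proof (rule inj_onI)
  fix x y assume xy: "x \<in> half_triangle (snd s)" "y \<in> half_triangle (snd s)" "fst s x = fst s y"
  have "y \<in> triangle" using xy(2) by (simp add: half_triangle_iff)
  then show "x = y" by (rule T_half_inj[OF s xy(1) _ xy(3), symmetric])
 qed
 then show ?thesis using x by (rule inv_into_f_f)
qed

lemma ginv: assumes s: "s \<in> sides"
 shows "strict_mono (gfun_inv s)" "gfun_inv s 0 = 0" "gfun_inv s 1 = 1"
  "continuous_on UNIV (gfun_inv s)"
  "gfun s (gfun_inv s u) = u" "gfun_inv s (gfun s u) = u"
proof -
 have "glues (fst s) (nx (snd s)) (pv (snd s)) (fst (opp s)) (gperm s (nx (snd s))) (gperm s (pv (snd s))) (gfun s)"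
  using gluing[OF s] by (simp add: gluing_def)
 from glues_inverse[OF this] show "strict_mono (gfun_inv s)" "gfun_inv s 0 = 0"
  "gfun_inv s 1 = 1" "continuous_on UNIV (gfun_inv s)"
  by (simp_all add: glues_def)
 show "gfun s (gfun_inv s u) = u" by (rule surj_f_inv_f[OF gfun(5)[OF s]])
 show "gfun_inv s (gfun s u) = u"
  by (rule inv_f_f[OF strict_mono_imp_inj_on[OF gfun(1)[OF s]]])
qed

lemma opp_half_inv:
 assumes s: "s \<in> sides" and z: "z \<in> kite" "Im z \<le> 0"
 shows "(let x = inv_into (half_triangle (snd (opp s))) (fst (opp s)) (chart s z) in
   untwist (gfun_inv s) (Complex (x $ gperm s (pv (snd s))) (x $ snd (opp s)))) = z"
proof -
 let ?x = "tri_pt (snd (opp s)) (gperm s (pv (snd s))) (twist (gfun s) z)"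
 have x: "chart s z = fst (opp s) ?x" "?x \<in> half_triangle (snd (opp s))"
  by (rule chart_lower_kite[OF s z])+
 have i: "inv_into (half_triangle (snd (opp s))) (fst (opp s)) (chart s z) = ?x"
  unfolding x(1) by (rule T_half_inv[OF opp(1)[OF s] x(2)])
 have "snd (opp s) ~= gperm s (pv (snd s))" using gperm(3)[OF s] by simp
 then have "Complex (?x $ gperm s (pv (snd s))) (?x $ snd (opp s)) = twist (gfun s) z"
  by (simp add: tri_pt_nth)
 then show ?thesis unfolding i Let_def
  by (simp only: untwist_twist[OF gfun(1-3)[OF s] ginv(6)[OF s] z])
qed

lemma chart_inv_chart:
 assumes s: "s \<in> sides" and z: "z \<in> kite"
 shows "chart_inv s (chart s z) = z"
proof (cases "0 \<le> Im z")
 case True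
 let ?x = "tri_pt (snd s) (pv (snd s)) z"
 have x: "chart s z = fst s ?x" "?x \<in> half_triangle (snd s)" by (rule chart_upper_kite[OF z True])+
 have "chart s z \<in> fst s ` half_triangle (snd s)" unfolding x(1) using x(2) by (rule imageI)
 then show ?thesis unfolding chart_inv_def Let_def x(1) T_half_inv[OF s x(2)]
  by (simp add: tri_pt_nth)
next
 case False
 then have z': "Im z \<le> 0" by simp
 let ?x = "tri_pt (snd (opp s)) (gperm s (pv (snd s))) (twist (gfun s) z)"
 have x: "chart s z = fst (opp s) ?x" "?x \<in> half_triangle (snd (opp s))"
  by (rule chart_lower_kite[OF s z z'])+
 have "chart s z \<notin> fst s ` half_triangle (snd s)"
 proof
  assume "chart s z \<in> fst s ` half_triangle (snd s)"
  then obtain w where w: "w \<in> half_triangle (snd s)" "chart s z = fst s w" by blast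
  have "w \<in> triangle" using w(1) by (simp add: half_triangle_iff)
  moreover have "fst (opp s) ?x = fst s w" using x(1) w(2) by simp
  ultimately have "?x \<in> open_side (snd (opp s))"
   using T_half_eq[OF opp(1)[OF s] x(2) fst_in_T(1)[OF s]] fst_opp_neq[OF s] by metis
  then have "?x $ snd (opp s) = 0" by (simp add: open_side_iff)
  moreover have "snd (opp s) ~= gperm s (pv (snd s))" using gperm(3)[OF s] by simp
  ultimately have "Im (twist (gfun s) z) = 0" by (simp add: tri_pt_nth)
  then show False using False by (simp add: twist_def)
 qed
 then show ?thesis unfolding chart_inv_def using opp_half_inv[OF s z z'] by simp
qed

lemma chart_image:
 assumes s: "s \<in> sides"
 shows "chart s ` kite = star s"
proof
 show "chart s ` kite \<subseteq> star s"
 proof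
  fix y assume "y \<in> chart s ` kite"
  then obtain z where z: "z \<in> kite" "y = chart s z" by blast
  show "y \<in> star s"
  proof (cases "0 \<le> Im z")
   case True
   then show ?thesis using chart_upper_kite[OF z(1) True] unfolding z(2) star_def by simp
  next
   case False
   then have z': "Im z \<le> 0" by simp
   show ?thesis using chart_lower_kite[OF s z(1) z'] unfolding z(2) star_def by simp
  qed
 qed
 show "star s \<subseteq> chart s ` kite"
 proof
  fix y assume "y \<in> star s"
  then consider x where "x \<in> half_triangle (snd s)" "y = fst s x"
   | x where "x \<in> half_triangle (snd (opp s))" "y = fst (opp s) x"
   unfolding star_def by blast
  then show "y \<in> chart s ` kite"
  proof cases
   case (1 x)
   let ?z = "Complex (x $ pv (snd s)) (x $ snd s)"
   have z: "?z \<in> kite" "0 \<le> Im ?z" by (rule half_coords[OF nx_pv_neq(4) 1(1)])+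
   have "x \<in> triangle" using 1(1) by (simp add: half_triangle_iff)
   then have "chart s ?z = y" unfolding chart_upper[OF z(2)] 1(2)
    by (simp only: tri_pt_coords[OF nx_pv_neq(4)])
   then show ?thesis using z(1) by blast
  next
   case (2 x)
   have ne: "snd (opp s) ~= gperm s (pv (snd s))" using gperm(3)[OF s] by simp
   let ?w = "Complex (x $ gperm s (pv (snd s))) (x $ snd (opp s))"
   let ?z = "untwist (gfun_inv s) ?w"
   have w: "?w \<in> kite" "0 \<le> Im ?w" by (rule half_coords[OF ne 2(1)])+
   have z: "?z \<in> kite" "Im ?z \<le> 0" by (rule untwist_kite[OF ginv(1-3)[OF s] w])+
   have "x \<in> triangle" using 2(1) by (simp add: half_triangle_iff)
   then have "chart s ?z = y" unfolding chart_lower_kite(1)[OF s z] 2(2)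
    by (simp only: twist_untwist[OF gfun(1-3)[OF s] ginv(5)[OF s] w] tri_pt_coords[OF ne])
   then show ?thesis using z(1) by blast
  qed
 qed
qed

text \<open>Both half triangles are closed in the star, being its intersections with compact
  triangle images; so the two continuous formulas can be pasted along the edge.\<close>

lemma continuous_on_chart_inv:
 assumes s: "s \<in> sides"
 shows "continuous_on (star s) (chart_inv s)"
proof -
 let ?A = "fst s ` half_triangle (snd s)" and ?B = "fst (opp s) ` half_triangle (snd (opp s))"
 let ?iA = "inv_into (half_triangle (snd s)) (fst s)" and ?iB = "inv_into (half_triangle (snd (opp s))) (fst (opp s))"
 have os: "opp s \<in> sides" by (rule opp(1)[OF s])
 have clA: "closedin (top_of_set (star s)) (fst s ` half_triangle (snd s))" if s: "s \<in> sides" for s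
 proof -
  have "closed (fst s ` triangle)" by (rule closed_T_image[OF fst_in_T(1)[OF s] compact_triangle order_refl])
  moreover have "fst s ` half_triangle (snd s) = star s \<inter> fst s ` triangle"
  proof
   show "fst s ` half_triangle (snd s) \<subseteq> star s \<inter> fst s ` triangle"
    unfolding star_def using half_triangle_subset by blast
   show "star s \<inter> fst s ` triangle \<subseteq> fst s ` half_triangle (snd s)"
   proof
    fix y assume "y \<in> star s \<inter> fst s ` triangle"
    then obtain x where x: "x \<in> triangle" "y = fst s x" "fst s x \<in> star s" by blast
    then have "x \<in> half_triangle (snd s)"
     using star_iff[OF s fst_in_T(1)[OF s] x(1)] fst_opp_neq[OF s] by simp
    then show "y \<in> fst s ` half_triangle (snd s)" using x(2) by simp
   qed
  qed
  ultimately show ?thesis by (simp add: closedin_closed_Int)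
 qed
 have A: "closedin (top_of_set (?A \<union> ?B)) ?A" using clA[OF s] by (simp add: star_def)
 have B: "closedin (top_of_set (?A \<union> ?B)) ?B" using clA[OF os] s by (simp add: star_def Un_commute)
 have cA: "continuous_on ?A (\<lambda>y. Complex (?iA y $ pv (snd s)) (?iA y $ snd s))"
  using T_half_inverse_continuous[OF s] by (intro continuous_on_Complex continuous_on_component)
 have cB1: "continuous_on ?B (\<lambda>y. Complex (?iB y $ gperm s (pv (snd s))) (?iB y $ snd (opp s)))"
  using T_half_inverse_continuous[OF os] by (intro continuous_on_Complex continuous_on_component)
 have cu: "continuous_on {w. Im w ~= 1} (untwist (gfun_inv s))"
  by (rule continuous_on_untwist[OF ginv(4)[OF s]]) simp
 have cB: "continuous_on ?B (\<lambda>y. untwist (gfun_inv s) (Complex (?iB y $ gperm s (pv (snd s))) (?iB y $ snd (opp s))))"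
 proof (rule continuous_on_compose2[OF cu cB1])
  have ne: "snd (opp s) ~= gperm s (pv (snd s))" using gperm(3)[OF s] by simp
  show "(\<lambda>y. Complex (?iB y $ gperm s (pv (snd s))) (?iB y $ snd (opp s))) ` ?B \<subseteq> {w. Im w ~= 1}"
  proof (intro image_subsetI)
   fix y assume "y \<in> ?B"
   then obtain x where x: "x \<in> half_triangle (snd (opp s))" "y = fst (opp s) x" by blast
   have "Complex (x $ gperm s (pv (snd s))) (x $ snd (opp s)) \<in> kite" by (rule half_coords(1)[OF ne x(1)])
   then show "Complex (?iB y $ gperm s (pv (snd s))) (?iB y $ snd (opp s)) \<in> {w. Im w ~= 1}"
    unfolding x(2) T_half_inv[OF os x(1)] by (auto simp: kite_def)
  qed
 qed
 have agree: "Complex (?iA y $ pv (snd s)) (?iA y $ snd s)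
  = untwist (gfun_inv s) (Complex (?iB y $ gperm s (pv (snd s))) (?iB y $ snd (opp s)))"
  if "y \<in> ?A \<and> y \<notin> ?A \<or> y \<in> ?B \<and> y \<in> ?A" for y
 proof -
  have "y \<in> ?A" "y \<in> ?B" using that by blast+
  then obtain x x' where x: "x \<in> half_triangle (snd s)" "y = fst s x" and x': "x' \<in> half_triangle (snd (opp s))" "y = fst (opp s) x'"
   by blast
  have "x' \<in> triangle" "fst s x = fst (opp s) x'" using x x' by (simp_all add: half_triangle_iff)
  then have "x \<in> open_side (snd s)" using T_half_eq[OF s x(1) fst_in_T(2)[OF s]] fst_opp_neq[OF s] by metis
  then have x0: "x $ snd s = 0" by (simp add: open_side_iff)
  let ?z = "Complex (x $ pv (snd s)) (x $ snd s)"
  have z: "?z \<in> kite" "0 \<le> Im ?z" by (rule half_coords[OF nx_pv_neq(4) x(1)])+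
  have z': "Im ?z \<le> 0" using x0 by simp
  have "x \<in> triangle" using x(1) by (simp add: half_triangle_iff)
  then have y: "y = chart s ?z" unfolding chart_upper[OF z(2)] x(2)
   by (simp only: tri_pt_coords[OF nx_pv_neq(4)])
  have "?iA y = x" unfolding x(2) by (rule T_half_inv[OF s x(1)])
  then show ?thesis using opp_half_inv[OF s z(1) z'] unfolding y[symmetric] Let_def by simp
 qed
 have "continuous_on (?A \<union> ?B) (\<lambda>y. if y \<in> ?A then Complex (?iA y $ pv (snd s)) (?iA y $ snd s)
  else untwist (gfun_inv s) (Complex (?iB y $ gperm s (pv (snd s))) (?iB y $ snd (opp s))))"
  by (rule continuous_on_cases_local[OF A B cA cB agree])
 then show ?thesis unfolding star_def chart_inv_def Let_def by (simp only:)
qed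

end

section \<open>Galleries\<close>

definition const_path :: "'a => real => 'a" where
 "const_path x = (\<lambda>_. x)"

lemma const_path [simp]: "path (const_path x)" "path_image (const_path x) = {x}"
 "pathstart (const_path x) = x" "pathfinish (const_path x) = x"
 by (auto simp: const_path_def path_def path_image_def pathstart_def pathfinish_def)

text \<open>Two paths in [0,1] with common ends are linearly homotopic. The unit, inverse and
  subdivision laws below are instances with suitable f and g.\<close>

lemma homotopic_paths_compose_unit_interval:
 fixes p :: "real => 'a::topological_space"
 assumes p: "path p" "path_image p \<subseteq> S" and f: "path f" "path_image f \<subseteq> {0..1}" and g: "path g" "path_image g \<subseteq> {0..1}"
  and e: "pathstart g = pathstart f" "pathfinish g = pathfinish f"
 shows "homotopic_paths S (p \<circ> f) (p \<circ> g)"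
proof (rule homotopic_paths_continuous_image)
 show "homotopic_paths {0..1} f g"
 proof (rule homotopic_paths_linear[OF f(1) g(1) e])
  fix t :: real assume t: "t \<in> {0..1}"
  have "f t \<in> {0..1}" "g t \<in> {0..1}"
   using f(2) g(2) imageI[OF t, of f] imageI[OF t, of g] unfolding path_image_def by blast+
  then show "closed_segment (f t) (g t) \<subseteq> {0..1}" by (intro closed_segment_subset) simp_all
 qed
 show "continuous_on {0..1} p" using p(1) by (simp add: path_def)
 show "p \<in> {0..1} \<rightarrow> S" using p(2) by (auto simp: path_image_def)
qed

lemma compose_linepath_01: "p \<circ> linepath 0 (1::real) = p"
 by (simp add: fun_eq_iff linepath_def)

lemma const_path_compose: "p \<circ> const_path (t::real) = const_path (p t)"
 by (simp add: fun_eq_iff const_path_def)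

lemma homotopic_paths_lid_const:
 fixes p :: "real => 'a::topological_space"
 assumes "path p" "path_image p \<subseteq> S" "x = pathstart p"
 shows "homotopic_paths S (const_path x +++ p) p"
proof -
 have "homotopic_paths S (p \<circ> (const_path 0 +++ linepath 0 1)) (p \<circ> linepath 0 1)"
  by (rule homotopic_paths_compose_unit_interval[OF assms(1,2)]) (simp_all add: path_image_join closed_segment_eq_real_ivl)
 then show ?thesis
  by (simp only: path_compose_join compose_linepath_01 const_path_compose assms(3) pathstart_def)
qed

lemma homotopic_paths_rid_const:
 fixes p :: "real => 'a::topological_space"
 assumes "path p" "path_image p \<subseteq> S" "x = pathfinish p"
 shows "homotopic_paths S (p +++ const_path x) p"
proof -
 have "homotopic_paths S (p \<circ> (linepath 0 1 +++ const_path 1)) (p \<circ> linepath 0 1)"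
  by (rule homotopic_paths_compose_unit_interval[OF assms(1,2)]) (simp_all add: path_image_join closed_segment_eq_real_ivl)
 then show ?thesis
  by (simp only: path_compose_join compose_linepath_01 const_path_compose assms(3) pathfinish_def)
qed

lemma homotopic_paths_rinv_const:
 fixes p :: "real => 'a::topological_space"
 assumes "path p" "path_image p \<subseteq> S"
 shows "homotopic_paths S (p +++ reversepath p) (const_path (pathstart p))"
proof -
 have "homotopic_paths S (p \<circ> (linepath 0 1 +++ linepath 1 0)) (p \<circ> const_path 0)"
  by (rule homotopic_paths_compose_unit_interval[OF assms(1,2)]) (simp_all add: path_image_join closed_segment_eq_real_ivl)
 moreover have "p \<circ> linepath 1 0 = reversepath p"
  by (simp add: fun_eq_iff linepath_def reversepath_def)
 ultimately show ?thesis
  by (simp only: path_compose_join compose_linepath_01 const_path_compose pathstart_def)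
qed

lemma homotopic_paths_linv_const:
 fixes p :: "real => 'a::topological_space"
 assumes "path p" "path_image p \<subseteq> S"
 shows "homotopic_paths S (reversepath p +++ p) (const_path (pathfinish p))"
 using homotopic_paths_rinv_const[of "reversepath p" S] assms by simp

lemma homotopic_paths_subpath_join:
 fixes p :: "real => 'a::topological_space"
 assumes "path p" "path_image p \<subseteq> S" "u \<in> {0..1}" "v \<in> {0..1}"
 shows "homotopic_paths S (p \<circ> linepath 0 v) ((p \<circ> linepath 0 u) +++ (p \<circ> linepath u v))"
proof -
 have "homotopic_paths S (p \<circ> linepath 0 v) (p \<circ> (linepath 0 u +++ linepath u v))"
  by (rule homotopic_paths_compose_unit_interval[OF assms(1,2)])
   (use assms(3,4) in \<open>simp_all add: path_image_join closed_segment_eq_real_ivl\<close>)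
 then show ?thesis by (simp only: path_compose_join)
qed

context bipartite_surface
begin

section \<open>The path groupoid of the punctured surface\<close>

abbreviation homotopic (infix "\<simeq>" 50) where
 "p \<simeq> q \<equiv> homotopic_paths (M - P) p q"

definition pth :: "(real => 'a) => 'a => 'a => bool" where
 "pth p x y \<longleftrightarrow> path p \<and> path_image p \<subseteq> M - P \<and> pathstart p = x \<and> pathfinish p = y"

lemma pthD:
 assumes "pth p x y"
 shows "path p" "path_image p \<subseteq> M - P" "pathstart p = x" "pathfinish p = y"
 using assms unfolding pth_def by blast+

lemma pthI: "path p ==> path_image p \<subseteq> M - P ==> pathstart p = x ==> pathfinish p = y ==> pth p x y"
 unfolding pth_def by (intro conjI)

lemma pth_join: "pth p x y ==> pth q y z ==> pth (p +++ q) x z"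
 unfolding pth_def by (simp add: subset_path_image_join)

lemma pth_reverse: "pth p x y ==> pth (reversepath p) y x"
 unfolding pth_def by simp

lemma pth_const: "x \<in> M - P ==> pth (const_path x) x x"
 unfolding pth_def by simp

lemma pth_end: "pth p x y ==> y \<in> M - P"
 using pathfinish_in_path_image[of p] pthD[of p x y] by auto

lemma pth_refl: "pth p x y ==> p \<simeq> p"
 using pthD[of p x y] by simp

lemma pth_homotopic: "pth p x y ==> p \<simeq> q ==> pth q x y"
 using homotopic_paths_imp_path[of "M - P" p q] homotopic_paths_imp_subset[of "M - P" p q]
  homotopic_paths_imp_pathstart[of "M - P" p q] homotopic_paths_imp_pathfinish[of "M - P" p q]
 unfolding pth_def by simp

lemma pth_assoc: "pth a x y ==> pth b y z ==> pth c z w ==> (a +++ b) +++ c \<simeq> a +++ (b +++ c)"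
 by (rule homotopic_paths_sym, rule homotopic_paths_assoc) (simp_all only: pth_def)

lemma pth_joinI: "a \<simeq> a' ==> b \<simeq> b' ==> pth a x y ==> pth b y z ==> a +++ b \<simeq> a' +++ b'"
 by (rule homotopic_paths_join) (simp_all only: pth_def)

lemma pth_lid: "pth a x y ==> const_path x +++ a \<simeq> a"
 by (rule homotopic_paths_lid_const) (simp_all only: pth_def)

lemma pth_rid: "pth a x y ==> a +++ const_path y \<simeq> a"
 by (rule homotopic_paths_rid_const) (simp_all only: pth_def)

lemma pth_linv: "pth a x y ==> reversepath a +++ a \<simeq> const_path y"
 using homotopic_paths_linv_const[of a "M - P"] pthD[of a x y] by simp

lemma pth_rinv: "pth a x y ==> a +++ reversepath a \<simeq> const_path x"
 using homotopic_paths_rinv_const[of a "M - P"] pthD[of a x y] by simp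

lemma pth_cancel_inverse:
 assumes a: "pth a x y" and b: "pth b y z"
 shows "reversepath a +++ (a +++ b) \<simeq> b"
proof -
 have "reversepath a +++ (a +++ b) \<simeq> (reversepath a +++ a) +++ b"
  by (rule homotopic_paths_sym[OF pth_assoc[OF pth_reverse[OF a] a b]])
 also have "\<dots> \<simeq> const_path y +++ b"
  by (rule pth_joinI[OF pth_linv[OF a] pth_refl[OF b] pth_join[OF pth_reverse[OF a] a] b])
 also have "\<dots> \<simeq> b" by (rule pth_lid[OF b])
 finally show ?thesis .
qed

lemma pth_cancel_left:
 assumes a: "pth a x y" and b: "pth b y z" and c: "pth c y z" and h: "a +++ b \<simeq> a +++ c"
 shows "b \<simeq> c"
proof -
 have "b \<simeq> reversepath a +++ (a +++ b)" by (rule homotopic_paths_sym[OF pth_cancel_inverse[OF a b]])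
 also have "\<dots> \<simeq> reversepath a +++ (a +++ c)"
  by (rule pth_joinI[OF pth_refl[OF pth_reverse[OF a]] h pth_reverse[OF a] pth_join[OF a b]])
 also have "\<dots> \<simeq> c" by (rule pth_cancel_inverse[OF a c])
 finally show ?thesis .
qed

lemma pth_cancel_right:
 assumes a: "pth a x y" and b: "pth b x y" and c: "pth c y z" and h: "a +++ c \<simeq> b +++ c"
 shows "a \<simeq> b"
proof -
 have e: "reversepath (d +++ c) = reversepath c +++ reversepath d" if "pth d x y" for d
  by (rule reversepath_joinpaths) (simp only: pthD[OF that] pthD[OF c])
 have "reversepath c +++ reversepath a \<simeq> reversepath c +++ reversepath b"
  using homotopic_paths_reversepath_D[OF h] unfolding e[OF a] e[OF b] .
 from pth_cancel_left[OF pth_reverse[OF c] pth_reverse[OF a] pth_reverse[OF b] this]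
 have "reversepath a \<simeq> reversepath b" .
 from homotopic_paths_reversepath_D[OF this] show ?thesis by (simp only: reversepath_reversepath)
qed

lemma pth_cancel_middle:
 assumes a: "pth a x y" and b: "pth b y z" and c: "pth c z w" and d: "pth d z v" and e: "pth e v u"
 shows "(a +++ (b +++ c)) +++ (reversepath c +++ (d +++ e)) \<simeq> a +++ ((b +++ d) +++ e)"
proof -
 note de = pth_join[OF d e] and r = pth_reverse[OF c]
 note rde = pth_join[OF r de]
 have 1: "c +++ (reversepath c +++ (d +++ e)) \<simeq> d +++ e"
  using pth_cancel_inverse[OF r de] by (simp only: reversepath_reversepath)
 have "(a +++ (b +++ c)) +++ (reversepath c +++ (d +++ e)) \<simeq> a +++ ((b +++ c) +++ (reversepath c +++ (d +++ e)))"
  by (rule pth_assoc[OF a pth_join[OF b c] rde])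
 also have "\<dots> \<simeq> a +++ (b +++ (c +++ (reversepath c +++ (d +++ e))))"
  by (rule pth_joinI[OF pth_refl[OF a] pth_assoc[OF b c rde] a pth_join[OF pth_join[OF b c] rde]])
 also have "\<dots> \<simeq> a +++ (b +++ (d +++ e))"
  by (rule pth_joinI[OF pth_refl[OF a] pth_joinI[OF pth_refl[OF b] 1 b pth_join[OF c rde]] a pth_join[OF b pth_join[OF c rde]]])
 also have "\<dots> \<simeq> a +++ ((b +++ d) +++ e)"
  by (rule pth_joinI[OF pth_refl[OF a] homotopic_paths_sym[OF pth_assoc[OF b d e]] a pth_join[OF b de]])
 finally show ?thesis .
qed

lemma chart_inv_in_kite:
 assumes s: "s \<in> sides" and y: "y \<in> star s"
 shows "chart_inv s y \<in> kite" "chart s (chart_inv s y) = y"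
proof -
 have "y \<in> chart s ` kite" unfolding chart_image[OF s] by (rule y)
 then obtain z where z: "y = chart s z" "z \<in> kite" by (rule imageE)
 show "chart_inv s y \<in> kite" "chart s (chart_inv s y) = y" unfolding z(1) chart_inv_chart[OF s z(2)] by (rule z(2), rule refl)
qed

lemma continuous_on_chart_kite: "s \<in> sides ==> continuous_on kite (chart s)"
 by (erule continuous_on_subset[OF continuous_on_chart]) blast

lemma chart_in_star: "s \<in> sides ==> z \<in> kite ==> chart s z \<in> star s"
 unfolding chart_image[symmetric] by (rule imageI)

text \<open>A star is simply connected: in the chart both paths lie in the convex kite, where a
  linear homotopy is available.\<close>

lemma star_homotopic:
 assumes s: "s \<in> sides" and p: "path p" "path_image p \<subseteq> star s" and q: "path q" "path_image q \<subseteq> star s"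
  and e: "pathstart p = pathstart q" "pathfinish p = pathfinish q"
 shows "homotopic_paths (star s) p q"
proof -
 have h: "homotopic_paths (star s) r (chart s \<circ> (chart_inv s \<circ> r))" if r: "path r" "path_image r \<subseteq> star s" for r
 proof (rule homotopic_paths_eq[OF r])
  fix t :: real assume "t \<in> {0..1}"
  then have "r t \<in> star s" using r(2) by (auto simp: path_image_def)
  from chart_inv_in_kite(2)[OF s this] show "r t = (chart s \<circ> (chart_inv s \<circ> r)) t" by (simp only: o_def)
 qed
 have k: "path (chart_inv s \<circ> r)" "path_image (chart_inv s \<circ> r) \<subseteq> kite" if r: "path r" "path_image r \<subseteq> star s" for r
 proof -
  show "path (chart_inv s \<circ> r)"
   by (rule path_continuous_image[OF r(1) continuous_on_subset[OF continuous_on_chart_inv[OF s] r(2)]])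
  show "path_image (chart_inv s \<circ> r) \<subseteq> kite"
   unfolding path_image_compose by (rule image_subsetI, rule chart_inv_in_kite(1)[OF s], rule subsetD[OF r(2)])
 qed
 have "homotopic_paths kite (chart_inv s \<circ> p) (chart_inv s \<circ> q)"
 proof (rule homotopic_paths_linear)
  show "path (chart_inv s \<circ> p)" "path (chart_inv s \<circ> q)" by (rule k(1)[OF p], rule k(1)[OF q])
  show "pathstart (chart_inv s \<circ> q) = pathstart (chart_inv s \<circ> p)"
   "pathfinish (chart_inv s \<circ> q) = pathfinish (chart_inv s \<circ> p)"
   using e by (simp_all add: pathstart_compose pathfinish_compose)
  fix t :: real assume t: "t \<in> {0..1}"
  have "(chart_inv s \<circ> p) t \<in> path_image (chart_inv s \<circ> p)" "(chart_inv s \<circ> q) t \<in> path_image (chart_inv s \<circ> q)"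
   using t by (simp_all add: path_image_def)
  then have "(chart_inv s \<circ> p) t \<in> kite" "(chart_inv s \<circ> q) t \<in> kite"
   using k(2)[OF p] k(2)[OF q] by blast+
  then show "closed_segment ((chart_inv s \<circ> p) t) ((chart_inv s \<circ> q) t) \<subseteq> kite"
   by (rule closed_segment_subset[OF _ _ convex_kite])
 qed
 then have "homotopic_paths (star s) (chart s \<circ> (chart_inv s \<circ> p)) (chart s \<circ> (chart_inv s \<circ> q))"
  by (rule homotopic_paths_continuous_image[OF _ continuous_on_chart_kite[OF s]])
   (rule Pi_I, rule chart_in_star[OF s])
 from homotopic_paths_trans[OF h[OF p] homotopic_paths_trans[OF this homotopic_paths_sym[OF h[OF q]]]] show ?thesis .
qed

lemma star_homotopic': 
 assumes s: "s \<in> sides" and p: "path p" "path_image p \<subseteq> star s" and q: "path q" "path_image q \<subseteq> star s"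
  and e: "pathstart p = pathstart q" "pathfinish p = pathfinish q"
 shows "p \<simeq> q"
 by (rule homotopic_paths_subset[OF star_homotopic[OF assms] star_subset[OF s]])

lemma star_path_exists:
 assumes s: "s \<in> sides" and x: "x \<in> star s" and y: "y \<in> star s"
 shows "\<exists>p. path p \<and> path_image p \<subseteq> star s \<and> pathstart p = x \<and> pathfinish p = y"
proof (intro exI conjI)
 let ?l = "linepath (chart_inv s x) (chart_inv s y)"
 have l: "path_image ?l \<subseteq> kite"
  using closed_segment_subset[OF chart_inv_in_kite(1)[OF s x] chart_inv_in_kite(1)[OF s y] convex_kite] by simp
 show "path (chart s \<circ> ?l)"
  by (rule path_continuous_image[OF path_linepath continuous_on_subset[OF continuous_on_chart_kite[OF s] l]])
 show "path_image (chart s \<circ> ?l) \<subseteq> star s"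
  unfolding path_image_compose by (rule image_subsetI, rule chart_in_star[OF s], rule subsetD[OF l])
 show "pathstart (chart s \<circ> ?l) = x" "pathfinish (chart s \<circ> ?l) = y"
  unfolding pathstart_compose pathfinish_compose pathstart_linepath pathfinish_linepath
  by (rule chart_inv_in_kite(2)[OF s x], rule chart_inv_in_kite(2)[OF s y])
qed

text \<open>By \<open>star_homotopic\<close> any path in the star with these ends would
  serve.\<close>

definition crossing :: "'a side => real => 'a" where
 "crossing s = (SOME p. path p \<and> path_image p \<subseteq> star s \<and> pathstart p = fst s barycentre \<and>
  pathfinish p = fst (opp s) barycentre)"

lemma barycentre_star:
 "fst s barycentre \<in> star s" "fst (opp s) barycentre \<in> star s"
 unfolding star_def by (rule UnI1, rule imageI, rule barycentre_half(1)) (rule UnI2, rule imageI, rule barycentre_half(1))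

lemma crossing:
 assumes s: "s \<in> sides"
 shows "path (crossing s)" "path_image (crossing s) \<subseteq> star s" "pathstart (crossing s) = fst s barycentre"
  "pathfinish (crossing s) = fst (opp s) barycentre" "path_image (crossing s) \<subseteq> M - P"
proof -
 note c = someI_ex[OF star_path_exists[OF s barycentre_star], folded crossing_def]
 show 1: "path (crossing s)" "path_image (crossing s) \<subseteq> star s" "pathstart (crossing s) = fst s barycentre"
  "pathfinish (crossing s) = fst (opp s) barycentre"
  using c by blast+
 show "path_image (crossing s) \<subseteq> M - P" using 1(2) star_subset[OF s] by (rule subset_trans)
qed

text \<open>A point of an edge lies in two triangles. One of them is chosen once and for all, so
  that every path has a well-defined change of triangle between any two of its points.\<close>

definition home :: "'a => (real^3 => 'a) \<times> (real^3)" where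
 "home x = (SOME h. fst h \<in> \<T> \<and> snd h \<in> triangle \<and> fst h (snd h) = x)"

lemma home:
 assumes "x \<in> M"
 shows "fst (home x) \<in> \<T>" "snd (home x) \<in> triangle" "fst (home x) (snd (home x)) = x"
proof -
 have "\<exists>h. fst h \<in> \<T> \<and> snd h \<in> triangle \<and> fst h (snd h) = x"
 proof -
  have "x \<in> (\<Union>\<tau>\<in>\<T>. \<tau> ` triangle)" unfolding T_Union by (rule assms)
  then obtain \<tau> where \<tau>: "\<tau> \<in> \<T>" "x \<in> \<tau> ` triangle" by (rule UN_E)
  from \<tau>(2) obtain y where "x = \<tau> y" "y \<in> triangle" by (rule imageE)
  then show ?thesis using \<tau>(1) by (intro exI[of _ "(\<tau>, y)"] conjI) (simp_all only: fst_conv snd_conv)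
 qed
 note h = someI_ex[OF this, folded home_def]
 show "fst (home x) \<in> \<T>" "snd (home x) \<in> triangle" "fst (home x) (snd (home x)) = x" using h by blast+
qed

lemma home_star:
 assumes s: "s \<in> sides" and x: "x \<in> star s"
 shows "(fst (home x) = fst s \<and> snd (home x) \<in> half_triangle (snd s)) \<or>
  (fst (home x) = fst (opp s) \<and> snd (home x) \<in> half_triangle (snd (opp s)))"
proof -
 have M: "x \<in> M" using subsetD[OF star_subset[OF s] x] by (rule DiffD1)
 have "fst (home x) (snd (home x)) \<in> star s" unfolding home(3)[OF M] by (rule x)
 then show ?thesis unfolding star_iff[OF s home(1,2)[OF M]] .
qed

lemma home_interior:
 assumes "\<tau> \<in> \<T>" "y \<in> open_triangle"
 shows "home (\<tau> y) = (\<tau>, y)"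
proof -
 have y: "y \<in> triangle" using assms(2) by (simp add: open_triangle_def)
 have M: "\<tau> y \<in> M" by (rule T_in_M[OF assms(1) y])
 have "\<tau> = fst (home (\<tau> y)) \<and> y = snd (home (\<tau> y))"
  by (rule T_interior[OF assms(1) home(1)[OF M] assms(2) home(2)[OF M]]) (simp only: home(3)[OF M])
 from conjunct1[OF this] conjunct2[OF this] show ?thesis by (intro prod_eqI) (simp_all only: fst_conv snd_conv)
qed

lemma home_barycentre: "\<tau> \<in> \<T> ==> home (\<tau> barycentre) = (\<tau>, barycentre)"
 by (rule home_interior[OF _ barycentre_half(2)])

lemma ex_star:
 assumes "x \<in> M - P"
 shows "\<exists>s\<in>sides. x \<in> star s \<and> fst s = fst (home x) \<and> snd (home x) \<in> half_triangle (snd s)"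
proof -
 have M: "x \<in> M" using assms by blast
 have "snd (home x) \<notin> range corner"
  using T_in_P_iff[OF home(1,2)[OF M]] assms by (simp only: home(3)[OF M] Diff_iff simp_thms)
 then obtain i where i: "snd (home x) \<in> half_triangle i"
  using triangle_cases[OF home(2)[OF M]] unfolding half_triangle_eq by (elim disjE exE) blast+
 have "(fst (home x), i) \<in> sides" using home(1)[OF M] by simp
 moreover have "x \<in> star (fst (home x), i)"
  unfolding star_def fst_conv snd_conv
  by (rule UnI1, rule image_eqI[OF _ i], rule home(3)[OF M, symmetric])
 ultimately show ?thesis using i by (intro bexI[of _ "(fst (home x), i)"] conjI) (simp_all only: fst_conv snd_conv)
qed

definition spoke :: "'a => real => 'a" where
 "spoke x = fst (home x) \<circ> linepath barycentre (snd (home x))"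

lemma convex_half_triangle: "convex (half_triangle i)"
proof -
 have eq: "half_triangle i = triangle \<inter> ({x. 0 < x $ nx i} \<inter> {x. 0 < x $ pv i})"
  by (intro equalityI subsetI) (simp_all only: half_triangle_iff Int_iff mem_Collect_eq simp_thms)
 have "convex {x :: real^3. 0 < x $ k}" for k
  using convex_halfspace_gt[of "0::real" "axis k 1 :: real^3"] by (simp add: inner_axis')
 then show ?thesis unfolding eq by (intro convex_Int convex_triangle)
qed

lemma spoke_star:
 assumes s: "s \<in> sides" and x: "x \<in> star s"
 shows "path_image (spoke x) \<subseteq> star s"
proof -
 have "linepath barycentre (snd (home x)) ` {0..1} \<subseteq> half_triangle i" if "snd (home x) \<in> half_triangle i" for i
  using closed_segment_subset[OF barycentre_half(1) that convex_half_triangle]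
  by (simp only: linepath_image_01)
 then show ?thesis using home_star[OF s x] unfolding path_image_def spoke_def star_def image_comp[symmetric]
  by (elim disjE conjE) (simp_all only: image_mono le_supI1 le_supI2)
qed

lemma spoke:
 assumes x: "x \<in> M - P"
 shows "path (spoke x)" "path_image (spoke x) \<subseteq> M - P" "pathstart (spoke x) = fst (home x) barycentre"
  "pathfinish (spoke x) = x"
proof -
 have M: "x \<in> M" using x by blast
 have "closed_segment barycentre (snd (home x)) \<subseteq> triangle"
  by (rule closed_segment_subset[OF barycentre_half(3) home(2)[OF M] convex_triangle])
 then show "path (spoke x)" unfolding spoke_def
  by (intro path_continuous_image path_linepath continuous_on_subset[OF T_continuous[OF home(1)[OF M]]]) simp
 obtain s where s: "s \<in> sides" "x \<in> star s" using ex_star[OF x] by blast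
 show "path_image (spoke x) \<subseteq> M - P" using spoke_star[OF s] star_subset[OF s(1)] by (rule subset_trans)
 show "pathstart (spoke x) = fst (home x) barycentre" "pathfinish (spoke x) = x"
  unfolding spoke_def by (simp_all add: pathstart_compose pathfinish_compose home(3)[OF M])
qed

fun is_gallery :: "(real^3 => 'a) => 'a side list => (real^3 => 'a) => bool" where
 "is_gallery \<tau> [] \<tau>' \<longleftrightarrow> \<tau> \<in> \<T> \<and> \<tau> = \<tau>'"
| "is_gallery \<tau> (s # w) \<tau>' \<longleftrightarrow> s \<in> sides \<and> fst s = \<tau> \<and> is_gallery (fst (opp s)) w \<tau>'"

fun gpath :: "(real^3 => 'a) => 'a side list => real => 'a" where
 "gpath \<tau> [] = const_path (\<tau> barycentre)"
| "gpath \<tau> (s # w) = crossing s +++ gpath (fst (opp s)) w"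

lemma is_gallery_T: "is_gallery \<tau> w \<tau>' ==> \<tau> \<in> \<T> \<and> \<tau>' \<in> \<T>"
proof (induction w arbitrary: \<tau>)
 case Nil
 then show ?case by auto
next
 case (Cons s w)
 then have s: "s \<in> sides" "fst s = \<tau>" and w: "is_gallery (fst (opp s)) w \<tau>'" by (simp_all only: is_gallery.simps simp_thms)
 show ?case using Cons.IH[OF w] fst_in_T(1)[OF s(1)] unfolding s(2) by blast
qed

lemma barycentre_punctured: "\<tau> \<in> \<T> ==> \<tau> barycentre \<in> M - P"
 by (rule T_punctured, assumption, rule DiffI[OF barycentre_half(3) open_triangle_not_corner[OF barycentre_half(2)]])

lemma gpath:
 assumes "is_gallery \<tau> w \<tau>'"
 shows "path (gpath \<tau> w) \<and> path_image (gpath \<tau> w) \<subseteq> M - P \<and>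
  pathstart (gpath \<tau> w) = \<tau> barycentre \<and> pathfinish (gpath \<tau> w) = \<tau>' barycentre"
 using assms
proof (induction w arbitrary: \<tau>)
 case Nil
 then have "\<tau> \<in> \<T>" "\<tau>' = \<tau>" unfolding is_gallery.simps by blast+
 then show ?case using barycentre_punctured[of \<tau>] by simp
next
 case (Cons s w)
 then have s: "s \<in> sides" "fst s = \<tau>" and w: "is_gallery (fst (opp s)) w \<tau>'" by (simp_all only: is_gallery.simps simp_thms)
 note IH = Cons.IH[OF w]
 have "path_image (crossing s +++ gpath (fst (opp s)) w) \<subseteq> M - P"
  by (rule subset_path_image_join) (use IH crossing(5)[OF s(1)] in blast)+
 moreover have "path (crossing s +++ gpath (fst (opp s)) w)"
  using IH crossing(1,4)[OF s(1)] by simp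
 ultimately show ?case using IH crossing(3)[OF s(1)] s(2) by simp
qed

lemma is_gallery_append: "is_gallery \<tau> u \<tau>1 ==> is_gallery \<tau>1 w \<tau>' ==> is_gallery \<tau> (u @ w) \<tau>'"
proof (induction u arbitrary: \<tau>)
 case Nil
 then show ?case by simp
next
 case (Cons s u)
 then have s: "s \<in> sides" "fst s = \<tau>" and u: "is_gallery (fst (opp s)) u \<tau>1" by (simp_all only: is_gallery.simps simp_thms)
 show ?case using Cons.IH[OF u Cons.prems(2)] s by (simp only: append_Cons is_gallery.simps simp_thms)
qed

lemma gpath_append:
 assumes "is_gallery \<tau> u \<tau>1" "is_gallery \<tau>1 w \<tau>'"
 shows "gpath \<tau> u +++ gpath \<tau>1 w \<simeq> gpath \<tau> (u @ w)"
 using assms(1)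
proof (induction u arbitrary: \<tau>)
 case Nil
 then have "\<tau> = \<tau>1" by simp
 then show ?case using gpath[OF assms(2)] by (simp add: homotopic_paths_lid_const)
next
 case (Cons s u)
 then have s: "s \<in> sides" "fst s = \<tau>" and u: "is_gallery (fst (opp s)) u \<tau>1" by (simp_all only: is_gallery.simps simp_thms)
 note gu = gpath[OF u] and gw = gpath[OF assms(2)] and c = crossing[OF s(1)]
 have "(crossing s +++ gpath (fst (opp s)) u) +++ gpath \<tau>1 w
   \<simeq> crossing s +++ (gpath (fst (opp s)) u +++ gpath \<tau>1 w)"
  by (rule homotopic_paths_sym, rule homotopic_paths_assoc) (use gu gw c in simp_all)
 also have "crossing s +++ (gpath (fst (opp s)) u +++ gpath \<tau>1 w)
   \<simeq> crossing s +++ gpath (fst (opp s)) (u @ w)"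
  by (rule homotopic_paths_join[OF _ Cons.IH[OF u]]) (use gu gw c in simp_all)
 finally show ?case by simp
qed

text \<open>Within one star only two triangles occur, so at most one crossing is needed between the
  chosen triangles of two points.\<close>

definition step :: "'a side => 'a => 'a => 'a side list" where
 "step s x y = (if fst (home x) = fst (home y) then [] else if fst (home x) = fst s then [s] else [opp s])"

lemma is_gallery_step:
 assumes s: "s \<in> sides" and x: "x \<in> star s" and y: "y \<in> star s"
 shows "is_gallery (fst (home x)) (step s x y) (fst (home y))"
proof -
 have os: "opp s \<in> sides" by (rule opp(1)[OF s])
 have T: "fst (home x) \<in> \<T>" by (rule home(1)) (use x star_subset[OF s] in blast)
 consider "fst (home x) = fst (home y)"
  | "fst (home x) = fst s" "fst (home y) = fst (opp s)" "fst (home x) ~= fst (home y)"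
  | "fst (home x) = fst (opp s)" "fst (home y) = fst s" "fst (home x) ~= fst (home y)" "fst (home x) ~= fst s"
  using home_star[OF s x] home_star[OF s y] by metis
 then show ?thesis
 proof cases
  case 1
  then show ?thesis using T by (simp only: step_def if_True is_gallery.simps simp_thms)
 next
  case 2
  then have "step s x y = [s]" by (simp add: step_def)
  then show ?thesis using 2 s fst_in_T(2)[OF s] by (simp only: is_gallery.simps simp_thms)
 next
  case 3
  then have "step s x y = [opp s]" by (simp add: step_def)
  then show ?thesis using 3 os fst_in_T(1)[OF s] by (simp only: is_gallery.simps simp_thms opp_opp[OF s])
 qed
qed

lemma gpath_step_star:
 assumes s: "s \<in> sides" and x: "x \<in> star s" and y: "y \<in> star s"
 shows "path_image (gpath (fst (home x)) (step s x y)) \<subseteq> star s"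
proof -
 have "fst (home x) barycentre \<in> star s" using home_star[OF s x] barycentre_star by metis
 moreover have "path_image (crossing s +++ const_path (fst (opp s) barycentre)) \<subseteq> star s"
  by (rule subset_path_image_join) (use crossing(2)[OF s] barycentre_star in simp_all)
 moreover have "path_image (crossing (opp s) +++ const_path (fst s barycentre)) \<subseteq> star s"
  by (rule subset_path_image_join) (use crossing(2)[OF opp(1)[OF s]] star_opp[OF s] barycentre_star in simp_all)
 moreover have "step s x y = [] \<or> (step s x y = [s] \<and> fst (home x) = fst s) \<or>
   (step s x y = [opp s] \<and> fst (home x) = fst (opp s))"
  using home_star[OF s x] by (auto simp: step_def)
 ultimately show ?thesis using s by (elim disjE conjE) simp_all
qed

lemma piece_homotopic:
 assumes s: "s \<in> sides" and p: "path p" "path_image p \<subseteq> star s"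
 shows "p \<simeq> reversepath (spoke (pathstart p)) +++
  (gpath (fst (home (pathstart p))) (step s (pathstart p) (pathfinish p)) +++ spoke (pathfinish p))"
proof -
 let ?x = "pathstart p" and ?y = "pathfinish p"
 have xy: "?x \<in> star s" "?y \<in> star s" using p(2) by blast+
 then have xM: "?x \<in> M - P" "?y \<in> M - P" using star_subset[OF s] by blast+
 note g = gpath[OF is_gallery_step[OF s xy]] and sx = spoke[OF xM(1)] and sy = spoke[OF xM(2)]
 show ?thesis
 proof (rule star_homotopic'[OF s p])
  show "path_image (reversepath (spoke ?x) +++ (gpath (fst (home ?x)) (step s ?x ?y) +++ spoke ?y)) \<subseteq> star s"
   by (intro subset_path_image_join gpath_step_star[OF s xy] spoke_star[OF s xy(2)])
    (simp add: spoke_star[OF s xy(1)])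
 qed (use g sx sy in simp_all)
qed

definition subordinate :: "nat => (real => 'a) => (nat => 'a side) => bool" where
 "subordinate n p sd \<longleftrightarrow> 0 < n \<and> (\<forall>k<n. sd k \<in> sides \<and> p ` {real k / n .. real (Suc k) / n} \<subseteq> star (sd k))"

definition path_word :: "(real => 'a) => nat => (nat => 'a side) => nat => 'a side list" where
 "path_word p n sd m = concat (map (\<lambda>k. step (sd k) (p (real k / n)) (p (real (Suc k) / n))) [0..<m])"

text \<open>Each piece is replaced by a spoke back to a centre, at most one crossing, and a spoke
  out again; between neighbouring pieces the spokes cancel.\<close>

lemma path_homotopic_gallery:
 assumes p: "path p" "path_image p \<subseteq> M - P" and f: "subordinate n p sd" and m: "m \<le> n"
 shows "is_gallery (fst (home (p 0))) (path_word p n sd m) (fst (home (p (real m / n)))) \<and>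
  p \<circ> linepath 0 (real m / n) \<simeq> reversepath (spoke (p 0)) +++
   (gpath (fst (home (p 0))) (path_word p n sd m) +++ spoke (p (real m / n)))"
 using m
proof (induction m)
 case 0
 have p0: "p 0 \<in> M - P" using p(2) by (rule subsetD) (auto simp: path_image_def)
 note s0 = spoke[OF p0]
 let ?l = "const_path (fst (home (p 0)) barycentre)"
 have T: "fst (home (p 0)) \<in> \<T>" by (rule home(1)) (use p0 in blast)
 have "reversepath (spoke (p 0)) +++ (?l +++ spoke (p 0)) \<simeq> reversepath (spoke (p 0)) +++ spoke (p 0)"
  by (rule homotopic_paths_join[OF _ homotopic_paths_lid_const]) (use s0 in simp_all)
 also have "\<dots> \<simeq> const_path (p 0)"
  using homotopic_paths_linv_const[OF s0(1,2)] s0(4) by simp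
 finally have "const_path (p 0) \<simeq> reversepath (spoke (p 0)) +++ (?l +++ spoke (p 0))"
  by (rule homotopic_paths_sym)
 moreover have "p \<circ> linepath 0 0 = const_path (p 0)" by (simp add: linepath_def const_path_def o_def)
 ultimately show ?case using T by (simp add: path_word_def const_path_def)
next
 case (Suc m)
 then have IH: "is_gallery (fst (home (p 0))) (path_word p n sd m) (fst (home (p (real m / n))))"
  "p \<circ> linepath 0 (real m / n) \<simeq> reversepath (spoke (p 0)) +++
   (gpath (fst (home (p 0))) (path_word p n sd m) +++ spoke (p (real m / n)))" using Suc.prems Suc_leD by blast+
 have n: "0 < n" and mn: "m < n" using f Suc.prems by (auto simp: subordinate_def)
 let ?u = "real m / n" and ?v = "real (Suc m) / n" and ?s = "sd m"
 have uv: "0 \<le> ?u" "?u \<le> ?v" "?v \<le> 1" using n Suc.prems by (simp_all add: divide_right_mono)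
 have s: "?s \<in> sides" and im: "p ` {?u..?v} \<subseteq> star ?s" using f mn by (simp_all add: subordinate_def)
 let ?q = "p \<circ> linepath ?u ?v"
 have u01: "?u \<in> {0..1}" "?v \<in> {0..1}" "(0::real) \<in> {0..1}" using uv by simp_all
 have q: "path ?q" "path_image ?q \<subseteq> star ?s" "pathstart ?q = p ?u" "pathfinish ?q = p ?v"
 proof -
  have seg: "closed_segment ?u ?v = {?u..?v}" using uv(2) by (simp add: closed_segment_eq_real_ivl)
  show "path ?q"
   by (rule path_continuous_image[OF path_linepath continuous_on_subset[OF p(1)[unfolded path_def]]])
    (simp only: path_image_linepath seg, use uv in simp)
  show "path_image ?q \<subseteq> star ?s" unfolding path_image_compose path_image_linepath seg by (rule im)
 qed (simp_all add: pathstart_compose pathfinish_compose)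
 have pu: "p t \<in> M - P" if "t \<in> {0..1}" for t using p(2) by (rule subsetD) (use that in \<open>auto simp: path_image_def\<close>)
 have st: "p ?u \<in> star ?s" "p ?v \<in> star ?s" using im uv by auto
 note g1 = gpath[OF IH(1)] and g2 = gpath[OF is_gallery_step[OF s st]]
 note s0 = spoke[OF pu[OF u01(3)]] and su = spoke[OF pu[OF u01(1)]] and sv = spoke[OF pu[OF u01(2)]]
 have w: "path_word p n sd (Suc m) = path_word p n sd m @ step ?s (p ?u) (p ?v)" by (simp add: path_word_def)
 have gal: "is_gallery (fst (home (p 0))) (path_word p n sd (Suc m)) (fst (home (p ?v)))"
  unfolding w by (rule is_gallery_append[OF IH(1) is_gallery_step[OF s st]])
 have "p \<circ> linepath 0 ?v \<simeq> (p \<circ> linepath 0 ?u) +++ ?q"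
  by (rule homotopic_paths_subpath_join[OF p u01(1,2)])
 also have "(p \<circ> linepath 0 ?u) +++ ?q \<simeq>
  (reversepath (spoke (p 0)) +++ (gpath (fst (home (p 0))) (path_word p n sd m) +++ spoke (p ?u))) +++
  (reversepath (spoke (p ?u)) +++ (gpath (fst (home (p ?u))) (step ?s (p ?u) (p ?v)) +++ spoke (p ?v)))"
  by (rule homotopic_paths_join[OF IH(2) piece_homotopic[OF s q(1,2), unfolded q(3,4)]]) (simp add: pathstart_compose pathfinish_compose)
 also have "\<dots> \<simeq> reversepath (spoke (p 0)) +++
   ((gpath (fst (home (p 0))) (path_word p n sd m) +++ gpath (fst (home (p ?u))) (step ?s (p ?u) (p ?v))) +++ spoke (p ?v))"
  by (rule pth_cancel_middle[OF pth_reverse[OF pthI[OF s0]] _ pthI[OF su] _ pthI[OF sv]]) (use g1 g2 in \<open>simp_all only: pth_def\<close>)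
 also have "\<dots> \<simeq> reversepath (spoke (p 0)) +++ (gpath (fst (home (p 0))) (path_word p n sd (Suc m)) +++ spoke (p ?v))"
  unfolding w
  by (rule homotopic_paths_join[OF _ homotopic_paths_join[OF gpath_append[OF IH(1) is_gallery_step[OF s st]]]])
   (use g1 g2 s0 su sv in simp_all)
 finally show ?case by (rule conjI[OF gal])
qed

lemma pth_gallery: "is_gallery \<tau> w \<tau>' ==> pth (gpath \<tau> w) (\<tau> barycentre) (\<tau>' barycentre)"
 using gpath[of \<tau> w \<tau>'] unfolding pth_def .

lemma pth_crossing: "s \<in> sides ==> pth (crossing s) (fst s barycentre) (fst (opp s) barycentre)"
 by (rule pthI[OF crossing(1) crossing(5) crossing(3) crossing(4)])

lemma crossing_pair:
 assumes s: "s \<in> sides"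
 shows "crossing s +++ crossing (opp s) \<simeq> const_path (fst s barycentre)"
proof (rule star_homotopic'[OF s])
 note c = crossing[OF s] and c' = crossing[OF opp(1)[OF s], unfolded opp_opp[OF s] star_opp[OF s]]
 show "path_image (crossing s +++ crossing (opp s)) \<subseteq> star s" by (rule subset_path_image_join[OF c(2) c'(2)])
 show "path_image (const_path (fst s barycentre)) \<subseteq> star s" using barycentre_star(1)[of s] by simp
 show "path (crossing s +++ crossing (opp s))" using c c' by simp
 show "pathstart (crossing s +++ crossing (opp s)) = pathstart (const_path (fst s barycentre))"
  "pathfinish (crossing s +++ crossing (opp s)) = pathfinish (const_path (fst s barycentre))" using c c' by simp_all
qed simp

end

section \<open>Holonomy\<close>

fun wmat :: "('s => 'b::semiring_1^3^3) => 's list => 'b^3^3" where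
 "wmat X [] = mat 1"
| "wmat X (s # w) = X s ** wmat X w"

lemma wmat_append: "wmat X (u @ w) = wmat X u ** wmat X w"
 by (induction u) (simp_all add: matrix_mul_assoc)

lemma half_triangle_two:
 assumes "i ~= j" "x \<in> half_triangle i" "x \<in> half_triangle j"
 shows "x \<in> open_triangle"
proof -
 have "0 < x $ i" using assms(1,3) unfolding half_triangle_def by blast
 then show ?thesis using assms(2) unfolding half_triangle_iff open_triangle_iff[of x i] by blast
qed

context bipartite_surface
begin

text \<open>All vertices are punctures, hence no relation arises around a vertex: inverse values on
  the two sides of an edge are the only condition for a well-defined holonomy.\<close>

definition inverse_crossings :: "('a side => 'b::semiring_1^3^3) => bool" where
 "inverse_crossings X \<longleftrightarrow> (\<forall>s\<in>sides. X s ** X (opp s) = mat 1)"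

lemma inverse_crossings:
 assumes "inverse_crossings X" "s \<in> sides"
 shows "X s ** X (opp s) = mat 1" "X (opp s) ** X s = mat 1"
proof -
 show "X s ** X (opp s) = mat 1" using assms unfolding inverse_crossings_def by (rule bspec)
 have "X (opp s) ** X (opp (opp s)) = mat 1"
  using assms(1) opp(1)[OF assms(2)] unfolding inverse_crossings_def by (rule bspec)
 then show "X (opp s) ** X s = mat 1" by (simp only: opp_opp[OF assms(2)])
qed

lemma step_self: "step s x x = []"
 by (simp add: step_def)

lemma home_star_fst:
 assumes "s \<in> sides" "x \<in> star s"
 shows "fst (home x) = fst s \<or> fst (home x) = fst (opp s)"
 using home_star[OF assms] by (elim disjE conjE) simp_all

lemma step_opp:
 assumes s: "s \<in> sides" and x: "x \<in> star s"
 shows "step (opp s) x y = step s x y"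
 using home_star_fst[OF s x] fst_opp_neq[OF s] opp_opp[OF s] by (elim disjE) (simp_all add: step_def)

text \<open>Each of the three points belongs to one of the two triangles of the star; going to the
  other one and back cancels by \<open>inverse_crossings\<close>.\<close>

lemma step_cocycle:
 assumes X: "inverse_crossings X" and s: "s \<in> sides" and x: "x \<in> star s" and y: "y \<in> star s" and z: "z \<in> star s"
 shows "wmat X (step s x y) ** wmat X (step s y z) = wmat X (step s x z)"
 using home_star_fst[OF s x] home_star_fst[OF s y] home_star_fst[OF s z] fst_opp_neq[OF s] inverse_crossings[OF X s]
 by (elim disjE) (simp_all add: step_def)

lemma home_chart:
 assumes s: "s \<in> sides" and z: "z \<in> kite" and o: "snd (home (chart s z)) \<in> open_triangle"
 shows "(0 < Im z \<and> fst (home (chart s z)) = fst s) \<or> (Im z < 0 \<and> fst (home (chart s z)) = fst (opp s))"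
proof -
 let ?y = "chart s z"
 have M: "?y \<in> M" using subsetD[OF star_subset[OF s] chart_in_star[OF s z]] by (rule DiffD1)
 have key: "fst (home ?y) = \<tau> \<and> x \<in> open_triangle" if "?y = \<tau> x" "x \<in> half_triangle i" "\<tau> \<in> \<T>" for \<tau> x i
 proof -
  have x: "x \<in> triangle" using that(2) unfolding half_triangle_def by blast
  have "fst (home ?y) = \<tau> \<and> snd (home ?y) = x"
   by (rule T_interior[OF home(1)[OF M] that(3) o x]) (simp only: home(3)[OF M] that(1)[symmetric])
  then show ?thesis using o by (elim conjE) simp
 qed
 show ?thesis
 proof (cases "0 \<le> Im z")
  case True
  from key[OF chart_upper_kite[OF z True] fst_in_T(1)[OF s]]
  have "fst (home ?y) = fst s" "0 < tri_pt (snd s) (pv (snd s)) z $ snd s"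
   unfolding open_triangle_def by blast+
  then show ?thesis by (simp add: tri_pt_nth)
 next
  case False
  then have F: "Im z \<le> 0" by simp
  have ne: "snd (opp s) ~= gperm s (pv (snd s))" using gperm(3)[OF s] by simp
  from key[OF chart_lower_kite[OF s z F] fst_in_T(2)[OF s]]
  have "fst (home ?y) = fst (opp s)" "0 < tri_pt (snd (opp s)) (gperm s (pv (snd s))) (twist (gfun s) z) $ snd (opp s)"
   unfolding open_triangle_def by blast+
  then show ?thesis using ne by (simp add: tri_pt_nth twist_def)
 qed
qed

lemma home_open_of_two_stars:
 assumes s: "s \<in> sides" and r: "r \<in> sides" and ne: "r ~= s" "r ~= opp s" and z: "z \<in> star s" "z \<in> star r"
 shows "snd (home z) \<in> open_triangle"
proof -
 have ne': "opp r ~= s" "opp r ~= opp s"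
  using ne opp_opp[OF r] opp_opp[OF s] by metis+
 have key: "snd (home z) \<in> open_triangle"
  if "fst (home z) = fst a" "snd (home z) \<in> half_triangle (snd a)" "fst (home z) = fst b" "snd (home z) \<in> half_triangle (snd b)" "b ~= a"
  for a b :: "'a side"
  by (rule half_triangle_two[OF _ that(2,4)]) (use that(1,3,5) in \<open>simp add: prod_eq_iff\<close>)
 show ?thesis using home_star[OF s z(1)] home_star[OF r z(2)]
  by (elim disjE conjE) (erule key, assumption, assumption, assumption, rule ne ne')+
qed

text \<open>If the two stars belong to different edges, they overlap only in open triangles, so C
  avoids the edge of s. The imaginary part in the chart of s then has constant sign on C, both
  points lie in the same triangle and both words are empty.\<close>

lemma step_compat:
 assumes s: "s \<in> sides" and r: "r \<in> sides" and C: "connected C" "C \<subseteq> star s" "C \<subseteq> star r"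
  and x: "x \<in> C" and y: "y \<in> C"
 shows "step s x y = step r x y"
proof (cases "r = s \<or> r = opp s")
 case True
 then show ?thesis using step_opp[OF s subsetD[OF C(2) x]] by (elim disjE) simp_all
next
 case False
 let ?f = "\<lambda>z. Im (chart_inv s z)"
 have f: "(0 < ?f z \<and> fst (home z) = fst s) \<or> (?f z < 0 \<and> fst (home z) = fst (opp s))" if "z \<in> C" for z
 proof -
  have z: "z \<in> star s" "z \<in> star r" using that C by blast+
  have "snd (home z) \<in> open_triangle"
   by (rule home_open_of_two_stars[OF s r _ _ z]) (use False in blast)+
  then have "snd (home (chart s (chart_inv s z))) \<in> open_triangle"
   by (simp only: chart_inv_in_kite(2)[OF s z(1)])
  from home_chart[OF s chart_inv_in_kite(1)[OF s z(1)] this] show ?thesis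
   by (simp only: chart_inv_in_kite(2)[OF s z(1)])
 qed
 have conn: "connected (?f ` C)"
  by (rule connected_continuous_image[OF continuous_on_Im[OF continuous_on_subset[OF continuous_on_chart_inv[OF s] C(2)]] C(1)])
 have nz: "0 \<notin> ?f ` C" using f by fastforce
 have "\<not> (?f x \<le> 0 \<and> 0 \<le> ?f y)" "\<not> (?f y \<le> 0 \<and> 0 \<le> ?f x)"
  using connectedD_interval[OF conn imageI[OF x] imageI[OF y], of 0]
   connectedD_interval[OF conn imageI[OF y] imageI[OF x], of 0] nz by blast+
 then have "fst (home x) = fst (home y)" using f[OF x] f[OF y] by (elim disjE conjE) auto
 then show ?thesis by (simp add: step_def)
qed

lemma subordinateD:
 assumes "subordinate n p sd"
 shows "0 < n" "\<And>k. k < n ==> sd k \<in> sides" "\<And>k. k < n ==> p ` {real k / n .. real (Suc k) / n} \<subseteq> star (sd k)"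
 using assms unfolding subordinate_def by blast+

lemma frac_01: "0 < n ==> k \<le> n ==> real k / real n \<in> {0..1}"
 by simp

lemma frac_le: "0 < n ==> real k / real n \<le> real (Suc k) / real n"
 by (simp add: divide_right_mono)

lemma subdivision_subset:
 assumes "k < n"
 shows "{real k / real n .. real (Suc k) / real n} \<subseteq> {0..1}"
proof
 fix t assume "t \<in> {real k / real n .. real (Suc k) / real n}"
 then have "real k / real n \<le> t" "t \<le> real (Suc k) / real n" unfolding atLeastAtMost_iff by (rule conjunct1, rule conjunct2)
 moreover have "0 \<le> real k / real n" "real (Suc k) / real n \<le> 1" using assms by simp_all
 ultimately show "t \<in> {0..1}" unfolding atLeastAtMost_iff by linarith
qed

lemma path_word_indep:
 assumes p: "path p" and s: "subordinate n p sd" "subordinate n p sd'" and m: "m \<le> n"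
 shows "path_word p n sd m = path_word p n sd' m"
proof -
 have "step (sd k) (p (real k / n)) (p (real (Suc k) / n)) = step (sd' k) (p (real k / n)) (p (real (Suc k) / n))"
  if k: "k < n" for k
 proof (rule step_compat[OF subordinateD(2)[OF s(1) k] subordinateD(2)[OF s(2) k]])
  have n: "0 < n" by (rule subordinateD(1)[OF s(1)])
  show "connected (p ` {real k / n .. real (Suc k) / n})"
  proof (rule connected_continuous_image[OF continuous_on_subset[OF p[unfolded path_def]]])
   show "{real k / n .. real (Suc k) / n} \<subseteq> {0..1}" by (rule subdivision_subset[OF k])
  qed simp
  show "p (real k / n) \<in> p ` {real k / n .. real (Suc k) / n}" "p (real (Suc k) / n) \<in> p ` {real k / n .. real (Suc k) / n}"
   using frac_le[OF n] by simp_all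
 qed (rule subordinateD(3)[OF s(1) k], rule subordinateD(3)[OF s(2) k])
 then show ?thesis unfolding path_word_def using m by (intro arg_cong[of _ _ concat] map_cong) simp_all
qed

lemma path_word_cong:
 assumes "\<forall>t\<in>{0..1}. p t = q t" "0 < n" "m \<le> n"
 shows "path_word p n sd m = path_word q n sd m"
proof -
 have e: "p (real k / n) = q (real k / n)" if "k \<le> n" for k by (rule bspec[OF assms(1) frac_01[OF assms(2) that]])
 have "step (sd k) (p (real k / n)) (p (real (Suc k) / n)) = step (sd k) (q (real k / n)) (q (real (Suc k) / n))"
  if "k < m" for k using e[of k] e[of "Suc k"] that assms(3) by (simp del: of_nat_Suc)
 then show ?thesis unfolding path_word_def by (intro arg_cong[of _ _ concat] map_cong) simp_all
qed

lemma subordinate_cong: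
 assumes "\<forall>t\<in>{0..1}. p t = q t" "subordinate n p sd"
 shows "subordinate n q sd"
proof -
 have "q ` {real k / n .. real (Suc k) / n} = p ` {real k / n .. real (Suc k) / n}" if "k < n" for k
 proof (rule image_cong[OF refl])
  fix t assume "t \<in> {real k / n .. real (Suc k) / n}"
  from subsetD[OF subdivision_subset[OF that] this] show "q t = p t" by (rule bspec[OF assms(1), symmetric])
 qed
 then show ?thesis using assms(2) by (simp add: subordinate_def)
qed

lemma wmat_chain:
 assumes X: "inverse_crossings X" and s: "s \<in> sides" and x: "\<And>k. k \<le> m ==> x k \<in> star s"
 shows "wmat X (concat (map (\<lambda>k. step s (x k) (x (Suc k))) [0..<m])) = wmat X (step s (x 0) (x m))"
 using x
proof (induction m)
 case 0
 then show ?case by (simp add: step_self)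
next
 case (Suc m)
 have "wmat X (concat (map (\<lambda>k. step s (x k) (x (Suc k))) [0..<Suc m])) =
   wmat X (step s (x 0) (x m)) ** wmat X (step s (x m) (x (Suc m)))"
  using Suc.IH Suc.prems by (simp add: wmat_append)
 also have "\<dots> = wmat X (step s (x 0) (x (Suc m)))"
  by (rule step_cocycle[OF X s]) (use Suc.prems in simp_all)
 finally show ?case .
qed

lemma refine_bounds:
 assumes "0 < m" "0 < (n::nat)"
 shows "real (k div m) / n \<le> real k / real (n * m)" "real (Suc k) / real (n * m) \<le> real (Suc (k div m)) / n"
proof -
 have e: "real j / n = real (j * m) / real (n * m)" for j using assms by simp
 have "k div m * m \<le> k" "Suc k \<le> Suc (k div m) * m"
  using dividend_less_div_times[OF assms(1), of k] by simp_all
 then show "real (k div m) / n \<le> real k / real (n * m)" "real (Suc k) / real (n * m) \<le> real (Suc (k div m)) / n"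
  unfolding e by (intro divide_right_mono, simp only: of_nat_le_iff, simp)+
qed

text \<open>The pieces that refine one old piece lie in one star, where by \<open>wmat_chain\<close>
  their steps multiply to the step of the whole piece.\<close>

lemma path_word_refine:
 assumes X: "inverse_crossings X" and f: "subordinate n p sd" and m: "0 < m"
 shows "subordinate (n * m) p (\<lambda>k. sd (k div m))"
  "wmat X (path_word p (n * m) (\<lambda>k. sd (k div m)) (n * m)) = wmat X (path_word p n sd n)"
proof -
 note n = subordinateD(1)[OF f] and sT = subordinateD(2)[OF f] and im = subordinateD(3)[OF f]
 let ?sd = "\<lambda>k. sd (k div m)" and ?N = "n * m"
 have lt: "k div m < n" if "k < n * m" for k using that m by (simp add: div_less_iff_less_mult)
 show sub: "subordinate ?N p ?sd" unfolding subordinate_def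
 proof (intro conjI allI impI)
  show "0 < ?N" using n m by simp
  fix k assume k: "k < ?N"
  show "?sd k \<in> sides" by (rule sT[OF lt[OF k]])
  show "p ` {real k / real ?N .. real (Suc k) / real ?N} \<subseteq> star (?sd k)"
   by (rule subset_trans[OF image_mono im[OF lt[OF k]]]) (use refine_bounds[OF m n, of k] in auto)
 qed
 have "wmat X (path_word p ?N ?sd (j * m)) = wmat X (path_word p n sd j)" if "j \<le> n" for j
  using that
 proof (induction j)
  case 0
  then show ?case by (simp add: path_word_def)
 next
  case (Suc j)
  let ?x = "\<lambda>k. p (real (k + j * m) / real ?N)"
  have j: "j < n" using Suc.prems by simp
  have "[j * m..<m + j * m] = map (\<lambda>i. i + j * m) [0..<m]" by (simp add: map_add_upt)
  then have "[0..<Suc j * m] = [0..<j * m] @ map (\<lambda>i. i + j * m) [0..<m]"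
   using upt_add_eq_append[of 0 "j * m" m] by (simp add: add.commute)
  then have "path_word p ?N ?sd (Suc j * m) = path_word p ?N ?sd (j * m) @
    concat (map (\<lambda>k. step (?sd (k + j * m)) (?x k) (?x (Suc k))) [0..<m])"
   by (simp add: path_word_def o_def)
  also have "map (\<lambda>k. step (?sd (k + j * m)) (?x k) (?x (Suc k))) [0..<m] = map (\<lambda>k. step (sd j) (?x k) (?x (Suc k))) [0..<m]"
   using m by (intro map_cong) simp_all
  finally have w: "wmat X (path_word p ?N ?sd (Suc j * m)) = wmat X (path_word p n sd j) **
    wmat X (concat (map (\<lambda>k. step (sd j) (?x k) (?x (Suc k))) [0..<m]))"
   using Suc by (simp add: wmat_append)
  have e: "real i / n = real (i * m) / real ?N" for i using m n by simp
  have "wmat X (concat (map (\<lambda>k. step (sd j) (?x k) (?x (Suc k))) [0..<m])) = wmat X (step (sd j) (?x 0) (?x m))"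
  proof (rule wmat_chain[OF X sT[OF j]])
   fix k assume k: "k \<le> m"
   have "real (k + j * m) / real ?N \<in> {real j / n .. real (Suc j) / n}"
    unfolding e atLeastAtMost_iff
    by (intro conjI divide_right_mono) (use k in \<open>simp_all only: of_nat_le_iff of_nat_0_le_iff mult_Suc le_add2 add_le_cancel_right\<close>)
   then show "?x k \<in> star (sd j)" using im[OF j] by blast
  qed
  moreover have "?x 0 = p (real j / n)" "?x m = p (real (Suc j) / n)" unfolding e by (simp_all add: add.commute)
  ultimately show ?case unfolding w by (simp add: path_word_def wmat_append)
 qed
 then show "wmat X (path_word p ?N ?sd ?N) = wmat X (path_word p n sd n)" by blast
qed

lemma path_word_unique:
 assumes X: "inverse_crossings X" and p: "path p" and f: "subordinate n p sd" "subordinate m p sd'"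
 shows "wmat X (path_word p n sd n) = wmat X (path_word p m sd' m)"
proof -
 note n = subordinateD(1)[OF f(1)] and m = subordinateD(1)[OF f(2)]
 note a = path_word_refine[OF X f(1) m] and b = path_word_refine[OF X f(2) n, unfolded mult.commute[of m n]]
 have "path_word p (n * m) (\<lambda>k. sd (k div m)) (n * m) = path_word p (n * m) (\<lambda>k. sd' (k div n)) (n * m)"
  by (rule path_word_indep[OF p a(1) b(1) order_refl])
 then show ?thesis using a(2) b(2) by simp
qed

text \<open>Both subdivisions are first refined to the common number K = n m of pieces, since the
  join divides its interval into two halves of equal length.\<close>

lemma path_word_join:
 assumes X: "inverse_crossings X" and f: "subordinate n p sd" "subordinate m q sd'" and e: "pathfinish p = pathstart q"
 shows "\<exists>N sd''. subordinate N (p +++ q) sd'' \<and>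
  wmat X (path_word (p +++ q) N sd'' N) = wmat X (path_word p n sd n) ** wmat X (path_word q m sd' m)"
proof -
 note n = subordinateD(1)[OF f(1)] and m = subordinateD(1)[OF f(2)]
 note a = path_word_refine[OF X f(1) m] and b = path_word_refine[OF X f(2) n, unfolded mult.commute[of m n]]
 define K where "K = n * m"
 define u where "u = (\<lambda>k. sd (k div m))"
 define v where "v = (\<lambda>k. sd' (k div n))"
 note a = a[folded K_def u_def] and b = b[folded K_def v_def]
 have K: "0 < K" using n m by (simp add: K_def)
 let ?r = "p +++ q" and ?w = "\<lambda>k. if k < K then u k else v (k - K)"
 have r1: "?r t = p (2 * t)" if "t \<le> 1/2" for t using that by (simp add: joinpaths_def)
 have r2: "?r t = q (2 * t - 1)" if "1/2 \<le> t" for t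
 proof (cases "t = 1/2")
  case True
  show ?thesis unfolding True using e by (simp add: joinpaths_def pathfinish_def pathstart_def)
 next
  case False
  then show ?thesis using that by (simp add: joinpaths_def)
 qed
 have c1: "2 * (real k / real (K + K)) = real k / K" for k using K by (simp add: field_simps)
 have c2: "2 * (real (k + K) / real (K + K)) - 1 = real k / K" for k using K by (simp add: field_simps)
 have v1: "?r (real k / real (K + K)) = p (real k / K)" if "k \<le> K" for k
  by (subst r1) (use that K c1 in \<open>simp_all add: field_simps\<close>)
 have v2: "?r (real (k + K) / real (K + K)) = q (real k / K)" for k
  by (subst r2) (use K in \<open>simp add: field_simps\<close>, simp only: c2)
 have sub: "subordinate (K + K) ?r ?w" unfolding subordinate_def
 proof (intro conjI allI impI)
  show "0 < K + K" using K by simp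
  fix k assume k: "k < K + K"
  show "?w k \<in> sides"
   using subordinateD(2)[OF a(1), of k] subordinateD(2)[OF b(1), of "k - K"] k by simp
  show "?r ` {real k / real (K + K) .. real (Suc k) / real (K + K)} \<subseteq> star (?w k)"
  proof (rule image_subsetI)
   fix t assume t: "t \<in> {real k / real (K + K) .. real (Suc k) / real (K + K)}"
   show "?r t \<in> star (?w k)"
   proof (cases "k < K")
    case True
    have "real (Suc k) \<le> K" using True by linarith
    then have "real (Suc k) / real (K + K) \<le> 1/2" using K by (simp add: field_simps)
    then have "t \<le> 1/2" using t unfolding atLeastAtMost_iff by linarith
    then have "?r t = p (2 * t)" by (rule r1)
    moreover have "2 * t \<in> {real k / K .. real (Suc k) / K}"
     using t c1[of k] c1[of "Suc k"] unfolding atLeastAtMost_iff by linarith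
    ultimately show ?thesis using subordinateD(3)[OF a(1) True] True by auto
   next
    case False
    then obtain j where j: "k = j + K" by (metis add.commute le_add_diff_inverse not_less)
    have "1/2 \<le> real k / real (K + K)" unfolding j using K by (simp add: field_simps)
    then have "1/2 \<le> t" using t unfolding atLeastAtMost_iff by linarith
    then have "?r t = q (2 * t - 1)" by (rule r2)
    moreover have "2 * t - 1 \<in> {real j / K .. real (Suc j) / K}"
     using t c2[of j] c2[of "Suc j"] unfolding j atLeastAtMost_iff add_Suc by linarith
    moreover have "j < K" using k j by simp
    ultimately show ?thesis using subordinateD(3)[OF b(1), of j] j by auto
   qed
  qed
 qed
 have "path_word ?r (K + K) ?w (K + K) = path_word p K u K @ path_word q K v K"
 proof -
  have 0: "[0..<K + K] = [0..<K] @ map (\<lambda>i. i + K) [0..<K]"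
   using upt_add_eq_append[of 0 K K] by (simp add: map_add_upt)
  let ?st = "\<lambda>k. step (?w k) (?r (real k / real (K + K))) (?r (real (Suc k) / real (K + K)))"
  have 1: "map ?st [0..<K] = map (\<lambda>k. step (u k) (p (real k / K)) (p (real (Suc k) / K))) [0..<K]"
   using v1 by (intro map_cong refl) (simp del: of_nat_Suc of_nat_add)
  have "?st (k + K) = step (v k) (q (real k / K)) (q (real (Suc k) / K))" for k
   using v2[of k] v2[of "Suc k"] by (simp del: of_nat_Suc of_nat_add)
  then have 2: "map ?st (map (\<lambda>i. i + K) [0..<K]) = map (\<lambda>k. step (v k) (q (real k / K)) (q (real (Suc k) / K))) [0..<K]"
   by (simp only: map_map o_def)
  show ?thesis unfolding path_word_def 0 map_append 1 2 by (rule concat_append)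
 qed
 then have "wmat X (path_word ?r (K + K) ?w (K + K)) = wmat X (path_word p n sd n) ** wmat X (path_word q m sd' m)"
  by (simp only: wmat_append a(2) b(2))
 then show ?thesis using sub by (intro exI conjI)
qed

definition grid :: "(real \<times> real => 'a) => nat => (nat => nat => 'a side) => bool" where
 "grid h N sd \<longleftrightarrow> 0 < N \<and> (\<forall>a<N. \<forall>b<N. sd a b \<in> sides \<and>
  h ` ({real a / N .. real (Suc a) / N} \<times> {real b / N .. real (Suc b) / N}) \<subseteq> star (sd a b))"

lemma gridD:
 assumes "grid h N sd"
 shows "0 < N" "\<And>a b. a < N ==> b < N ==> sd a b \<in> sides"
  "\<And>a b. a < N ==> b < N ==> h ` ({real a / N .. real (Suc a) / N} \<times> {real b / N .. real (Suc b) / N}) \<subseteq> star (sd a b)"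
 using assms unfolding grid_def by blast+

text \<open>A Lebesgue number of the cover by preimages of stars is compared with 2/N, which bounds
  the diameter of a grid square.\<close>

lemma grid_exists:
 fixes h :: "real \<times> real => 'a"
 assumes h: "continuous_on ({0..1} \<times> {0..1}) h" "h \<in> {0..1} \<times> {0..1} \<rightarrow> M - P"
 shows "\<exists>N sd. grid h N sd"
proof -
 let ?S = "{0..1} \<times> {0..1} :: (real \<times> real) set"
 have "\<exists>W. open W \<and> ?S \<inter> h -` star s = ?S \<inter> W" if s: "s \<in> sides" for s
 proof -
  have "openin (top_of_set M) (star s)" by (rule openin_star[OF s])
  then obtain V where V: "open V" "star s = M \<inter> V" unfolding openin_open by (elim exE conjE)
  have "openin (top_of_set ?S) (?S \<inter> h -` V)" by (rule continuous_openin_preimage_gen[OF h(1) V(1)])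
  then obtain W where W: "open W" "?S \<inter> h -` V = ?S \<inter> W" unfolding openin_open by (elim exE conjE)
  have "h z \<in> M" if "z \<in> ?S" for z using DiffD1[OF Pi_mem[OF h(2) that]] .
  then have "?S \<inter> h -` star s = ?S \<inter> h -` V" unfolding V(2)
   by (intro equalityI subsetI IntI) (simp_all only: Int_iff vimage_eq simp_thms)
  then have "open W \<and> ?S \<inter> h -` star s = ?S \<inter> W" using W by simp
  then show ?thesis by (rule exI)
 qed
 note ex = someI_ex[OF this]
 define W where "W s = (SOME W. open W \<and> ?S \<inter> h -` star s = ?S \<inter> W)" for s
 have W: "open (W s)" "?S \<inter> h -` star s = ?S \<inter> W s" if "s \<in> sides" for s
  unfolding W_def by (rule conjunct1[OF ex[OF that]], rule conjunct2[OF ex[OF that]])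
 have cov: "?S \<subseteq> \<Union>(W ` (sides))"
 proof
  fix z assume z: "z \<in> ?S"
  from ex_star[OF Pi_mem[OF h(2) z]] obtain s where s: "s \<in> sides" "h z \<in> star s" by (elim bexE conjE)
  have "z \<in> ?S \<inter> W s" unfolding W(2)[OF s(1), symmetric] using z s(2) by (intro IntI vimageI2)
  then show "z \<in> \<Union>(W ` (sides))" by (intro UN_I[OF s(1)]) (rule IntD2)
 qed
 have S: "compact ?S" by (intro compact_Times compact_Icc)
 have "(0, 0) \<in> ?S" by simp
 then have ne: "W ` (sides) ~= {}" using cov by blast
 have ope: "open B" if B: "B \<in> W ` (sides)" for B
  using B by (rule imageE) (simp only: W(1))
 have "\<exists>d>0. \<forall>Q. Q \<subseteq> ?S --> diameter Q < d --> (\<exists>B\<in>W ` (sides). Q \<subseteq> B)"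
  by (rule Lebesgue_number_lemma[OF S ne cov ope], assumption) (intro exI conjI allI impI)
 then obtain d where d: "0 < d" "\<And>Q. Q \<subseteq> ?S ==> diameter Q < d ==> \<exists>B\<in>W ` (sides). Q \<subseteq> B"
  by (elim exE conjE) (simp only: HOL.simp_thms)
 obtain N :: nat where N: "2 / d < N" using reals_Archimedean2[of "2 / d"] by (rule exE)
 have "0 < 2 / d" using d(1) by simp
 then have "0 < real N" using N by linarith
 then have N0: "0 < N" by simp
 have "\<exists>s. s \<in> sides \<and> h ` ({real a / N .. real (Suc a) / N} \<times> {real b / N .. real (Suc b) / N}) \<subseteq> star s"
  if ab: "a < N" "b < N" for a b
 proof -
  let ?Q = "{real a / N .. real (Suc a) / N} \<times> {real b / N .. real (Suc b) / N}"
  have len: "real (Suc k) / N - real k / N = 1 / N" for k by (simp add: diff_divide_distrib[symmetric])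
  have Q: "?Q \<subseteq> ?S" by (rule Sigma_mono[OF subdivision_subset[OF ab(1)] subdivision_subset[OF ab(2)]])
  have "diameter ?Q \<le> 2 / N"
  proof (rule diameter_le)
   fix x y assume "x \<in> ?Q" "y \<in> ?Q"
   then have "\<bar>fst x - fst y\<bar> \<le> 1 / N" "\<bar>snd x - snd y\<bar> \<le> 1 / N"
    using len[of a] len[of b] unfolding mem_Times_iff atLeastAtMost_iff abs_le_iff by linarith+
   moreover have "norm (x - y) \<le> \<bar>fst x - fst y\<bar> + \<bar>snd x - snd y\<bar>"
    using norm_Pair_le[of "fst x - fst y" "snd x - snd y"] by (simp add: minus_prod_def)
   ultimately show "norm (x - y) \<le> 2 / N" by simp
  qed simp
  also have "\<dots> < d" using N d(1) N0 by (simp add: field_simps)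
  finally have "\<exists>B\<in>W ` (sides). ?Q \<subseteq> B" by (rule d(2)[OF Q])
  then obtain s where s: "s \<in> sides" "?Q \<subseteq> W s" by (elim bexE imageE) simp
  have "?Q \<subseteq> ?S \<inter> h -` star s" unfolding W(2)[OF s(1)] by (rule Int_greatest[OF Q s(2)])
  then have "h ` ?Q \<subseteq> star s" unfolding image_subset_iff_subset_vimage by (rule order_trans[OF _ Int_lower2])
  then show ?thesis using s(1) by (intro exI conjI)
 qed
 note ex = someI_ex[OF this]
 define sd where "sd a b = (SOME s. s \<in> sides \<and>
  h ` ({real a / N .. real (Suc a) / N} \<times> {real b / N .. real (Suc b) / N}) \<subseteq> star s)" for a b
 have "grid h N sd" unfolding grid_def sd_def
  by (intro conjI allI impI N0, rule conjunct1[OF ex], assumption+, rule conjunct2[OF ex])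
 then show ?thesis by (intro exI)
qed

lemma grid_row:
 fixes h :: "real \<times> real => 'a"
 assumes G: "grid h N sd" and a: "a < N"
 shows "subordinate N (\<lambda>t. h (real a / N, t)) (sd a)" "subordinate N (\<lambda>t. h (real (Suc a) / N, t)) (sd a)"
proof -
 have key: "subordinate N (\<lambda>t. h (u, t)) (sd a)" if u: "u \<in> {real a / N .. real (Suc a) / N}" for u
  unfolding subordinate_def
 proof (intro conjI allI impI)
  fix b assume b: "b < N"
  show "(\<lambda>t. h (u, t)) ` {real b / N .. real (Suc b) / N} \<subseteq> star (sd a b)"
   by (rule image_subsetI, rule subsetD[OF gridD(3)[OF G a b]], rule imageI, rule SigmaI[OF u])
 qed (rule gridD(1)[OF G], rule gridD(2)[OF G a])
 show "subordinate N (\<lambda>t. h (real a / N, t)) (sd a)" "subordinate N (\<lambda>t. h (real (Suc a) / N, t)) (sd a)"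
  by (rule key, use frac_le[OF gridD(1)[OF G], of a] in simp)+
qed

lemma subordinate_exists:
 assumes p: "path p" "path_image p \<subseteq> M - P"
 obtains n sd where "subordinate n p sd"
proof -
 let ?h = "\<lambda>z :: real \<times> real. p (snd z)"
 have "continuous_on ({0..1} \<times> {0..1}) ?h"
  by (rule continuous_on_compose2[OF p(1)[unfolded path_def] continuous_on_snd[OF continuous_on_id]]) auto
 moreover have "?h \<in> {0..1} \<times> {0..1} \<rightarrow> M - P"
  by (rule Pi_I, rule subsetD[OF p(2)]) (simp only: path_image_def mem_Times_iff imageI)
 ultimately have "\<exists>N sd. grid ?h N sd" by (rule grid_exists)
 then obtain N sd where N: "grid ?h N sd" by (elim exE)
 from grid_row(1)[OF N gridD(1)[OF N]] have "subordinate N p (sd 0)" by simp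
 then show ?thesis by (rule that)
qed

text \<open>Neighbouring rows form a ladder. Up to a given rung, the first row followed by the rung
  has the same product as the second row, by the cocycle rule in each square; the last rung is
  trivial because the homotopy fixes the end points.\<close>

lemma grid_row_wmat:
 fixes h :: "real \<times> real => 'a"
 assumes X: "inverse_crossings X" and h: "continuous_on ({0..1} \<times> {0..1}) h"
  and ends: "\<forall>u\<in>{0..1}. h (u, 0) = h (0, 0) \<and> h (u, 1) = h (0, 1)"
  and G: "grid h N sd" and a: "a < N"
 shows "wmat X (path_word (\<lambda>t. h (real a / N, t)) N (sd a) N) =
  wmat X (path_word (\<lambda>t. h (real (Suc a) / N, t)) N (sd a) N)"
proof -
 note N = gridD(1)[OF G] and sT = gridD(2)[OF G a] and im = gridD(3)[OF G a]
 define x where "x b = h (real a / N, real b / N)" for b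
 define y where "y b = h (real (Suc a) / N, real b / N)" for b
 let ?C = "\<lambda>b. h ` ({real a / N .. real (Suc a) / N} \<times> {real b / N})"
 have conn: "connected (?C b)" if "b \<le> N" for b
 proof (rule connected_continuous_image[OF continuous_on_subset[OF h]])
  show "{real a / N .. real (Suc a) / N} \<times> {real b / N} \<subseteq> {0..1} \<times> {0..1}"
   by (rule Sigma_mono[OF subdivision_subset[OF a]]) (use frac_01[OF N that] in blast)
 qed (intro connected_Times connected_Icc connected_sing)
 have C: "?C b \<subseteq> star (sd a b)" "?C (Suc b) \<subseteq> star (sd a b)" if "b < N" for b
  by (rule subset_trans[OF image_mono[OF Sigma_mono[OF order_refl]] im[OF that]], use frac_le[OF N, of b] in simp)+
 have xy: "x b \<in> ?C b" "y b \<in> ?C b" for b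
  unfolding x_def y_def by (rule imageI, rule SigmaI, use frac_le[OF N, of a] in simp, rule singletonI)+
 have st: "x b \<in> star (sd a b)" "y b \<in> star (sd a b)" "x (Suc b) \<in> star (sd a b)" "y (Suc b) \<in> star (sd a b)"
  if "b < N" for b using C[OF that] xy[of b] xy[of "Suc b"] by blast+
 have e0: "x 0 = y 0" "x N = y N"
  unfolding x_def y_def using bspec[OF ends frac_01[OF N less_imp_le[OF a]]] bspec[OF ends frac_01[OF N Suc_leI[OF a]]] N by simp_all
 have main: "wmat X (path_word (\<lambda>t. h (real a / N, t)) N (sd a) (Suc b)) ** wmat X (step (sd a b) (x (Suc b)) (y (Suc b))) =
  wmat X (path_word (\<lambda>t. h (real (Suc a) / N, t)) N (sd a) (Suc b))" if "b < N" for b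
  using that
 proof (induction b)
  case 0
  have "wmat X (step (sd a 0) (x 0) (x (Suc 0))) ** wmat X (step (sd a 0) (x (Suc 0)) (y (Suc 0))) =
    wmat X (step (sd a 0) (y 0) (y (Suc 0)))"
   unfolding e0(1)[symmetric] by (rule step_cocycle[OF X sT[OF 0]]) (rule st[OF 0])+
  then show ?case by (simp add: path_word_def x_def y_def del: of_nat_Suc)
 next
  case (Suc b)
  then have b: "b < N" by simp
  let ?s = "sd a (Suc b)" and ?P = "\<lambda>a' b. path_word (\<lambda>t. h (real a' / N, t)) N (sd a) b"
  have "wmat X (?P a (Suc (Suc b))) ** wmat X (step ?s (x (Suc (Suc b))) (y (Suc (Suc b)))) =
   wmat X (?P a (Suc b)) ** (wmat X (step ?s (x (Suc b)) (x (Suc (Suc b)))) ** wmat X (step ?s (x (Suc (Suc b))) (y (Suc (Suc b)))))"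
   by (simp add: path_word_def wmat_append x_def y_def matrix_mul_assoc del: of_nat_Suc)
  also have "\<dots> = wmat X (?P a (Suc b)) ** wmat X (step ?s (x (Suc b)) (y (Suc (Suc b))))"
   by (subst step_cocycle[OF X sT[OF Suc.prems]]) (rule st[OF Suc.prems] refl)+
  also have "\<dots> = wmat X (?P a (Suc b)) ** (wmat X (step ?s (x (Suc b)) (y (Suc b))) ** wmat X (step ?s (y (Suc b)) (y (Suc (Suc b)))))"
   by (subst step_cocycle[OF X sT[OF Suc.prems]]) (rule st[OF Suc.prems] refl)+
  \<comment> \<open>The rung is a common side of two squares, hence its image is a connected set in
    both stars.\<close>
  also have "step ?s (x (Suc b)) (y (Suc b)) = step (sd a b) (x (Suc b)) (y (Suc b))"
   by (rule step_compat[OF sT[OF Suc.prems] sT[OF b] conn C(1)[OF Suc.prems] C(2)[OF b] xy]) (use b in simp)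
  finally show ?case using Suc.IH[OF b]
   by (simp add: path_word_def wmat_append x_def y_def matrix_mul_assoc del: of_nat_Suc)
 qed
 obtain b where b: "N = Suc b" using N by (cases N) simp_all
 have "wmat X (step (sd a b) (x N) (y N)) = mat 1" unfolding e0(2) by (simp add: step_self)
 then show ?thesis using main[of b] unfolding b by simp
qed

text \<open>An inner row of the grid carries the stars of the squares on either side of it;
  \<open>path_word_indep\<close> passes from one choice to the other, and
  \<open>grid_row_wmat\<close> from one row to the next.\<close>

theorem homotopic_path_words:
 assumes X: "inverse_crossings X" and pq: "p \<simeq> q" and f: "subordinate n p sd" "subordinate m q sd'"
 shows "wmat X (path_word p n sd n) = wmat X (path_word q m sd' m)"
proof -
 obtain h :: "real \<times> real => 'a" where h: "continuous_on ({0..1} \<times> {0..1}) h" "h \<in> {0..1} \<times> {0..1} \<rightarrow> M - P"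
  "\<forall>t\<in>{0..1}. h (0, t) = p t" "\<forall>t\<in>{0..1}. h (1, t) = q t"
  "\<forall>u\<in>{0..1}. pathstart (h \<circ> Pair u) = pathstart p \<and> pathfinish (h \<circ> Pair u) = pathfinish p"
  using pq unfolding homotopic_paths by (elim exE conjE)
 have ends: "\<forall>u\<in>{0..1}. h (u, 0) = h (0, 0) \<and> h (u, 1) = h (0, 1)"
  using h(5) bspec[OF h(5), of 0] by (simp add: pathstart_def pathfinish_def)
 obtain N sg where G: "grid h N sg" using grid_exists[OF h(1,2)] by (elim exE)
 note N = gridD(1)[OF G] and row = grid_row[OF G] and rw = grid_row_wmat[OF X h(1) ends G]
 let ?r = "\<lambda>a. \<lambda>t. h (real a / N, t)"
 have pr: "path (?r a)" if "a \<le> N" for a unfolding path_def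
  by (rule continuous_on_compose2[OF h(1)], intro continuous_on_Pair continuous_on_const continuous_on_id)
   (rule image_subsetI, rule SigmaI[OF frac_01[OF N that]])
 have ind: "wmat X (path_word (?r 0) N (sg 0) N) = wmat X (path_word (?r (Suc a)) N (sg a) N)" if "a < N" for a
  using that
 proof (induction a)
  case 0
  show ?case by (rule rw[OF N])
 next
  case (Suc a)
  then have a: "a < N" by simp
  have "path_word (?r (Suc a)) N (sg a) N = path_word (?r (Suc a)) N (sg (Suc a)) N"
   by (rule path_word_indep[OF pr row(2)[OF a] row(1)[OF Suc.prems] order_refl]) (use a in simp)
  then show ?case using Suc.IH[OF a] rw[OF Suc.prems] by simp
 qed
 obtain b where b: "N = Suc b" using N by (cases N) simp_all
 have bN: "b < N" unfolding b by simp
 have r0: "\<forall>t\<in>{0..1}. ?r 0 t = p t" "\<forall>t\<in>{0..1}. ?r (Suc b) t = q t"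
  using h(3,4) N unfolding b by simp_all
 have pp: "path p" "path q" using homotopic_paths_imp_path[OF pq] by blast+
 have "wmat X (path_word p n sd n) = wmat X (path_word p N (sg 0) N)"
  by (rule path_word_unique[OF X pp(1) f(1) subordinate_cong[OF r0(1) row(1)[OF N]]])
 also have "\<dots> = wmat X (path_word (?r 0) N (sg 0) N)"
  by (subst path_word_cong[OF r0(1) N order_refl]) (rule refl)
 also have "\<dots> = wmat X (path_word (?r (Suc b)) N (sg b) N)" by (rule ind[OF bN])
 also have "\<dots> = wmat X (path_word q N (sg b) N)"
  by (subst path_word_cong[OF r0(2) N order_refl]) (rule refl)
 also have "\<dots> = wmat X (path_word q m sd' m)"
  by (rule path_word_unique[OF X pp(2) subordinate_cong[OF r0(2) row(2)[OF bN]] f(2)])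
 finally show ?thesis .
qed

lemma gpath_word:
 assumes X: "inverse_crossings X" and "is_gallery \<tau> w \<tau>'"
 shows "\<exists>n sd. subordinate n (gpath \<tau> w) sd \<and> wmat X (path_word (gpath \<tau> w) n sd n) = wmat X w"
 using assms(2)
proof (induction w arbitrary: \<tau>)
 case Nil
 then have T: "\<tau> \<in> \<T>" unfolding is_gallery.simps by (rule conjunct1)
 have "subordinate 1 (const_path (\<tau> barycentre)) (\<lambda>_. (\<tau>, 1))"
  using T barycentre_star(1)[of "(\<tau>, 1)"] by (simp add: subordinate_def const_path_def image_constant_conv)
 moreover have "path_word (const_path (\<tau> barycentre)) 1 (\<lambda>_. (\<tau>, 1)) 1 = []"
  by (simp add: path_word_def const_path_def step_self)
 ultimately show ?case by (intro exI[of _ 1] exI[of _ "\<lambda>_. (\<tau>, 1)"]) simp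
next
 case (Cons s w)
 then have s: "s \<in> sides" "fst s = \<tau>" and w: "is_gallery (fst (opp s)) w \<tau>'" by (simp_all only: is_gallery.simps simp_thms)
 obtain n sd where n: "subordinate n (gpath (fst (opp s)) w) sd"
  "wmat X (path_word (gpath (fst (opp s)) w) n sd n) = wmat X w" using Cons.IH[OF w] by blast
 note c = crossing[OF s(1)]
 have 1: "subordinate 1 (crossing s) (\<lambda>_. s)" using s(1) c(2) by (simp add: subordinate_def path_image_def)
 have "crossing s 0 = fst s barycentre" "crossing s 1 = fst (opp s) barycentre"
  using c(3,4) by (simp_all only: pathstart_def pathfinish_def)
 then have w1: "path_word (crossing s) 1 (\<lambda>_. s) 1 = [s]"
  using fst_opp_neq[OF s(1)] home_barycentre[OF fst_in_T(1)[OF s(1)]] home_barycentre[OF fst_in_T(2)[OF s(1)]]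
  by (simp add: path_word_def step_def)
 have "pathfinish (crossing s) = pathstart (gpath (fst (opp s)) w)" using c(4) gpath[OF w] by simp
 from path_word_join[OF X 1 n(1) this] show ?case unfolding w1 n(2) by simp
qed

theorem homotopic_galleries_wmat:
 assumes X: "inverse_crossings X" and w: "is_gallery \<tau> w \<tau>'" "is_gallery \<tau> w' \<tau>'"
  and h: "gpath \<tau> w \<simeq> gpath \<tau> w'"
 shows "wmat X w = wmat X w'"
proof -
 obtain n sd where 1: "subordinate n (gpath \<tau> w) sd" "wmat X (path_word (gpath \<tau> w) n sd n) = wmat X w"
  using gpath_word[OF X w(1)] by blast
 obtain m sd' where 2: "subordinate m (gpath \<tau> w') sd'" "wmat X (path_word (gpath \<tau> w') m sd' m) = wmat X w'"
  using gpath_word[OF X w(2)] by blast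
 show ?thesis using homotopic_path_words[OF X h 1(1) 2(1)] unfolding 1(2) 2(2) .
qed

end

section \<open>Vertices of the lifted triangulation\<close>

lemma side_point_ends: "side_point b c 0 = corner b" "b ~= c ==> side_point b c 1 = corner c"
 by (auto simp: vec_eq_iff side_point_def corner_nth)

context bipartite_surface
begin

lemma corner_glued:
 assumes s: "s \<in> sides" and j: "j ~= snd s"
 shows "fst s (corner j) = fst (opp s) (corner (gperm s j))"
proof -
 have "gperm s (nx (snd s)) ~= gperm s (pv (snd s))" using gperm(3)[OF s] by simp
 then have "fst s (corner (nx (snd s))) = fst (opp s) (corner (gperm s (nx (snd s))))"
  "fst s (corner (pv (snd s))) = fst (opp s) (corner (gperm s (pv (snd s))))"
  using gfun(6)[OF s, of 0] gfun(6)[OF s, of 1] gfun(2,3)[OF s] by (simp_all add: side_point_ends)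
 then show ?thesis using three_nx_cases[of j "snd s"] j by (elim disjE) simp_all
qed

lemma tri_pt_0: "distinct [a, b, c] ==> tri_pt a c 0 = corner b"
 using tri_pt_real[of a b c 0] by (simp add: side_point_ends)

lemma tri_pt_1: "distinct [a, b, c] ==> tri_pt a c 1 = corner c"
 using tri_pt_real[of a b c 1] by (simp add: side_point_ends)

lemma chart_ends:
 assumes s: "s \<in> sides"
 shows "chart s 0 = fst s (corner (nx (snd s)))" "chart s 1 = fst s (corner (pv (snd s)))"
 using tri_pt_0[of "snd s" "nx (snd s)" "pv (snd s)"] tri_pt_1[of "snd s" "nx (snd s)" "pv (snd s)"]
 by (simp_all add: chart_upper)

lemma chart_end_in_M: "s \<in> sides ==> e \<in> {0, 1} ==> chart s e \<in> M"
 using T_in_M[OF fst_in_T(1)[of s] corner_in_triangle] chart_ends[of s] by (elim insertE emptyE) simp_all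

text \<open>The linear homotopy in the chart stays in the kite until time 1 and always ends at e, so
  only the end point of each path is a puncture.\<close>

lemma chart_puncture_homotopic:
 assumes s: "s \<in> sides" and e: "e \<in> {0, 1}"
  and r: "continuous_on {0..1} r1" "continuous_on {0..1} r2"
  and k: "\<And>t. t \<in> {0..<1} ==> r1 t \<in> kite" "\<And>t. t \<in> {0..<1} ==> r2 t \<in> kite"
  and ends: "r1 1 = e" "r2 1 = e" "r1 0 = r2 (0::real)"
  and c: "\<And>t. t \<in> {0..1} ==> c t = chart s (r1 t)" "\<And>t. t \<in> {0..1} ==> d t = chart s (r2 t)"
 shows "puncture_homotopic M P c d"
proof -
 define g where "g u t = (1 - u) *\<^sub>R r1 t + u *\<^sub>R r2 t" for u t
 have g: "g u t \<in> kite" if "u \<in> {0..1}" "t \<in> {0..<1}" for u t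
  unfolding g_def by (rule convexD[OF convex_kite k(1)[OF that(2)] k(2)[OF that(2)]]) (use that(1) in simp_all)
 have g1: "g u 1 = e" for u unfolding g_def ends by (simp add: scaleR_left_distrib[symmetric])
 have gK: "g u t \<in> insert 0 (insert 1 kite)" if "u \<in> {0..1}" "t \<in> {0..1}" for u t
 proof (cases "t = 1")
  case True
  then show ?thesis using e by (elim insertE emptyE) (simp_all add: g1)
 next
  case False
  then show ?thesis using g[OF that(1), of t] that(2) by simp
 qed
 have gP: "chart s (g u t) \<in> M - P" if "u \<in> {0..1}" "t \<in> {0..<1}" for u t
  by (rule subsetD[OF star_subset[OF s] chart_in_star[OF s g[OF that]]])
 have gM: "chart s (g u t) \<in> M" if "u \<in> {0..1}" "t \<in> {0..1}" for u t
 proof (cases "t = 1")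
  case True
  then show ?thesis using chart_end_in_M[OF s e] by (simp add: g1)
 next
  case False
  then have "t \<in> {0..<1}" using that(2) by simp
  from gP[OF that(1) this] show ?thesis by (rule DiffD1)
 qed
 have cont: "continuous_on ({0..1} \<times> {0..1}) (\<lambda>z. chart s (g (fst z) (snd z)))"
 proof (rule continuous_on_compose2[OF continuous_on_chart[OF s]])
  have "continuous_on ({0..1} \<times> {0..1}) (\<lambda>z :: real \<times> real. r (snd z))" if "continuous_on {0..1} r" for r :: "real => complex"
   by (rule continuous_on_compose2[OF that continuous_on_snd[OF continuous_on_id]]) (simp add: image_subset_iff)
  then show "continuous_on ({0..1} \<times> {0..1}) (\<lambda>z. g (fst z) (snd z))"
   unfolding g_def using r by (intro continuous_intros)
  show "(\<lambda>z. g (fst z) (snd z)) ` ({0..1} \<times> {0..1}) \<subseteq> insert 0 (insert 1 kite)"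
   by (rule image_subsetI, rule gK) (simp_all only: mem_Times_iff)
 qed
 have g0: "g 0 t = r1 t" "g 1 t = r2 t" "g u 0 = r1 0" for u t
  unfolding g_def by (simp_all add: ends(3) scaleR_left_distrib[symmetric])
 show ?thesis unfolding puncture_homotopic_iff
 proof (intro exI[of _ "\<lambda>z. chart s (g (fst z) (snd z))"] conjI ballI, goal_cases)
  case 1 show ?case by (rule cont)
 next
  case 2 then show ?case unfolding fst_conv snd_conv by (rule gM)
 next
  case 3 then show ?case by (simp only: fst_conv snd_conv g0 c)
 next
  case 4 then show ?case by (simp only: fst_conv snd_conv g0 c)
 next
  case 5 show ?case using c(1)[of 0] by (simp add: g0)
 next
  case 6 show ?case using c(1)[of 1] by (simp add: g1 ends)
 next
  case 7 then show ?case unfolding fst_conv snd_conv by (rule gP)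
 qed
qed

lemma vertex_path:
 assumes T: "\<tau> \<in> \<T>"
 shows "puncture_path M P (\<tau> barycentre) (\<tau> \<circ> linepath barycentre (corner i))"
proof -
 let ?l = "linepath barycentre (corner i)"
 have tri: "?l t \<in> triangle" if "t \<in> {0..1}" for t
  using convexD[OF convex_triangle barycentre_half(3) corner_in_triangle, of "1 - t" t] that
  by (simp add: linepath_def)
 have "?l t \<in> triangle - range corner" if t: "t \<in> {0..<1}" for t
 proof -
  have pos: "0 < ?l t $ j" for j
   using t by (simp add: linepath_def barycentre_def corner_nth add_pos_nonneg)
  have "?l t \<in> open_triangle" unfolding open_triangle_def using tri[of t] t pos by simp
  then show ?thesis using open_triangle_not_corner tri[of t] t by simp
 qed
 then have 2: "(\<tau> \<circ> ?l) ` {0..<1} \<subseteq> M - P"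
  unfolding image_comp[symmetric] by (intro image_subsetI) (metis T T_punctured imageE)
 have 1: "path (\<tau> \<circ> ?l)"
  by (rule path_continuous_image[OF path_linepath continuous_on_subset[OF T_continuous[OF T]]])
   (simp only: path_image_def image_subset_iff, rule ballI, rule tri)
 have "\<tau> (corner i) \<in> P" using T_in_P_iff[OF T corner_in_triangle] by simp
 then show ?thesis unfolding puncture_path_def using 1 2 by (simp add: pathstart_compose pathfinish_compose)
qed

text \<open>Both paths to the common vertex are read in the chart of the star: the straight one from
  the centre above the edge, and the crossing followed by the image of a straight one below the
  edge. Then \<open>chart_puncture_homotopic\<close> compares them.\<close>

lemma corner_homotopic:
 assumes s: "s \<in> sides" and j: "j ~= snd s"
 shows "puncture_homotopic M P (fst s \<circ> linepath barycentre (corner j))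
  (crossing s +++ (fst (opp s) \<circ> linepath barycentre (corner (gperm s j))))"
proof -
 \<comment> \<open>In the chart the common vertex is the end 0 or 1 of the edge; b represents the
   centre in the coordinates of either triangle.\<close>
 define e :: complex where "e = (if j = nx (snd s) then 0 else 1)"
 define b where "b = Complex (1/3) (1/3)"
 let ?a = "snd s" and ?c = "pv (snd s)" and ?a' = "snd (opp s)" and ?c' = "gperm s (pv (snd s))"
 let ?u = "untwist (gfun_inv s)"
 have j: "j = nx (snd s) \<or> j = pv (snd s)" using three_nx_cases[of j "snd s"] j by simp
 have e01: "e \<in> {0, 1}" by (simp add: e_def)
 have d: "distinct [?a, nx ?a, ?c]" by simp
 have d': "distinct [?a', gperm s (nx ?a), ?c']" by (rule gperm(3)[OF s])
 have te: "tri_pt ?a ?c e = corner j" "tri_pt ?a' ?c' e = corner (gperm s j)"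
  using j tri_pt_0[OF d] tri_pt_1[OF d] tri_pt_0[OF d'] tri_pt_1[OF d'] unfolding e_def by (elim disjE; simp)+
 have tb: "tri_pt a c b = barycentre" for a c by (simp add: tri_pt_def b_def barycentre_def vec_eq_iff)
 have b: "b \<in> kite" by (simp add: kite_def b_def)
 have lk: "linepath b e t \<in> kite" if "t \<in> {0..<1}" for t
  unfolding linepath_def by (rule kite_insert_convex[OF e01 b]) (use that in simp_all)
 have lIm: "Im (linepath b e t) = (1 - t) / 3" for t
  by (simp add: linepath_def b_def e_def)
 have lpos: "0 \<le> Im (linepath b e t)" if "t \<in> {0..1}" for t using that by (simp add: lIm)
 have up: "chart s (linepath b e t) = fst s (linepath barycentre (corner j) t)" if "t \<in> {0..1}" for t
  by (simp only: chart_upper[OF lpos[OF that]] tri_pt_affine tb te)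
 have low: "?u w \<in> kite" "chart s (?u w) = fst (opp s) (tri_pt ?a' ?c' w)" if w: "w \<in> kite" "0 \<le> Im w" for w
 proof -
  note k = untwist_kite[OF ginv(1-3)[OF s] w]
  show "?u w \<in> kite" by (rule k(1))
  show "chart s (?u w) = fst (opp s) (tri_pt ?a' ?c' w)"
   unfolding chart_lower_kite(1)[OF s k] twist_untwist[OF gfun(1-3)[OF s] ginv(5)[OF s] w] ..
 qed
 have ue: "?u e = e" using ginv(2,3)[OF s] by (simp add: untwist_def e_def complex_eq_iff)
 have down: "chart s (?u (linepath b e t)) = fst (opp s) (linepath barycentre (corner (gperm s j)) t)"
  if t: "t \<in> {0..1}" for t
 proof (cases "t = 1")
  case True
  have "fst s (corner j) = fst (opp s) (corner (gperm s j))" using corner_glued[OF s] j by (elim disjE) simp_all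
  then show ?thesis using up[of 1] by (simp add: True ue linepath_1')
 next
  case False
  then have "t \<in> {0..<1}" using t by simp
  then show ?thesis by (simp only: low(2)[OF lk lpos[OF t]] tri_pt_affine tb te)
 qed
 let ?r = "(chart_inv s \<circ> crossing s) +++ (?u \<circ> linepath b e)"
 note cr = crossing[OF s]
 have crs: "crossing s t \<in> star s" if "t \<in> {0..1}" for t
  using cr(2) that unfolding path_image_def by (rule subsetD[OF _ imageI])
 have st: "chart_inv s (fst s barycentre) = b" "chart_inv s (fst (opp s) barycentre) = ?u b"
 proof -
  have 1: "chart s b = fst s barycentre" using up[of 0] by (simp add: linepath_0')
  show "chart_inv s (fst s barycentre) = b" unfolding 1[symmetric] by (rule chart_inv_chart[OF s b])
  have bI: "0 \<le> Im b" by (simp add: b_def)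
  have 2: "chart s (?u b) = fst (opp s) barycentre" by (simp only: low(2)[OF b bI] tb)
  show "chart_inv s (fst (opp s) barycentre) = ?u b" unfolding 2[symmetric] by (rule chart_inv_chart[OF s low(1)[OF b bI]])
 qed
 show ?thesis
 proof (rule chart_puncture_homotopic[OF s e01, of "linepath b e" ?r])
  show "continuous_on {0..1} (linepath b e)" by (rule continuous_on_linepath)
  have p1: "path (chart_inv s \<circ> crossing s)"
   by (rule path_continuous_image[OF cr(1) continuous_on_subset[OF continuous_on_chart_inv[OF s] cr(2)]])
  have p2: "path (?u \<circ> linepath b e)"
  proof (rule path_continuous_image[OF path_linepath continuous_on_untwist[OF ginv(4)[OF s]]])
   fix z assume "z \<in> path_image (linepath b e)"
   then obtain t where "t \<in> {0..1}" "z = linepath b e t" unfolding path_image_def by (elim imageE)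
   then show "Im z ~= 1" by (simp add: lIm)
  qed
  have "path ?r" by (rule path_join_imp[OF p1 p2]) (simp add: pathstart_compose pathfinish_compose cr st)
  then show "continuous_on {0..1} ?r" by (simp only: path_def)
  show "linepath b e t \<in> kite" if "t \<in> {0..<1}" for t by (rule lk[OF that])
  show "?r t \<in> kite" if t: "t \<in> {0..<1}" for t
  proof (cases "t \<le> 1/2")
   case True
   then show ?thesis using chart_inv_in_kite(1)[OF s crs[of "2 * t"]] t by (simp add: joinpaths_def)
  next
   case False
   then have "2 * t - 1 \<in> {0..<1}" "2 * t - 1 \<in> {0..1}" using t by simp_all
   from low(1)[OF lk[OF this(1)] lpos[OF this(2)]] show ?thesis using False by (simp add: joinpaths_def)
  qed
  show "linepath b e 1 = e" by (rule linepath_1')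
  show "?r 1 = e" by (simp add: joinpaths_def ue linepath_1')
  show "linepath b e 0 = ?r 0" using cr(3) st(1) by (simp add: joinpaths_def pathstart_def linepath_0')
  show "(fst s \<circ> linepath barycentre (corner j)) t = chart s (linepath b e t)" if "t \<in> {0..1}" for t
   by (simp only: up[OF that] o_def)
  show "(crossing s +++ (fst (opp s) \<circ> linepath barycentre (corner (gperm s j)))) t = chart s (?r t)"
   if t: "t \<in> {0..1}" for t
  proof (cases "t \<le> 1/2")
   case True
   then show ?thesis using chart_inv_in_kite(2)[OF s crs[of "2 * t"]] t by (simp add: joinpaths_def)
  next
   case False
   then have "2 * t - 1 \<in> {0..1}" using t by simp
   from down[OF this] show ?thesis using False by (simp add: joinpaths_def)
  qed
 qed
qed

end

locale pointed_surface = bipartite_surface M P \<T> for M P :: "'a::t2_space set" and \<T> +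
 fixes x0 :: 'a
 assumes P_subset: "P \<subseteq> M" and x0: "x0 \<in> M - P"
begin

text \<open>Such a path stands for the lift of \<tau> that it reaches in the universal
  cover.\<close>

definition based :: "(real => 'a) => (real^3 => 'a) => bool" where
 "based \<delta> \<tau> \<longleftrightarrow> \<tau> \<in> \<T> \<and> path \<delta> \<and> path_image \<delta> \<subseteq> M - P \<and> pathstart \<delta> = x0 \<and> pathfinish \<delta> = \<tau> barycentre"

lemma basedD:
 assumes "based \<delta> \<tau>"
 shows "\<tau> \<in> \<T>" "path \<delta>" "path_image \<delta> \<subseteq> M - P" "pathstart \<delta> = x0" "pathfinish \<delta> = \<tau> barycentre"
 using assms unfolding based_def by blast+

lemma pth_based: "based \<delta> \<tau> ==> pth \<delta> x0 (\<tau> barycentre)"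
 unfolding based_def pth_def by blast

lemma vertex_path_ends:
 "\<tau> \<in> \<T> ==> pathstart (\<tau> \<circ> linepath barycentre (corner i)) = \<tau> barycentre"
 by (simp add: pathstart_compose)

lemma based_vertex_path:
 assumes "based \<delta> \<tau>"
 shows "puncture_path M P x0 (\<delta> +++ (\<tau> \<circ> linepath barycentre (corner i)))"
 using basedD[OF assms] vertex_path[of \<tau> i] by (intro puncture_path_join) simp_all

abbreviation vertex :: "(real => 'a) => (real^3 => 'a) => 3 => (real => 'a) set" where
 "vertex \<equiv> farey_vertex M P"

lemma vertex_in_farey_set: "based \<delta> \<tau> ==> vertex \<delta> \<tau> i \<in> farey_set M P x0"
 unfolding farey_vertex_def farey_set_def using based_vertex_path[of \<delta> \<tau> i] by blast

lemma vertex_homotopic: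
 assumes "based \<delta> \<tau>" "\<delta> \<simeq> \<delta>'"
 shows "vertex \<delta> \<tau> i = vertex \<delta>' \<tau> i"
 unfolding farey_vertex_def
 by (intro puncture_class_eqI puncture_homotopic_join[OF assms(2) puncture_homotopic_refl[OF vertex_path P_subset]])
  (simp_all only: basedD[OF assms(1)] vertex_path_ends[OF basedD(1)[OF assms(1)]])

definition loop :: "(real => 'a) => bool" where
 "loop p \<longleftrightarrow> path p \<and> path_image p \<subseteq> M - P \<and> pathstart p = x0 \<and> pathfinish p = x0"

lemma loopD:
 assumes "loop p"
 shows "path p" "path_image p \<subseteq> M - P" "pathstart p = x0" "pathfinish p = x0"
 using assms unfolding loop_def by blast+

lemma based_join: "loop p ==> based \<delta> \<tau> ==> based (p +++ \<delta>) \<tau>"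
 unfolding based_def loop_def by (simp add: subset_path_image_join)

lemma based_gallery: "based \<delta> \<tau> ==> is_gallery \<tau> w \<tau>' ==> based (\<delta> +++ gpath \<tau> w) \<tau>'"
 using gpath[of \<tau> w \<tau>'] is_gallery_T[of \<tau> w \<tau>'] unfolding based_def by (simp add: subset_path_image_join)

lemma based_crossing: "s \<in> sides ==> based \<delta> (fst s) ==> based (\<delta> +++ crossing s) (fst (opp s))"
 using crossing[of s] fst_in_T(2)[of s] unfolding based_def by (simp add: subset_path_image_join)

abbreviation cl :: "(real => 'a) => (real => 'a) set" where
 "cl \<equiv> path_class (M - P)"

abbreviation \<pi>\<^sub>1 where "\<pi>\<^sub>1 \<equiv> fundamental_group (M - P) x0"

lemma carrier_fundamental: "carrier \<pi>\<^sub>1 = {cl p | p. loop p}"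
 unfolding fundamental_group_def loop_def by simp

lemma cl_eq_iff: "loop p ==> cl p = cl q \<longleftrightarrow> p \<simeq> q"
 unfolding path_class_def loop_def
 by (metis (mono_tags, lifting) homotopic_paths_refl homotopic_paths_sym homotopic_paths_trans mem_Collect_eq Collect_cong)

lemma cl_refl: "loop p ==> p \<in> cl p"
 unfolding path_class_def loop_def by simp

lemma farey_act_vertex:
 assumes p: "loop p" and b: "based \<delta> \<tau>"
 shows "farey_act M P (cl p) (vertex \<delta> \<tau> i) = vertex (p +++ \<delta>) \<tau> i"
proof -
 let ?v = "\<tau> \<circ> linepath barycentre (corner i)"
 note pD = loopD[OF p] and bD = basedD[OF b]
 have v: "puncture_path M P (\<tau> barycentre) ?v" by (rule vertex_path[OF bD(1)])
 have as: "puncture_homotopic M P (p +++ (\<delta> +++ ?v)) ((p +++ \<delta>) +++ ?v)"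
  by (rule puncture_homotopic_assoc[OF pD(1,2) bD(2,3) v _ bD(5) P_subset]) (simp only: pD bD)
 show ?thesis
 proof (intro equalityI subsetI)
  fix d assume "d \<in> farey_act M P (cl p) (vertex \<delta> \<tau> i)"
  then obtain p' c where d: "p \<simeq> p'" "puncture_homotopic M P (\<delta> +++ ?v) c" "puncture_homotopic M P (p' +++ c) d"
   unfolding farey_act_def farey_vertex_def puncture_class_def path_class_def mem_Collect_eq by (elim bexE) simp
  have "puncture_homotopic M P (p +++ (\<delta> +++ ?v)) (p' +++ c)"
   by (rule puncture_homotopic_join[OF d(1,2)]) (simp add: pD bD)
  from puncture_homotopic_trans[OF puncture_homotopic_sym[OF as] puncture_homotopic_trans[OF this d(3)]]
  show "d \<in> vertex (p +++ \<delta>) \<tau> i" unfolding farey_vertex_def puncture_class_def mem_Collect_eq .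
 next
  fix d assume "d \<in> vertex (p +++ \<delta>) \<tau> i"
  then have "puncture_homotopic M P ((p +++ \<delta>) +++ ?v) d" unfolding farey_vertex_def puncture_class_def mem_Collect_eq .
  from puncture_homotopic_trans[OF as this] show "d \<in> farey_act M P (cl p) (vertex \<delta> \<tau> i)"
   unfolding farey_act_def farey_vertex_def puncture_class_def mem_Collect_eq
   by (intro bexI[OF _ cl_refl[OF p]] bexI[of _ "\<delta> +++ ?v"])
    (simp_all only: mem_Collect_eq puncture_homotopic_refl[OF based_vertex_path[OF b] P_subset])
 qed
qed

text \<open>This is \<open>corner_homotopic\<close> preceded by \<delta>: adjacent lifted triangles
  share the end points of their common edge.\<close>

lemma vertex_crossing:
 assumes s: "s \<in> sides" and b: "based \<delta> (fst s)" and j: "j ~= snd s"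
 shows "vertex (\<delta> +++ crossing s) (fst (opp s)) (gperm s j) = vertex \<delta> (fst s) j"
proof -
 let ?v = "fst s \<circ> linepath barycentre (corner j)" and ?v' = "fst (opp s) \<circ> linepath barycentre (corner (gperm s j))"
 note bD = basedD[OF b] and c = crossing[OF s]
 have r: "\<delta> \<simeq> \<delta>" using bD by simp
 have "puncture_homotopic M P (\<delta> +++ ?v) (\<delta> +++ (crossing s +++ ?v'))"
  by (rule puncture_homotopic_join[OF r corner_homotopic[OF s j]]) (simp add: bD pathstart_compose)
 moreover have "puncture_homotopic M P (\<delta> +++ (crossing s +++ ?v')) ((\<delta> +++ crossing s) +++ ?v')"
  by (rule puncture_homotopic_assoc[OF bD(2,3) c(1,5) vertex_path[OF fst_in_T(2)[OF s]] _ c(4) P_subset]) (simp only: bD c)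
 ultimately have "puncture_homotopic M P (\<delta> +++ ?v) ((\<delta> +++ crossing s) +++ ?v')" by (rule puncture_homotopic_trans)
 from puncture_class_eqI[OF this] show ?thesis unfolding farey_vertex_def by (rule sym)
qed

end

section \<open>The cocycle of a bent representation\<close>

text \<open>What the comparison uses about a bent crossing and its unbent companion: the same
  corners, shear and relabelling, and x replaced by -1.\<close>

definition crossing_form :: "3 => (3 => 3) => complex^3^3 => real^3^3 => bool" where
 "crossing_form a \<sigma> X N \<longleftrightarrow> (\<exists>b c t x. distinct [a, b, c] \<and> 0 < t \<and> cmod x = 1 \<and>
  X = cross a b c (of_real t) x ** perm_matrix \<sigma> \<and> N = cross a b c t (-1) ** perm_matrix \<sigma>)"

locale bent_surface = pointed_surface M P \<T> x0 for M P :: "'a::t2_space set" and \<T> x0 +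
 fixes \<rho> :: "(real => 'a) set => (complex^3^3) set" and \<phi> :: "(real => 'a) set => (complex^3) set"
 assumes \<rho>_hom: "\<rho> \<in> hom (fundamental_group (M - P) x0) PU21"
  and \<phi>_act: "\<And>\<gamma> \<xi>. \<gamma> \<in> carrier (fundamental_group (M - P) x0) ==> \<xi> \<in> farey_set M P x0 ==>
   \<phi> (farey_act M P \<gamma> \<xi>) = PU21_act (\<rho> \<gamma>) (\<phi> \<xi>)"
  and \<phi>_triangle: "\<And>a b c. (a, b, c) \<in> farey_triangles M P \<T> x0 ==> real_ideal_triangle (\<phi> a) (\<phi> b) (\<phi> c)"
begin

definition framed :: "(real => 'a) => (real^3 => 'a) => complex^3^3 => bool" where
 "framed \<delta> \<tau> F \<longleftrightarrow> is_frame F \<and> (\<forall>j. \<phi> (vertex \<delta> \<tau> j) = vec.span {column j F})"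

lemma framedD: "framed \<delta> \<tau> F ==> is_frame F" "framed \<delta> \<tau> F ==> \<phi> (vertex \<delta> \<tau> j) = vec.span {column j F}"
 unfolding framed_def by blast+

lemma framed_exists:
 assumes "based \<delta> \<tau>"
 shows "\<exists>F. framed \<delta> \<tau> F"
proof -
 have "(vertex \<delta> \<tau> 1, vertex \<delta> \<tau> 2, vertex \<delta> \<tau> 3) \<in> farey_triangles M P \<T> x0"
  unfolding farey_triangles_def using assms unfolding based_def by blast
 then show ?thesis
 proof (rule frame_exists[OF \<phi>_triangle])
  fix F assume "is_frame F" "\<And>j. \<phi> (vertex \<delta> \<tau> j) = vec.span {column j F}"
  then have "framed \<delta> \<tau> F" unfolding framed_def by (intro conjI allI)
  then show ?thesis by (rule exI)
 qed
qed

lemma framed_unique: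
 assumes "framed \<delta> \<tau> F" "framed \<delta> \<tau> G"
 shows "\<exists>c. cmod c = 1 \<and> G = mat c ** F"
proof -
 have "vec.span {column j G} = vec.span {column j F}" for j
  using framedD(2)[OF assms(1), of j] framedD(2)[OF assms(2), of j] by simp
 then obtain c where "cmod c = 1" "G = mat c ** F" by (rule frame_unique[OF framedD(1)[OF assms(1)] framedD(1)[OF assms(2)]])
 then show ?thesis by (intro exI conjI)
qed

lemma framed_homotopic:
 assumes "based \<delta> \<tau>" "\<delta> \<simeq> \<delta>'" "framed \<delta> \<tau> F"
 shows "framed \<delta>' \<tau> F"
 using assms(3) unfolding framed_def vertex_homotopic[OF assms(1,2)] .

lemma \<rho>_lift:
 assumes "loop p"
 shows "\<exists>A \<in> carrier U21. \<rho> (cl p) = pclass A"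
proof -
 have "cl p \<in> carrier \<pi>\<^sub>1" unfolding carrier_fundamental using assms by blast
 then have "\<rho> (cl p) \<in> carrier PU21" using \<rho>_hom unfolding hom_def by blast
 then show ?thesis unfolding carrier_PU21 by (elim imageE) blast
qed

lemma framed_act:
 assumes p: "loop p" and b: "based \<delta> \<tau>" and A: "A \<in> carrier U21" "\<rho> (cl p) = pclass A" and F: "framed \<delta> \<tau> F"
 shows "framed (p +++ \<delta>) \<tau> (A ** F)"
 unfolding framed_def
proof (intro conjI allI)
 show "is_frame (A ** F)" by (rule is_frame_U21[OF A(1) framedD(1)[OF F]])
 fix j
 have c: "cl p \<in> carrier \<pi>\<^sub>1" unfolding carrier_fundamental using p by blast
 have "\<phi> (vertex (p +++ \<delta>) \<tau> j) = PU21_act (pclass A) (vec.span {column j F})"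
  unfolding farey_act_vertex[OF p b, symmetric] \<phi>_act[OF c vertex_in_farey_set[OF b]] A(2) framedD(2)[OF F] ..
 then show "\<phi> (vertex (p +++ \<delta>) \<tau> j) = vec.span {column j (A ** F)}"
  by (simp only: PU21_act_span column_mult)
qed

definition crossing_matrix :: "'a side => real => complex => complex^3^3" where
 "crossing_matrix s t x = cross (snd s) (nx (snd s)) (pv (snd s)) (of_real t) x ** perm_matrix (gperm s)"

lemma framed_crossing_exists:
 assumes s: "s \<in> sides" and b: "based \<delta> (fst s)" and F: "framed \<delta> (fst s) F"
  and G: "framed (\<delta> +++ crossing s) (fst (opp s)) G"
 shows "\<exists>t x k. 0 < t \<and> cmod x = 1 \<and> cmod k = 1 \<and> G = mat k ** (F ** crossing_matrix s t x)"
proof -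
 have sp: "vec.span {column (gperm s j) G} = vec.span {column j F}" if "j ~= snd s" for j
  using vertex_crossing[OF s b that] framedD(2)[OF F, of j] framedD(2)[OF G, of "gperm s j"] by simp
 have d: "distinct [snd s, nx (snd s), pv (snd s)]" by simp
 obtain t x k where "0 < t" "cmod x = 1" "cmod k = 1"
  "G = mat k ** (F ** (cross (snd s) (nx (snd s)) (pv (snd s)) (of_real t) x ** perm_matrix (gperm s)))"
  by (rule frame_cross[OF framedD(1)[OF F] framedD(1)[OF G] d gperm(1)[OF s] sp sp]) simp_all
 then show ?thesis unfolding crossing_matrix_def by blast
qed

text \<open>The parameters belong to the edge: they must serve every lift of the triangle and every
  choice of frames, up to a unit scalar.\<close>

definition bending :: "'a side => real \<times> complex => bool" where
 "bending s tx \<longleftrightarrow> 0 < fst tx \<and> cmod (snd tx) = 1 \<and>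
  (\<forall>\<delta> F G. based \<delta> (fst s) --> framed \<delta> (fst s) F --> framed (\<delta> +++ crossing s) (fst (opp s)) G -->
   (\<exists>k. cmod k = 1 \<and> G = mat k ** (F ** crossing_matrix s (fst tx) (snd tx))))"

lemma mat_left_commute: "(A :: complex^3^3) ** (mat c ** B) = mat c ** (A ** (B :: complex^3^3))"
proof -
 have "A ** (mat c ** B) = (A ** mat c) ** B" by (rule matrix_mul_assoc)
 also have "A ** mat c = mat c ** A" by (rule matrix_mult_mat_commute)
 also have "(mat c ** A) ** B = mat c ** (A ** B)" by (rule matrix_mul_assoc[symmetric])
 finally show ?thesis .
qed

lemma mat_cancel: "cmod c = 1 ==> mat (1 / c) ** (mat c ** (B :: complex^3^3)) = B"
 by (subst matrix_mul_assoc, subst mat_mult_mat) auto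

lemma mat_collect: "mat a ** (mat b ** ((mat c ** F) ** Y)) = mat (a * b * c) ** ((F :: complex^3^3) ** (Y :: complex^3^3))"
proof -
 have "mat a ** (mat b ** ((mat c ** F) ** Y)) = ((mat a ** mat b) ** mat c) ** (F ** Y)" by (simp only: matrix_mul_assoc)
 then show ?thesis by (simp only: mat_mult_mat)
qed

lemma homotopic_loop_between:
 assumes b: "based \<delta>0 \<tau>" "based \<delta> \<tau>"
 shows "loop (\<delta> +++ reversepath \<delta>0)" "(\<delta> +++ reversepath \<delta>0) +++ \<delta>0 \<simeq> \<delta>"
proof -
 note d0 = pth_based[OF b(1)] and d = pth_based[OF b(2)]
 note r = pth_reverse[OF d0]
 show "loop (\<delta> +++ reversepath \<delta>0)" using pth_join[OF d r] unfolding loop_def pth_def .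
 have "(\<delta> +++ reversepath \<delta>0) +++ \<delta>0 \<simeq> \<delta> +++ (reversepath \<delta>0 +++ \<delta>0)" by (rule pth_assoc[OF d r d0])
 also have "\<dots> \<simeq> \<delta> +++ const_path (\<tau> barycentre)"
  by (rule pth_joinI[OF pth_refl[OF d] pth_linv[OF d0] d pth_join[OF r d0]])
 also have "\<dots> \<simeq> \<delta>" by (rule pth_rid[OF d])
 finally show "(\<delta> +++ reversepath \<delta>0) +++ \<delta>0 \<simeq> \<delta>" .
qed

text \<open>Any lift is the image of a fixed one under a loop p. A lift of \<rho> (cl p) to U(2,1)
  carries the frames of the fixed triangle and of its neighbour to frames of the translated ones,
  and such a left factor does not affect the crossing matrix.\<close>

lemma bending_exists:
 assumes s: "s \<in> sides"
 shows "\<exists>tx. bending s tx"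
proof (cases "\<exists>\<delta>. based \<delta> (fst s)")
 case False
 \<comment> \<open>Without a lift of the triangle the condition on frames is vacuous, and (1, 1)
   meets the conditions on t and x.\<close>
 then have "bending s (1, 1)" unfolding bending_def by simp
 then show ?thesis by (rule exI)
next
 case True
 then obtain \<delta>0 where b0: "based \<delta>0 (fst s)" by (rule exE)
 obtain F\<^sub>0 where F0: "framed \<delta>0 (fst s) F\<^sub>0" using framed_exists[OF b0] by (rule exE)
 obtain G\<^sub>0 where G0: "framed (\<delta>0 +++ crossing s) (fst (opp s)) G\<^sub>0" using framed_exists[OF based_crossing[OF s b0]] by (rule exE)
 obtain t x k where t: "0 < t" "cmod x = 1" "cmod k = 1" "G\<^sub>0 = mat k ** (F\<^sub>0 ** crossing_matrix s t x)"
  using framed_crossing_exists[OF s b0 F0 G0] by (elim exE conjE)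
 have key: "\<exists>k. cmod k = 1 \<and> G = mat k ** (F ** crossing_matrix s t x)"
  if b: "based \<delta> (fst s)" and F: "framed \<delta> (fst s) F" and G: "framed (\<delta> +++ crossing s) (fst (opp s)) G" for \<delta> F G
 proof -
  let ?p = "\<delta> +++ reversepath \<delta>0"
  note p = homotopic_loop_between[OF b0 b]
  note d0 = basedD[OF b0] and pD = loopD[OF p(1)] and c = crossing[OF s]
  obtain A where A: "A \<in> carrier U21" "\<rho> (cl ?p) = pclass A" using \<rho>_lift[OF p(1)] by (elim bexE)
  have 1: "framed \<delta> (fst s) (A ** F\<^sub>0)"
   by (rule framed_homotopic[OF based_join[OF p(1) b0] p(2) framed_act[OF p(1) b0 A F0]])
  have "?p +++ (\<delta>0 +++ crossing s) \<simeq> (?p +++ \<delta>0) +++ crossing s"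
   by (rule homotopic_paths_assoc[OF pD(1,2) d0(2,3) c(1,5)]) (simp_all only: pD d0 c)
  also have "\<dots> \<simeq> \<delta> +++ crossing s"
   by (rule homotopic_paths_join[OF p(2)]) (use c d0 in simp_all)
  finally have 2: "framed (\<delta> +++ crossing s) (fst (opp s)) (A ** G\<^sub>0)"
   by (rule framed_homotopic[OF based_join[OF p(1) based_crossing[OF s b0]] _ framed_act[OF p(1) based_crossing[OF s b0] A G0]])
  obtain c1 where c1: "cmod c1 = 1" "F = mat c1 ** (A ** F\<^sub>0)" using framed_unique[OF 1 F] by (elim exE conjE)
  obtain c2 where c2: "cmod c2 = 1" "G = mat c2 ** (A ** G\<^sub>0)" using framed_unique[OF 2 G] by (elim exE conjE)
  have AF: "A ** F\<^sub>0 = mat (1 / c1) ** F" unfolding c1(2) by (rule mat_cancel[OF c1(1), symmetric])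
  have "G = mat c2 ** (mat k ** ((A ** F\<^sub>0) ** crossing_matrix s t x))"
   unfolding c2(2) t(4) by (simp only: mat_left_commute[of A k]) (simp only: matrix_mul_assoc[of A])
  then have e: "G = mat (c2 * k * (1 / c1)) ** (F ** crossing_matrix s t x)"
   unfolding AF mat_collect .
  have n: "cmod (c2 * k * (1 / c1)) = 1" using c1(1) c2(1) t(3) by (simp add: norm_mult norm_divide)
  show ?thesis by (rule exI, rule conjI[OF n e])
 qed
 have "bending s (t, x)" unfolding bending_def fst_conv snd_conv by (intro conjI allI impI t(1,2)) (rule key)
 then show ?thesis by (rule exI)
qed

definition bend :: "'a side => real \<times> complex" where
 "bend s = (SOME tx. bending s tx)"

lemma bend: "s \<in> sides ==> bending s (bend s)"
 unfolding bend_def by (rule someI_ex[OF bending_exists])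

definition colouring :: "((real^3 => 'a) => bool) => bool" where
 "colouring c \<longleftrightarrow> (\<forall>s\<in>sides. c (fst (opp s)) = (\<not> c (fst s)))"

lemma colouring_exists: "\<exists>c. colouring c"
 using bipartite[unfolded bipartite_triangulation_def]
proof (elim exE)
 fix c :: "(real^3 => 'a) => bool"
 assume C: "\<forall>s\<in>sides. \<forall>s'\<in>sides. s ~= s' \<and> side_image s = side_image s' --> c (fst s) ~= c (fst s')"
 have "colouring c" unfolding colouring_def
 proof (rule ballI)
  fix s :: "'a side"
  assume s: "s \<in> sides"
  have "c (fst s) ~= c (fst (opp s))"
   by (rule C[THEN bspec, OF s, THEN bspec, OF opp(1)[OF s], THEN mp])
    (rule conjI[OF opp(2)[OF s, THEN not_sym] opp(3)[OF s, symmetric]])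
  then show "c (fst (opp s)) = (\<not> c (fst s))" by (cases "c (fst s)") simp_all
 qed
 then show "\<exists>c. colouring c" by blast
qed

definition colour :: "(real^3 => 'a) => bool" where
 "colour = (SOME c. colouring c)"

lemma colour:
 assumes "s \<in> sides"
 shows "colour (fst (opp s)) = (\<not> colour (fst s))"
proof -
 have "colouring colour" unfolding colour_def by (rule someI_ex[OF colouring_exists])
 then show ?thesis unfolding colouring_def using assms by (rule bspec)
qed

text \<open>Only one of the two sides of an edge carries a choice of bending parameters; the other one
 gets the inverse matrix.\<close>

definition cX :: "'a side => complex^3^3" where
 "cX s = (let r = opp s in if colour (fst s) then crossing_matrix s (fst (bend s)) (snd (bend s))
  else cross (gperm r (snd r)) (gperm r (nx (snd r))) (gperm r (pv (snd r)))
   (1 / of_real (fst (bend r))) (1 / snd (bend r)) ** perm_matrix (gperm s))"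

definition rX :: "'a side => real^3^3" where
 "rX s = (let r = opp s in if colour (fst s)
  then cross (snd s) (nx (snd s)) (pv (snd s)) (fst (bend s)) (-1) ** perm_matrix (gperm s)
  else cross (gperm r (snd r)) (gperm r (nx (snd r))) (gperm r (pv (snd r))) (1 / fst (bend r)) (-1) ** perm_matrix (gperm s))"

lemma bend_pos: "s \<in> sides ==> 0 < fst (bend s) \<and> cmod (snd (bend s)) = 1"
proof -
 assume s: "s \<in> sides"
 note b = bend[OF s, unfolded bending_def]
 show ?thesis by (rule conjI[OF conjunct1[OF b] conjunct1[OF conjunct2[OF b]]])
qed

lemma gperm_o:
 assumes "s \<in> sides"
 shows "gperm (opp s) \<circ> gperm s = id" "gperm s \<circ> gperm (opp s) = id"
proof -
 show "gperm (opp s) \<circ> gperm s = id" by (rule ext) (simp only: o_def id_def gperm_opp[OF assms])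
 show "gperm s \<circ> gperm (opp s) = id"
  by (rule ext) (simp only: o_def id_def gperm_opp[OF opp(1)[OF assms], unfolded opp_opp[OF assms]])
qed

lemma coloured_inverse:
 assumes s: "s \<in> sides" and c: "colour (fst s)"
 shows "cX s ** cX (opp s) = mat 1" "rX s ** rX (opp s) = mat 1"
proof -
 have c': "\<not> colour (fst (opp s))" using colour[OF s] c by simp
 have d: "distinct [snd s, nx (snd s), pv (snd s)]" by simp
 have nz: "complex_of_real (fst (bend s)) ~= 0" "snd (bend s) ~= 0" "fst (bend s) ~= 0"
 proof -
  show "complex_of_real (fst (bend s)) ~= 0" "fst (bend s) ~= 0" using conjunct1[OF bend_pos[OF s]] by simp_all
  show "snd (bend s) ~= 0" using conjunct2[OF bend_pos[OF s]] by (metis norm_zero zero_neq_one)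
 qed
 show "cX s ** cX (opp s) = mat 1"
  unfolding cX_def Let_def crossing_matrix_def opp_opp[OF s] if_P[OF c] if_not_P[OF c']
  by (rule cross_perm_inverse[OF d nz(1,2) gperm_o[OF s]])
 show "rX s ** rX (opp s) = mat 1"
  unfolding rX_def Let_def opp_opp[OF s] if_P[OF c] if_not_P[OF c']
  using cross_perm_inverse[OF d nz(3) _ gperm_o[OF s], of "-1"] by simp
qed

lemma square_inverse:
 fixes A B :: "'b::field^3^3"
 shows "A ** B = mat 1 ==> B ** A = mat 1"
 by (simp add: matrix_left_right_inverse)

lemma inverse_cX: "inverse_crossings cX" and inverse_rX: "inverse_crossings rX"
proof -
 have "cX s ** cX (opp s) = mat 1 \<and> rX s ** rX (opp s) = mat 1" if s: "s \<in> sides" for s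
 proof (cases "colour (fst s)")
  case True
  then show ?thesis using coloured_inverse[OF s] by simp
 next
  case False
  then have "colour (fst (opp s))" using colour[OF s] by simp
  note i = coloured_inverse[OF opp(1)[OF s] this, unfolded opp_opp[OF s]]
  show ?thesis using square_inverse[OF i(1)] square_inverse[OF i(2)] by (rule conjI)
 qed
 note i = this
 show "inverse_crossings cX" unfolding inverse_crossings_def by (rule ballI, rule conjunct1[OF i])
 show "inverse_crossings rX" unfolding inverse_crossings_def by (rule ballI, rule conjunct2[OF i])
qed

lemma crossing_form:
 assumes s: "s \<in> sides"
 shows "crossing_form (snd s) (gperm s) (cX s) (rX s)"
proof (cases "colour (fst s)")
 case True
 have d: "distinct [snd s, nx (snd s), pv (snd s)]" by simp
 show ?thesis unfolding crossing_form_def cX_def rX_def Let_def crossing_matrix_def if_P[OF True]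
  by (rule exI[of _ "nx (snd s)"], rule exI[of _ "pv (snd s)"], rule exI[of _ "fst (bend s)"], rule exI[of _ "snd (bend s)"],
   intro conjI refl d conjunct1[OF bend_pos[OF s]] conjunct2[OF bend_pos[OF s]])
next
 case False
 let ?r = "opp s"
 have r: "?r \<in> sides" by (rule opp(1)[OF s])
 have e: "gperm ?r (snd ?r) = snd s" using gperm(2)[OF r] opp_opp[OF s] by simp
 have d: "distinct [snd s, gperm ?r (nx (snd ?r)), gperm ?r (pv (snd ?r))]" using gperm(3)[OF r] opp_opp[OF s] by simp
 have "0 < 1 / fst (bend ?r)" "cmod (1 / snd (bend ?r)) = 1" using bend_pos[OF r] by (simp_all add: norm_divide)
 note p = this
 have o: "1 / complex_of_real (fst (bend ?r)) = of_real (1 / fst (bend ?r))" by simp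
 show ?thesis unfolding crossing_form_def cX_def rX_def Let_def if_not_P[OF False] e o
  by (rule exI[of _ "gperm ?r (nx (snd ?r))"], rule exI[of _ "gperm ?r (pv (snd ?r))"],
   rule exI[of _ "1 / fst (bend ?r)"], rule exI[of _ "1 / snd (bend ?r)"], intro conjI refl d p)
qed

lemma crossing_back_homotopic:
 assumes s: "s \<in> sides" and b: "based \<delta> (fst s)"
 shows "(\<delta> +++ crossing s) +++ crossing (opp s) \<simeq> \<delta>"
proof -
 note d = pth_based[OF b] and c = pth_crossing[OF s] and c' = pth_crossing[OF opp(1)[OF s], unfolded opp_opp[OF s]]
 have "(\<delta> +++ crossing s) +++ crossing (opp s) \<simeq> \<delta> +++ (crossing s +++ crossing (opp s))"
  by (rule pth_assoc[OF d c c'])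
 also have "\<dots> \<simeq> \<delta> +++ const_path (fst s barycentre)"
  by (rule pth_joinI[OF pth_refl[OF d] crossing_pair[OF s] d pth_join[OF c c']])
 also have "\<dots> \<simeq> \<delta>" by (rule pth_rid[OF d])
 finally show ?thesis .
qed

text \<open>On the side without parameters of its own the edge is crossed back, where the chosen
  parameters apply, and the resulting equation is inverted.\<close>

lemma framed_crossing:
 assumes s: "s \<in> sides" and b: "based \<delta> (fst s)" and F: "framed \<delta> (fst s) F"
  and G: "framed (\<delta> +++ crossing s) (fst (opp s)) G"
 shows "\<exists>k. cmod k = 1 \<and> G = mat k ** (F ** cX s)"
proof (cases "colour (fst s)")
 case True
 have "\<exists>k. cmod k = 1 \<and> G = mat k ** (F ** crossing_matrix s (fst (bend s)) (snd (bend s)))"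
  using bend[OF s] b F G unfolding bending_def by (elim conjE allE impE)
 then show ?thesis unfolding cX_def Let_def if_P[OF True] .
next
 case False
 let ?r = "opp s"
 have r: "?r \<in> sides" "opp ?r = s" by (rule opp(1)[OF s], rule opp_opp[OF s])
 have c: "colour (fst ?r)" using colour[OF s] False by simp
 have b': "based (\<delta> +++ crossing s) (fst ?r)" by (rule based_crossing[OF s b])
 have "framed ((\<delta> +++ crossing s) +++ crossing ?r) (fst s) F"
  by (rule framed_homotopic[OF b homotopic_paths_sym[OF crossing_back_homotopic[OF s b]] F])
 then have "\<exists>k. cmod k = 1 \<and> F = mat k ** (G ** crossing_matrix ?r (fst (bend ?r)) (snd (bend ?r)))"
  using bend[OF r(1)] b' G unfolding bending_def r(2) by (elim conjE allE impE)
 then obtain k where k: "cmod k = 1" "F = mat k ** (G ** cX ?r)" unfolding cX_def Let_def if_P[OF c] by (elim exE conjE)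
 have "F ** cX s = mat k ** (G ** (cX ?r ** cX s))" unfolding k(2) by (simp only: matrix_mul_assoc)
 also have "cX ?r ** cX s = mat 1" by (rule inverse_crossings(2)[OF inverse_cX s])
 finally have "F ** cX s = mat k ** G" by (simp only: matrix_mul_rid)
 then have "G = mat (1 / k) ** (F ** cX s)" using mat_cancel[OF k(1), of G] by simp
 then show ?thesis using k(1) by (intro exI[of _ "1 / k"]) (simp add: norm_divide)
qed

lemma framed_gallery:
 assumes "based \<delta> \<tau>" "framed \<delta> \<tau> F" "is_gallery \<tau> w \<tau>'" "framed (\<delta> +++ gpath \<tau> w) \<tau>' G"
 shows "\<exists>k. cmod k = 1 \<and> G = mat k ** (F ** wmat cX w)"
 using assms
proof (induction w arbitrary: \<delta> \<tau> F)
 case Nil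
 have e: "\<tau>' = \<tau>" using Nil.prems(3) unfolding is_gallery.simps by blast
 have "\<delta> +++ gpath \<tau> [] \<simeq> \<delta>"
  unfolding gpath.simps by (rule homotopic_paths_rid_const) (use basedD[OF Nil.prems(1)] in simp_all)
 from framed_homotopic[OF based_gallery[OF Nil.prems(1,3), unfolded e] this Nil.prems(4)[unfolded e]]
 have "framed \<delta> \<tau> G" .
 from framed_unique[OF Nil.prems(2) this] show ?case by (simp only: wmat.simps matrix_mul_rid)
next
 case (Cons s w)
 have s: "s \<in> sides" "fst s = \<tau>" and w: "is_gallery (fst (opp s)) w \<tau>'"
  using Cons.prems(3) unfolding is_gallery.simps by blast+
 have b: "based \<delta> (fst s)" using Cons.prems(1) unfolding s(2) .
 have b': "based (\<delta> +++ crossing s) (fst (opp s))" by (rule based_crossing[OF s(1) b])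
 obtain H where H: "framed (\<delta> +++ crossing s) (fst (opp s)) H" using framed_exists[OF b'] by (rule exE)
 note d = basedD[OF b] and c = crossing[OF s(1)] and g = gpath[OF w]
 have "\<delta> +++ gpath \<tau> (s # w) \<simeq> (\<delta> +++ crossing s) +++ gpath (fst (opp s)) w"
  unfolding gpath.simps by (rule homotopic_paths_assoc) (use d c g in simp_all)
 from framed_homotopic[OF based_gallery[OF Cons.prems(1,3)] this Cons.prems(4)]
 have "framed ((\<delta> +++ crossing s) +++ gpath (fst (opp s)) w) \<tau>' G" .
 from Cons.IH[OF b' H w this] obtain k where k: "cmod k = 1" "G = mat k ** (H ** wmat cX w)" by (elim exE conjE)
 obtain l where l: "cmod l = 1" "H = mat l ** (F ** cX s)"
  using framed_crossing[OF s(1) b _ H] Cons.prems(2) unfolding s(2) by blast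
 have "G = mat (k * l) ** (F ** wmat cX (s # w))"
  unfolding k(2) l(2) by (simp only: matrix_mul_assoc mat_mult_mat[symmetric] wmat.simps)
 then show ?case using k(1) l(1) by (intro exI[of _ "k * l"]) (simp add: norm_mult)
qed

text \<open>A F is a frame of the lift translated by p, and this lift is also reached from \<delta>
  through the gallery; \<open>framed_gallery\<close> compares the two frames.\<close>

theorem \<rho>_gallery:
 assumes p: "loop p" and b: "based \<delta> \<tau>" and w: "is_gallery \<tau> w \<tau>" and h: "p +++ \<delta> \<simeq> \<delta> +++ gpath \<tau> w"
  and F: "framed \<delta> \<tau> F" and A: "A \<in> carrier U21" "\<rho> (cl p) = pclass A"
 shows "\<exists>k. cmod k = 1 \<and> A ** F = mat k ** (F ** wmat cX w)"
 by (rule framed_gallery[OF b F w framed_homotopic[OF based_join[OF p b] h framed_act[OF p b A F]]])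

end

section \<open>Orientations\<close>

text \<open>One chart is enough to define the sign of f at z; \<open>oriented_by_iff\<close> shows
  that every chart gives the same answer.\<close>

definition oriented_by :: "('a set \<times> ('a => complex)) set => (complex => 'a) => complex => bool" where
 "oriented_by \<A> f z \<longleftrightarrow> (\<exists>(U, h)\<in>\<A>. f z \<in> U \<and> op_at (h \<circ> f) z)"

definition patch :: "'a::topological_space set => complex set => (complex => 'a) => bool" where
 "patch M \<Omega> f \<longleftrightarrow> open \<Omega> \<and> continuous_on \<Omega> f \<and> inj_on f \<Omega> \<and> f ` \<Omega> \<subseteq> M"

lemma patchD:
 assumes "patch M \<Omega> f"
 shows "open \<Omega>" "continuous_on \<Omega> f" "inj_on f \<Omega>" "f ` \<Omega> \<subseteq> M"
 using assms unfolding patch_def by blast+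

lemma patch_nbhd:
 assumes f: "patch M \<Omega> f" and z: "z \<in> \<Omega>" and U: "openin (top_of_set M) U" "f z \<in> U"
 shows "\<exists>R>0. cball z R \<subseteq> \<Omega> \<and> f ` cball z R \<subseteq> U"
proof -
 note fD = patchD[OF f]
 obtain V where V: "open V" "U = M \<inter> V" using U(1) unfolding openin_open by (elim exE conjE)
 have o: "open (\<Omega> \<inter> f -` V)" using continuous_open_preimage[OF fD(2,1) V(1)] .
 have "z \<in> \<Omega> \<inter> f -` V" using z U(2) V(2) by simp
 from bspec[OF iffD1[OF open_contains_cball o] this]
 obtain R where R: "0 < R" "cball z R \<subseteq> \<Omega> \<inter> f -` V" by (elim exE conjE)
 have "f ` cball z R \<subseteq> U" unfolding V(2) using R(2) fD(4) by blast
 then show ?thesis using R by blast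
qed

lemma patch_cball:
 assumes "patch M \<Omega> f" "cball z R \<subseteq> \<Omega>"
 shows "continuous_on (cball z R) f" "inj_on f (cball z R)"
 using patchD[OF assms(1)] assms(2) by (blast intro: continuous_on_subset inj_on_subset)+

lemma atlasD:
 assumes A: "oriented_atlas M \<A>" and U: "(U, h) \<in> \<A>"
 shows "openin (top_of_set M) U" "open (h ` U)" "continuous_on U h" "inj_on h U" "continuous_on (h ` U) (inv_into U h)"
proof -
 have *: "openin (top_of_set M) U \<and> open (h ` U) \<and> (\<exists>h'. homeomorphism U (h ` U) h h')"
  using A U unfolding oriented_atlas_def by blast
 then show "openin (top_of_set M) U" "open (h ` U)" by blast+
 obtain h' where h': "homeomorphism U (h ` U) h h'" using * by blast
 show "continuous_on U h" using h' by (rule homeomorphism_cont1)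
 show i: "inj_on h U" using h' unfolding homeomorphism_def by (metis inj_on_inverseI)
 have "inv_into U h y = h' y" if "y \<in> h ` U" for y
  using that h' i unfolding homeomorphism_def by (elim imageE) (simp add: inv_into_f_f)
 then show "continuous_on (h ` U) (inv_into U h)"
  using homeomorphism_cont2[OF h'] by (simp cong: continuous_on_cong)
qed

lemma atlas_cover:
 assumes "oriented_atlas M \<A>" "y \<in> M"
 obtains U h where "(U, h) \<in> \<A>" "y \<in> U"
 using assms unfolding oriented_atlas_def by blast

lemma atlas_orientation:
 assumes "oriented_atlas M \<A>" "(U, h) \<in> \<A>" "(V, k) \<in> \<A>" "x \<in> U" "x \<in> V"
 shows "op_at (k \<circ> inv_into U h) (h x)"
 using assms unfolding oriented_atlas_def by blast

lemma patch_chart: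
 assumes A: "oriented_atlas M \<A>" and f: "patch M \<Omega> f" and U: "(U, h) \<in> \<A>" and c: "cball z R \<subseteq> \<Omega>" "f ` cball z R \<subseteq> U"
 shows "continuous_on (cball z R) (h \<circ> f)" "inj_on (h \<circ> f) (cball z R)"
proof -
 note fc = patch_cball[OF f c(1)] and a = atlasD[OF A U]
 show "continuous_on (cball z R) (h \<circ> f)"
  by (rule continuous_on_compose[OF fc(1) continuous_on_subset[OF a(3) c(2)]])
 show "inj_on (h \<circ> f) (cball z R)" by (rule comp_inj_on[OF fc(2) inj_on_subset[OF a(4) c(2)]])
qed

text \<open>Transition maps preserve orientation, so by \<open>op_at_compose\<close> a change of
  chart does not affect the local degree.\<close>

lemma oriented_by_iff:
 assumes A: "oriented_atlas M \<A>" and f: "patch M \<Omega> f" and z: "z \<in> \<Omega>" and U: "(U, h) \<in> \<A>" "f z \<in> U"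
 shows "oriented_by \<A> f z \<longleftrightarrow> op_at (h \<circ> f) z"
proof -
 have "op_at (k \<circ> f) z \<longleftrightarrow> op_at (h \<circ> f) z"
  if V: "(V, k) \<in> \<A>" "f z \<in> V" for V k
 proof -
  note u = atlasD[OF A U(1)] and v = atlasD[OF A V(1)]
  obtain R where R: "0 < R" "cball z R \<subseteq> \<Omega>" "f ` cball z R \<subseteq> U \<inter> V"
   using patch_nbhd[OF f z openin_Int[OF u(1) v(1)]] U(2) V(2) by blast
  have fU: "f ` cball z R \<subseteq> U" and fV: "f ` cball z R \<subseteq> V" using R(3) by blast+
  have E: "open (h ` (U \<inter> V))"
  proof -
   obtain W where W: "open W" "V = M \<inter> W" using v(1) unfolding openin_open by (elim exE conjE)
   have UM: "U \<subseteq> M" by (rule openin_imp_subset[OF u(1)])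
   have "h ` (U \<inter> V) = h ` U \<inter> inv_into U h -` W"
   proof (intro equalityI subsetI)
    fix y assume "y \<in> h ` (U \<inter> V)"
    then obtain x where "x \<in> U" "x \<in> V" "y = h x" by blast
    then show "y \<in> h ` U \<inter> inv_into U h -` W" using inv_into_f_f[OF u(4)] unfolding W(2) by simp
   next
    fix y assume "y \<in> h ` U \<inter> inv_into U h -` W"
    then obtain x where "x \<in> U" "y = h x" "inv_into U h y \<in> W" by blast
    then show "y \<in> h ` (U \<inter> V)" using inv_into_f_f[OF u(4)] UM unfolding W(2) by auto
   qed
   then show ?thesis using continuous_open_preimage[OF u(5,2) W(1)] by simp
  qed
  let ?F = "k \<circ> inv_into U h"
  have sub: "inv_into U h ` h ` (U \<inter> V) \<subseteq> V" using inv_into_f_f[OF u(4)] by auto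
  have cF: "continuous_on (h ` (U \<inter> V)) ?F"
   by (rule continuous_on_compose[OF continuous_on_subset[OF u(5)] continuous_on_subset[OF v(3) sub]]) blast
  have iF: "inj_on ?F (h ` (U \<inter> V))"
   by (rule comp_inj_on[OF inj_on_subset[OF inj_on_inv_into[OF order_refl]] inj_on_subset[OF v(4) sub]]) blast
  have "op_at (?F \<circ> (h \<circ> f)) z \<longleftrightarrow>
    (op_at ?F ((h \<circ> f) z) \<longleftrightarrow> op_at (h \<circ> f) z)"
   by (rule op_at_compose[OF patch_chart[OF A f U(1) R(2) fU] R(1) cF iF E]) (use U(2) V(2) in simp)
  moreover have "op_at ?F ((h \<circ> f) z)"
   using atlas_orientation[OF A U(1) V(1) U(2) V(2)] by simp
  moreover have "op_at (?F \<circ> (h \<circ> f)) z \<longleftrightarrow> op_at (k \<circ> f) z"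
  proof (rule op_at_cong[OF R(1)])
   fix w assume "w \<in> cball z R"
   then have "f w \<in> U" using fU by blast
   then show "(?F \<circ> (h \<circ> f)) w = (k \<circ> f) w" using inv_into_f_f[OF u(4)] by simp
  qed
  ultimately show ?thesis by blast
 qed
 then show ?thesis unfolding oriented_by_def using U by blast
qed

text \<open>The sign is locally constant, since near a point one chart suffices and
  \<open>op_at_near\<close> applies.\<close>

lemma oriented_by_constant:
 assumes A: "oriented_atlas M \<A>" and f: "patch M \<Omega> f" and con: "connected \<Omega>" and z: "z \<in> \<Omega>" "z' \<in> \<Omega>"
 shows "oriented_by \<A> f z \<longleftrightarrow> oriented_by \<A> f z'"
proof (rule connected_local_const[OF con z], rule ballI)
 fix a assume a: "a \<in> \<Omega>"
 have "f a \<in> M" using patchD(4)[OF f] a by blast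
 then obtain U h where U: "(U, h) \<in> \<A>" "f a \<in> U" by (rule atlas_cover[OF A])
 obtain R where R: "0 < R" "cball a R \<subseteq> \<Omega>" "f ` cball a R \<subseteq> U"
  using patch_nbhd[OF f a atlasD(1)[OF A U(1)] U(2)] by blast
 have R2: "2 * (R / 2) = R" by simp
 note pc = patch_chart[OF A f U(1) R(2,3)]
 have key: "oriented_by \<A> f a = oriented_by \<A> f b" if b: "b \<in> ball a (R/2)" for b
 proof -
  have b': "b \<in> cball a (R/2)" "b \<in> cball a R" using b R(1) by simp_all
  have bO: "b \<in> \<Omega>" "f b \<in> U" using R(2,3) b'(2) by blast+
  have "op_at (h \<circ> f) a \<longleftrightarrow> op_at (h \<circ> f) b"
   by (rule op_at_near[where r = "R/2", unfolded R2, OF pc _ b'(1)]) (use R(1) in simp)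
  then show ?thesis unfolding oriented_by_iff[OF A f a U] oriented_by_iff[OF A f bO(1) U(1) bO(2)] .
 qed
 show "\<forall>\<^sub>F b in at a within \<Omega>. oriented_by \<A> f a = oriented_by \<A> f b"
  unfolding eventually_at_topological
  by (intro exI[of _ "ball a (R/2)"] conjI ballI impI) (use R(1) key in simp_all)
qed

lemma oriented_by_compose:
 assumes A: "oriented_atlas M \<A>" and f: "patch M \<Omega> f" and g: "patch \<Omega> \<Omega>' g" and z: "z \<in> \<Omega>'"
 shows "oriented_by \<A> (f \<circ> g) z \<longleftrightarrow> (oriented_by \<A> f (g z) \<longleftrightarrow> op_at g z)"
proof -
 note fD = patchD[OF f] and gD = patchD[OF g]
 have gz: "g z \<in> \<Omega>" using gD(4) z by blast
 have "f (g z) \<in> M" using fD(4) gz by blast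
 then obtain U h where U: "(U, h) \<in> \<A>" "f (g z) \<in> U" by (rule atlas_cover[OF A])
 obtain R where R: "0 < R" "cball (g z) R \<subseteq> \<Omega>" "f ` cball (g z) R \<subseteq> U"
  using patch_nbhd[OF f gz atlasD(1)[OF A U(1)] U(2)] by blast
 obtain r where r: "0 < r" "cball z r \<subseteq> \<Omega>'" using gD(1) z unfolding open_contains_cball by blast
 have fg: "patch M \<Omega>' (f \<circ> g)" unfolding patch_def
 proof (intro conjI gD(1))
  show "continuous_on \<Omega>' (f \<circ> g)" by (rule continuous_on_compose[OF gD(2) continuous_on_subset[OF fD(2) gD(4)]])
  show "inj_on (f \<circ> g) \<Omega>'" by (rule comp_inj_on[OF gD(3) inj_on_subset[OF fD(3) gD(4)]])
  show "(f \<circ> g) ` \<Omega>' \<subseteq> M" using fD(4) gD(4) by auto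
 qed
 note pc = patch_chart[OF A f U(1) R(2,3)] and gc = patch_cball[OF g r(2)]
 have "op_at ((h \<circ> f) \<circ> g) z \<longleftrightarrow>
  (op_at (h \<circ> f) (g z) \<longleftrightarrow> op_at g z)"
  by (rule op_at_compose[OF gc r(1) continuous_on_subset[OF pc(1) ball_subset_cball]
   inj_on_subset[OF pc(2) ball_subset_cball] open_ball]) (use R(1) in simp)
 then show ?thesis
  using oriented_by_iff[OF A fg z U(1)] oriented_by_iff[OF A f gz U] U(2) by (simp add: o_assoc)
qed

lemma oriented_by_cong:
 assumes "0 < R" "\<And>w. w \<in> cball z R ==> f w = g w"
 shows "oriented_by \<A> f z \<longleftrightarrow> oriented_by \<A> g z"
proof -
 have "op_at (h \<circ> f) z \<longleftrightarrow> op_at (h \<circ> g) z" for h :: "'a => complex"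
  by (rule op_at_cong[OF assms(1)]) (simp add: assms(2))
 moreover have "f z = g z" using assms by simp
 ultimately show ?thesis unfolding oriented_by_def by simp
qed

lemma op_at_mult_i: "op_at (\<lambda>z. \<i> * z) z"
proof (rule op_at_straight[of _ 1])
 fix u c assume "u ~= z" "0 \<le> (c::real)"
 then show "\<i> * u - \<i> * z ~= - (of_real c * (u - z))"
 proof -
  have "\<i> + of_real c ~= 0" by (simp add: complex_eq_iff)
  then have "(\<i> + of_real c) * (u - z) ~= 0" using \<open>u ~= z\<close> by simp
  then show ?thesis by (simp add: algebra_simps)
 qed
qed (auto intro!: continuous_intros)

lemma op_at_compose_UNIV:
 assumes "continuous_on UNIV T" "inj T" "continuous_on UNIV F" "inj F"
 shows "op_at (F \<circ> T) z \<longleftrightarrow> (op_at F (T z) \<longleftrightarrow> op_at T z)"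
 by (rule op_at_compose[where E = UNIV and R = 1])
  (use assms continuous_on_subset[OF assms(1) subset_UNIV] inj_on_subset[OF assms(2) subset_UNIV] in simp_all)

text \<open>Affine symmetries of the triangle with corners 0, 1, i: \<open>cyclic\<close> permutes
  the corners cyclically, \<open>reflect\<close> exchanges 0 and 1.\<close>

definition cyclic :: "complex => complex" where
 "cyclic z = Complex (1 - Re z - Im z) (Re z)"

definition reflect :: "complex => complex" where
 "reflect z = Complex (1 - Re z - Im z) (Im z)"

lemma continuous_cyclic: "continuous_on S cyclic" "continuous_on S reflect"
 unfolding cyclic_def reflect_def by (intro continuous_intros)+

lemma inj_cyclic: "inj cyclic" "inj reflect"
 by (auto intro!: injI simp: cyclic_def reflect_def complex_eq_iff)

lemma op_at_cyclic: "op_at cyclic z"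
proof (rule op_at_straight[of _ 1])
 fix u c assume u: "u ~= z" and c: "0 \<le> (c::real)"
 show "cyclic u - cyclic z ~= - (of_real c * (u - z))"
 proof
  assume "cyclic u - cyclic z = - (of_real c * (u - z))"
  then have e: "- (Re u - Re z) - (Im u - Im z) = - c * (Re u - Re z)" "Re u - Re z = - c * (Im u - Im z)"
   by (simp_all add: cyclic_def complex_eq_iff algebra_simps)
  \<comment> \<open>The factor is the characteristic polynomial of the linear part of
    \<open>cyclic\<close> at -c; it has no real root, so no non-zero vector is sent to a real
    multiple of itself.\<close>
  then have "(c * c - c + 1) * (Im u - Im z) = 0" by (simp add: algebra_simps) algebra
  moreover have "c * c - c + 1 = (c - 1/2)\<^sup>2 + 3/4" by (simp add: power2_eq_square algebra_simps)
  then have "c * c - c + 1 ~= 0" using zero_le_power2[of "c - 1/2"] by linarith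
  ultimately have "Im u = Im z" by simp
  then show False using e(2) u by (simp add: complex_eq_iff)
 qed
qed (simp_all add: continuous_cyclic)

text \<open>The map is conjugation followed by two quarter turns and a shear S, and only conjugation
  reverses orientation. The half turn is split into quarter turns because it sends every vector to
  its opposite, where \<open>op_at_straight\<close> does not apply.\<close>

lemma not_op_at_reflect: "\<not> op_at reflect z"
proof -
 define S where "S z = Complex (1 + Re z - Im z) (Im z)" for z
 have S: "continuous_on UNIV S" "inj S"
  unfolding S_def by (intro continuous_intros, auto intro!: injI simp: complex_eq_iff)
 have oS: "op_at S w" for w
 proof (rule op_at_straight[of _ 1])
  fix u c assume u: "u ~= w" and c: "0 \<le> (c::real)"
  show "S u - S w ~= - (of_real c * (u - w))"
  proof
   assume "S u - S w = - (of_real c * (u - w))"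
   then have e: "(Re u - Re w) - (Im u - Im w) = - c * (Re u - Re w)" "Im u - Im w = - c * (Im u - Im w)"
    by (simp_all add: S_def complex_eq_iff algebra_simps)
   then have "(1 + c) * (Im u - Im w) = 0" by (simp add: algebra_simps)
   then have i: "Im u - Im w = 0" using c by simp
   then have "(1 + c) * (Re u - Re w) = 0" using e(1) by (simp add: algebra_simps)
   then show False using c i u by (simp add: complex_eq_iff)
  qed
 qed (use S continuous_on_subset in \<open>blast, simp\<close>)
 let ?i = "\<lambda>z. \<i> * z"
 have i: "continuous_on UNIV ?i" "inj ?i" by (intro continuous_intros, simp add: inj_on_def)
 have c: "continuous_on UNIV cnj" "inj cnj" by (intro continuous_intros, simp add: inj_on_def)
 have ic: "continuous_on UNIV (?i \<circ> cnj)" "inj (?i \<circ> cnj)"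
  using i c by (simp_all add: continuous_on_compose2 inj_compose o_def)
   (auto intro!: continuous_intros simp: inj_def)
 have iic: "continuous_on UNIV (?i \<circ> (?i \<circ> cnj))" "inj (?i \<circ> (?i \<circ> cnj))"
  by (auto intro!: continuous_intros simp: inj_def o_def)
 have "reflect = S \<circ> (?i \<circ> (?i \<circ> cnj))" by (simp add: fun_eq_iff reflect_def S_def complex_eq_iff)
 moreover have "\<not> op_at (S \<circ> (?i \<circ> (?i \<circ> cnj))) z"
  using oS op_at_mult_i not_op_at_cnj
  by (simp only: op_at_compose_UNIV[OF iic S] op_at_compose_UNIV[OF ic i]
   op_at_compose_UNIV[OF c i]) simp
 ultimately show ?thesis by simp
qed

text \<open>Composed with conjugation, the map keeps imaginary parts and is increasing on each
  horizontal line, so \<open>op_at_straight\<close> applies; removing the conjugation reverses the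
  sign.\<close>

lemma not_op_at_twist:
 assumes f: "strict_mono f" "continuous_on UNIV f" and z: "- 1 < Im z"
 shows "\<not> op_at (twist f) z"
proof -
 \<comment> \<open>With this radius the disc stays above the line Im = -1, where
   \<open>twist\<close> degenerates.\<close>
 define R where "R = (1 + Im z) / 2"
 have R: "0 < R" using z by (simp add: R_def)
 have Im: "-1 < Im u" if "u \<in> cball z R" for u
 proof -
  have "Im (z - u) \<le> cmod (z - u)" by (rule order_trans[OF abs_ge_self abs_Im_le_cmod])
  moreover have "cmod (z - u) \<le> R" using that by (simp add: dist_norm)
  ultimately have "Im z - Im u \<le> R" by simp
  then show ?thesis using z unfolding R_def by (simp add: field_simps)
 qed
 have cont: "continuous_on (cball z R) (twist f)" by (rule continuous_on_twist[OF f(2)]) (use Im in force)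
 have inj: "inj_on (twist f) (cball z R)"
 proof (rule inj_onI)
  fix u w assume u: "u \<in> cball z R" and w: "w \<in> cball z R" and e0: "twist f u = twist f w"
  from e0 have c: "(1 + Im u) * f (Re u / (1 + Im u)) = (1 + Im w) * f (Re w / (1 + Im w)) \<and> - Im u = - Im w"
   unfolding twist_def complex.inject .
  note e = conjunct1[OF c]
  have i: "Im u = Im w" using conjunct2[OF c] by simp
  have nz: "1 + Im w ~= 0" using Im[OF w] by simp
  have "f (Re u / (1 + Im w)) = f (Re w / (1 + Im w))" using e[unfolded i] nz unfolding mult_cancel_left by blast
  then have "Re u / (1 + Im w) = Re w / (1 + Im w)" using strict_mono_eq[OF f(1)] by blast
  then have "Re u = Re w" using nz by simp
  then show "u = w" using i by (rule complex_eqI)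
 qed
 have "op_at (cnj \<circ> twist f) z"
 proof (rule op_at_straight[OF _ R])
  show "continuous_on (cball z R) (cnj \<circ> twist f)" using cont by (intro continuous_on_compose continuous_on_cnj continuous_on_id)
  fix u c assume u: "u \<in> cball z R" "u ~= z" and c: "0 \<le> (c::real)"
  show "(cnj \<circ> twist f) u - (cnj \<circ> twist f) z ~= - (of_real c * (u - z))"
  proof
   assume "(cnj \<circ> twist f) u - (cnj \<circ> twist f) z = - (of_real c * (u - z))"
   then have e: "(1 + Im u) * f (Re u / (1 + Im u)) - (1 + Im z) * f (Re z / (1 + Im z)) = - c * (Re u - Re z)"
    "Im u - Im z = - c * (Im u - Im z)"
    by (simp_all add: twist_def complex_eq_iff)
   have "(1 + c) * (Im u - Im z) = 0" using e(2) by (simp add: algebra_simps)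
   then have i: "Im u = Im z" using c by simp
   then have ne: "Re u ~= Re z" using u(2) by (simp add: complex_eq_iff)
   have e1: "(1 + Im z) * (f (Re u / (1 + Im z)) - f (Re z / (1 + Im z))) = - c * (Re u - Re z)"
    using e(1) i by (simp add: algebra_simps)
   have p: "0 < 1 + Im z" using z by simp
   show False
   proof (cases "Re u < Re z")
    case True
    then have "f (Re u / (1 + Im z)) < f (Re z / (1 + Im z))" using p f(1) by (simp add: strict_mono_less divide_strict_right_mono)
    then have "(1 + Im z) * (f (Re u / (1 + Im z)) - f (Re z / (1 + Im z))) < 0" using p by (simp add: mult_pos_neg)
    moreover have "0 \<le> - c * (Re u - Re z)" using c True by (simp add: mult_nonneg_nonpos)
    ultimately show False using e1 by simp
   next
    case False
    then have "Re z < Re u" using ne by simp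
    then have "f (Re z / (1 + Im z)) < f (Re u / (1 + Im z))" using p f(1) by (simp add: strict_mono_less divide_strict_right_mono)
    then have "0 < (1 + Im z) * (f (Re u / (1 + Im z)) - f (Re z / (1 + Im z)))" using p by simp
    moreover have "- c * (Re u - Re z) \<le> 0" using c \<open>Re z < Re u\<close> by simp
    ultimately show False using e1 by simp
   qed
  qed
 qed
 moreover have "op_at (cnj \<circ> twist f) z \<longleftrightarrow>
   (op_at cnj (twist f z) \<longleftrightarrow> op_at (twist f) z)"
  by (rule op_at_compose[OF cont inj R _ _ open_UNIV]) (auto intro!: continuous_intros simp: inj_def)
 ultimately show ?thesis using not_op_at_cnj by simp
qed

definition corner_region :: "complex set" where
 "corner_region = {z. 0 < Re z \<and> 0 < Im z \<and> Re z + Im z < 1}"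

definition middle :: complex where
 "middle = Complex (1/3) (1/3)"

lemma open_corner_region: "open corner_region"
proof -
 have e: "corner_region = {z. 0 < Re z} \<inter> ({z. 0 < Im z} \<inter> {z. Re z + Im z < 1})" by (auto simp: corner_region_def)
 have "open {z. Re z + Im z < 1}" by (intro open_Collect_less continuous_intros)
 then show ?thesis unfolding e by (intro open_Int open_halfspace_Re_gt open_halfspace_Im_gt)
qed

lemma middle: "middle \<in> corner_region" "cyclic middle = middle" "reflect middle = middle"
 by (simp_all add: middle_def corner_region_def cyclic_def reflect_def)

lemma patch_cyclic: "patch corner_region corner_region cyclic" "patch corner_region corner_region reflect"
 unfolding patch_def using open_corner_region continuous_cyclic inj_cyclic
 by (auto intro: inj_on_subset simp: corner_region_def cyclic_def reflect_def)

lemma tri_pt_cyclic: "tri_pt (nx a) (pv (nx a)) = tri_pt a (pv a) \<circ> cyclic"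
 "tri_pt a (nx a) = tri_pt a (pv a) \<circ> reflect"
 by (simp_all add: fun_eq_iff vec_eq_iff all_three_iff[of _ a] tri_pt_def cyclic_def reflect_def)

lemma tri_pt_open_triangle:
 assumes "distinct [a, b, c]" "z \<in> corner_region"
 shows "tri_pt a c z \<in> open_triangle"
proof -
 have e: "tri_pt a c z $ a = Im z" "tri_pt a c z $ c = Re z" "tri_pt a c z $ b = 1 - Re z - Im z"
  using assms(1) by (auto simp: tri_pt_def)
 then have "tri_pt a c z \<in> triangle" using assms(2) by (simp add: triangle_iff[OF assms(1)] corner_region_def)
 moreover have "0 < tri_pt a c z $ k" for k
  using distinct_three_exhaust[OF assms(1), of k] e assms(2) by (elim disjE) (simp_all add: corner_region_def)
 ultimately show ?thesis by (simp add: open_triangle_def)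
qed

lemma bij_preserves_or_reverses:
 assumes "bij \<sigma>"
 shows "\<sigma> (pv i) = pv (\<sigma> i) ==> \<sigma> (nx k) = nx (\<sigma> k)" "\<sigma> (pv i) = nx (\<sigma> i) ==> \<sigma> (nx k) = pv (\<sigma> k)"
proof -
 have ne: "\<sigma> (nx i) ~= \<sigma> i" "\<sigma> (nx i) ~= \<sigma> (pv i)" using assms by (simp_all add: bij_def inj_eq)
 have c: "\<sigma> (nx i) = \<sigma> i \<or> \<sigma> (nx i) = nx (\<sigma> i) \<or> \<sigma> (nx i) = pv (\<sigma> i)" by (rule three_nx_cases)
 {
  assume p: "\<sigma> (pv i) = pv (\<sigma> i)"
  then have "\<sigma> (nx i) = nx (\<sigma> i)" using c ne by simp
  then show "\<sigma> (nx k) = nx (\<sigma> k)" using p three_nx_cases[of k i] by (elim disjE) simp_all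
 next
  assume p: "\<sigma> (pv i) = nx (\<sigma> i)"
  then have "\<sigma> (nx i) = pv (\<sigma> i)" using c ne by simp
  then show "\<sigma> (nx k) = pv (\<sigma> k)" using p three_nx_cases[of k i] by (elim disjE) simp_all
 }
qed

context bipartite_surface
begin

lemma patch_triangle:
 assumes T: "\<tau> \<in> \<T>" and d: "distinct [a, b, c]"
 shows "patch M corner_region (\<tau> \<circ> tri_pt a c)"
 unfolding patch_def
proof (intro conjI open_corner_region)
 have o: "tri_pt a c ` corner_region \<subseteq> open_triangle" using tri_pt_open_triangle[OF d] by (rule image_subsetI)
 have t: "open_triangle \<subseteq> triangle" by (auto simp: open_triangle_def)
 show "continuous_on corner_region (\<tau> \<circ> tri_pt a c)"
  by (rule continuous_on_compose[OF continuous_on_tri_pt continuous_on_subset[OF T_continuous[OF T] subset_trans[OF o t]]])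
 show "inj_on (\<tau> \<circ> tri_pt a c) corner_region"
 proof (rule inj_onI)
  fix z w assume z: "z \<in> corner_region" and w: "w \<in> corner_region" and "(\<tau> \<circ> tri_pt a c) z = (\<tau> \<circ> tri_pt a c) w"
  then have "tri_pt a c z = tri_pt a c w"
   using T_interior[OF T T tri_pt_open_triangle[OF d z] subsetD[OF t tri_pt_open_triangle[OF d w]]] by simp
  then have "tri_pt a c z $ a = tri_pt a c w $ a" "tri_pt a c z $ c = tri_pt a c w $ c" by simp_all
  moreover have "a ~= c" using d by simp
  ultimately show "z = w" by (simp add: tri_pt_nth complex_eq_iff)
 qed
 show "(\<tau> \<circ> tri_pt a c) ` corner_region \<subseteq> M"
  unfolding image_comp[symmetric] by (rule image_subsetI, rule T_in_M[OF T], rule subsetD[OF subset_trans[OF o t]])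
qed

lemma patch_star:
 assumes s: "s \<in> sides"
 shows "patch M kite (chart s)"
 unfolding patch_def
proof (intro conjI open_kite continuous_on_chart_kite[OF s])
 show "inj_on (chart s) kite" by (rule inj_on_inverseI[of _ "chart_inv s"]) (rule chart_inv_chart[OF s])
 show "chart s ` kite \<subseteq> M" unfolding chart_image[OF s] using star_subset[OF s] by blast
qed

text \<open>Whether the numbering of the corners of \<tau> agrees with the orientation. Only the
  cyclic order of the corners matters (\<open>positive_cyclic\<close>).\<close>

definition positive :: "('a set \<times> ('a => complex)) set => (real^3 => 'a) => bool" where
 "positive \<A> \<tau> \<longleftrightarrow> oriented_by \<A> (\<tau> \<circ> tri_pt 1 (pv 1)) middle"

context
 fixes \<A> :: "('a set \<times> ('a => complex)) set"
 assumes A: "oriented_atlas M \<A>"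
begin

lemma positive_cyclic:
 assumes T: "\<tau> \<in> \<T>"
 shows "oriented_by \<A> (\<tau> \<circ> tri_pt a (pv a)) middle \<longleftrightarrow> positive \<A> \<tau>"
proof -
 have step: "oriented_by \<A> (\<tau> \<circ> tri_pt (nx a) (pv (nx a))) middle \<longleftrightarrow> oriented_by \<A> (\<tau> \<circ> tri_pt a (pv a)) middle" for a
 proof -
  have d: "distinct [a, nx a, pv a]" by simp
  show ?thesis
   using oriented_by_compose[OF A patch_triangle[OF T d] patch_cyclic(1) middle(1)] op_at_cyclic
   by (simp only: tri_pt_cyclic o_assoc middle simp_thms)
 qed
 show ?thesis using three_nx_cases[of a 1] step[of 1] step[of "nx 1"] unfolding positive_def nx_pv by (elim disjE) simp_all
qed

lemma positive_reflect:
 assumes T: "\<tau> \<in> \<T>"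
 shows "oriented_by \<A> (\<tau> \<circ> tri_pt a (nx a)) middle \<longleftrightarrow> \<not> positive \<A> \<tau>"
proof -
 have d: "distinct [a, nx a, pv a]" by simp
 show ?thesis
  using oriented_by_compose[OF A patch_triangle[OF T d] patch_cyclic(2) middle(1)] not_op_at_reflect
   positive_cyclic[OF T, of a]
  by (simp only: tri_pt_cyclic o_assoc middle simp_thms)
qed

text \<open>The sign is constant on the connected kite, and near the centre of the upper half the
  chart is the affine parametrisation of \<open>fst s\<close>.\<close>

lemma positive_chart:
 assumes s: "s \<in> sides" and z: "z \<in> kite"
 shows "oriented_by \<A> (chart s) z \<longleftrightarrow> positive \<A> (fst s)"
proof -
 have m: "middle \<in> kite" by (simp add: middle_def kite_def)
 have "oriented_by \<A> (chart s) z \<longleftrightarrow> oriented_by \<A> (chart s) middle"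
  by (rule oriented_by_constant[OF A patch_star[OF s] convex_connected[OF convex_kite] z m])
 also have "\<dots> \<longleftrightarrow> oriented_by \<A> (fst s \<circ> tri_pt (snd s) (pv (snd s))) middle"
 \<comment> \<open>The disc of radius 1/3 about the centre stays in the closed upper half
   plane.\<close>
 proof (rule oriented_by_cong[of "1/3"])
  fix w assume "w \<in> cball middle (1/3)"
  then have "cmod (middle - w) \<le> 1/3" by (simp add: dist_norm)
  moreover have "Im (middle - w) \<le> cmod (middle - w)" by (rule order_trans[OF abs_ge_self abs_Im_le_cmod])
  ultimately have "Im middle - Im w \<le> 1/3" by simp
  then have "0 \<le> Im w" by (simp add: middle_def)
  then show "chart s w = (fst s \<circ> tri_pt (snd s) (pv (snd s))) w" by (simp add: chart_upper)
 qed simp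
 finally show ?thesis by (simp only: positive_cyclic[OF fst_in_T(1)[OF s]])
qed

text \<open>Below the edge the same chart is the parametrisation of the opposite triangle after
  \<open>twist\<close>. The chart has one sign on the whole star and \<open>twist\<close> reverses
  orientation, hence the negation.\<close>

lemma positive_opposite:
 assumes s: "s \<in> sides"
 shows "oriented_by \<A> (fst (opp s) \<circ> tri_pt (snd (opp s)) (gperm s (pv (snd s)))) middle \<longleftrightarrow> \<not> positive \<A> (fst s)"
proof -
 let ?f = "gfun s" and ?q = "fst (opp s) \<circ> tri_pt (snd (opp s)) (gperm s (pv (snd s)))"
 define L where "L = kite \<inter> {z. Im z < 0}"
 have m: "middle \<in> kite" "0 \<le> Im middle" by (simp_all add: middle_def kite_def)
 define z where "z = untwist (inv_into UNIV ?f) middle"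
 note zk = untwist_kite[OF ginv(1-3)[OF s] m, folded z_def]
 have tz: "twist ?f z = middle" unfolding z_def by (rule twist_untwist[OF gfun(1-3)[OF s] ginv(5)[OF s] m])
 have "Im z = - (1/3)" by (simp add: z_def untwist_def middle_def)
 then have zL: "z \<in> L" using zk by (simp add: L_def)
 have Lk: "w \<in> kite" "Im w \<le> 0" "Im w < 0" if "w \<in> L" for w using that by (simp_all add: L_def)
 have oL: "open L" unfolding L_def by (intro open_Int open_kite open_halfspace_Im_lt)
 have pt: "patch corner_region L (twist ?f)" unfolding patch_def
 proof (intro conjI oL)
  have "Im w ~= -1" if "w \<in> L" for w using Lk(1)[OF that] by (simp add: kite_def) linarith
  then show "continuous_on L (twist ?f)" by (rule continuous_on_twist[OF gfun(4)[OF s]])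
  show "inj_on (twist ?f) L"
   by (rule inj_on_inverseI[of _ "untwist (inv_into UNIV ?f)"])
    (rule untwist_twist[OF gfun(1-3)[OF s] ginv(6)[OF s] Lk(1,2)])
  show "twist ?f ` L \<subseteq> corner_region"
  proof (rule image_subsetI)
   fix w assume w: "w \<in> L"
   from twist_kite(1)[OF gfun(1-3)[OF s] Lk(1,2)[OF w]] have "twist ?f w \<in> kite" .
   moreover have "0 < Im (twist ?f w)" using Lk(3)[OF w] by (simp add: twist_def)
   ultimately show "twist ?f w \<in> corner_region" by (simp add: kite_def corner_region_def)
  qed
 qed
 obtain R where R: "0 < R" "cball z R \<subseteq> L" using bspec[OF iffD1[OF open_contains_cball oL] zL] by (elim exE conjE)
 have "positive \<A> (fst s) \<longleftrightarrow> oriented_by \<A> (chart s) z" by (simp only: positive_chart[OF s zk(1)])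
 also have "\<dots> \<longleftrightarrow> oriented_by \<A> (?q \<circ> twist ?f) z"
 proof (rule oriented_by_cong[OF R(1)])
  fix w assume "w \<in> cball z R"
  then have "w \<in> L" using R(2) by blast
  from chart_lower_kite(1)[OF s Lk(1,2)[OF this]] show "chart s w = (?q \<circ> twist ?f) w" by simp
 qed
 also have "\<dots> \<longleftrightarrow> (oriented_by \<A> ?q (twist ?f z) \<longleftrightarrow> op_at (twist ?f) z)"
  by (rule oriented_by_compose[OF A patch_triangle[OF fst_in_T(2)[OF s] gperm(3)[OF s]] pt zL])
 also have "op_at (twist ?f) z \<longleftrightarrow> False"
  using not_op_at_twist[OF gfun(1,4)[OF s], of z] \<open>Im z = - (1/3)\<close> by simp
 finally have "positive \<A> (fst s) \<longleftrightarrow> (oriented_by \<A> ?q middle \<longleftrightarrow> False)" unfolding tz .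
 then show ?thesis by blast
qed

text \<open>The sign of the opposite triangle in its own cyclic order is compared with the sign in
  the order inherited through the gluing, which \<open>positive_opposite\<close> determines.\<close>

theorem gperm_orientation:
 assumes s: "s \<in> sides"
 shows "positive \<A> (fst s) = positive \<A> (fst (opp s)) ==> gperm s (nx k) = pv (gperm s k)"
  "positive \<A> (fst s) ~= positive \<A> (fst (opp s)) ==> gperm s (nx k) = nx (gperm s k)"
proof -
 let ?i = "snd s" and ?i' = "snd (opp s)"
 have g: "gperm s ?i = ?i'" by (rule gperm(2)[OF s])
 note T = fst_in_T(2)[OF s] and P = positive_opposite[OF s] and br = bij_preserves_or_reverses[OF gperm(1)[OF s], where i = ?i]
 have c: "gperm s (pv ?i) = nx ?i' \<or> gperm s (pv ?i) = pv ?i'" using three_nx_cases[of "gperm s (pv ?i)" ?i'] gperm(3)[OF s] by auto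
 {
  assume "positive \<A> (fst s) = positive \<A> (fst (opp s))"
  then have "gperm s (pv ?i) ~= pv ?i'" using P positive_cyclic[OF T, of ?i'] by metis
  then show "gperm s (nx k) = pv (gperm s k)" using c br(2)[of k] g by simp
 next
  assume "positive \<A> (fst s) ~= positive \<A> (fst (opp s))"
  then have "gperm s (pv ?i) ~= nx ?i'" using P positive_reflect[OF T, of ?i'] by metis
  then show "gperm s (nx k) = nx (gperm s k)" using c br(1)[of k] g by simp
 }
qed

end

end

section \<open>Reduced galleries\<close>

context bipartite_surface
begin

lemma is_gallery_Cons:
 assumes "is_gallery \<tau> (s # w) \<tau>'"
 shows "s \<in> sides" "fst s = \<tau>" "is_gallery (fst (opp s)) w \<tau>'"
 using assms unfolding is_gallery.simps by blast+

lemma is_gallery_split: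
 assumes "is_gallery \<tau> (u @ w) \<tau>'"
 shows "\<exists>\<tau>1. is_gallery \<tau> u \<tau>1 \<and> is_gallery \<tau>1 w \<tau>'"
 using assms
proof (induction u arbitrary: \<tau>)
 case Nil
 then have w: "is_gallery \<tau> w \<tau>'" by simp
 then have "is_gallery \<tau> [] \<tau>" using is_gallery_T[OF w] by simp
 then show ?case using w by (intro exI conjI)
next
 case (Cons s u)
 note g = is_gallery_Cons[OF Cons.prems[unfolded append_Cons]]
 from Cons.IH[OF g(3)] obtain \<tau>1 where t: "is_gallery (fst (opp s)) u \<tau>1" "is_gallery \<tau>1 w \<tau>'" by (elim exE conjE)
 have "is_gallery \<tau> (s # u) \<tau>1" unfolding is_gallery.simps using g(1,2) t(1) by (intro conjI)
 then show ?case using t(2) by (intro exI conjI)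
qed

lemma gallery_cancel:
 assumes g: "is_gallery \<tau> (a @ s # opp s # b) \<tau>'"
 shows "is_gallery \<tau> (a @ b) \<tau>'" "gpath \<tau> (a @ s # opp s # b) \<simeq> gpath \<tau> (a @ b)"
proof -
 obtain \<tau>1 where a: "is_gallery \<tau> a \<tau>1" and sb: "is_gallery \<tau>1 (s # opp s # b) \<tau>'"
  using is_gallery_split[OF g] by (elim exE conjE)
 note s = is_gallery_Cons[OF sb]
 note r = is_gallery_Cons[OF s(3)]
 have b: "is_gallery \<tau>1 b \<tau>'" using r(3) unfolding opp_opp[OF s(1)] s(2) .
 show "is_gallery \<tau> (a @ b) \<tau>'" by (rule is_gallery_append[OF a b])
 note pa = pth_gallery[OF a] and pb = pth_gallery[OF b] and cs = pth_crossing[OF s(1), unfolded s(2)]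
  and co = pth_crossing[OF opp(1)[OF s(1)], unfolded opp_opp[OF s(1)] s(2)]
 have "gpath \<tau> (a @ s # opp s # b) \<simeq> gpath \<tau> a +++ gpath \<tau>1 (s # opp s # b)"
  by (rule homotopic_paths_sym[OF gpath_append[OF a sb]])
 also have "gpath \<tau>1 (s # opp s # b) = crossing s +++ (crossing (opp s) +++ gpath \<tau>1 b)"
  by (simp only: gpath.simps opp_opp[OF s(1)] s(2))
 also have "gpath \<tau> a +++ (crossing s +++ (crossing (opp s) +++ gpath \<tau>1 b)) \<simeq> gpath \<tau> a +++ gpath \<tau>1 b"
 proof (rule pth_joinI[OF pth_refl[OF pa] _ pa pth_join[OF cs pth_join[OF co pb]]])
  have "crossing s +++ (crossing (opp s) +++ gpath \<tau>1 b) \<simeq> (crossing s +++ crossing (opp s)) +++ gpath \<tau>1 b"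
   by (rule homotopic_paths_sym[OF pth_assoc[OF cs co pb]])
  also have "\<dots> \<simeq> const_path (\<tau>1 barycentre) +++ gpath \<tau>1 b"
   by (rule pth_joinI[OF crossing_pair[OF s(1), unfolded s(2)] pth_refl[OF pb] pth_join[OF cs co] pb])
  also have "\<dots> \<simeq> gpath \<tau>1 b" by (rule pth_lid[OF pb])
  finally show "crossing s +++ (crossing (opp s) +++ gpath \<tau>1 b) \<simeq> gpath \<tau>1 b" .
 qed
 also have "\<dots> \<simeq> gpath \<tau> (a @ b)" by (rule gpath_append[OF a b])
 finally show "gpath \<tau> (a @ s # opp s # b) \<simeq> gpath \<tau> (a @ b)" .
qed

fun reduced :: "'a side list => bool" where
 "reduced [] \<longleftrightarrow> True"
| "reduced [s] \<longleftrightarrow> True"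
| "reduced (s # r # w) \<longleftrightarrow> r ~= opp s \<and> reduced (r # w)"

lemma not_reduced: "\<not> reduced u ==> \<exists>a s b. u = a @ s # opp s # b"
proof (induction u rule: reduced.induct)
 case (3 s r w)
 show ?case
 proof (cases "r = opp s")
  case True
  then have "s # r # w = [] @ s # opp s # w" by simp
  then show ?thesis by (intro exI)
 next
  case False
  then have "\<not> reduced (r # w)" using "3.prems" by simp
  from "3.IH"[OF this] obtain a t b where "r # w = a @ t # opp t # b" by (elim exE)
  then have "s # r # w = (s # a) @ t # opp t # b" by simp
  then show ?thesis by (intro exI)
 qed
qed simp_all

lemma reduced_exists:
 "is_gallery \<tau> w \<tau>' ==> \<exists>u. is_gallery \<tau> u \<tau>' \<and> gpath \<tau> w \<simeq> gpath \<tau> u \<and> reduced u"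
proof (induction w rule: length_induct)
 case (1 w)
 show ?case
 proof (cases "reduced w")
  case True
  then show ?thesis using "1.prems" pth_refl[OF pth_gallery[OF "1.prems"]] by (intro exI conjI)
 next
  case False
  from not_reduced[OF this] obtain a s b where w: "w = a @ s # opp s # b" by (elim exE)
  note c = gallery_cancel[OF "1.prems"[unfolded w]]
  have "length (a @ b) < length w" unfolding w by simp
  from "1.IH"[rule_format, OF this c(1)] obtain u where
   u: "is_gallery \<tau> u \<tau>'" "gpath \<tau> (a @ b) \<simeq> gpath \<tau> u" "reduced u" by (elim exE conjE)
  from homotopic_paths_trans[OF c(2) u(2)] have "gpath \<tau> w \<simeq> gpath \<tau> u" unfolding w .
  then show ?thesis using u(1,3) by (intro exI conjI)
 qed
qed

lemma reduced_ConsD: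
 assumes "reduced (s # r # w)"
 shows "r ~= opp s" "reduced (r # w)"
 using assms by simp_all

lemma snd_neq_opp:
 assumes "fst r = fst (opp s)" "r ~= opp s"
 shows "snd r ~= snd (opp s)"
 using assms by (simp add: prod_eq_iff)

end

lemma axis_1_nth: "axis k (1::real) $ j = (if j = k then 1 else 0)"
 by (simp add: axis_def)

section \<open>Entrywise domination and traces\<close>

definition dominated :: "complex^3^3 => real^3^3 => bool" where
 "dominated A B \<longleftrightarrow> (\<forall>j k. cmod (A $ j $ k) \<le> B $ j $ k)"

lemma dominated_mult:
 assumes "dominated A B" "dominated C D"
 shows "dominated (A ** C) (B ** D)"
 unfolding dominated_def
proof (intro allI)
 fix j k
 have ab: "cmod (A $ j $ i) \<le> B $ j $ i" "cmod (C $ i $ k) \<le> D $ i $ k" for i using assms unfolding dominated_def by blast+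
 have "cmod ((A ** C) $ j $ k) \<le> (\<Sum>i\<in>UNIV. cmod (A $ j $ i * C $ i $ k))"
  by (simp add: matrix_matrix_mult_def norm_sum)
 also have "\<dots> \<le> (\<Sum>i\<in>UNIV. B $ j $ i * D $ i $ k)"
 proof (rule sum_mono)
  fix i
  show "cmod (A $ j $ i * C $ i $ k) \<le> B $ j $ i * D $ i $ k" unfolding norm_mult
   by (rule mult_mono[OF ab]) (use order_trans[OF norm_ge_zero ab(1)] in simp_all)
 qed
 finally show "cmod ((A ** C) $ j $ k) \<le> (B ** D) $ j $ k" by (simp add: matrix_matrix_mult_def)
qed

lemma dominated_mat_1: "dominated (mat 1) (mat 1)"
 by (simp add: dominated_def mat_def)

lemma dominated_mpow: "dominated A B ==> dominated (mpow A n) (mpow B n)"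
 by (induction n) (simp_all add: dominated_mat_1 dominated_mult)

lemma dominated_trace: "dominated A B ==> cmod (trace A) \<le> trace B"
 unfolding dominated_def trace_def by (intro order_trans[OF norm_sum] sum_mono) simp

lemma mpow_similar:
 assumes "F ** Fi = mat 1" "Fi ** F = mat 1"
 shows "mpow (F ** W ** Fi) n = F ** mpow W n ** Fi"
proof (induction n)
 case 0
 show ?case using assms(1) by simp
next
 case (Suc n)
 have "mpow (F ** W ** Fi) (Suc n) = F ** W ** (Fi ** F) ** mpow W n ** Fi" using Suc by (simp add: matrix_mul_assoc)
 then show ?case unfolding assms(2) by (simp add: matrix_mul_assoc)
qed

lemma trace_similar:
 fixes F :: "'b::comm_semiring_1^'n^'n"
 assumes "Fi ** F = mat 1"
 shows "trace (F ** W ** Fi) = trace W"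
proof -
 have "trace (F ** W ** Fi) = trace (Fi ** (F ** W))" by (rule trace_mul_sym)
 also have "Fi ** (F ** W) = (Fi ** F) ** W" by (rule matrix_mul_assoc)
 finally show ?thesis unfolding assms by simp
qed

lemma mpow_scalar: "mpow (mat k ** (A :: complex^3^3)) n = mat (k ^ n) ** mpow A n"
proof (induction n)
 case 0
 show ?case by simp
next
 case (Suc n)
 have "mpow (mat k ** A) (Suc n) = mat k ** ((A ** mat (k ^ n)) ** mpow A n)" using Suc by (simp add: matrix_mul_assoc)
 also have "A ** mat (k ^ n) = mat (k ^ n) ** A" by (rule matrix_mult_mat_commute)
 also have "mat k ** ((mat (k ^ n) ** A) ** mpow A n) = (mat k ** mat (k ^ n)) ** (A ** mpow A n)" by (simp only: matrix_mul_assoc)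
 finally show ?case unfolding mat_mult_mat by simp
qed

lemma trace_scalar: "trace (mat k ** (A :: complex^3^3)) = k * trace A"
 by (simp add: trace_def matrix_matrix_mult_def mat_def sum_3 algebra_simps)

lemma cmod_trace_mpow:
 fixes F Fi W :: "complex^3^3"
 assumes "F ** Fi = mat 1" "Fi ** F = mat 1" "cmod k = 1"
 shows "cmod (trace (mpow (mat k ** (F ** W ** Fi)) n)) = cmod (trace (mpow (W :: complex^3^3) n))"
 unfolding mpow_scalar mpow_similar[OF assms(1,2)] trace_scalar trace_similar[OF assms(2)]
 by (simp add: norm_mult norm_power assms(3))

context bipartite_surface
begin

context
 fixes X :: "'a side => complex^3^3" and N :: "'a side => real^3^3"
 assumes form: "\<And>s. s \<in> sides ==> crossing_form (snd s) (gperm s) (X s) (N s)"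
begin

text \<open>Ping-pong, read from the last crossing backwards: a frame vector has non-negative
  coordinates, and since no crossing is undone by the next one, each cone lies on the inner side of
  the edge from which the preceding crossing arrives.\<close>

lemma gallery_side_cone:
 "is_gallery \<tau> (s # w) \<tau>' ==> reduced (s # w) ==> wmat N (s # w) *v axis k 1 \<in> side_cone (snd s)"
proof (induction w arbitrary: s \<tau>)
 case Nil
 note s = is_gallery_Cons[OF Nil.prems(1)]
 obtain b c t where f: "distinct [snd s, b, c]" "0 < t" "N s = cross (snd s) b c t (-1) ** perm_matrix (gperm s)"
  using form[OF s(1)] unfolding crossing_form_def by (elim exE conjE)
 have "(cross (snd s) b c t (-1) ** perm_matrix (gperm s)) *v axis k 1 \<in> side_cone (snd s)"
  by (rule side_cone_cross[OF f(1) gperm(1)[OF s(1)] f(2)]) (simp_all add: axis_1_nth)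
 then show ?case unfolding wmat.simps matrix_mul_rid f(3) .
next
 case (Cons r w)
 note s = is_gallery_Cons[OF Cons.prems(1)]
 note r = is_gallery_Cons[OF s(3)] and red = reduced_ConsD[OF Cons.prems(2)]
 obtain b c t where f: "distinct [snd s, b, c]" "0 < t" "N s = cross (snd s) b c t (-1) ** perm_matrix (gperm s)"
  using form[OF s(1)] unfolding crossing_form_def by (elim exE conjE)
 let ?v = "wmat N (r # w) *v axis k 1"
 have ne: "snd r ~= gperm s (snd s)" using snd_neq_opp[OF r(2) red(1)] gperm(2)[OF s(1)] by simp
 note v = side_cone_other[OF Cons.IH[OF s(3) red(2)] ne]
 have "(cross (snd s) b c t (-1) ** perm_matrix (gperm s)) *v ?v \<in> side_cone (snd s)"
  by (rule side_cone_cross[OF f(1) gperm(1)[OF s(1)] f(2) conjunct1[OF v]]) (rule mp[OF spec[OF conjunct2[OF v]]])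
 then show ?case unfolding wmat.simps(2)[of N s] f(3) matrix_vector_mul_assoc .
qed

lemma reduced_row_bound:
 assumes "is_gallery \<tau> (s # w) \<tau>'" "reduced (s # w)"
 shows "\<bar>wmat N (s # w) $ snd s $ k\<bar> \<le> (\<Sum>j\<in>UNIV - {snd s}. \<bar>wmat N (s # w) $ j $ k\<bar>)"
proof -
 have "wmat N (s # w) *v axis k 1 = column k (wmat N (s # w))" by (simp add: column_eq_mult_axis)
 then show ?thesis using side_cone_abs[OF gallery_side_cone[OF assms, of k]] by (simp add: column_def)
qed

lemma crossing_dominated:
 assumes s: "s \<in> sides" and l: "l ~= snd (opp s)"
 shows "dominated (turn (snd s) ** X s ** turn l) (turn (snd s) ** N s ** turn l)"
proof -
 obtain b c t x where f: "distinct [snd s, b, c]" "0 < t" "cmod x = 1"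
   "X s = cross (snd s) b c (of_real t) x ** perm_matrix (gperm s)"
   "N s = cross (snd s) b c t (-1) ** perm_matrix (gperm s)"
  using form[OF s] unfolding crossing_form_def by (elim exE conjE)
 have "l ~= gperm s (snd s)" using l gperm(2)[OF s] by simp
 from norm_turn_cross_turn_le[OF f(1) gperm(1)[OF s] this f(2,3)] show ?thesis unfolding dominated_def f(4,5) by blast
qed

lemma insert_turn: "(A :: 'b::comm_ring_1^3^3) ** (B ** C) = (A ** turn i) ** (turn i ** B ** C)"
proof -
 have "(A ** turn i) ** (turn i ** B ** C) = A ** (turn i ** turn i) ** (B ** C)" by (simp only: matrix_mul_assoc)
 then show ?thesis by (simp only: turn_turn matrix_mul_rid matrix_mul_assoc)
qed

text \<open>Between consecutive crossings s and r the square of \<open>turn (snd r)\<close> is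
  inserted. In a reduced gallery \<open>snd r\<close> differs from \<open>snd (opp s)\<close>, which
  is the condition under which a single crossing is dominated.\<close>

lemma gallery_dominated:
 "is_gallery \<tau> (s # w) \<tau>' ==> reduced (s # w) ==> l ~= snd (opp (last (s # w))) ==>
  dominated (turn (snd s) ** wmat X (s # w) ** turn l) (turn (snd s) ** wmat N (s # w) ** turn l)"
proof (induction w arbitrary: s \<tau>)
 case Nil
 then show ?case using crossing_dominated[OF is_gallery_Cons(1)[OF Nil.prems(1)]] by simp
next
 case (Cons r w)
 note s = is_gallery_Cons[OF Cons.prems(1)]
 note r = is_gallery_Cons[OF s(3)] and red = reduced_ConsD[OF Cons.prems(2)]
 have l: "l ~= snd (opp (last (r # w)))" using Cons.prems(3) by simp
 note d = dominated_mult[OF crossing_dominated[OF s(1) snd_neq_opp[OF r(2) red(1)]] Cons.IH[OF s(3) red(2) l]]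
 have e: "turn (snd s) ** wmat Y (s # r # w) ** turn l = (turn (snd s) ** Y s ** turn (snd r)) ** (turn (snd r) ** wmat Y (r # w) ** turn l)"
  for Y :: "_ => 'b::comm_ring_1^3^3"
  using insert_turn[of "turn (snd s) ** Y s" "wmat Y (r # w)" "turn l" "snd r"] by (simp only: wmat.simps(2)[of Y s] matrix_mul_assoc)
 show ?case unfolding e by (rule d)
qed

text \<open>The word is closed up by putting the \<open>turn\<close> of its first crossing at both
  ends. Cyclic reducedness is the condition for this at the last crossing, and as
  \<open>turn\<close> is an involution the result is a conjugation, invisible to traces.\<close>

lemma cyclic_gallery_trace:
 assumes g: "is_gallery \<tau> w \<tau>" and red: "reduced w" and cyc: "w ~= [] ==> hd w ~= opp (last w)"
 shows "cmod (trace (mpow (wmat X w) n)) \<le> trace (mpow (wmat N w) n)"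
proof (cases w)
 case Nil
 have "dominated (mpow (mat 1) n) (mpow (mat 1) n)" by (rule dominated_mpow[OF dominated_mat_1])
 from dominated_trace[OF this] show ?thesis unfolding Nil by simp
next
 case (Cons s v)
 note s = is_gallery_Cons[OF g[unfolded Cons]]
 have last: "fst (opp (last w)) = \<tau>"
 proof -
  have e: "butlast w @ [last w] = w" using Cons by simp
  have "is_gallery \<tau> (butlast w @ [last w]) \<tau>" unfolding e by (rule g)
  from is_gallery_split[OF this] obtain \<tau>1 where "is_gallery \<tau>1 [last w] \<tau>" by (elim exE conjE)
  from is_gallery_Cons(3)[OF this] show ?thesis unfolding is_gallery.simps by (rule conjunct2)
 qed
 have "s ~= opp (last w)" using cyc unfolding Cons by simp
 then have l: "snd s ~= snd (opp (last (s # v)))" using s(2) last unfolding Cons by (simp add: prod_eq_iff)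
 have d: "dominated (mpow (turn (snd s) ** wmat X w ** turn (snd s)) n) (mpow (turn (snd s) ** wmat N w ** turn (snd s)) n)"
  unfolding Cons by (rule dominated_mpow[OF gallery_dominated[OF g[unfolded Cons] red[unfolded Cons] l]])
 show ?thesis using dominated_trace[OF d]
  unfolding mpow_similar[OF turn_turn turn_turn] trace_similar[OF turn_turn] .
qed

end

end

context pointed_surface
begin

lemma pth_loop: "loop p ==> pth p x0 x0"
 unfolding loop_def pth_def .

lemma spoke_barycentre: "\<tau> \<in> \<T> ==> spoke (\<tau> barycentre) = const_path (\<tau> barycentre)"
 unfolding spoke_def by (simp add: home_barycentre linepath_refl const_path_def fun_eq_iff)

text \<open>The path from centre to centre is read as a gallery; the spokes at both of its ends are
  constant.\<close>

lemma gallery_between: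
 assumes b: "based \<delta> \<tau>" "based \<delta>' \<tau>'"
 shows "\<exists>w. is_gallery \<tau> w \<tau>' \<and> \<delta>' \<simeq> \<delta> +++ gpath \<tau> w"
proof -
 note T = basedD(1)[OF b(1)] basedD(1)[OF b(2)] and d = pth_based[OF b(1)] and d' = pth_based[OF b(2)]
 let ?q = "reversepath \<delta> +++ \<delta>'"
 have q: "pth ?q (\<tau> barycentre) (\<tau>' barycentre)" by (rule pth_join[OF pth_reverse[OF d] d'])
 obtain n sd where f: "subordinate n ?q sd" by (rule subordinate_exists[OF pthD(1,2)[OF q]])
 have n: "0 < n" by (rule subordinateD(1)[OF f])
 have e: "?q 0 = \<tau> barycentre" "?q (real n / real n) = \<tau>' barycentre"
  using pthD(3,4)[OF q] n unfolding pathstart_def pathfinish_def by simp_all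
 have l: "?q \<circ> linepath 0 (real n / real n) = ?q" using n by (simp add: compose_linepath_01)
 define w where "w = path_word ?q n sd n"
 note pg = path_homotopic_gallery[OF pthD(1,2)[OF q] f order_refl, folded w_def,
   unfolded l e home_barycentre[OF T(1)] home_barycentre[OF T(2)] spoke_barycentre[OF T(1)] spoke_barycentre[OF T(2)] fst_conv]
 have g: "is_gallery \<tau> w \<tau>'" by (rule conjunct1[OF pg])
 note pw = pth_gallery[OF g] and c = pth_const[OF barycentre_punctured[OF T(1)]] and c' = pth_const[OF barycentre_punctured[OF T(2)]]
 have "reversepath (const_path (\<tau> barycentre)) = const_path (\<tau> barycentre)" by (simp add: reversepath_def const_path_def)
 then have "?q \<simeq> const_path (\<tau> barycentre) +++ (gpath \<tau> w +++ const_path (\<tau>' barycentre))" using conjunct2[OF pg] by simp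
 also have "\<dots> \<simeq> gpath \<tau> w +++ const_path (\<tau>' barycentre)"
  by (rule pth_lid[OF pth_join[OF pw c']])
 also have "\<dots> \<simeq> gpath \<tau> w" by (rule pth_rid[OF pw])
 finally have qw: "?q \<simeq> gpath \<tau> w" .
 have "\<delta>' \<simeq> \<delta> +++ ?q"
  using homotopic_paths_sym[OF pth_cancel_inverse[OF pth_reverse[OF d] d']] by (simp only: reversepath_reversepath)
 also have "\<dots> \<simeq> \<delta> +++ gpath \<tau> w" by (rule pth_joinI[OF pth_refl[OF d] qw d q])
 finally show ?thesis using g by (intro exI conjI)
qed

end

section \<open>The dominating representation\<close>

abbreviation cmat :: "real^3^3 => complex^3^3" where
 "cmat \<equiv> map_matrix complex_of_real"

lemma cmat_nth: "cmat B $ i $ j = of_real (B $ i $ j)"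
 by (simp add: map_matrix_def)

lemma mpow_cmat: "mpow (cmat B) n = cmat (mpow B n)"
 by (induction n) (simp_all add: map_matrix_mult map_matrix_mat)

lemma trace_cmat: "trace (cmat B) = of_real (trace B)"
 by (simp add: trace_def cmat_nth)

definition flip :: "3 => 3" where
 "flip k = (if k = 1 then 1 else if k = 2 then 3 else 2)"

lemma flip: "flip (flip k) = k" "flip (nx k) = pv (flip k)" "flip (pv k) = nx (flip k)"
 using three_cases[of k] by (auto simp: flip_def nx_def pv_def)

lemma mat_scalar_nth: "(mat c ** A) $ i $ j = c * (A :: complex^3^3) $ i $ j"
 by (simp add: matrix_matrix_mult_def mat_def if_distrib if_distribR sum.delta cong: if_cong)

locale oriented_bent_surface = bent_surface M P \<T> x0 \<rho> \<phi>
 for M P :: "'a::t2_space set" and \<T> x0 \<rho> \<phi> +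
 fixes \<A> :: "('a set \<times> ('a => complex)) set"
 assumes atlas: "oriented_atlas M \<A>"
begin

text \<open>The corners of negative triangles are renumbered by the order reversing
  \<open>flip\<close>, so that all numberings agree with the orientation.\<close>

definition lab :: "(real^3 => 'a) => 3 => 3" where
 "lab \<tau> = (if positive \<A> \<tau> then id else flip)"

lemma lab_lab: "lab \<tau> (lab \<tau> k) = k"
 by (simp add: lab_def flip)

lemma bij_lab: "bij (lab \<tau>)"
 by (rule o_bij[of "lab \<tau>"]) (simp_all add: fun_eq_iff lab_lab)

definition Pm :: "(real^3 => 'a) => real^3^3" where
 "Pm \<tau> = perm_matrix (lab \<tau>)"

lemma Pm_Pm: "Pm \<tau> ** Pm \<tau> = mat 1"
proof -
 have "lab \<tau> \<circ> lab \<tau> = id" by (simp add: fun_eq_iff lab_lab)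
 then show ?thesis unfolding Pm_def perm_matrix_comp by (simp only: perm_matrix_id)
qed

text \<open>Once both triangles are renumbered along the orientation, the gluing reverses the cyclic
  order in either case of \<open>gperm_orientation\<close>, and \<open>cross_base_component\<close>
  applies.\<close>

lemma rX_component:
 assumes s: "s \<in> sides"
 shows "Pm (fst s) ** rX s ** Pm (fst (opp s)) \<in> base_component"
proof -
 obtain b c t x where f: "distinct [snd s, b, c]" "0 < t" "rX s = cross (snd s) b c t (-1) ** perm_matrix (gperm s)"
  using crossing_form[OF s] unfolding crossing_form_def by (elim exE conjE)
 let ?o = "lab (fst s)" and ?o' = "lab (fst (opp s))"
 have "Pm (fst s) ** cross (snd s) b c t (-1) = cross (?o (snd s)) (?o b) (?o c) t (-1) ** Pm (fst s)"
  unfolding Pm_def perm_matrix_cross[OF bij_lab] by (simp only: lab_lab)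
 then have e: "Pm (fst s) ** rX s ** Pm (fst (opp s)) =
   cross (?o (snd s)) (?o b) (?o c) t (-1) ** ((Pm (fst s) ** perm_matrix (gperm s)) ** Pm (fst (opp s)))"
  unfolding f(3) by (simp only: matrix_mul_assoc)
 have "inj ?o" using bij_lab by (rule bij_is_inj)
 then have d: "distinct [?o (snd s), ?o b, ?o c]" using f(1) by (simp add: inj_eq)
 have "(?o' \<circ> (gperm s \<circ> ?o)) (nx k) = pv ((?o' \<circ> (gperm s \<circ> ?o)) k)" for k
 proof (cases "positive \<A> (fst s) = positive \<A> (fst (opp s))")
  case True
  note g = gperm_orientation(1)[OF atlas s True]
  have g': "gperm s (pv k) = nx (gperm s k)" for k using g[of "nx k"] g[of k] by simp
  show ?thesis using True by (simp add: lab_def g g' flip)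
 next
  case False
  note g = gperm_orientation(2)[OF atlas s False]
  have g': "gperm s (pv k) = pv (gperm s k)" for k using g[of "nx k"] g[of k] by simp
  show ?thesis using False by (auto simp: lab_def g g' flip)
 qed
 then have "cross (?o (snd s)) (?o b) (?o c) t (-1) ** perm_matrix (?o' \<circ> (gperm s \<circ> ?o)) \<in> base_component"
  by (rule cross_base_component[OF d f(2)])
 then show ?thesis unfolding e unfolding Pm_def perm_matrix_comp .
qed

lemma wmat_component: "is_gallery \<tau> w \<tau>' ==> Pm \<tau> ** wmat rX w ** Pm \<tau>' \<in> base_component"
proof (induction w arbitrary: \<tau>)
 case Nil
 then have "\<tau>' = \<tau>" by simp
 moreover have "(mat 1 :: real^3^3) \<in> base_component"
  using rotation_base_component[of id] by (simp add: perm_matrix_id)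
 ultimately show ?case by (simp add: Pm_Pm)
next
 case (Cons s w)
 note s = is_gallery_Cons[OF Cons.prems]
 let ?q = "Pm (fst (opp s))"
 have "(Pm \<tau> ** rX s ** ?q) ** (?q ** wmat rX w ** Pm \<tau>') = Pm \<tau> ** rX s ** (?q ** ?q) ** wmat rX w ** Pm \<tau>'"
  by (simp only: matrix_mul_assoc)
 then have e: "Pm \<tau> ** wmat rX (s # w) ** Pm \<tau>' = (Pm \<tau> ** rX s ** ?q) ** (?q ** wmat rX w ** Pm \<tau>')"
  by (simp only: Pm_Pm matrix_mul_rid wmat.simps matrix_mul_assoc)
 show ?case unfolding e by (rule base_component_mult[OF rX_component[OF s(1), unfolded s(2)] Cons.IH[OF s(3)]])
qed

definition \<tau>0 :: "real^3 => 'a" where "\<tau>0 = fst (home x0)"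

definition \<delta>0 :: "real => 'a" where "\<delta>0 = reversepath (spoke x0)"

lemma based_0: "based \<delta>0 \<tau>0"
proof -
 have "x0 \<in> M" using x0 by (rule DiffD1)
 then show ?thesis unfolding based_def \<delta>0_def \<tau>0_def using home(1)[of x0] spoke[OF x0] by simp
qed

lemmas pth_0 = pth_based[OF based_0]

definition has_word :: "(real => 'a) => 'a side list => bool" where
 "has_word p w \<longleftrightarrow> is_gallery \<tau>0 w \<tau>0 \<and> p +++ \<delta>0 \<simeq> \<delta>0 +++ gpath \<tau>0 w"

lemma has_wordD: "has_word p w ==> is_gallery \<tau>0 w \<tau>0" "has_word p w ==> p +++ \<delta>0 \<simeq> \<delta>0 +++ gpath \<tau>0 w"
 unfolding has_word_def by (rule conjunct1, assumption) (rule conjunct2)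

lemma word_exists:
 assumes "loop p"
 shows "\<exists>w. has_word p w"
 unfolding has_word_def by (rule gallery_between[OF based_0 based_join[OF assms based_0]])

lemma loop_homotopic: "loop p ==> p \<simeq> q ==> loop q"
 using pth_homotopic[of p x0 x0 q] unfolding loop_def pth_def .

lemma word_unique:
 assumes p: "loop p" and h: "p \<simeq> q" and w: "has_word p w" "has_word q v"
 shows "wmat rX w = wmat rX v"
proof -
 note gw = has_wordD(1)[OF w(1)] and gv = has_wordD(1)[OF w(2)] and pp = pth_loop[OF p]
 have "\<delta>0 +++ gpath \<tau>0 w \<simeq> p +++ \<delta>0" by (rule homotopic_paths_sym[OF has_wordD(2)[OF w(1)]])
 also have "\<dots> \<simeq> q +++ \<delta>0" by (rule pth_joinI[OF h pth_refl[OF pth_0] pp pth_0])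
 also have "\<dots> \<simeq> \<delta>0 +++ gpath \<tau>0 v" by (rule has_wordD(2)[OF w(2)])
 finally have "gpath \<tau>0 w \<simeq> gpath \<tau>0 v" by (rule pth_cancel_left[OF pth_0 pth_gallery[OF gw] pth_gallery[OF gv]])
 then show ?thesis by (rule homotopic_galleries_wmat[OF inverse_rX gw gv])
qed

lemma word_join:
 assumes p: "loop p" and q: "loop q" and w: "has_word p w" "has_word q v"
 shows "has_word (p +++ q) (w @ v)"
proof -
 note gw = has_wordD(1)[OF w(1)] and gv = has_wordD(1)[OF w(2)] and pp = pth_loop[OF p] and pq = pth_loop[OF q]
 note pw = pth_gallery[OF gw] and pv = pth_gallery[OF gv]
 have "(p +++ q) +++ \<delta>0 \<simeq> p +++ (q +++ \<delta>0)" by (rule pth_assoc[OF pp pq pth_0])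
 also have "\<dots> \<simeq> p +++ (\<delta>0 +++ gpath \<tau>0 v)"
  by (rule pth_joinI[OF pth_refl[OF pp] has_wordD(2)[OF w(2)] pp pth_join[OF pq pth_0]])
 also have "\<dots> \<simeq> (p +++ \<delta>0) +++ gpath \<tau>0 v"
  by (rule homotopic_paths_sym[OF pth_assoc[OF pp pth_0 pv]])
 also have "\<dots> \<simeq> (\<delta>0 +++ gpath \<tau>0 w) +++ gpath \<tau>0 v"
  by (rule pth_joinI[OF has_wordD(2)[OF w(1)] pth_refl[OF pv] pth_join[OF pp pth_0] pv])
 also have "\<dots> \<simeq> \<delta>0 +++ (gpath \<tau>0 w +++ gpath \<tau>0 v)"
  by (rule pth_assoc[OF pth_0 pw pv])
 also have "\<dots> \<simeq> \<delta>0 +++ gpath \<tau>0 (w @ v)"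
  by (rule pth_joinI[OF pth_refl[OF pth_0] gpath_append[OF gw gv] pth_0 pth_join[OF pw pv]])
 finally show ?thesis unfolding has_word_def using is_gallery_append[OF gw gv] by (intro conjI)
qed

lemma loop_const: "loop (const_path x0)"
 unfolding loop_def using x0 by simp

lemma word_Nil:
 assumes p: "loop p"
 shows "has_word p [] \<longleftrightarrow> p \<simeq> const_path x0"
proof -
 note c = pth_loop[OF loop_const] and pp = pth_loop[OF p]
 have g: "is_gallery \<tau>0 [] \<tau>0" using basedD(1)[OF based_0] by simp
 have "const_path x0 +++ \<delta>0 \<simeq> \<delta>0" by (rule pth_lid[OF pth_0])
 also have "\<dots> \<simeq> \<delta>0 +++ gpath \<tau>0 []" unfolding gpath.simps by (rule homotopic_paths_sym[OF pth_rid[OF pth_0]])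
 finally have 1: "const_path x0 +++ \<delta>0 \<simeq> \<delta>0 +++ gpath \<tau>0 []" .
 show ?thesis
 proof
  assume "has_word p []"
  from homotopic_paths_trans[OF has_wordD(2)[OF this] homotopic_paths_sym[OF 1]]
  show "p \<simeq> const_path x0" by (rule pth_cancel_right[OF pp c pth_0])
 next
  assume h: "p \<simeq> const_path x0"
  have "p +++ \<delta>0 \<simeq> const_path x0 +++ \<delta>0" by (rule pth_joinI[OF h pth_refl[OF pth_0] pp pth_0])
  from homotopic_paths_trans[OF this 1] show "has_word p []" unfolding has_word_def by (rule conjI[OF g])
 qed
qed

definition hol :: "(real => 'a) => real^3^3" where
 "hol p = wmat rX (SOME w. has_word p w)"

lemma hol_eq:
 assumes "loop p" "has_word p w"
 shows "hol p = wmat rX w"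
 unfolding hol_def
 by (rule word_unique[OF assms(1) pth_refl[OF pth_loop[OF assms(1)]] someI_ex[OF word_exists[OF assms(1)]] assms(2)])

lemma hol_cong:
 assumes "loop p" "p \<simeq> q"
 shows "hol p = hol q"
proof -
 have q: "loop q" by (rule loop_homotopic[OF assms])
 show ?thesis unfolding hol_def
  by (rule word_unique[OF assms someI_ex[OF word_exists[OF assms(1)]] someI_ex[OF word_exists[OF q]]])
qed

lemma loop_join: "loop p ==> loop q ==> loop (p +++ q)"
 unfolding loop_def by (simp add: subset_path_image_join)

lemma loop_reverse: "loop p ==> loop (reversepath p)"
 unfolding loop_def by simp

lemma hol_join:
 assumes p: "loop p" and q: "loop q"
 shows "hol (p +++ q) = hol p ** hol q"
proof -
 obtain w v where w: "has_word p w" "has_word q v" using word_exists[OF p] word_exists[OF q] by (elim exE)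
 show ?thesis
  unfolding hol_eq[OF p w(1)] hol_eq[OF q w(2)] hol_eq[OF loop_join[OF p q] word_join[OF p q w]] by (rule wmat_append)
qed

lemma hol_const:
 assumes p: "loop p" and h: "p \<simeq> const_path x0"
 shows "hol p = mat 1"
 using hol_eq[OF p] word_Nil[OF p] h by simp

text \<open>A real frame for the base triangle; conjugation by it turns holonomies, which preserve
  \<open>gram\<close>, into matrices preserving \<open>J21\<close>.\<close>

definition Lm :: "real^3^3" where "Lm = base_frame ** Pm \<tau>0"

definition Li :: "real^3^3" where "Li = Pm \<tau>0 ** base_frame_inv"

lemma Lm_Li: "Lm ** Li = mat 1"
proof -
 have "Lm ** Li = base_frame ** (Pm \<tau>0 ** Pm \<tau>0) ** base_frame_inv" by (simp only: Lm_def Li_def matrix_mul_assoc)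
 then show ?thesis by (simp only: Pm_Pm matrix_mul_rid base_frame_inv)
qed

lemma Li_Lm: "Li ** Lm = mat 1"
 by (rule square_inverse[OF Lm_Li])

definition rm :: "(real => 'a) => real^3^3" where
 "rm p = Lm ** hol p ** Li"

lemma rm_component:
 assumes p: "loop p"
 shows "rm p \<in> O21_component"
proof -
 obtain w where w: "has_word p w" using word_exists[OF p] by (rule exE)
 have "base_frame ** (Pm \<tau>0 ** hol p ** Pm \<tau>0) ** base_frame_inv \<in> O21_component"
  using wmat_component[OF has_wordD(1)[OF w]] unfolding hol_eq[OF p w] base_component_def mem_Collect_eq .
 then show ?thesis by (simp only: rm_def Lm_def Li_def matrix_mul_assoc)
qed

lemma rm_U21:
 assumes "loop p"
 shows "cmat (rm p) \<in> carrier U21"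
 by (rule O21_real_U21, rule subsetD[OF connected_component_subset rm_component[OF assms]])

lemma rm_join:
 assumes "loop p" "loop q"
 shows "rm (p +++ q) = rm p ** rm q"
proof -
 have "rm p ** rm q = Lm ** hol p ** (Li ** Lm) ** hol q ** Li" by (simp only: rm_def matrix_mul_assoc)
 then show ?thesis unfolding rm_def hol_join[OF assms] by (simp only: Li_Lm matrix_mul_rid matrix_mul_assoc)
qed

definition \<rho>0 :: "(real => 'a) set => (complex^3^3) set" where
 "\<rho>0 \<gamma> = pclass (cmat (rm (SOME p. loop p \<and> \<gamma> = cl p)))"

lemma \<rho>0_cl:
 assumes p: "loop p"
 shows "\<rho>0 (cl p) = pclass (cmat (rm p))"
proof -
 let ?q = "SOME q. loop q \<and> cl p = cl q"
 have "loop p \<and> cl p = cl p" using p by simp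
 from someI[of "\<lambda>q. loop q \<and> cl p = cl q", OF this] have q: "loop ?q" "cl p = cl ?q"
  by (rule conjunct1, rule conjunct2)
 have "p \<simeq> ?q" using cl_eq_iff[OF p, of ?q] q(2) by (rule iffD1)
 from hol_cong[OF p this] have "rm ?q = rm p" unfolding rm_def by (simp only:)
 then show ?thesis unfolding \<rho>0_def by (simp only:)
qed

lemma fundamental_mult:
 assumes p: "loop p" and q: "loop q"
 shows "cl p \<otimes>\<^bsub>\<pi>\<^sub>1\<^esub> cl q = cl (p +++ q)"
proof -
 have "(\<exists>p'\<in>cl p. \<exists>q'\<in>cl q. p' +++ q' \<simeq> r) \<longleftrightarrow> p +++ q \<simeq> r" for r
 proof
  assume "\<exists>p'\<in>cl p. \<exists>q'\<in>cl q. p' +++ q' \<simeq> r"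
  then obtain p' q' where h: "p \<simeq> p'" "q \<simeq> q'" "p' +++ q' \<simeq> r" unfolding path_class_def mem_Collect_eq by (elim bexE) simp
  from homotopic_paths_trans[OF pth_joinI[OF h(1,2) pth_loop[OF p] pth_loop[OF q]] h(3)] show "p +++ q \<simeq> r" .
 next
  assume "p +++ q \<simeq> r"
  then show "\<exists>p'\<in>cl p. \<exists>q'\<in>cl q. p' +++ q' \<simeq> r" by (intro bexI[OF _ cl_refl[OF p]] bexI[OF _ cl_refl[OF q]])
 qed
 then show ?thesis unfolding fundamental_group_def path_class_def[of _ "p +++ q"] by simp
qed

theorem \<rho>0_hom: "\<rho>0 \<in> hom \<pi>\<^sub>1 (PU21\<lparr>carrier := PO21\<rparr>)"
proof (rule homI)
 fix \<gamma> assume "\<gamma> \<in> carrier \<pi>\<^sub>1"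
 then obtain p where p: "\<gamma> = cl p" "loop p" unfolding carrier_fundamental by blast
 show "\<rho>0 \<gamma> \<in> carrier (PU21\<lparr>carrier := PO21\<rparr>)"
  unfolding p(1) \<rho>0_cl[OF p(2)] PO21_def using rm_component[OF p(2)] by auto
next
 fix \<gamma> \<gamma>' assume "\<gamma> \<in> carrier \<pi>\<^sub>1" "\<gamma>' \<in> carrier \<pi>\<^sub>1"
 then obtain p q where p: "\<gamma> = cl p" "loop p" and q: "\<gamma>' = cl q" "loop q" unfolding carrier_fundamental by blast
 have "\<rho>0 (\<gamma> \<otimes>\<^bsub>\<pi>\<^sub>1\<^esub> \<gamma>') = pclass (cmat (rm p) ** cmat (rm q))"
  unfolding p(1) q(1) fundamental_mult[OF p(2) q(2)] \<rho>0_cl[OF loop_join[OF p(2) q(2)]] rm_join[OF p(2) q(2)] map_matrix_mult ..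
 also have "\<dots> = \<rho>0 \<gamma> \<otimes>\<^bsub>PU21\<^esub> \<rho>0 \<gamma>'"
  unfolding p(1) q(1) \<rho>0_cl[OF p(2)] \<rho>0_cl[OF q(2)] by (rule mult_PU21[OF rm_U21[OF p(2)] rm_U21[OF q(2)], symmetric])
 finally show "\<rho>0 (\<gamma> \<otimes>\<^bsub>\<pi>\<^sub>1\<^esub> \<gamma>') = \<rho>0 \<gamma> \<otimes>\<^bsub>PU21\<lparr>carrier := PO21\<rparr>\<^esub> \<rho>0 \<gamma>'" by simp
qed

text \<open>The holonomy of a non-trivial reduced word has a row whose entries are dominated by the
 other entries of their columns, so that it stays away from the scalars.\<close>

definition nbhd :: "(real => 'a) => (complex^3^3) set" where
 "nbhd q = {A \<in> carrier U21. \<forall>i. \<exists>k. (\<Sum>j\<in>UNIV - {i}. cmod ((cmat (Li ** rm (reversepath q)) ** A ** cmat Lm) $ j $ k))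
  < cmod ((cmat (Li ** rm (reversepath q)) ** A ** cmat Lm) $ i $ k)}"

lemma nbhd_matrix:
 assumes p: "loop p" and q: "loop q"
 shows "cmat (Li ** rm (reversepath q)) ** (mat c ** cmat (rm p)) ** cmat Lm = mat c ** cmat (hol (reversepath q +++ p))"
proof -
 let ?r = "reversepath q"
 have 1: "Li ** rm ?r ** rm p ** Lm = (Li ** Lm) ** hol ?r ** (Li ** Lm) ** hol p ** (Li ** Lm)"
  by (simp only: rm_def matrix_mul_assoc)
 have 2: "Li ** rm ?r ** rm p ** Lm = hol (?r +++ p)"
  unfolding 1 Li_Lm hol_join[OF loop_reverse[OF q] p] by (simp only: matrix_mul_lid matrix_mul_rid)
 have "cmat (Li ** rm ?r) ** (mat c ** cmat (rm p)) ** cmat Lm = mat c ** (cmat (Li ** rm ?r) ** cmat (rm p)) ** cmat Lm"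
  unfolding mat_left_commute ..
 also have "\<dots> = mat c ** cmat (Li ** rm ?r ** rm p ** Lm)" by (simp only: map_matrix_mult matrix_mul_assoc)
 finally show ?thesis unfolding 2 .
qed

lemma cmod_scalar_cmat: "cmod c = 1 ==> cmod ((mat c ** cmat B) $ j $ k) = \<bar>B $ j $ k\<bar>"
 by (simp add: mat_scalar_nth cmat_nth norm_mult)

text \<open>Let a reduced word of the reverse of q followed by p start with s. Its holonomy obeys
  \<open>reduced_row_bound\<close> in the row \<open>snd s\<close>, while membership in the
  neighbourhood says the contrary in some column. So the reduced word is empty.\<close>

lemma nbhd_homotopic:
 assumes p: "loop p" and q: "loop q" and c: "cmod c = 1" and A: "mat c ** cmat (rm p) \<in> nbhd q"
 shows "q \<simeq> p"
proof -
 let ?r = "reversepath q +++ p"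
 have r: "loop ?r" by (rule loop_join[OF loop_reverse[OF q] p])
 have n: "\<exists>k. (\<Sum>j\<in>UNIV - {i}. \<bar>hol ?r $ j $ k\<bar>) < \<bar>hol ?r $ i $ k\<bar>" for i
  using A unfolding nbhd_def mem_Collect_eq nbhd_matrix[OF p q] cmod_scalar_cmat[OF c] by blast
 obtain w where w: "has_word ?r w" using word_exists[OF r] by (rule exE)
 obtain u where u: "is_gallery \<tau>0 u \<tau>0" "gpath \<tau>0 w \<simeq> gpath \<tau>0 u" "reduced u"
  using reduced_exists[OF has_wordD(1)[OF w]] by (elim exE conjE)
 have "\<delta>0 +++ gpath \<tau>0 w \<simeq> \<delta>0 +++ gpath \<tau>0 u"
  by (rule pth_joinI[OF pth_refl[OF pth_0] u(2) pth_0 pth_gallery[OF has_wordD(1)[OF w]]])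
 from homotopic_paths_trans[OF has_wordD(2)[OF w] this] have hu: "has_word ?r u" unfolding has_word_def by (rule conjI[OF u(1)])
 have "u = []"
 proof (cases u)
  case (Cons s v)
  obtain k where "(\<Sum>j\<in>UNIV - {snd s}. \<bar>hol ?r $ j $ k\<bar>) < \<bar>hol ?r $ snd s $ k\<bar>" using n[of "snd s"] by (rule exE)
  moreover have "\<bar>hol ?r $ snd s $ k\<bar> \<le> (\<Sum>j\<in>UNIV - {snd s}. \<bar>hol ?r $ j $ k\<bar>)"
   unfolding hol_eq[OF r hu] Cons by (rule reduced_row_bound[OF crossing_form u(1)[unfolded Cons] u(3)[unfolded Cons]])
  ultimately show ?thesis by linarith
 qed
 then have "has_word ?r []" using hu by simp
 then have h: "?r \<simeq> const_path x0" using word_Nil[OF r] by blast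
 note pq = pth_loop[OF q] and pp = pth_loop[OF p]
 have "q \<simeq> q +++ const_path x0" by (rule homotopic_paths_sym[OF pth_rid[OF pq]])
 also have "\<dots> \<simeq> q +++ ?r"
  by (rule pth_joinI[OF pth_refl[OF pq] homotopic_paths_sym[OF h] pq pth_loop[OF loop_const]])
 also have "\<dots> \<simeq> p"
  using pth_cancel_inverse[OF pth_reverse[OF pq] pp] by (simp only: reversepath_reversepath)
 finally show ?thesis .
qed

lemma nbhd_self:
 assumes q: "loop q" and c: "cmod c = 1"
 shows "mat c ** cmat (rm q) \<in> nbhd q"
proof -
 have h: "hol (reversepath q +++ q) = mat 1"
  by (rule hol_const[OF loop_join[OF loop_reverse[OF q] q] pth_linv[OF pth_loop[OF q]]])
 have "mat c ** cmat (rm q) \<in> carrier U21"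
  using group.is_monoid[OF group_U21] monoid.m_closed[of U21 "mat c" "cmat (rm q)"] mat_in_U21[OF c] rm_U21[OF q]
  by (simp add: U21_def)
 moreover have "(\<Sum>j\<in>UNIV - {i}. \<bar>(mat 1 :: real^3^3) $ j $ i\<bar>) < \<bar>(mat 1 :: real^3^3) $ i $ i\<bar>" for i
  by (simp add: mat_def)
 ultimately show ?thesis unfolding nbhd_def mem_Collect_eq nbhd_matrix[OF q q] cmod_scalar_cmat[OF c] h by blast
qed

lemma nbhd_scalar:
 assumes A: "A \<in> nbhd q" and c: "cmod c = 1"
 shows "mat c ** A \<in> nbhd q"
proof -
 have AU: "A \<in> carrier U21" using A unfolding nbhd_def by blast
 have "mat c ** A \<in> carrier U21"
  using group.is_monoid[OF group_U21] monoid.m_closed[of U21 "mat c" A] mat_in_U21[OF c] AU by (simp add: U21_def)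
 moreover have "cmod ((D ** (mat c ** A) ** E) $ j $ k) = cmod ((D ** A ** E) $ j $ k)" for D E :: "complex^3^3" and j k
 proof -
  have "D ** (mat c ** A) ** E = mat c ** (D ** A ** E)" unfolding mat_left_commute by (simp only: matrix_mul_assoc)
  then show ?thesis by (simp add: mat_scalar_nth norm_mult c)
 qed
 ultimately show ?thesis using A unfolding nbhd_def mem_Collect_eq by simp
qed

lemma openin_nbhd: "openin (top_of_set (carrier U21)) (nbhd q)"
proof -
 let ?Z = "\<lambda>A. cmat (Li ** rm (reversepath q)) ** A ** cmat Lm"
 have cont: "continuous_on UNIV (\<lambda>A. ?Z A $ j $ k)" for j k
  unfolding matrix_matrix_mult_def by (simp, intro continuous_intros)
 have "open {A. (\<Sum>j\<in>UNIV - {i}. cmod (?Z A $ j $ k)) < cmod (?Z A $ i $ k)}" for i k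
  by (intro open_Collect_less continuous_on_sum continuous_on_norm cont)
 then have "open (\<Inter>i. \<Union>k. {A. (\<Sum>j\<in>UNIV - {i}. cmod (?Z A $ j $ k)) < cmod (?Z A $ i $ k)})"
  by (intro open_INT open_UN ballI finite)
 moreover have "nbhd q = carrier U21 \<inter> (\<Inter>i. \<Union>k. {A. (\<Sum>j\<in>UNIV - {i}. cmod (?Z A $ j $ k)) < cmod (?Z A $ i $ k)})"
  unfolding nbhd_def by auto
 ultimately show ?thesis unfolding openin_open by blast
qed

text \<open>Stability under unit scalars makes the neighbourhood a union of classes, so it descends
  to the quotient topology.\<close>

lemma openin_nbhd_classes: "openin PU21_topology {C \<in> carrier PU21. C \<subseteq> nbhd q}"
proof -
 have "\<Union>{C \<in> carrier PU21. C \<subseteq> nbhd q} = nbhd q"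
 proof (intro equalityI subsetI)
  fix A assume A: "A \<in> nbhd q"
  then have "A \<in> carrier U21" unfolding nbhd_def by blast
  then have "pclass A \<in> carrier PU21" unfolding carrier_PU21 by (rule imageI)
  moreover have "pclass A \<subseteq> nbhd q" unfolding pclass_eq using nbhd_scalar[OF A] by blast
  ultimately show "A \<in> \<Union>{C \<in> carrier PU21. C \<subseteq> nbhd q}" using mem_pclass[of A] by blast
 qed blast
 then show ?thesis unfolding openin_PU21_topology using openin_nbhd by auto
qed

theorem \<rho>0_discrete_faithful: "discrete_faithful \<pi>\<^sub>1 \<rho>0"
proof -
 let ?S = "\<rho>0 ` carrier \<pi>\<^sub>1"
 \<comment> \<open>This equivalence yields injectivity and also isolates each value within the
   image.\<close>
 have iff: "\<rho>0 (cl p) \<subseteq> nbhd q \<longleftrightarrow> cl p = cl q" if p: "loop p" and q: "loop q" for p q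
 proof
  assume "\<rho>0 (cl p) \<subseteq> nbhd q"
  then have "mat 1 ** cmat (rm p) \<in> nbhd q" unfolding \<rho>0_cl[OF p] using mem_pclass[of "cmat (rm p)"] by auto
  from nbhd_homotopic[OF p q _ this] have "q \<simeq> p" by simp
  then show "cl p = cl q" using cl_eq_iff[OF q, of p] by blast
 next
  assume e: "cl p = cl q"
  show "\<rho>0 (cl p) \<subseteq> nbhd q" unfolding e \<rho>0_cl[OF q] pclass_eq using nbhd_self[OF q] by blast
 qed
 have "inj_on \<rho>0 (carrier \<pi>\<^sub>1)"
 proof (rule inj_onI)
  fix \<gamma> \<gamma>' assume "\<gamma> \<in> carrier \<pi>\<^sub>1" "\<gamma>' \<in> carrier \<pi>\<^sub>1" and e: "\<rho>0 \<gamma> = \<rho>0 \<gamma>'"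
  then obtain p q where p: "\<gamma> = cl p" "loop p" and q: "\<gamma>' = cl q" "loop q" unfolding carrier_fundamental by blast
  have "\<rho>0 (cl q) \<subseteq> nbhd q" using iff[OF q(2) q(2)] by simp
  then have "\<rho>0 (cl p) \<subseteq> nbhd q" using e unfolding p(1) q(1) by simp
  then show "\<gamma> = \<gamma>'" using iff[OF p(2) q(2)] unfolding p(1) q(1) by simp
 qed
 moreover have "discrete_topology ?S = subtopology PU21_topology ?S"
 proof (subst discrete_topology_unique, intro conjI ballI)
  have S: "\<rho>0 (cl q) \<in> {C \<in> carrier PU21. C \<subseteq> nbhd q}" if q: "loop q" for q
   using iff[OF q q] rm_U21[OF q] unfolding \<rho>0_cl[OF q] carrier_PU21 by simp
  have "?S \<subseteq> topspace PU21_topology"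
  proof (rule image_subsetI)
   fix \<gamma> assume "\<gamma> \<in> carrier \<pi>\<^sub>1"
   then obtain q where q: "\<gamma> = cl q" "loop q" unfolding carrier_fundamental by blast
   show "\<rho>0 \<gamma> \<in> topspace PU21_topology" unfolding q(1) by (rule subsetD[OF openin_subset[OF openin_nbhd_classes] S[OF q(2)]])
  qed
  then show "topspace (subtopology PU21_topology ?S) = ?S" by auto
  fix X assume "X \<in> ?S"
  then obtain q where q: "X = \<rho>0 (cl q)" "loop q" unfolding carrier_fundamental by blast
  have "{X} = {C \<in> carrier PU21. C \<subseteq> nbhd q} \<inter> ?S"
  proof (intro equalityI subsetI)
   fix Y assume "Y \<in> {X}"
   then have "Y = X" by simp
   then show "Y \<in> {C \<in> carrier PU21. C \<subseteq> nbhd q} \<inter> ?S" using S[OF q(2)] \<open>X \<in> ?S\<close> q(1) by simp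
  next
   fix Y assume Y: "Y \<in> {C \<in> carrier PU21. C \<subseteq> nbhd q} \<inter> ?S"
   then obtain p where p: "Y = \<rho>0 (cl p)" "loop p" unfolding carrier_fundamental by blast
   have "cl p = cl q" using Y iff[OF p(2) q(2)] unfolding p(1) by simp
   then show "Y \<in> {X}" unfolding p(1) q(1) by simp
  qed
  with openin_nbhd_classes[of q] show "openin (subtopology PU21_topology ?S) {X}"
   unfolding openin_subtopology by (intro exI conjI)
 qed
 ultimately show ?thesis unfolding discrete_faithful_def by (intro conjI) (assumption, rule sym)
qed

end

section \<open>Loops around a puncture\<close>

context bipartite_surface
begin

text \<open>The corners of the triangles of a gallery around a vertex that lie at this vertex.\<close>

fun tracked :: "'a side list => 3 => 3 => bool" where
 "tracked [] a b \<longleftrightarrow> a = b"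
| "tracked (s # w) a b \<longleftrightarrow> a ~= snd s \<and> tracked w (gperm s a) b"

lemma tracked_append: "tracked u a b ==> tracked w b c ==> tracked (u @ w) a c"
 by (induction u arbitrary: a) simp_all

text \<open>\<open>gfun_inv s (1/2)\<close> is the position on the edge of s that corresponds to the
  midpoint in the opposite triangle. A point whose coordinate at one end of the edge exceeds l lies,
  in either triangle, on the same side of this position as that end; this makes the corners of
  neighbouring triangles match.\<close>

definition cusp_bound :: "real => bool" where
 "cusp_bound l \<longleftrightarrow> 1 / 2 \<le> l \<and> l < 1 \<and>
  (\<forall>s\<in>sides. 1 - l \<le> gfun_inv s (1/2) \<and> gfun_inv s (1/2) \<le> l)"

lemma cusp_bound_exists: "\<exists>l. cusp_bound l"
proof -
 let ?g = "\<lambda>s. gfun_inv s (1/2)"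
 define L where "L = insert (1/2) ((\<lambda>s. max (?g s) (1 - ?g s)) ` (sides))"
 have fin: "finite L" unfolding L_def using finite_T by simp
 have g: "0 < ?g s \<and> ?g s < 1" if s: "s \<in> sides" for s
  using strict_monoD[OF ginv(1)[OF s], of 0 "1/2"] strict_monoD[OF ginv(1)[OF s], of "1/2" 1] ginv(2,3)[OF s] by simp
 have lt: "x < 1" if "x \<in> L" for x using that g unfolding L_def by fastforce
 have "cusp_bound (Max L)" unfolding cusp_bound_def
 proof (intro conjI ballI)
  show "1 / 2 \<le> Max L" by (rule Max_ge[OF fin]) (simp add: L_def)
  show "Max L < 1" by (rule lt[OF Max_in[OF fin]]) (simp add: L_def)
  fix s :: "'a side"
  assume s: "s \<in> sides"
  have "max (?g s) (1 - ?g s) \<in> L" unfolding L_def by (rule insertI2, rule imageI[OF s])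
  then have "max (?g s) (1 - ?g s) \<le> Max L" by (rule Max_ge[OF fin])
  then show "1 - Max L \<le> ?g s" "?g s \<le> Max L" by linarith+
 qed
 then show ?thesis by (rule exI)
qed

context
 fixes l :: real
 assumes l: "cusp_bound l"
begin

lemma cusp_boundD:
 "1 / 2 \<le> l" "l < 1" "s \<in> sides ==> 1 - l \<le> gfun_inv s (1/2)"
 "s \<in> sides ==> gfun_inv s (1/2) \<le> l"
 using l unfolding cusp_bound_def by blast+

definition near_cusp :: "'a => bool" where
 "near_cusp m \<longleftrightarrow> (\<exists>i. l < snd (home m) $ i)"

text \<open>The corner is unique: as l is at least 1/2, no two barycentric coordinates exceed
  it.\<close>

definition cusp_corner :: "'a => 3" where
 "cusp_corner m = (SOME i. l < snd (home m) $ i)"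

lemma cusp_corner: "near_cusp m ==> l < snd (home m) $ cusp_corner m"
 unfolding near_cusp_def cusp_corner_def by (rule someI_ex)

text \<open>A neighbourhood of all punctures at once: only the compact cores of the triangles are
  removed. That a path in it stays near one vertex is the content of
  \<open>path_word_tracked\<close>.\<close>

definition cusp_nbhd :: "'a set" where
 "cusp_nbhd = M - (\<Union>\<tau>\<in>\<T>. \<tau> ` {y \<in> triangle. \<forall>i. y $ i \<le> l})"

lemma openin_cusp_nbhd: "openin (top_of_set M) cusp_nbhd"
proof -
 let ?K = "{y :: real^3. y \<in> triangle \<and> (\<forall>i. y $ i \<le> l)}"
 have "?K = triangle \<inter> (\<Inter>i. {y. y $ i \<le> l})" by auto
 moreover have "closed (\<Inter>i. {y :: real^3. y $ i \<le> l})"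
  by (intro closed_INT ballI closed_Collect_le continuous_intros)
 ultimately have "compact ?K" using compact_triangle by (simp add: compact_Int_closed)
 then have "closed (\<tau> ` ?K)" if "\<tau> \<in> \<T>" for \<tau> by (rule closed_T_image[OF that]) blast
 then have "closed (\<Union>\<tau>\<in>\<T>. \<tau> ` ?K)" by (intro closed_UN finite_T ballI)
 then have "open (- (\<Union>\<tau>\<in>\<T>. \<tau> ` ?K))" by (rule open_Compl)
 moreover have "cusp_nbhd = M \<inter> - (\<Union>\<tau>\<in>\<T>. \<tau> ` ?K)" unfolding cusp_nbhd_def by (rule Diff_eq)
 ultimately show ?thesis unfolding openin_open by (intro exI conjI)
qed

lemma puncture_in_cusp_nbhd:
 assumes "q \<in> P" "q \<in> M"
 shows "q \<in> cusp_nbhd"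
proof -
 have "q ~= \<tau> y" if T: "\<tau> \<in> \<T>" and y: "y \<in> triangle" "\<forall>i. y $ i \<le> l" for \<tau> y
 proof
  assume "q = \<tau> y"
  then have "y \<in> range corner" using T_in_P_iff[OF T y(1)] assms(1) by simp
  then obtain i where "y = corner i" by (rule rangeE)
  then have "1 \<le> l" using y(2)[rule_format, of i] by (simp add: corner_nth)
  then show False using cusp_boundD(2) by simp
 qed
 then show ?thesis unfolding cusp_nbhd_def using assms(2) by auto
qed

lemma cusp_nbhd_near:
 assumes "m \<in> cusp_nbhd"
 shows "near_cusp m"
proof (rule ccontr)
 have M: "m \<in> M" using assms unfolding cusp_nbhd_def by (rule DiffD1)
 assume "\<not> near_cusp m"
 then have "snd (home m) \<in> {y \<in> triangle. \<forall>i. y $ i \<le> l}" using home(2)[OF M] unfolding near_cusp_def by (simp add: not_less)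
 then have "fst (home m) (snd (home m)) \<in> (\<Union>\<tau>\<in>\<T>. \<tau> ` {y \<in> triangle. \<forall>i. y $ i \<le> l})"
  by (intro UN_I[OF home(1)[OF M]] imageI)
 then show False using assms unfolding home(3)[OF M] cusp_nbhd_def by blast
qed

text \<open>The relative position on the parallel to the edge, which is the quantity that
  \<open>twist\<close> hands to the gluing function.\<close>

definition position :: "complex => real" where
 "position z = Re z / (1 - \<bar>Im z\<bar>)"

text \<open>In the chart of the star of \<open>s\<close>, the corner near which a point lies is determined by the
 distance from the common side and by the position along this side.\<close>

lemma star_cusp_cases:
 assumes s: "s \<in> sides" and m: "m \<in> star s" and n: "near_cusp m"
 defines "\<theta> \<equiv> gfun_inv s (1/2)" and "z \<equiv> chart_inv s m"
 shows "(fst (home m) = fst s \<and> 0 \<le> Im z \<and>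
   (l < \<bar>Im z\<bar> \<and> cusp_corner m = snd s \<or>
   \<bar>Im z\<bar> < 1 - l \<and> \<theta> < position z \<and> cusp_corner m = pv (snd s) \<or>
   \<bar>Im z\<bar> < 1 - l \<and> position z < \<theta> \<and> cusp_corner m = nx (snd s))) \<or>
  (fst (home m) = fst (opp s) \<and> Im z \<le> 0 \<and>
   (l < \<bar>Im z\<bar> \<and> cusp_corner m = snd (opp s) \<or>
   \<bar>Im z\<bar> < 1 - l \<and> \<theta> < position z \<and> cusp_corner m = gperm s (pv (snd s)) \<or>
   \<bar>Im z\<bar> < 1 - l \<and> position z < \<theta> \<and> cusp_corner m = gperm s (nx (snd s))))"
proof -
 define y where "y = snd (home m)"
 define k where "k = cusp_corner m"
 have M: "m \<in> M" using subsetD[OF star_subset[OF s] m] by (rule DiffD1)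
 have yk: "l < y $ k" unfolding y_def k_def by (rule cusp_corner[OF n])
 have yT: "y \<in> triangle" unfolding y_def by (rule home(2)[OF M])
 note lb = cusp_boundD(1,2) and th = cusp_boundD(3,4)[OF s, folded \<theta>_def]
 show ?thesis using home_star[OF s m]
 proof (elim disjE conjE)
  assume h: "fst (home m) = fst s" "snd (home m) \<in> half_triangle (snd s)"
  let ?a = "snd s" and ?b = "nx (snd s)" and ?c = "pv (snd s)"
  have ac: "?a ~= ?c" and d: "distinct [?a, ?b, ?c]" by simp_all
  have yh: "y \<in> half_triangle ?a" using h(2) unfolding y_def .
  let ?z = "Complex (y $ ?c) (y $ ?a)"
  note hc = half_coords[OF ac yh]
  have "chart s ?z = fst s y" using chart_upper[OF hc(2), of s] tri_pt_coords[OF ac yT] by simp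
  also have "fst s y = m" using home(3)[OF M] h(1) unfolding y_def by simp
  finally have z: "z = ?z" unfolding z_def using chart_inv_chart[OF s hc(1)] by simp
  have y: "0 \<le> y $ ?a" "0 \<le> y $ ?b" "0 \<le> y $ ?c" "y $ ?a + y $ ?b + y $ ?c = 1" using yT unfolding triangle_iff[OF d] by blast+
  have Im: "Im z = y $ ?a" "Re z = y $ ?c" by (simp_all add: z)
  have "0 < 1 - y $ ?a" using hc(1) unfolding kite_def mem_Collect_eq complex.sel by linarith
  then have pos: "t < position z \<longleftrightarrow> t * (1 - y $ ?a) < y $ ?c" "position z < t \<longleftrightarrow> y $ ?c < t * (1 - y $ ?a)" for t
   using y(1) by (simp_all add: position_def Im pos_less_divide_eq pos_divide_less_eq)
  have "l < \<bar>Im z\<bar> \<and> k = ?a \<or> \<bar>Im z\<bar> < 1 - l \<and> \<theta> < position z \<and> k = ?c \<or> \<bar>Im z\<bar> < 1 - l \<and> position z < \<theta> \<and> k = ?b"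
   using three_nx_cases[of k ?a]
  proof (elim disjE)
   assume k: "k = ?a"
   then show ?thesis using yk y by (simp add: Im)
  next
   assume k: "k = ?b"
   have "y $ ?c < (1 - l) * (1 - y $ ?a)"
   proof -
    have "0 \<le> l * y $ ?a" using lb y(1) by simp
    then show ?thesis using yk y(4) unfolding k by (simp add: algebra_simps)
   qed
   also have "(1 - l) * (1 - y $ ?a) \<le> \<theta> * (1 - y $ ?a)" using th(1) \<open>0 < 1 - y $ ?a\<close> by (simp add: mult_right_mono)
   finally show ?thesis using yk y k by (simp add: Im pos)
  next
   assume k: "k = ?c"
   have "\<theta> * (1 - y $ ?a) \<le> l * (1 - y $ ?a)" using th(2) \<open>0 < 1 - y $ ?a\<close> by (simp add: mult_right_mono)
   also have "l * (1 - y $ ?a) \<le> l" using lb y(1) by (simp add: algebra_simps)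
   also have "l < y $ ?c" using yk unfolding k .
   finally show ?thesis using yk y k by (simp add: Im pos)
  qed
  then show ?thesis using h(1) y(1) unfolding k_def Im by blast
 next
  assume h: "fst (home m) = fst (opp s)" "snd (home m) \<in> half_triangle (snd (opp s))"
  let ?a = "snd (opp s)" and ?b = "gperm s (nx (snd s))" and ?c = "gperm s (pv (snd s))"
  let ?g = "gfun_inv s"
  have d: "distinct [?a, ?b, ?c]" by (rule gperm(3)[OF s])
  have ac: "?a ~= ?c" using d by simp
  have yh: "y \<in> half_triangle ?a" using h(2) unfolding y_def .
  let ?w = "Complex (y $ ?c) (y $ ?a)"
  note hc = half_coords[OF ac yh]
  note uk = untwist_kite[OF ginv(1-3)[OF s] hc]
  have "chart s (untwist ?g ?w) = fst (opp s) y"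
   unfolding chart_lower_kite(1)[OF s uk] twist_untwist[OF gfun(1-3)[OF s] ginv(5)[OF s] hc] tri_pt_coords[OF ac yT] ..
  also have "fst (opp s) y = m" using home(3)[OF M] h(1) unfolding y_def by simp
  finally have z: "z = untwist ?g ?w" unfolding z_def using chart_inv_chart[OF s uk(1)] by simp
  have y: "0 \<le> y $ ?a" "0 \<le> y $ ?b" "0 \<le> y $ ?c" "y $ ?a + y $ ?b + y $ ?c = 1" using yT unfolding triangle_iff[OF d] by blast+
  have y1: "0 < 1 - y $ ?a" using hc(1) unfolding kite_def mem_Collect_eq complex.sel by linarith
  have Im: "Im z = - (y $ ?a)" by (simp add: z untwist_def)
  have pos: "position z = ?g (y $ ?c / (1 - y $ ?a))" using y(1) y1 by (simp add: position_def z untwist_def)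
  have mono: "?g u < ?g v \<longleftrightarrow> u < v" for u v by (rule strict_mono_less[OF ginv(1)[OF s]])
  have "l < \<bar>Im z\<bar> \<and> k = ?a \<or> \<bar>Im z\<bar> < 1 - l \<and> \<theta> < position z \<and> k = ?c \<or> \<bar>Im z\<bar> < 1 - l \<and> position z < \<theta> \<and> k = ?b"
   using distinct_three_exhaust[OF d, of k]
  proof (elim disjE)
   assume k: "k = ?a"
   then show ?thesis using yk y by (simp add: Im)
  next
   assume k: "k = ?b"
   have "y $ ?c / (1 - y $ ?a) < 1/2" using yk y y1 lb unfolding k by (simp add: pos_divide_less_eq)
   then show ?thesis using yk y k by (simp add: Im pos \<theta>_def mono)
  next
   assume k: "k = ?c"
   have "1/2 < y $ ?c / (1 - y $ ?a)" using yk y y1 lb unfolding k by (simp add: pos_less_divide_eq)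
   then show ?thesis using yk y k by (simp add: Im pos \<theta>_def mono)
  qed
  then show ?thesis using h(1) y(1) unfolding k_def Im by simp
 qed
qed

lemma connected_no_value:
 assumes C: "connected C" and f: "continuous_on C f" and ne: "\<And>x. x \<in> C ==> f x ~= (v::real)" and xy: "x \<in> C" "y \<in> C"
 shows "f x < v \<longleftrightarrow> f y < v"
proof -
 have conn: "connected (f ` C)" by (rule connected_continuous_image[OF f C])
 have nz: "v \<notin> f ` C" using ne by blast
 have "\<not> (f x \<le> v \<and> v \<le> f y)" "\<not> (f y \<le> v \<and> v \<le> f x)"
  using connectedD_interval[OF conn imageI[OF xy(1)] imageI[OF xy(2)], of v]
   connectedD_interval[OF conn imageI[OF xy(2)] imageI[OF xy(1)], of v] nz by blast+
 then show ?thesis by linarith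
qed

text \<open>On C the absolute imaginary part avoids the values from 1 - l to l. Above l the set
  stays near one apex and no crossing occurs; below 1 - l the position avoids the threshold, so the
  set stays near one end of the edge and a crossing, if any, carries the corner along by
  \<open>gperm\<close>.\<close>

lemma step_tracked:
 assumes s: "s \<in> sides" and C: "connected C" "C \<subseteq> star s" "\<And>m. m \<in> C ==> near_cusp m" and xy: "x \<in> C" "y \<in> C"
 shows "tracked (step s x y) (cusp_corner x) (cusp_corner y)"
proof -
 let ?z = "chart_inv s" and ?\<theta> = "gfun_inv s (1/2)"
 have cz: "continuous_on C ?z" by (rule continuous_on_subset[OF continuous_on_chart_inv[OF s] C(2)])
 note cases = star_cusp_cases[OF s subsetD[OF C(2)] C(3)]
 note lb = cusp_boundD(1,2)
 have k1: "\<bar>Im (?z m)\<bar> < 1" if "m \<in> C" for m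
  using chart_inv_in_kite(1)[OF s subsetD[OF C(2) that]] unfolding kite_def by simp
 have gne: "gperm s (pv (snd s)) ~= snd (opp s)" "gperm s (nx (snd s)) ~= snd (opp s)" using gperm(3)[OF s] by auto
 have gs: "gperm (opp s) (gperm s k) = k" for k by (rule gperm_opp[OF s])
 have oo: "opp (opp s) = s" by (rule opp_opp[OF s])
 have ne: "fst (opp s) ~= fst s" by (rule fst_opp_neq[OF s])
 have far: "\<bar>Im (?z x)\<bar> < l \<longleftrightarrow> \<bar>Im (?z m)\<bar> < l" if m: "m \<in> C" for m
 proof (rule connected_no_value[OF C(1) _ _ xy(1) m])
  show "continuous_on C (\<lambda>m. \<bar>Im (?z m)\<bar>)" by (intro continuous_intros cz)
  show "\<bar>Im (?z m)\<bar> ~= l" if "m \<in> C" for m using cases[OF that that] lb by (elim disjE conjE) linarith+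
 qed
 show ?thesis
 proof (cases "\<bar>Im (?z x)\<bar> < l")
  case False
  then have all: "\<not> \<bar>Im (?z m)\<bar> < l" if "m \<in> C" for m using far[OF that] by simp
  have sg: "Im (?z x) < 0 \<longleftrightarrow> Im (?z y) < 0"
  proof (rule connected_no_value[OF C(1) _ _ xy])
   show "continuous_on C (\<lambda>m. Im (?z m))" by (intro continuous_intros cz)
   show "Im (?z m) ~= 0" if "m \<in> C" for m using all[OF that] lb by auto
  qed
  have nx: "\<not> \<bar>Im (?z x)\<bar> < 1 - l" "\<not> \<bar>Im (?z y)\<bar> < 1 - l" using all[OF xy(1)] all[OF xy(2)] lb by linarith+
  have "fst (home x) = fst (home y) \<and> cusp_corner x = cusp_corner y"
   using cases[OF xy(1) xy(1)] cases[OF xy(2) xy(2)] nx sg all[OF xy(1)] all[OF xy(2)] lb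
   by (elim disjE conjE) (simp_all, (linarith+)?)
  then show ?thesis by (simp add: step_def)
 next
  case True
  then have all: "\<bar>Im (?z m)\<bar> < l" if "m \<in> C" for m using far[OF that] by simp
  have nl: "\<not> l < \<bar>Im (?z x)\<bar>" "\<not> l < \<bar>Im (?z y)\<bar>" using all[OF xy(1)] all[OF xy(2)] by linarith+
  have pp: "position (?z x) < ?\<theta> \<longleftrightarrow> position (?z y) < ?\<theta>"
  proof (rule connected_no_value[OF C(1) _ _ xy])
   show "continuous_on C (\<lambda>m. position (?z m))" unfolding position_def
    by (intro continuous_intros cz ballI) (use k1 in force)
   show "position (?z m) ~= ?\<theta>" if "m \<in> C" for m
    using cases[OF that that] all[OF that] by (elim disjE conjE) linarith+
  qed
  show ?thesis
   using cases[OF xy(1) xy(1)] cases[OF xy(2) xy(2)] nl pp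
   by (elim disjE conjE) (simp_all add: step_def gne gs oo ne ne[symmetric], (linarith+)?)
 qed
qed

lemma path_word_tracked:
 assumes p: "path p" and f: "subordinate n p sd" and near: "\<And>t. t \<in> {0..1} ==> near_cusp (p t)" and m: "m \<le> n"
 shows "tracked (path_word p n sd m) (cusp_corner (p 0)) (cusp_corner (p (real m / n)))"
 using m
proof (induction m)
 case 0
 show ?case by (simp add: path_word_def)
next
 case (Suc m)
 then have k: "m < n" by simp
 have n: "0 < n" by (rule subordinateD(1)[OF f])
 let ?I = "{real m / n .. real (Suc m) / n}"
 have "connected (p ` ?I)"
  by (rule connected_continuous_image[OF continuous_on_subset[OF p[unfolded path_def] subdivision_subset[OF k]] connected_Icc])
 moreover have "near_cusp x" if x: "x \<in> p ` ?I" for x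
 proof -
  obtain t where t: "x = p t" "t \<in> ?I" using x by (rule imageE)
  show ?thesis unfolding t(1) by (rule near[OF subsetD[OF subdivision_subset[OF k] t(2)]])
 qed
 moreover have "p (real m / n) \<in> p ` ?I" "p (real (Suc m) / n) \<in> p ` ?I" using frac_le[OF n, of m] by simp_all
 ultimately have "tracked (step (sd m) (p (real m / n)) (p (real (Suc m) / n))) (cusp_corner (p (real m / n))) (cusp_corner (p (real (Suc m) / n)))"
  by (intro step_tracked[OF subordinateD(2)[OF f k] _ subordinateD(3)[OF f k]])
 moreover have "tracked (path_word p n sd m) (cusp_corner (p 0)) (cusp_corner (p (real m / n)))" by (rule Suc.IH[OF less_imp_le[OF k]])
 moreover have "path_word p n sd (Suc m) = path_word p n sd m @ step (sd m) (p (real m / n)) (p (real (Suc m) / n))"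
  by (simp add: path_word_def)
 ultimately show ?case using tracked_append by (simp del: of_nat_Suc)
qed

end

text \<open>In the square of the free homotopy, the left side is homotopic to the bottom, the right
  side and the top reversed. Bottom and top are the same trace d of the base point because all
  stages are loops.\<close>

lemma homotopic_loops_conjugate_path:
 assumes h: "homotopic_loops (M - P) p c" and p: "pth p x x"
 shows "\<exists>d. pth d x (pathstart c) \<and> pth c (pathstart c) (pathstart c) \<and> p \<simeq> (d +++ c) +++ reversepath d"
proof -
 obtain h where h: "continuous_on ({0..1::real} \<times> {0..1::real}) h" "h \<in> {0..1} \<times> {0..1} \<rightarrow> M - P"
  "\<forall>t\<in>{0..1}. h (0, t) = p t" "\<forall>t\<in>{0..1}. h (1, t) = c t" "\<forall>u\<in>{0..1}. pathfinish (h \<circ> Pair u) = pathstart (h \<circ> Pair u)"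
  using h unfolding homotopic_loops by (elim exE conjE)
 let ?Q = "{0..1::real} \<times> {0..1::real}"
 let ?l1 = "linepath (0, 0) (1::real, 0::real)" and ?l2 = "linepath (1::real, 0::real) (1, 1)" and ?l3 = "linepath (1::real, 1::real) (0, 1)"
  and ?l = "linepath (0::real, 0::real) (0, 1)"
 have cQ: "convex ?Q" by (intro convex_Times convex_closed_interval)
 have seg: "path_image (linepath a b) \<subseteq> ?Q" if "a \<in> ?Q" "b \<in> ?Q" for a b
  unfolding path_image_linepath by (rule closed_segment_subset[OF that cQ])
 have i: "path_image ?l1 \<subseteq> ?Q" "path_image ?l2 \<subseteq> ?Q" "path_image ?l3 \<subseteq> ?Q" "path_image ?l \<subseteq> ?Q" by (rule seg; simp)+
 have pl: "pth (h \<circ> r) (h (pathstart r)) (h (pathfinish r))" if r: "path r" "path_image r \<subseteq> ?Q" for r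
 proof (rule pthI)
  show "path (h \<circ> r)" by (rule path_continuous_image[OF r(1) continuous_on_subset[OF h(1) r(2)]])
  show "path_image (h \<circ> r) \<subseteq> M - P" unfolding path_image_compose
   by (rule image_subsetI, rule Pi_mem[OF h(2)], rule subsetD[OF r(2)])
 qed (simp_all only: pathstart_compose pathfinish_compose)
 have hom: "homotopic_paths ?Q ?l ((?l1 +++ ?l2) +++ ?l3)"
 proof (rule homotopic_paths_linear)
  fix t :: real assume t: "t \<in> {0..1}"
  have j: "path_image ((?l1 +++ ?l2) +++ ?l3) \<subseteq> ?Q" by (intro subset_path_image_join i)
  have "?l t \<in> ?Q" "((?l1 +++ ?l2) +++ ?l3) t \<in> ?Q"
   by (rule subsetD[OF i(4)[unfolded path_image_def] imageI[OF t]], rule subsetD[OF j[unfolded path_image_def] imageI[OF t]])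
  then show "closed_segment (?l t) (((?l1 +++ ?l2) +++ ?l3) t) \<subseteq> ?Q" by (rule closed_segment_subset[OF _ _ cQ])
 qed simp_all
 have H: "h \<circ> ?l \<simeq> ((h \<circ> ?l1) +++ (h \<circ> ?l2)) +++ (h \<circ> ?l3)"
  using homotopic_paths_continuous_image[OF hom h(1,2)] by (simp only: path_compose_join)
 note p1 = pl[OF path_linepath i(1)] and p2 = pl[OF path_linepath i(2)] and p3 = pl[OF path_linepath i(3)] and p0 = pl[OF path_linepath i(4)]
 have lt: "?l t = (0, t)" "?l1 t = (t, 0)" "?l2 t = (1, t)" "?l3 t = (1 - t, 1)" for t by (simp_all add: linepath_def)
 have e0: "p \<simeq> h \<circ> ?l"
  by (rule homotopic_paths_eq[OF pthD(1,2)[OF p]]) (use h(3) in \<open>simp only: o_def lt\<close>)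
 have e2: "h \<circ> ?l2 \<simeq> c"
  by (rule homotopic_paths_eq[OF pthD(1,2)[OF p2]]) (use h(4) in \<open>simp only: o_def lt\<close>)
 have e3: "h \<circ> ?l3 \<simeq> reversepath (h \<circ> ?l1)"
 proof (rule homotopic_paths_eq[OF pthD(1,2)[OF p3]])
  fix t :: real assume "t \<in> {0..1}"
  then have "1 - t \<in> {0..1}" by simp
  from bspec[OF h(5) this] show "(h \<circ> ?l3) t = reversepath (h \<circ> ?l1) t" by (simp add: lt reversepath_def pathstart_def pathfinish_def)
 qed
 have c0: "h (1, 0) = pathstart c" "h (1, 1) = pathstart c" "h (0, 0) = x"
  using h(4) bspec[OF h(5), of 1] h(3) pthD(3)[OF p] by (simp_all add: pathstart_def pathfinish_def)
 have d: "pth (h \<circ> ?l1) x (pathstart c)" using p1 by (simp add: c0)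
 have c2: "pth (h \<circ> ?l2) (pathstart c) (pathstart c)" using p2 by (simp add: c0)
 have c: "pth c (pathstart c) (pathstart c)" by (rule pth_homotopic[OF c2 e2])
 have d3: "pth (h \<circ> ?l3) (pathstart c) x" by (rule pth_homotopic[OF pth_reverse[OF d] homotopic_paths_sym[OF e3]])
 have "p \<simeq> ((h \<circ> ?l1) +++ (h \<circ> ?l2)) +++ (h \<circ> ?l3)" by (rule homotopic_paths_trans[OF e0 H])
 also have "\<dots> \<simeq> ((h \<circ> ?l1) +++ c) +++ reversepath (h \<circ> ?l1)"
  by (rule pth_joinI[OF pth_joinI[OF pth_refl[OF d] e2 d c2] e3 pth_join[OF d c2] d3])
 finally show ?thesis using d c by (intro exI conjI)
qed

end

section \<open>Domination\<close>

lemma adjoint_cmat: "adjoint_matrix (cmat B) = cmat (transpose B)"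
 by (simp add: vec_eq_iff adjoint_matrix_def transpose_def cmat_nth)

lemma cmat_J21: "cmat J21 = J21"
 by (simp add: vec_eq_iff forall_3 J21_def cmat_nth)

lemma cmat_gram: "cmat gram = gram"
 by (simp add: vec_eq_iff gram_def cmat_nth)

lemma cmat_perm_matrix: "cmat (perm_matrix \<sigma>) = perm_matrix \<sigma>"
 by (simp add: vec_eq_iff perm_matrix_def cmat_nth)

lemma is_frame_base_frame: "is_frame (cmat base_frame)"
proof -
 have "adjoint_matrix (cmat base_frame) ** J21 ** cmat base_frame = cmat (transpose base_frame ** J21 ** base_frame)"
  unfolding adjoint_cmat map_matrix_mult cmat_J21 ..
 then show ?thesis unfolding is_frame_def transpose_base_frame_gram cmat_gram .
qed

text \<open>Column a of F is a null eigenvector of A for the eigenvalue k t, so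
  \<open>U21_spectral_radius_null_eigenvector\<close> gives the spectral radius.\<close>

lemma spectral_radius3_null_column:
 fixes F W :: "complex^3^3"
 assumes A: "A \<in> carrier U21" and AF: "A ** F = mat k ** (F ** W)" and k: "cmod k = 1" and t: "0 < t"
  and W: "\<And>j. W $ j $ a = (if j = a then of_real t else 0)"
  and null: "column a F ~= 0" "herm (column a F) (column a F) = 0"
 shows "spectral_radius3 A = max t (1 / t)"
proof -
 have "column a (mat k ** (F ** W)) = (k * of_real t) *s column a F"
 proof -
  have "(F ** W) $ j $ a = F $ j $ a * of_real t" for j
   by (simp add: matrix_matrix_mult_def W if_distrib[of "\<lambda>x. _ * x"] sum.delta cong: if_cong)
  then show ?thesis by (simp add: vec_eq_iff column_def mat_scalar_nth mult.assoc mult.commute)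
 qed
 then have "A *v column a F = (k * of_real t) *s column a F" unfolding AF[symmetric] column_mult .
 from U21_spectral_radius_null_eigenvector[OF A null this] show ?thesis using k t by (simp add: norm_mult)
qed

text \<open>At the end points of the crossed edge a crossing is a mere scaling by t or 1/t, so that
  x does not enter.\<close>

lemma cross_column:
 assumes "distinct [a, b, c]" "d ~= a" "0 < (t::real)"
 shows "\<exists>u>0. \<forall>j. cross a b c (of_real t) x $ j $ d = (if j = d then complex_of_real u else 0) \<and>
  cross a b c t (-1) $ j $ d = (if j = d then u else 0)"
proof (cases "d = b")
 case True
 then show ?thesis using assms by (intro exI[of _ t]) (auto simp: cross_def)
next
 case False
 then have "d = c" using distinct_three_exhaust[OF assms(1), of d] assms(2) by simp
 then show ?thesis using assms by (intro exI[of _ "1 / t"]) (auto simp: cross_def)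
qed

context bipartite_surface
begin

lemma wmat_invertible:
 assumes X: "inverse_crossings X"
 shows "is_gallery \<tau> w \<tau>' ==> \<exists>V. wmat X w ** V = mat 1 \<and> V ** wmat X w = mat 1"
proof (induction w arbitrary: \<tau>)
 case Nil
 have "wmat X [] ** mat 1 = mat 1 \<and> mat 1 ** wmat X [] = mat 1" by simp
 then show ?case by (rule exI)
next
 case (Cons s w)
 note s = is_gallery_Cons[OF Cons.prems]
 obtain V where V: "wmat X w ** V = mat 1" "V ** wmat X w = mat 1" using Cons.IH[OF s(3)] by (elim exE conjE)
 note i = inverse_crossings[OF X s(1)]
 have "wmat X (s # w) ** (V ** X (opp s)) = X s ** (wmat X w ** V) ** X (opp s)"
  by (simp only: wmat.simps matrix_mul_assoc)
 then have 1: "wmat X (s # w) ** (V ** X (opp s)) = mat 1" by (simp only: V matrix_mul_rid i)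
 have "(V ** X (opp s)) ** wmat X (s # w) = V ** (X (opp s) ** X s) ** wmat X w"
  by (simp only: wmat.simps matrix_mul_assoc)
 then have 2: "(V ** X (opp s)) ** wmat X (s # w) = mat 1" by (simp only: V matrix_mul_rid i)
 show ?case by (rule exI, rule conjI[OF 1 2])
qed

lemma tracked_column:
 assumes form: "\<And>s. s \<in> sides ==> crossing_form (snd s) (gperm s) (X s) (N s)"
 shows "is_gallery \<tau> w \<tau>' ==> tracked w a b ==>
  \<exists>t>0. \<forall>j. wmat X w $ j $ b = (if j = a then of_real t else 0) \<and> wmat N w $ j $ b = (if j = a then t else 0)"
proof (induction w arbitrary: \<tau> a)
 case Nil
 then show ?case by (intro exI[of _ 1]) (simp add: mat_def)
next
 case (Cons s w)
 note s = is_gallery_Cons[OF Cons.prems(1)]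
 have tr: "a ~= snd s" "tracked w (gperm s a) b" using Cons.prems(2) by simp_all
 obtain t where t: "0 < t" "\<forall>j. wmat X w $ j $ b = (if j = gperm s a then of_real t else 0) \<and> wmat N w $ j $ b = (if j = gperm s a then t else 0)"
  using Cons.IH[OF s(3) tr(2)] by (elim exE conjE)
 obtain b' c' r x where f: "distinct [snd s, b', c']" "0 < r"
   "X s = cross (snd s) b' c' (of_real r) x ** perm_matrix (gperm s)"
   "N s = cross (snd s) b' c' r (-1) ** perm_matrix (gperm s)"
  using form[OF s(1)] unfolding crossing_form_def by (elim exE conjE)
 obtain u where u: "0 < u" "\<forall>j. cross (snd s) b' c' (of_real r) x $ j $ a = (if j = a then complex_of_real u else 0) \<and>
  cross (snd s) b' c' r (-1) $ j $ a = (if j = a then u else 0)"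
  using cross_column[OF f(1) tr(1) f(2), of x] by (elim exE conjE)
 have inj: "inj (gperm s)" by (rule bij_is_inj[OF gperm(1)[OF s(1)]])
 have col: "X s $ j $ gperm s a = (if j = a then complex_of_real u else 0)" "N s $ j $ gperm s a = (if j = a then u else 0)" for j
  unfolding f(3,4) mult_perm_matrix_nth[OF inj] using u(2) by blast+
 have "wmat X (s # w) $ j $ b = (if j = a then of_real (u * t) else 0) \<and> wmat N (s # w) $ j $ b = (if j = a then u * t else 0)" for j
  using t(2) by (simp add: matrix_matrix_mult_def if_distrib[of "\<lambda>x. _ * x"] sum.delta col cong: if_cong)
 then show ?case using t(1) u(1) by (intro exI[of _ "u * t"]) simp
qed

end

context oriented_bent_surface
begin

text \<open>The base triangle may vary, so w represents the conjugacy class of p; this freedom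
  serves cyclic reduction and loops around a puncture.\<close>

definition rep_word :: "(real => 'a) => (real => 'a) => (real^3 => 'a) => 'a side list => bool" where
 "rep_word p \<delta> \<tau> w \<longleftrightarrow> based \<delta> \<tau> \<and> is_gallery \<tau> w \<tau> \<and> p +++ \<delta> \<simeq> \<delta> +++ gpath \<tau> w"

lemma rep_wordD:
 assumes "rep_word p \<delta> \<tau> w"
 shows "based \<delta> \<tau>" "is_gallery \<tau> w \<tau>" "p +++ \<delta> \<simeq> \<delta> +++ gpath \<tau> w"
 using assms unfolding rep_word_def by blast+

lemma \<rho>_conjugate:
 assumes p: "loop p" and r: "rep_word p \<delta> \<tau> w"
 obtains A F Fi k where "A \<in> carrier U21" "\<rho> (cl p) = pclass A" "is_frame F" "F ** Fi = mat 1" "Fi ** F = mat 1"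
  "cmod k = 1" "A ** F = mat k ** (F ** wmat cX w)" "A = mat k ** (F ** wmat cX w ** Fi)"
proof -
 note rD = rep_wordD[OF r]
 obtain A where A: "A \<in> carrier U21" "\<rho> (cl p) = pclass A" using \<rho>_lift[OF p] by (elim bexE)
 obtain F where F: "framed \<delta> \<tau> F" using framed_exists[OF rD(1)] by (rule exE)
 have iF: "is_frame F" by (rule framedD(1)[OF F])
 obtain k where k: "cmod k = 1" "A ** F = mat k ** (F ** wmat cX w)" using \<rho>_gallery[OF p rD F A] by (elim exE conjE)
 have "invertible F" using is_frame_det[OF iF] by (simp add: invertible_det_nz)
 then obtain Fi where Fi: "F ** Fi = mat 1" "Fi ** F = mat 1" unfolding invertible_def by (elim exE conjE)
 have "A = (A ** F) ** Fi" by (simp only: matrix_mul_assoc[symmetric] Fi matrix_mul_rid)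
 also have "\<dots> = mat k ** (F ** wmat cX w ** Fi)" unfolding k(2) by (simp only: matrix_mul_assoc)
 finally have "A = mat k ** (F ** wmat cX w ** Fi)" .
 then show ?thesis by (rule that[OF A iF Fi k])
qed

text \<open>If v leads from the base triangle to \<tau> and u is a word of p at the base, then u v
  and v w are homotopic, so the two holonomies are conjugate by that of v. The frame, which comes
  from a matrix in the identity component, provides null columns for peripheral loops.\<close>

lemma \<rho>0_conjugate:
 assumes p: "loop p" and r: "rep_word p \<delta> \<tau> w"
 obtains G Gi where "G ** Gi = mat 1" "Gi ** G = mat 1" "rm p = G ** wmat rX w ** Gi" "is_frame (cmat (G ** Pm \<tau>))"
proof -
 note rD = rep_wordD[OF r]
 obtain v where v: "is_gallery \<tau>0 v \<tau>" "\<delta> \<simeq> \<delta>0 +++ gpath \<tau>0 v" using gallery_between[OF based_0 rD(1)] by (elim exE conjE)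
 obtain u where u: "has_word p u" using word_exists[OF p] by (rule exE)
 note gu = has_wordD(1)[OF u]
 note pp = pth_loop[OF p] and pd = pth_based[OF rD(1)] and pu = pth_gallery[OF gu] and pv = pth_gallery[OF v(1)] and pw = pth_gallery[OF rD(2)]
 have "\<delta>0 +++ gpath \<tau>0 (u @ v) \<simeq> \<delta>0 +++ (gpath \<tau>0 u +++ gpath \<tau>0 v)"
  by (rule pth_joinI[OF pth_refl[OF pth_0] homotopic_paths_sym[OF gpath_append[OF gu v(1)]] pth_0 pth_gallery[OF is_gallery_append[OF gu v(1)]]])
 also have "\<dots> \<simeq> (\<delta>0 +++ gpath \<tau>0 u) +++ gpath \<tau>0 v"
  by (rule homotopic_paths_sym[OF pth_assoc[OF pth_0 pu pv]])
 also have "\<dots> \<simeq> (p +++ \<delta>0) +++ gpath \<tau>0 v"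
  by (rule pth_joinI[OF homotopic_paths_sym[OF has_wordD(2)[OF u]] pth_refl[OF pv] pth_join[OF pth_0 pu] pv])
 also have "\<dots> \<simeq> p +++ (\<delta>0 +++ gpath \<tau>0 v)" by (rule pth_assoc[OF pp pth_0 pv])
 also have "\<dots> \<simeq> p +++ \<delta>"
  by (rule pth_joinI[OF pth_refl[OF pp] homotopic_paths_sym[OF v(2)] pp pth_join[OF pth_0 pv]])
 also have "\<dots> \<simeq> \<delta> +++ gpath \<tau> w" by (rule rD(3))
 also have "\<dots> \<simeq> (\<delta>0 +++ gpath \<tau>0 v) +++ gpath \<tau> w"
  by (rule pth_joinI[OF v(2) pth_refl[OF pw] pd pw])
 also have "\<dots> \<simeq> \<delta>0 +++ (gpath \<tau>0 v +++ gpath \<tau> w)"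
  by (rule pth_assoc[OF pth_0 pv pw])
 also have "\<dots> \<simeq> \<delta>0 +++ gpath \<tau>0 (v @ w)"
  by (rule pth_joinI[OF pth_refl[OF pth_0] gpath_append[OF v(1) rD(2)] pth_0 pth_join[OF pv pw]])
 finally have "gpath \<tau>0 (u @ v) \<simeq> gpath \<tau>0 (v @ w)"
  by (rule pth_cancel_left[OF pth_0 pth_gallery[OF is_gallery_append[OF gu v(1)]] pth_gallery[OF is_gallery_append[OF v(1) rD(2)]]])
 from homotopic_galleries_wmat[OF inverse_rX is_gallery_append[OF gu v(1)] is_gallery_append[OF v(1) rD(2)] this]
 have uv: "wmat rX u ** wmat rX v = wmat rX v ** wmat rX w" unfolding wmat_append .
 obtain V where V: "wmat rX v ** V = mat 1" "V ** wmat rX v = mat 1" using wmat_invertible[OF inverse_rX v(1)] by (elim exE conjE)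
 have "hol p = wmat rX u ** (wmat rX v ** V)" unfolding hol_eq[OF p u] V by simp
 also have "\<dots> = (wmat rX u ** wmat rX v) ** V" by (rule matrix_mul_assoc)
 finally have hp: "hol p = (wmat rX v ** wmat rX w) ** V" unfolding uv .
 let ?G = "Lm ** wmat rX v" and ?Gi = "V ** Li"
 have "?G ** ?Gi = Lm ** (wmat rX v ** V) ** Li" by (simp only: matrix_mul_assoc)
 then have 1: "?G ** ?Gi = mat 1" by (simp only: V matrix_mul_rid Lm_Li)
 have 2: "?Gi ** ?G = mat 1" by (rule square_inverse[OF 1])
 have 3: "rm p = ?G ** wmat rX w ** ?Gi" unfolding rm_def hp by (simp only: matrix_mul_assoc)
 let ?N = "Pm \<tau>0 ** wmat rX v ** Pm \<tau>"
 have "?N \<in> base_component" by (rule wmat_component[OF v(1)])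
 then have "base_frame ** ?N ** base_frame_inv \<in> O21_component" unfolding base_component_def mem_Collect_eq .
 then have U: "cmat (base_frame ** ?N ** base_frame_inv) \<in> carrier U21"
  by (rule O21_real_U21[OF subsetD[OF connected_component_subset]])
 have "(base_frame ** ?N ** base_frame_inv) ** base_frame = base_frame ** ?N ** (base_frame_inv ** base_frame)"
  by (simp only: matrix_mul_assoc)
 then have "(base_frame ** ?N ** base_frame_inv) ** base_frame = ?G ** Pm \<tau>"
  by (simp only: base_frame_inv matrix_mul_rid Lm_def matrix_mul_assoc)
 then have "is_frame (cmat (?G ** Pm \<tau>))"
  using is_frame_U21[OF U is_frame_base_frame] unfolding map_matrix_mult[symmetric] by simp
 then show ?thesis by (rule that[OF 1 2 3])
qed

lemma rep_word_exists:
 assumes "loop p"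
 shows "\<exists>\<delta> \<tau> w. rep_word p \<delta> \<tau> w"
proof -
 obtain w where w: "has_word p w" using word_exists[OF assms] by (rule exE)
 have "rep_word p \<delta>0 \<tau>0 w" unfolding rep_word_def using based_0 has_wordD[OF w] by (intro conjI)
 then show ?thesis by (intro exI)
qed

lemma rep_word_cancel:
 assumes r: "rep_word p \<delta> \<tau> (a @ s # opp s # b)"
 shows "rep_word p \<delta> \<tau> (a @ b)"
proof -
 note rD = rep_wordD[OF r]
 note c = gallery_cancel[OF rD(2)]
 have "\<delta> +++ gpath \<tau> (a @ s # opp s # b) \<simeq> \<delta> +++ gpath \<tau> (a @ b)"
  by (rule pth_joinI[OF pth_refl[OF pth_based[OF rD(1)]] c(2) pth_based[OF rD(1)] pth_gallery[OF rD(2)]])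
 from homotopic_paths_trans[OF rD(3) this] show ?thesis unfolding rep_word_def using rD(1) c(1) by (intro conjI)
qed

text \<open>Carrying the base triangle across s conjugates by the first crossing and cancels the
  first and the last letter.\<close>

lemma rep_word_rotate:
 assumes p: "loop p" and r: "rep_word p \<delta> \<tau> (s # m @ [opp s])"
 shows "rep_word p (\<delta> +++ crossing s) (fst (opp s)) m"
proof -
 note rD = rep_wordD[OF r]
 note s = is_gallery_Cons[OF rD(2)]
 obtain \<tau>1 where m1: "is_gallery (fst (opp s)) m \<tau>1" "is_gallery \<tau>1 [opp s] \<tau>"
  using is_gallery_split[OF s(3)] by (elim exE conjE)
 have "\<tau>1 = fst (opp s)" using is_gallery_Cons(2)[OF m1(2)] by (rule sym)
 then have m: "is_gallery (fst (opp s)) m (fst (opp s))" using m1(1) by simp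
 have b: "based \<delta> (fst s)" using rD(1) unfolding s(2) .
 have b': "based (\<delta> +++ crossing s) (fst (opp s))" by (rule based_crossing[OF s(1) b])
 note pp = pth_loop[OF p] and pd = pth_based[OF rD(1)] and pw = pth_gallery[OF rD(2)] and pm = pth_gallery[OF m]
  and pc = pth_crossing[OF s(1), unfolded s(2)]
 have g1: "is_gallery \<tau> [s] (fst (opp s))" using s(1,2) fst_in_T(2)[OF s(1)] unfolding is_gallery.simps by (intro conjI refl)
 have "gpath \<tau> [s] \<simeq> crossing s" unfolding gpath.simps by (rule pth_rid[OF pc])
 note c1 = homotopic_paths_sym[OF this]
 have g2: "is_gallery \<tau> ((s # m) @ opp s # opp (opp s) # []) (fst (opp s))"
  using is_gallery_append[OF rD(2) g1] by (simp only: append_Cons append_Nil append_assoc opp_opp[OF s(1)])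
 have "gpath \<tau> (s # m @ [opp s]) +++ crossing s \<simeq> gpath \<tau> (s # m @ [opp s]) +++ gpath \<tau> [s]"
  by (rule pth_joinI[OF pth_refl[OF pw] c1 pw pc])
 also have "\<dots> \<simeq> gpath \<tau> ((s # m @ [opp s]) @ [s])"
  by (rule gpath_append[OF rD(2) g1])
 also have "(s # m @ [opp s]) @ [s] = (s # m) @ opp s # opp (opp s) # []" by (simp only: append_Cons append_Nil append_assoc opp_opp[OF s(1)])
 also have "gpath \<tau> ((s # m) @ opp s # opp (opp s) # []) \<simeq> gpath \<tau> ((s # m) @ [])"
  by (rule gallery_cancel(2)[OF g2])
 also have "gpath \<tau> ((s # m) @ []) = crossing s +++ gpath (fst (opp s)) m" by simp
 finally have w: "gpath \<tau> (s # m @ [opp s]) +++ crossing s \<simeq> crossing s +++ gpath (fst (opp s)) m" .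
 have "p +++ (\<delta> +++ crossing s) \<simeq> (p +++ \<delta>) +++ crossing s" by (rule homotopic_paths_sym[OF pth_assoc[OF pp pd pc]])
 also have "\<dots> \<simeq> (\<delta> +++ gpath \<tau> (s # m @ [opp s])) +++ crossing s"
  by (rule pth_joinI[OF rD(3) pth_refl[OF pc] pth_join[OF pp pd] pc])
 also have "\<dots> \<simeq> \<delta> +++ (gpath \<tau> (s # m @ [opp s]) +++ crossing s)"
  by (rule pth_assoc[OF pd pw pc])
 also have "\<dots> \<simeq> \<delta> +++ (crossing s +++ gpath (fst (opp s)) m)"
  by (rule pth_joinI[OF pth_refl[OF pd] w pd pth_join[OF pw pc]])
 also have "\<dots> \<simeq> (\<delta> +++ crossing s) +++ gpath (fst (opp s)) m"
  by (rule homotopic_paths_sym[OF pth_assoc[OF pd pc pm]])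
 finally show ?thesis unfolding rep_word_def using b' m by (intro conjI)
qed

text \<open>A shortest word in the conjugacy class is cyclically reduced.\<close>

lemma cyclic_word_exists:
 assumes p: "loop p"
 shows "\<exists>\<delta> \<tau> w. rep_word p \<delta> \<tau> w \<and> reduced w \<and> (w ~= [] --> hd w ~= opp (last w))"
proof -
 define Q where "Q n \<longleftrightarrow> (\<exists>\<delta> \<tau> w. rep_word p \<delta> \<tau> w \<and> length w = n)" for n
 have "\<exists>n. Q n" unfolding Q_def using rep_word_exists[OF p] by (elim exE) (intro exI conjI, assumption, rule refl)
 from LeastI_ex[OF this] obtain \<delta> \<tau> w where r: "rep_word p \<delta> \<tau> w" and n: "length w = (LEAST n. Q n)"
  unfolding Q_def[of "LEAST n. Q n"] by (elim exE conjE)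
 have min: "length w \<le> length v" if "rep_word p \<delta>' \<tau>' v" for \<delta>' \<tau>' v
 proof -
  have "Q (length v)" unfolding Q_def using that by (intro exI conjI) (assumption, rule refl)
  then show ?thesis unfolding n by (rule Least_le)
 qed
 have "reduced w"
 proof (rule ccontr)
  assume "\<not> reduced w"
  from not_reduced[OF this] obtain a s b where w: "w = a @ s # opp s # b" by (elim exE)
  from min[OF rep_word_cancel[OF r[unfolded w]]] show False unfolding w by simp
 qed
 moreover have "hd w ~= opp (last w)" if ne: "w ~= []"
 proof
  assume h: "hd w = opp (last w)"
  obtain s v where w: "w = s # v" using ne by (cases w) simp_all
  have s: "s \<in> sides" by (rule is_gallery_Cons(1)[OF rep_wordD(2)[OF r, unfolded w]])
  show False
  proof (cases "v = []")
   case True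
   then show False using h opp(2)[OF s] unfolding w by simp
  next
   case False
   then have v: "butlast v @ [last v] = v" by simp
   have "s = opp (last v)" using h False unfolding w by simp
   moreover have "last v \<in> sides"
   proof -
    have "is_gallery (fst (opp s)) (butlast v @ [last v]) \<tau>" unfolding v by (rule is_gallery_Cons(3)[OF rep_wordD(2)[OF r, unfolded w]])
    from is_gallery_split[OF this] obtain \<tau>1 where "is_gallery \<tau>1 [last v] \<tau>" by (elim exE conjE)
    then show ?thesis by (rule is_gallery_Cons(1))
   qed
   ultimately have "last v = opp s" by (simp only: opp_opp)
   then have w': "w = s # butlast v @ [opp s]" using v unfolding w by simp
   from min[OF rep_word_rotate[OF p r[unfolded w']]] show False unfolding w' by simp
  qed
 qed
 ultimately show ?thesis using r by blast
qed

theorem \<rho>0_dominates: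
 assumes p: "loop p"
 shows "translation_length (\<rho> (cl p)) \<le> translation_length (\<rho>0 (cl p))"
proof -
 obtain \<delta> \<tau> w where r: "rep_word p \<delta> \<tau> w" and red: "reduced w" and cyc: "w ~= [] --> hd w ~= opp (last w)"
  using cyclic_word_exists[OF p] by (elim exE conjE)
 obtain A F Fi k where A: "A \<in> carrier U21" "\<rho> (cl p) = pclass A" and F: "F ** Fi = mat 1" "Fi ** F = mat 1"
  and k: "cmod k = 1" and AF: "A = mat k ** (F ** wmat cX w ** Fi)" by (rule \<rho>_conjugate[OF p r])
 obtain G Gi where G: "G ** Gi = mat 1" "Gi ** G = mat 1" and R: "rm p = G ** wmat rX w ** Gi"
  by (rule \<rho>0_conjugate[OF p r])
 have "cmod (trace (mpow A n)) \<le> cmod (trace (mpow (cmat (rm p)) n))" for n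
 proof -
  have "cmod (trace (mpow A n)) = cmod (trace (mpow (wmat cX w) n))" unfolding AF by (rule cmod_trace_mpow[OF F k])
  also have "\<dots> \<le> trace (mpow (wmat rX w) n)"
   by (rule cyclic_gallery_trace[OF crossing_form rep_wordD(2)[OF r] red mp[OF cyc]])
  also have "trace (mpow (wmat rX w) n) = trace (mpow (rm p) n)"
   unfolding R mpow_similar[OF G] trace_similar[OF G(2)] ..
  also have "\<dots> \<le> cmod (trace (mpow (cmat (rm p)) n))" unfolding mpow_cmat trace_cmat by simp
  finally show ?thesis .
 qed
 then have le: "spectral_radius3 A \<le> spectral_radius3 (cmat (rm p))" by (rule spectral_radius3_le_of_trace[OF A(1) rm_U21[OF p]])
 have "1 \<le> spectral_radius3 A" by (rule U21_spectral_radius_ge_1[OF A(1)])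
 then show ?thesis using le unfolding A(2) \<rho>0_cl[OF p] translation_length_pclass by simp
qed

text \<open>The freely homotopic loop c stays in the cusp neighbourhood, so its word tracks one
  corner and, c being closed, returns to it. The path d followed by a spoke backwards makes the
  triangle at the start of c the base triangle.\<close>

lemma peripheral_rep_word:
 assumes p: "loop p" and per: "peripheral M P (cl p)"
 shows "\<exists>\<delta> \<tau> w a. rep_word p \<delta> \<tau> w \<and> tracked w a a"
proof -
 obtain l where l: "cusp_bound l" using cusp_bound_exists by (rule exE)
 obtain q where q: "q \<in> P" "\<forall>U. openin (top_of_set M) U \<and> q \<in> U -->
    (\<exists>p'\<in>cl p. \<exists>c. path_image c \<subseteq> U \<and> homotopic_loops (M - P) p' c)" using per unfolding peripheral_def by (elim bexE)
 have "\<exists>p'\<in>cl p. \<exists>c. path_image c \<subseteq> cusp_nbhd l \<and> homotopic_loops (M - P) p' c"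
  by (rule mp[OF spec[OF q(2)]], rule conjI[OF openin_cusp_nbhd[OF l] puncture_in_cusp_nbhd[OF l q(1) subsetD[OF P_subset q(1)]]])
 then obtain p' c where p': "p \<simeq> p'" and im: "path_image c \<subseteq> cusp_nbhd l" and hl: "homotopic_loops (M - P) p' c"
  unfolding path_class_def by (elim bexE exE conjE) simp
 note pp = pth_loop[OF p]
 have pp': "pth p' x0 x0" by (rule pth_homotopic[OF pp p'])
 define x where "x = pathstart c"
 obtain d where d: "pth d x0 x" and c: "pth c x x" and pd: "p' \<simeq> (d +++ c) +++ reversepath d"
  using homotopic_loops_conjugate_path[OF hl pp'] unfolding x_def by (elim exE conjE)
 have xM: "x \<in> M - P" by (rule pth_end[OF d])
 define \<tau> where "\<tau> = fst (home x)"
 define sp where "sp = spoke x"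
 have T: "\<tau> \<in> \<T>" unfolding \<tau>_def by (rule home(1)[OF DiffD1[OF xM]])
 have s: "pth sp (\<tau> barycentre) x" unfolding sp_def \<tau>_def by (rule pthI[OF spoke[OF xM]])
 obtain n sd where f: "subordinate n c sd" by (rule subordinate_exists[OF pthD(1,2)[OF c]])
 have n: "0 < n" by (rule subordinateD(1)[OF f])
 have e: "c 0 = x" "c (real n / real n) = x"
  using pthD(3,4)[OF c] n unfolding pathstart_def pathfinish_def by simp_all
 have ll: "c \<circ> linepath 0 (real n / real n) = c" using n by (simp add: compose_linepath_01)
 define w where "w = path_word c n sd n"
 note pg = path_homotopic_gallery[OF pthD(1,2)[OF c] f order_refl, folded w_def, unfolded ll e, folded \<tau>_def sp_def]
 note g = conjunct1[OF pg] and cg = conjunct2[OF pg]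
 have near: "near_cusp l (c t)" if "t \<in> {0..1}" for t
  by (rule cusp_nbhd_near[OF l subsetD[OF im]]) (simp only: path_image_def imageI[OF that])
 have tr: "tracked w (cusp_corner l x) (cusp_corner l x)"
  using path_word_tracked[OF l pthD(1)[OF c] f near order_refl] unfolding w_def[symmetric] e .
 note rd = pth_reverse[OF d] and rs = pth_reverse[OF s] and pw = pth_gallery[OF g]
 let ?rs = "reversepath sp" and ?g = "gpath \<tau> w"
 have "c +++ ?rs \<simeq> (?rs +++ (?g +++ sp)) +++ ?rs" by (rule pth_joinI[OF cg pth_refl[OF rs] c rs])
 also have "\<dots> \<simeq> ?rs +++ ((?g +++ sp) +++ ?rs)" by (rule pth_assoc[OF rs pth_join[OF pw s] rs])
 also have "\<dots> \<simeq> ?rs +++ (?g +++ (sp +++ ?rs))"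
  by (rule pth_joinI[OF pth_refl[OF rs] pth_assoc[OF pw s rs] rs pth_join[OF pth_join[OF pw s] rs]])
 also have "\<dots> \<simeq> ?rs +++ (?g +++ const_path (\<tau> barycentre))"
  by (rule pth_joinI[OF pth_refl[OF rs] pth_joinI[OF pth_refl[OF pw] pth_rinv[OF s] pw pth_join[OF s rs]] rs pth_join[OF pw pth_join[OF s rs]]])
 also have "\<dots> \<simeq> ?rs +++ ?g"
  by (rule pth_joinI[OF pth_refl[OF rs] pth_rid[OF pw] rs pth_join[OF pw pth_const[OF pth_end[OF pw]]]])
 finally have crs: "c +++ ?rs \<simeq> ?rs +++ ?g" .
 let ?\<delta> = "d +++ ?rs"
 have dl: "pth ?\<delta> x0 (\<tau> barycentre)" by (rule pth_join[OF d rs])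
 have dc: "pth (d +++ c) x0 x" by (rule pth_join[OF d c])
 have "p +++ ?\<delta> \<simeq> ((d +++ c) +++ reversepath d) +++ ?\<delta>"
  by (rule pth_joinI[OF homotopic_paths_trans[OF p' pd] pth_refl[OF dl] pp dl])
 also have "\<dots> \<simeq> (d +++ c) +++ (reversepath d +++ ?\<delta>)" by (rule pth_assoc[OF dc rd dl])
 also have "\<dots> \<simeq> (d +++ c) +++ ?rs"
  by (rule pth_joinI[OF pth_refl[OF dc] pth_cancel_inverse[OF d rs] dc pth_join[OF rd dl]])
 also have "\<dots> \<simeq> d +++ (c +++ ?rs)" by (rule pth_assoc[OF d c rs])
 also have "\<dots> \<simeq> d +++ (?rs +++ ?g)" by (rule pth_joinI[OF pth_refl[OF d] crs d pth_join[OF c rs]])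
 also have "\<dots> \<simeq> ?\<delta> +++ ?g" by (rule homotopic_paths_sym[OF pth_assoc[OF d rs pw]])
 finally have "rep_word p ?\<delta> \<tau> w" unfolding rep_word_def based_def using T pthD[OF dl] g by (intro conjI)
 then show ?thesis using tr by (intro exI conjI)
qed

theorem \<rho>0_peripheral:
 assumes p: "loop p" and per: "peripheral M P (cl p)"
 shows "translation_length (\<rho> (cl p)) = translation_length (\<rho>0 (cl p))"
proof -
 obtain \<delta> \<tau> w a where r: "rep_word p \<delta> \<tau> w" and tr: "tracked w a a" using peripheral_rep_word[OF assms] by (elim exE conjE)
 have "\<exists>t>0. \<forall>j. wmat cX w $ j $ a = (if j = a then of_real t else 0) \<and> wmat rX w $ j $ a = (if j = a then t else 0)"
  by (rule tracked_column[OF crossing_form rep_wordD(2)[OF r] tr])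
 then obtain t where t: "0 < t" "\<forall>j. wmat cX w $ j $ a = (if j = a then of_real t else 0) \<and> wmat rX w $ j $ a = (if j = a then t else 0)"
  by (elim exE conjE)
 obtain A F Fi k where A: "A \<in> carrier U21" "\<rho> (cl p) = pclass A" and F: "is_frame F"
  and k: "cmod k = 1" and AF: "A ** F = mat k ** (F ** wmat cX w)" by (rule \<rho>_conjugate[OF p r])
 have "spectral_radius3 A = max t (1 / t)"
 proof (rule spectral_radius3_null_column[OF A(1) AF k t(1)])
  show "wmat cX w $ j $ a = (if j = a then of_real t else 0)" for j using t(2) by blast
  show "column a F ~= 0" by (rule frame_column_nonzero[OF F])
  show "herm (column a F) (column a F) = 0" using F unfolding is_frame_iff by simp
 qed
 moreover have "spectral_radius3 (cmat (rm p)) = max t (1 / t)"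
 proof -
  obtain G Gi where G: "G ** Gi = mat 1" "Gi ** G = mat 1" and R: "rm p = G ** wmat rX w ** Gi" and fr: "is_frame (cmat (G ** Pm \<tau>))"
   by (rule \<rho>0_conjugate[OF p r])
  have "rm p ** G = G ** wmat rX w ** (Gi ** G)" unfolding R by (simp only: matrix_mul_assoc)
  then have "rm p ** G = G ** wmat rX w" by (simp only: G matrix_mul_rid)
  then have B: "cmat (rm p) ** cmat G = mat 1 ** (cmat G ** cmat (wmat rX w))" unfolding map_matrix_mult[symmetric] by simp
  have "lab \<tau> \<circ> lab \<tau> = id" by (simp add: fun_eq_iff lab_lab)
  note cp = column_mult_perm[OF this this]
  \<comment> \<open>The null vector at corner a is a column of the frame, renumbered by
    \<open>lab\<close>.\<close>
  have "G = (G ** Pm \<tau>) ** Pm \<tau>" by (simp only: matrix_mul_assoc[symmetric] Pm_Pm matrix_mul_rid)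
  then have "cmat G = cmat (G ** Pm \<tau>) ** cmat (Pm \<tau>)" unfolding map_matrix_mult[symmetric] by simp
  then have col: "column a (cmat G) = column (lab \<tau> a) (cmat (G ** Pm \<tau>))"
   using cp[of a "cmat (G ** Pm \<tau>)"] unfolding Pm_def[of \<tau>] cmat_perm_matrix by simp
  show ?thesis
  proof (rule spectral_radius3_null_column[OF rm_U21[OF p] B _ t(1)])
   show "column a (cmat G) ~= 0" unfolding col by (rule frame_column_nonzero[OF fr])
   show "herm (column a (cmat G)) (column a (cmat G)) = 0" unfolding col using fr unfolding is_frame_iff by simp
   show "cmat (wmat rX w) $ j $ a = (if j = a then of_real t else 0)" for j using t(2) by (simp add: cmat_nth)
  qed simp
 qed
 ultimately show ?thesis unfolding A(2) \<rho>0_cl[OF p] translation_length_pclass by simp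
qed

end

theorem theorem1p3:
  fixes M P :: "'a::t2_space set"
    and \<A> :: "('a set \<times> ('a \<Rightarrow> complex)) set"
    and \<T> :: "(real^3 \<Rightarrow> 'a) set"
    and x0 :: 'a
    and g k :: nat
    and \<rho> :: "(real \<Rightarrow> 'a) set \<Rightarrow> (complex^3^3) set"
  assumes "punctured_surface g k M \<A> P"
    and "k \<ge> 1"
    and "2 - 2 * int g - int k < 0"
    and "ideal_triangulation M P \<T>"
    and "bipartite_triangulation \<T>"
    and "x0 \<in> M - P"
    and "\<rho> \<in> hom (fundamental_group (M - P) x0) PU21"
    and "T_bent M P \<T> x0 \<rho>"
  shows "\<exists>\<rho>\<^sub>0. \<rho>\<^sub>0 \<in> hom (fundamental_group (M - P) x0) (PU21\<lparr>carrier := PO21\<rparr>) \<and>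
     discrete_faithful (fundamental_group (M - P) x0) \<rho>\<^sub>0 \<and>
     (\<forall>\<gamma>\<in>carrier (fundamental_group (M - P) x0).
        translation_length (\<rho> \<gamma>) \<le> translation_length (\<rho>\<^sub>0 \<gamma>)) \<and>
     (\<forall>\<gamma>\<in>carrier (fundamental_group (M - P) x0). peripheral M P \<gamma> \<longrightarrow>
        translation_length (\<rho> \<gamma>) = translation_length (\<rho>\<^sub>0 \<gamma>))"
proof -
 have atlas: "oriented_atlas M \<A>" and sub: "P \<subseteq> M" using assms(1) unfolding punctured_surface_def by blast+
 obtain \<phi> where
  act: "\<forall>\<gamma>\<in>carrier (fundamental_group (M - P) x0). \<forall>\<xi>\<in>farey_set M P x0. \<phi> (farey_act M P \<gamma> \<xi>) = PU21_act (\<rho> \<gamma>) (\<phi> \<xi>)"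
  and tri: "\<forall>(a, b, c)\<in>farey_triangles M P \<T> x0. real_ideal_triangle (\<phi> a) (\<phi> b) (\<phi> c)"
  using assms(8) unfolding T_bent_def by (elim exE conjE)
 interpret oriented_bent_surface M P \<T> x0 \<rho> \<phi> \<A>
 proof unfold_locales
  show "\<phi> (farey_act M P \<gamma> \<xi>) = PU21_act (\<rho> \<gamma>) (\<phi> \<xi>)"
   if "\<gamma> \<in> carrier (fundamental_group (M - P) x0)" "\<xi> \<in> farey_set M P x0" for \<gamma> \<xi>
   by (rule bspec[OF bspec[OF act that(1)] that(2)])
  show "real_ideal_triangle (\<phi> a) (\<phi> b) (\<phi> c)" if "(a, b, c) \<in> farey_triangles M P \<T> x0" for a b c
   using bspec[OF tri that] by simp
 qed (fact assms(4) assms(5) sub assms(6) assms(7) atlas)+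
 have "translation_length (\<rho> \<gamma>) \<le> translation_length (\<rho>0 \<gamma>)" if "\<gamma> \<in> carrier \<pi>\<^sub>1" for \<gamma>
  using that unfolding carrier_fundamental by (elim CollectE exE conjE) (simp add: \<rho>0_dominates)
 moreover have "translation_length (\<rho> \<gamma>) = translation_length (\<rho>0 \<gamma>)" if "\<gamma> \<in> carrier \<pi>\<^sub>1" "peripheral M P \<gamma>" for \<gamma>
  using that unfolding carrier_fundamental by (elim CollectE exE conjE) (simp add: \<rho>0_peripheral)
 ultimately show ?thesis
  by (intro exI[of _ \<rho>0] conjI ballI impI \<rho>0_hom \<rho>0_discrete_faithful)
qed

end
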